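(* Let $\pi:Q\to M=Q/G$ be a right principal $G$-bundle equipped with a horizontal distribution $\mathrm{H}Q\subset \mathrm{T}Q$ (not necessarily $G$-invariant) and a smooth Lagrangian $L:\mathrm{T}Q\to\mathbb{R}$ (not necessarily $G$-invariant). Let $\widetilde X(t)\in\mathrm H_{q(t)}Q$ be a horizontal admissible path and $\lambda:I\to\mathfrak g^*$. Then $\widetilde X(t)$ is a vakonomic extremal associated with the modified Lagrangian $\widetilde L(Z,t)=L(Z)-\langle\lambda(t),\omega(Z)\rangle$ if and only if it satisfies the following two conditions: $$\langle\mathrm dS_L(\widetilde X),\delta_{\widetilde Y}\widetilde X\rangle=\int_I\langle\lambda(t),\mathcal R(q(t))(X(t),Y(t))\rangle\,\mathrm dt$$ for every curve $Y(t)\in\mathrm T_{\pi(q(t))}M$ vanishing at the end-points (with $\widetilde Y(t)$ its horizontal lift to $q(t)$), and $$\Big\langle\mathrm HL(\widetilde X(t))-\frac{\mathrm d}{\mathrm dt}\big(\mathrm FL(\widetilde X(t))-\lambda(t)\big),b\Big\rangle+\big\langle\mathrm FL(\widetilde X(t))-\lambda(t),\mathcal B(q(t))(X(t),b)\big\rangle=0$$ for every $b\in\mathfrak g$ (and every $t\in I$).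
   Context: Everything is $C^\infty$; $I=[t_0,t_1]$ is a fixed interval. Variations. $\kappa_Q:\mathrm{TT}Q\to\mathrm{TT}Q$ is the canonical flip, $(q^a,\dot q^b,q'^c,\dot q'^d)\mapsto(q^a,q'^b,\dot q^c,\dot q'^d)$ in induced coordinates. If $\gamma(t)\in\mathrm{T}Q$ is the tangent lift of a curve $q(t)\in Q$ and $\xi(t)\in\mathrm{T}_{q(t)}Q$ is a curve (generator), the standard admissible variation generated by $\xi$ is $\delta_{\xi}\gamma(t)=\kappa_Q(\mathrm{T}_t\xi(t))\in\mathrm{T}_{\gamma(t)}\mathrm{T}Q$, where $\mathrm{T}_t\xi(t)\in\mathrm{TT}Q$ is the tangent lift of the curve $\xi$. The variation of the action is $\langle \mathrm{d}S_L(\gamma),\delta\gamma\rangle=\int_I\langle \mathrm{d}L(\gamma(t)),\delta\gamma(t)\rangle\,\mathrm{d}t$ (for a time-dependent Lagrangian, differentiate in the $\mathrm{T}Q$ variable). Chaplygin system. $\mathrm{V}Q=\ker\pi_*$; a horizontal distribution is a smooth distribution with $\mathrm{T}_qQ=\mathrm{H}_qQ\oplus\mathrm{V}_qQ$ for all $q$. A horizontal admissible path is a curve $\widetilde X(t)\in\mathrm{H}_{q(t)}Q$ which is the tangent lift of a curve $q(t)$. It is a vakonomic extremal associated with the modified Lagrangian $\widetilde L$ if it is an unconstrained extremal for $\widetilde L$, i.e. $\langle\mathrm dS_{\widetilde L}(\widetilde X),\delta_\xi\widetilde X\rangle=0$ for all generators $\xi(t)\in\mathrm T_{q(t)}Q$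 with $\xi(t_0)=\xi(t_1)=0$. Notation. $\mathfrak g=\mathrm{T}_eG$ carries the left Lie algebra structure. For $a\in\mathfrak g$, $\widetilde a$ is the fundamental vector field on $Q$, with flow $q\mapsto q\cdot\exp(ta)$; this identifies $\mathrm{V}Q\approx Q\times\mathfrak g$. $\omega:\mathrm{T}Q\to\mathfrak g$ is the projection onto the $\mathfrak g$-part in $\mathrm{T}Q=\mathrm{H}Q\oplus_Q(Q\times\mathfrak g)$. For $X\in\mathrm{T}_xM$ and $q\in\pi^{-1}(x)$, $\widetilde X_q\in\mathrm{H}_qQ$ is the horizontal lift. For a path $\widetilde X(t)$, $X(t)=\pi_*\widetilde X(t)$. Maps (tensorial, so defined by extending $X,Y$ to vector fields on $M$): curvature $\mathcal R(q)(X,Y)=\omega([\widetilde X,\widetilde Y]-\widetilde{[X,Y]})(q)\in\mathfrak g$, and $\mathcal B(q)(X,a)=\omega([\widetilde X,\widetilde a])(q)\in\mathfrak g$. Derivatives of $L$: $\mathrm{F}L,\mathrm{H}L:\mathrm{H}Q\to\mathfrak g^*$, $\langle\mathrm{F}L(\widetilde X_q),b\rangle=\frac{\mathrm d}{\mathrm dt}\big|_0L(\widetilde X_q+t\,\widetilde b_q)$ and $\langle\mathrm{H}L(\widetilde X_q),b\rangle=\frac{\mathrm d}{\mathrm dt}\big|_0L(\widetilde X_{q\cdot\exp(tb)})$, where $\widetilde X_{q\cdot \exp(tb)}$ is the horizontal lift of the same $X$ to the point $q\cdot\exp(tb)$. *)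

theory Defs
  imports "HOL-Analysis.Analysis" "HOL-Library.Function_Algebras" "HOL-Algebra.Group"
begin

section \<open>Model spaces\<close>

text \<open>Manifolds are modelled on finite-dimensional inner product spaces.  The library class
  \<open>euclidean_space\<close> would force the dimension to be positive and so exclude, e.g., discrete
  structure groups; the class below also admits dimension 0.  (Completeness follows from finite
  dimension.  It is a superclass only to make the library facts about Banach spaces applicable.)\<close>

class fin_dim_inner = real_inner + complete_space +
  assumes finite_spanning_combination:
    "\<exists>B. finite B \<and> (\<forall>x. \<exists>r. x = (\<Sum>b\<in>B. r b *\<^sub>R b))"

lemma fin_dim_inner_iff_span:
  "(\<exists>B::'a::real_vector set. finite B \<and> (\<forall>x. \<exists>r. x = (\<Sum>b\<in>B. r b *\<^sub>R b)))
    \<longleftrightarrow> (\<exists>B::'a set. finite B \<and> span B = UNIV)"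
proof -
  have "(\<forall>x. \<exists>r. x = (\<Sum>b\<in>B. r b *\<^sub>R b)) \<longleftrightarrow> span B = UNIV" if "finite B" for B :: "'a set"
    using span_finite[OF that] by (auto simp: set_eq_iff image_iff)
  then show ?thesis by blast
qed

lemmas finite_spanning = finite_spanning_combination[unfolded fin_dim_inner_iff_span]

instance euclidean_space \<subseteq> fin_dim_inner
proof
  show "\<exists>B::'a set. finite B \<and> (\<forall>x. \<exists>r. x = (\<Sum>b\<in>B. r b *\<^sub>R b))"
    unfolding fin_dim_inner_iff_span using span_Basis by (blast intro: finite_Basis)
qed

instance prod :: (fin_dim_inner, fin_dim_inner) fin_dim_inner
proof
  obtain B :: "'a set" where B: "finite B" "span B = UNIV" using finite_spanning by blast
  obtain C :: "'b set" where C: "finite C" "span C = UNIV" using finite_spanning by blast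
  let ?D = "(\<lambda>x. (x, 0::'b)) ` B \<union> (\<lambda>y. (0::'a, y)) ` C"
  have l: "linear (\<lambda>x::'a. (x, 0::'b))" "linear (\<lambda>y::'b. (0::'a, y))"
    by (auto simp: linear_iff)
  have "(x, y) \<in> span ?D" for x y
  proof -
    have "(x, 0) \<in> span ?D" "(0, y) \<in> span ?D"
      using linear_span_image[OF l(1), of B] linear_span_image[OF l(2), of C] B C
        span_mono[of "(\<lambda>x. (x, 0::'b)) ` B" ?D] span_mono[of "(\<lambda>y. (0::'a, y)) ` C" ?D]
      by auto
    from span_add[OF this] show ?thesis by simp
  qed
  then show "\<exists>B::('a \<times> 'b) set. finite B \<and> (\<forall>x. \<exists>r. x = (\<Sum>b\<in>B. r b *\<^sub>R b))"
    unfolding fin_dim_inner_iff_span using B C by (intro exI[of _ ?D]) auto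
qed

instantiation "fun" :: (type, real_vector) real_vector
begin
definition scaleR_fun :: "real \<Rightarrow> ('a \<Rightarrow> 'b) \<Rightarrow> 'a \<Rightarrow> 'b"
  where "scaleR_fun r f = (\<lambda>x. r *\<^sub>R f x)"
instance
  by standard (auto simp: scaleR_fun_def fun_eq_iff scaleR_add_right scaleR_add_left)
end

text \<open>\<open>Ck_on k S f\<close> is used for open sets \<open>S\<close>, and for (relatively open subsets of) real
  intervals, where it means one-sided derivatives at the end-points.  As the domain is
  finite-dimensional, \<open>f'\<close> is continuous as an operator-valued map iff all its evaluations
  at fixed vectors are.\<close>

primrec Ck_on :: "nat \<Rightarrow> 'a::real_normed_vector set \<Rightarrow> ('a \<Rightarrow> 'b::real_normed_vector) \<Rightarrow> bool"
  where
    "Ck_on 0 S f \<longleftrightarrow> continuous_on S f"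
  | "Ck_on (Suc k) S f \<longleftrightarrow>
      (\<exists>f'. (\<forall>x\<in>S. (f has_derivative f' x) (at x within S)) \<and> (\<forall>v. Ck_on k S (\<lambda>x. f' x v)))"

definition smooth_on :: "'a::real_normed_vector set \<Rightarrow> ('a \<Rightarrow> 'b::real_normed_vector) \<Rightarrow> bool"
  where "smooth_on S f \<longleftrightarrow> (\<forall>k. Ck_on k S f)"


section \<open>Manifolds\<close>

text \<open>A chart is a pair (domain, map); the values of the map outside the domain are irrelevant.
  A manifold is given by an atlas, which determines the points and the topology.\<close>

type_synonym ('a, 'e) chart = "'a set \<times> ('a \<Rightarrow> 'e)"
type_synonym ('a, 'e) atlas = "('a, 'e) chart set"

definition inv_chart :: "('a, 'e) chart \<Rightarrow> 'e \<Rightarrow> 'a"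
  where "inv_chart c = inv_into (fst c) (snd c)"

definition points :: "('a, 'e) atlas \<Rightarrow> 'a set"
  where "points A = (\<Union>c\<in>A. fst c)"

definition charts_at :: "('a, 'e) atlas \<Rightarrow> 'a \<Rightarrow> ('a, 'e) chart set"
  where "charts_at A x = {c\<in>A. x \<in> fst c}"

definition chart_at :: "('a, 'e) atlas \<Rightarrow> 'a \<Rightarrow> ('a, 'e) chart"
  where "chart_at A x = (SOME c. c \<in> charts_at A x)"

definition manifold_topology :: "('a, 'e::fin_dim_inner) atlas \<Rightarrow> 'a topology"
  where "manifold_topology A =
    topology (\<lambda>W. W \<subseteq> points A \<and> (\<forall>c\<in>A. open (snd c ` (W \<inter> fst c))))"

definition smooth_atlas :: "('a, 'e::fin_dim_inner) atlas \<Rightarrow> bool"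
  where "smooth_atlas A \<longleftrightarrow>
    (\<forall>c\<in>A. inj_on (snd c) (fst c) \<and> open (snd c ` fst c)) \<and>
    (\<forall>c\<in>A. \<forall>d\<in>A. open (snd c ` (fst c \<inter> fst d)) \<and>
       smooth_on (snd c ` (fst c \<inter> fst d)) (snd d \<circ> inv_chart c))"

lemma openin_manifold_topology:
  assumes "smooth_atlas A"
  shows "openin (manifold_topology A) W \<longleftrightarrow>
    W \<subseteq> points A \<and> (\<forall>c\<in>A. open (snd c ` (W \<inter> fst c)))"
proof -
  let ?P = "\<lambda>W. W \<subseteq> points A \<and> (\<forall>c\<in>A. open (snd c ` (W \<inter> fst c)))"
  have "istopology ?P"
    unfolding istopology_def
  proof (intro conjI allI impI)
    fix V W assume V: "?P V" and W: "?P W"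
    show "V \<inter> W \<subseteq> points A" using V by blast
    show "\<forall>c\<in>A. open (snd c ` (V \<inter> W \<inter> fst c))"
    proof
      fix c assume c: "c \<in> A"
      with assms have "inj_on (snd c) (fst c)" by (auto simp: smooth_atlas_def)
      then have "snd c ` (V \<inter> W \<inter> fst c) = snd c ` (V \<inter> fst c) \<inter> snd c ` (W \<inter> fst c)"
        by (auto simp: inj_on_def)
      then show "open (snd c ` (V \<inter> W \<inter> fst c))" using V W c by (simp add: open_Int)
    qed
  next
    fix K assume K: "\<forall>W\<in>K. ?P W"
    then show "\<Union>K \<subseteq> points A" by blast
    show "\<forall>c\<in>A. open (snd c ` (\<Union>K \<inter> fst c))"
    proof
      fix c assume "c \<in> A"
      then have "open (\<Union>W\<in>K. snd c ` (W \<inter> fst c))" using K by blast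
      also have "(\<Union>W\<in>K. snd c ` (W \<inter> fst c)) = snd c ` (\<Union>K \<inter> fst c)" by blast
      finally show "open (snd c ` (\<Union>K \<inter> fst c))" .
    qed
  qed
  then show ?thesis by (simp add: manifold_topology_def topology_inverse')
qed

lemma topspace_manifold_topology:
  assumes "smooth_atlas A"
  shows "topspace (manifold_topology A) = points A"
proof -
  have "openin (manifold_topology A) (points A)"
    unfolding openin_manifold_topology[OF assms]
  proof (intro conjI ballI)
    fix c assume "c \<in> A"
    then have "points A \<inter> fst c = fst c" by (auto simp: points_def)
    then show "open (snd c ` (points A \<inter> fst c))"
      using \<open>c \<in> A\<close> assms by (auto simp: smooth_atlas_def)
  qed simp
  then show ?thesis
    using openin_manifold_topology[OF assms] openin_subset by (metis openin_topspace subset_antisym)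
qed

definition smooth_manifold :: "('a, 'e::fin_dim_inner) atlas \<Rightarrow> bool"
  where "smooth_manifold A \<longleftrightarrow> smooth_atlas A \<and>
    Hausdorff_space (manifold_topology A) \<and> second_countable (manifold_topology A)"

definition open_submanifold :: "('a, 'e) atlas \<Rightarrow> 'a set \<Rightarrow> ('a, 'e) atlas"
  where "open_submanifold A U = (\<lambda>c. (fst c \<inter> U, snd c)) ` A"

definition prod_manifold :: "('a, 'e) atlas \<Rightarrow> ('b, 'f) atlas \<Rightarrow> ('a \<times> 'b, 'e \<times> 'f) atlas"
  where "prod_manifold A B = (\<lambda>(c, d). (fst c \<times> fst d, map_prod (snd c) (snd d))) ` (A \<times> B)"

definition smooth_map ::
    "('a, 'e::fin_dim_inner) atlas \<Rightarrow> ('b, 'f::fin_dim_inner) atlas \<Rightarrow> ('a \<Rightarrow> 'b) \<Rightarrow> bool"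
  where "smooth_map A B f \<longleftrightarrow>
    continuous_map (manifold_topology A) (manifold_topology B) f \<and>
    (\<forall>c\<in>A. \<forall>d\<in>B. smooth_on (snd c ` (fst c \<inter> f -` fst d)) (snd d \<circ> f \<circ> inv_chart c))"

definition smooth_fun :: "('a, 'e::fin_dim_inner) atlas \<Rightarrow> ('a \<Rightarrow> real) \<Rightarrow> bool"
  where "smooth_fun A f \<longleftrightarrow> (\<forall>c\<in>A. smooth_on (snd c ` fst c) (f \<circ> inv_chart c))"

definition smooth_curve :: "('a, 'e::fin_dim_inner) atlas \<Rightarrow> real set \<Rightarrow> (real \<Rightarrow> 'a) \<Rightarrow> bool"
  where "smooth_curve A I q \<longleftrightarrow>
    continuous_map (top_of_set I) (manifold_topology A) q \<and>
    (\<forall>c\<in>A. smooth_on {t\<in>I. q t \<in> fst c} (snd c \<circ> q))"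

definition diffeomorphism ::
    "('a, 'e::fin_dim_inner) atlas \<Rightarrow> ('b, 'f::fin_dim_inner) atlas \<Rightarrow> ('a \<Rightarrow> 'b) \<Rightarrow> bool"
  where "diffeomorphism A B f \<longleftrightarrow> bij_betw f (points A) (points B) \<and>
    smooth_map A B f \<and> smooth_map B A (inv_into (points A) f)"


section \<open>Tangent vectors\<close>

text \<open>A tangent vector at \<open>x\<close> is the family of its coordinate representations in the charts
  around \<open>x\<close>, related by the derivatives of the chart transitions (and 0 at all other
  indices).  The base point is not part of \<open>('a, 'e) tvec\<close>; an element of the tangent bundle is
  a pair (base point, vector).\<close>

type_synonym ('a, 'e) tvec = "('a, 'e) chart \<Rightarrow> 'e"
type_synonym ('a, 'e) tan = "'a \<times> ('a, 'e) tvec"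

definition tangent_space :: "('a, 'e::fin_dim_inner) atlas \<Rightarrow> 'a \<Rightarrow> ('a, 'e) tvec set"
  where "tangent_space A x = {v.
    (\<forall>c\<in>charts_at A x. \<forall>d\<in>charts_at A x.
       v d = frechet_derivative (snd d \<circ> inv_chart c) (at (snd c x)) (v c)) \<and>
    (\<forall>c. c \<notin> charts_at A x \<longrightarrow> v c = 0)}"

definition tangent_chart ::
    "('a, 'e::fin_dim_inner) atlas \<Rightarrow> ('a, 'e) chart \<Rightarrow> (('a, 'e) tan, 'e \<times> 'e) chart"
  where "tangent_chart A c =
    ({(x, v). x \<in> fst c \<and> v \<in> tangent_space A x}, \<lambda>(x, v). (snd c x, v c))"

definition tangent_bundle :: "('a, 'e::fin_dim_inner) atlas \<Rightarrow> (('a, 'e) tan, 'e \<times> 'e) atlas"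
  where "tangent_bundle A = tangent_chart A ` A"

definition tangent_map ::
    "('a, 'e::fin_dim_inner) atlas \<Rightarrow> ('b, 'f::fin_dim_inner) atlas \<Rightarrow> ('a \<Rightarrow> 'b) \<Rightarrow>
     'a \<Rightarrow> ('a, 'e) tvec \<Rightarrow> ('b, 'f) tvec"
  where "tangent_map A B f x v = (\<lambda>d.
    if d \<in> charts_at B (f x)
    then (let c = chart_at A x
          in frechet_derivative (snd d \<circ> f \<circ> inv_chart c) (at (snd c x)) (v c))
    else 0)"

definition differential ::
    "('a, 'e::fin_dim_inner) atlas \<Rightarrow> ('a \<Rightarrow> real) \<Rightarrow> ('a, 'e) tan \<Rightarrow> real"
  where "differential A f = (\<lambda>(x, v).
    let c = chart_at A x in frechet_derivative (f \<circ> inv_chart c) (at (snd c x)) (v c))"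

definition velocity ::
    "('a, 'e::fin_dim_inner) atlas \<Rightarrow> real set \<Rightarrow> (real \<Rightarrow> 'a) \<Rightarrow> real \<Rightarrow> ('a, 'e) tvec"
  where "velocity A I q t = (\<lambda>c.
    if c \<in> charts_at A (q t) then vector_derivative (snd c \<circ> q) (at t within I) else 0)"

definition tangent_lift ::
    "('a, 'e::fin_dim_inner) atlas \<Rightarrow> real set \<Rightarrow> (real \<Rightarrow> 'a) \<Rightarrow> real \<Rightarrow> ('a, 'e) tan"
  where "tangent_lift A I q t = (q t, velocity A I q t)"

definition smooth_vector_field ::
    "('a, 'e::fin_dim_inner) atlas \<Rightarrow> ('a \<Rightarrow> ('a, 'e) tvec) \<Rightarrow> bool"
  where "smooth_vector_field A X \<longleftrightarrow>
    (\<forall>x\<in>points A. X x \<in> tangent_space A x) \<and> smooth_map A (tangent_bundle A) (\<lambda>x. (x, X x))"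

text \<open>Sign convention: the bracket is the commutator of derivations, in coordinates
  \<open>DY(X) - DX(Y)\<close>.\<close>

definition lie_bracket ::
    "('a, 'e::fin_dim_inner) atlas \<Rightarrow> ('a \<Rightarrow> ('a, 'e) tvec) \<Rightarrow> ('a \<Rightarrow> ('a, 'e) tvec) \<Rightarrow>
     'a \<Rightarrow> ('a, 'e) tvec"
  where "lie_bracket A X Y x = (\<lambda>c.
    if c \<in> charts_at A x
    then frechet_derivative (\<lambda>u. Y (inv_chart c u) c) (at (snd c x)) (X x c)
       - frechet_derivative (\<lambda>u. X (inv_chart c u) c) (at (snd c x)) (Y x c)
    else 0)"

text \<open>A smooth distribution of possibly varying rank on different components: locally it has a
  smooth frame.\<close>

definition smooth_distribution ::
    "('a, 'e::fin_dim_inner) atlas \<Rightarrow> ('a \<Rightarrow> ('a, 'e) tvec set) \<Rightarrow> bool"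
  where "smooth_distribution A H \<longleftrightarrow>
    (\<forall>x\<in>points A. subspace (H x) \<and> H x \<subseteq> tangent_space A x) \<and>
    (\<forall>x\<in>points A. \<exists>U (k::nat) X. openin (manifold_topology A) U \<and> x \<in> U \<and>
      (\<forall>i<k. smooth_map (open_submanifold A U) (tangent_bundle A) (\<lambda>y. (y, X i y))) \<and>
      (\<forall>y\<in>U. inj_on (\<lambda>i. X i y) {..<k} \<and> independent ((\<lambda>i. X i y) ` {..<k}) \<and>
         H y = span ((\<lambda>i. X i y) ` {..<k})))"


section \<open>Variations\<close>

text \<open>The canonical flip, given by its expression in all induced coordinates of the iterated
  tangent bundle.\<close>

definition canonical_flip ::
    "('a, 'e::fin_dim_inner) atlas \<Rightarrow> (('a, 'e) tan, 'e \<times> 'e) tan \<Rightarrow> (('a, 'e) tan, 'e \<times> 'e) tan"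
  where "canonical_flip A W = (THE W'. W' \<in> points (tangent_bundle (tangent_bundle A)) \<and>
    (\<forall>c\<in>charts_at A (fst (fst W)).
      let C = tangent_chart (tangent_bundle A) (tangent_chart A c)
      in W' \<in> fst C \<and>
         snd C W' = (case snd C W of ((x, dx), (x', dx')) \<Rightarrow> ((x, x'), (dx, dx')))))"

definition generator ::
    "('a, 'e::fin_dim_inner) atlas \<Rightarrow> real set \<Rightarrow> (real \<Rightarrow> 'a) \<Rightarrow> (real \<Rightarrow> ('a, 'e) tvec) \<Rightarrow> bool"
  where "generator A I q \<xi> \<longleftrightarrow>
    (\<forall>t\<in>I. \<xi> t \<in> tangent_space A (q t)) \<and>
    smooth_curve (tangent_bundle A) I (\<lambda>t. (q t, \<xi> t))"

definition admissible_variation ::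
    "('a, 'e::fin_dim_inner) atlas \<Rightarrow> real set \<Rightarrow> (real \<Rightarrow> 'a) \<Rightarrow> (real \<Rightarrow> ('a, 'e) tvec) \<Rightarrow>
     real \<Rightarrow> (('a, 'e) tan, 'e \<times> 'e) tan"
  where "admissible_variation A I q \<xi> t =
    canonical_flip A (tangent_lift (tangent_bundle A) I (\<lambda>s. (q s, \<xi> s)) t)"

text \<open>\<open>\<langle>dS\<^sub>L(\<gamma>), \<delta>\<gamma>\<rangle>\<close>; the base curve \<open>\<gamma>\<close> is the first component of \<open>\<delta>\<gamma>\<close>.\<close>

definition action_variation ::
    "('a, 'e::fin_dim_inner) atlas \<Rightarrow> real set \<Rightarrow> (real \<Rightarrow> ('a, 'e) tan \<Rightarrow> real) \<Rightarrow>
     (real \<Rightarrow> (('a, 'e) tan, 'e \<times> 'e) tan) \<Rightarrow> real"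
  where "action_variation A I L \<delta>\<gamma> = integral I (\<lambda>t. differential (tangent_bundle A) (L t) (\<delta>\<gamma> t))"


section \<open>Lie groups and principal bundles\<close>

definition lie_group :: "'g monoid \<Rightarrow> ('g, 'k::fin_dim_inner) atlas \<Rightarrow> bool"
  where "lie_group G A \<longleftrightarrow> group G \<and> smooth_manifold A \<and> carrier G = points A \<and>
    smooth_map (prod_manifold A A) A (\<lambda>(g, h). g \<otimes>\<^bsub>G\<^esub> h) \<and> smooth_map A A (m_inv G)"

definition one_parameter_subgroup ::
    "'g monoid \<Rightarrow> ('g, 'k::fin_dim_inner) atlas \<Rightarrow> (real \<Rightarrow> 'g) \<Rightarrow> bool"
  where "one_parameter_subgroup G A \<theta> \<longleftrightarrow>
    smooth_curve A UNIV \<theta> \<and> (\<forall>s t. \<theta> (s + t) = \<theta> s \<otimes>\<^bsub>G\<^esub> \<theta> t)"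

definition lie_exp :: "'g monoid \<Rightarrow> ('g, 'k::fin_dim_inner) atlas \<Rightarrow> ('g, 'k) tvec \<Rightarrow> 'g"
  where "lie_exp G A a =
    (THE \<theta>. one_parameter_subgroup G A \<theta> \<and> velocity A UNIV \<theta> 0 = a) 1"

record ('q, 'e, 'm, 'f, 'g, 'k) chaplygin =
  grp :: "'g monoid"
  mfG :: "('g, 'k) atlas"
  mfQ :: "('q, 'e) atlas"
  mfM :: "('m, 'f) atlas"
  act :: "'q \<Rightarrow> 'g \<Rightarrow> 'q"
  proj :: "'q \<Rightarrow> 'm"
  hor :: "'q \<Rightarrow> ('q, 'e) tvec set"

text \<open>Equivariant local triviality makes the action free and the fibres of \<open>proj\<close> exactly its
  orbits, so \<open>M = Q/G\<close>.\<close>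

definition principal_bundle ::
    "('q, 'e::fin_dim_inner, 'm, 'f::fin_dim_inner, 'g, 'k::fin_dim_inner) chaplygin \<Rightarrow> bool"
  where "principal_bundle S \<longleftrightarrow>
    lie_group (grp S) (mfG S) \<and> smooth_manifold (mfQ S) \<and> smooth_manifold (mfM S) \<and>
    smooth_map (prod_manifold (mfQ S) (mfG S)) (mfQ S) (\<lambda>(q, g). act S q g) \<and>
    (\<forall>q\<in>points (mfQ S). act S q \<one>\<^bsub>grp S\<^esub> = q) \<and>
    (\<forall>q\<in>points (mfQ S). \<forall>g\<in>carrier (grp S). \<forall>h\<in>carrier (grp S).
       act S (act S q g) h = act S q (g \<otimes>\<^bsub>grp S\<^esub> h)) \<and>
    smooth_map (mfQ S) (mfM S) (proj S) \<and>
    (\<forall>q\<in>points (mfQ S). \<forall>g\<in>carrier (grp S). proj S (act S q g) = proj S q) \<and>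
    (\<forall>x\<in>points (mfM S). \<exists>U \<Phi>. openin (manifold_topology (mfM S)) U \<and> x \<in> U \<and>
       diffeomorphism (open_submanifold (mfQ S) (proj S -` U))
         (prod_manifold (open_submanifold (mfM S) U) (mfG S)) \<Phi> \<and>
       (\<forall>q\<in>points (mfQ S) \<inter> proj S -` U. fst (\<Phi> q) = proj S q \<and>
          (\<forall>g\<in>carrier (grp S). snd (\<Phi> (act S q g)) = snd (\<Phi> q) \<otimes>\<^bsub>grp S\<^esub> g)))"

definition lie_alg ::
    "('q, 'e, 'm, 'f, 'g, 'k::fin_dim_inner) chaplygin \<Rightarrow> ('g, 'k) tvec set"
  where "lie_alg S = tangent_space (mfG S) \<one>\<^bsub>grp S\<^esub>"

definition lie_alg_dual ::
    "('q, 'e, 'm, 'f, 'g, 'k::fin_dim_inner) chaplygin \<Rightarrow> (('g, 'k) tvec \<Rightarrow> real) set"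
  where "lie_alg_dual S = {\<mu>. (\<forall>a\<in>lie_alg S. \<forall>b\<in>lie_alg S. \<mu> (a + b) = \<mu> a + \<mu> b) \<and>
    (\<forall>r. \<forall>a\<in>lie_alg S. \<mu> (r *\<^sub>R a) = r * \<mu> a)}"

definition smooth_dual_curve ::
    "('q, 'e, 'm, 'f, 'g, 'k::fin_dim_inner) chaplygin \<Rightarrow> real set \<Rightarrow>
     (real \<Rightarrow> ('g, 'k) tvec \<Rightarrow> real) \<Rightarrow> bool"
  where "smooth_dual_curve S I \<mu> \<longleftrightarrow>
    (\<forall>t\<in>I. \<mu> t \<in> lie_alg_dual S) \<and> (\<forall>b\<in>lie_alg S. smooth_on I (\<lambda>t. \<mu> t b))"

definition dual_deriv ::
    "real set \<Rightarrow> (real \<Rightarrow> ('g, 'k) tvec \<Rightarrow> real) \<Rightarrow> real \<Rightarrow> ('g, 'k) tvec \<Rightarrow> real"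
  where "dual_deriv I \<mu> t = (\<lambda>b. vector_derivative (\<lambda>s. \<mu> s b) (at t within I))"

definition proj_vec ::
    "('q, 'e::fin_dim_inner, 'm, 'f::fin_dim_inner, 'g, 'k) chaplygin \<Rightarrow>
     ('q, 'e) tan \<Rightarrow> ('m, 'f) tvec"
  where "proj_vec S Z = tangent_map (mfQ S) (mfM S) (proj S) (fst Z) (snd Z)"

definition vertical_space ::
    "('q, 'e::fin_dim_inner, 'm, 'f::fin_dim_inner, 'g, 'k) chaplygin \<Rightarrow> 'q \<Rightarrow> ('q, 'e) tvec set"
  where "vertical_space S q = {v\<in>tangent_space (mfQ S) q. proj_vec S (q, v) = 0}"

definition horizontal_distribution ::
    "('q, 'e::fin_dim_inner, 'm, 'f::fin_dim_inner, 'g, 'k) chaplygin \<Rightarrow> bool"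
  where "horizontal_distribution S \<longleftrightarrow> smooth_distribution (mfQ S) (hor S) \<and>
    (\<forall>q\<in>points (mfQ S). hor S q \<inter> vertical_space S q = {0} \<and>
       tangent_space (mfQ S) q = {h + v | h v. h \<in> hor S q \<and> v \<in> vertical_space S q})"

definition exp_act ::
    "('q, 'e, 'm, 'f, 'g, 'k::fin_dim_inner) chaplygin \<Rightarrow> 'q \<Rightarrow> ('g, 'k) tvec \<Rightarrow> 'q"
  where "exp_act S q a = act S q (lie_exp (grp S) (mfG S) a)"

definition fundamental_field ::
    "('q, 'e::fin_dim_inner, 'm, 'f, 'g, 'k::fin_dim_inner) chaplygin \<Rightarrow>
     ('g, 'k) tvec \<Rightarrow> 'q \<Rightarrow> ('q, 'e) tvec"
  where "fundamental_field S a q = velocity (mfQ S) UNIV (\<lambda>t. exp_act S q (t *\<^sub>R a)) 0"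

definition omega ::
    "('q, 'e::fin_dim_inner, 'm, 'f, 'g, 'k::fin_dim_inner) chaplygin \<Rightarrow>
     ('q, 'e) tan \<Rightarrow> ('g, 'k) tvec"
  where "omega S Z =
    (THE a. a \<in> lie_alg S \<and> snd Z - fundamental_field S a (fst Z) \<in> hor S (fst Z))"

definition hlift ::
    "('q, 'e::fin_dim_inner, 'm, 'f::fin_dim_inner, 'g, 'k) chaplygin \<Rightarrow>
     'q \<Rightarrow> ('m, 'f) tvec \<Rightarrow> ('q, 'e) tvec"
  where "hlift S q X = (THE v. v \<in> hor S q \<and> proj_vec S (q, v) = X)"

abbreviation hlift_field ::
    "('q, 'e::fin_dim_inner, 'm, 'f::fin_dim_inner, 'g, 'k) chaplygin \<Rightarrow>
     ('m \<Rightarrow> ('m, 'f) tvec) \<Rightarrow> 'q \<Rightarrow> ('q, 'e) tvec"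
  where "hlift_field S X \<equiv> \<lambda>q. hlift S q (X (proj S q))"

text \<open>The maps \<open>\<R>\<close> and \<open>\<B>\<close>: the common value for all extensions of the given tangent vectors to
  vector fields on \<open>M\<close>.\<close>

definition curvature ::
    "('q, 'e::fin_dim_inner, 'm, 'f::fin_dim_inner, 'g, 'k::fin_dim_inner) chaplygin \<Rightarrow>
     'q \<Rightarrow> ('m, 'f) tvec \<Rightarrow> ('m, 'f) tvec \<Rightarrow> ('g, 'k) tvec"
  where "curvature S q X Y = (THE r. \<exists>X' Y'.
    smooth_vector_field (mfM S) X' \<and> X' (proj S q) = X \<and>
    smooth_vector_field (mfM S) Y' \<and> Y' (proj S q) = Y \<and>
    r = omega S (q, lie_bracket (mfQ S) (hlift_field S X') (hlift_field S Y') q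
                    - hlift_field S (lie_bracket (mfM S) X' Y') q))"

definition B_map ::
    "('q, 'e::fin_dim_inner, 'm, 'f::fin_dim_inner, 'g, 'k::fin_dim_inner) chaplygin \<Rightarrow>
     'q \<Rightarrow> ('m, 'f) tvec \<Rightarrow> ('g, 'k) tvec \<Rightarrow> ('g, 'k) tvec"
  where "B_map S q X a = (THE r. \<exists>X'.
    smooth_vector_field (mfM S) X' \<and> X' (proj S q) = X \<and>
    r = omega S (q, lie_bracket (mfQ S) (hlift_field S X') (fundamental_field S a) q))"

definition FL ::
    "('q, 'e::fin_dim_inner, 'm, 'f, 'g, 'k::fin_dim_inner) chaplygin \<Rightarrow>
     (('q, 'e) tan \<Rightarrow> real) \<Rightarrow> ('q, 'e) tan \<Rightarrow> ('g, 'k) tvec \<Rightarrow> real"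
  where "FL S L Z b = deriv (\<lambda>t. L (fst Z, snd Z + t *\<^sub>R fundamental_field S b (fst Z))) 0"

definition HL ::
    "('q, 'e::fin_dim_inner, 'm, 'f::fin_dim_inner, 'g, 'k::fin_dim_inner) chaplygin \<Rightarrow>
     (('q, 'e) tan \<Rightarrow> real) \<Rightarrow> ('q, 'e) tan \<Rightarrow> ('g, 'k) tvec \<Rightarrow> real"
  where "HL S L Z b = deriv (\<lambda>t. let q' = exp_act S (fst Z) (t *\<^sub>R b)
                                 in L (q', hlift S q' (proj_vec S Z))) 0"

definition horizontal_admissible_path ::
    "('q, 'e::fin_dim_inner, 'm, 'f, 'g, 'k) chaplygin \<Rightarrow> real set \<Rightarrow>
     (real \<Rightarrow> 'q) \<Rightarrow> (real \<Rightarrow> ('q, 'e) tan) \<Rightarrow> bool"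
  where "horizontal_admissible_path S I q Xt \<longleftrightarrow>
    smooth_curve (mfQ S) I q \<and>
    (\<forall>t\<in>I. Xt t = tangent_lift (mfQ S) I q t \<and> snd (Xt t) \<in> hor S (q t))"

definition modified_lagrangian ::
    "('q, 'e::fin_dim_inner, 'm, 'f, 'g, 'k::fin_dim_inner) chaplygin \<Rightarrow>
     (('q, 'e) tan \<Rightarrow> real) \<Rightarrow> (real \<Rightarrow> ('g, 'k) tvec \<Rightarrow> real) \<Rightarrow> real \<Rightarrow> ('q, 'e) tan \<Rightarrow> real"
  where "modified_lagrangian S L lam t Z = L Z - lam t (omega S Z)"

definition unconstrained_extremal ::
    "('q, 'e::fin_dim_inner) atlas \<Rightarrow> real \<Rightarrow> real \<Rightarrow> (real \<Rightarrow> ('q, 'e) tan \<Rightarrow> real) \<Rightarrow>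
     (real \<Rightarrow> 'q) \<Rightarrow> bool"
  where "unconstrained_extremal A t0 t1 L q \<longleftrightarrow>
    (\<forall>\<xi>. generator A {t0..t1} q \<xi> \<and> \<xi> t0 = 0 \<and> \<xi> t1 = 0 \<longrightarrow>
       action_variation A {t0..t1} L (admissible_variation A {t0..t1} q \<xi>) = 0)"

definition vakonomic_extremal ::
    "('q, 'e::fin_dim_inner, 'm, 'f, 'g, 'k) chaplygin \<Rightarrow> real \<Rightarrow> real \<Rightarrow>
     (real \<Rightarrow> ('q, 'e) tan \<Rightarrow> real) \<Rightarrow> (real \<Rightarrow> 'q) \<Rightarrow> (real \<Rightarrow> ('q, 'e) tan) \<Rightarrow> bool"
  where "vakonomic_extremal S t0 t1 L q Xt \<longleftrightarrow>
    horizontal_admissible_path S {t0..t1} q Xt \<and> unconstrained_extremal (mfQ S) t0 t1 L q"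

end

theory Submission imports Defs
begin

text \<open>A generator splits as \<open>\<xi> = Y\<^sup>h + b\<^sup>v\<close> into the horizontal lift of its projection
  \<open>Y\<close> and the fundamental vector of \<open>b = \<omega>(\<xi>)\<close>.  Along a horizontal path with velocity
  \<open>v\<close>, the variation of \<open>\<omega>(v)\<close> is \<open>d/dt \<omega>(\<xi>) + d\<omega>(\<xi>, v)\<close>, and since
  \<open>\<omega>\<close> is constant on horizontal lifts and on fundamental fields,
  \<open>d\<omega>(\<xi>, v) = \<R>(X, Y) + \<B>(X, b)\<close>.  For \<open>\<xi> = Y\<^sup>h\<close> the vanishing of the variation of
  the modified action is the first condition.  For \<open>\<xi> = b\<^sup>v\<close> the variation of \<open>L\<close> is
  \<open>HL(b) + FL(\<B>(X, b) + b')\<close>, and integrating by parts the term with \<open>b'\<close> gives, by the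
  fundamental lemma of the calculus of variations, the second condition.

  The tangent map of the bundle together with \<open>\<omega>\<close> trivializes \<open>TQ\<close> in charts.  That
  \<open>\<omega>\<close> is well defined uses that \<open>exp\<close> exists: one-parameter subgroups are
  obtained from local solutions of the left-invariant differential equation.\<close>

section \<open>Smooth functions on finite-dimensional spaces\<close>

text \<open>Many objects of the statement are definite descriptions (\<open>lie_exp\<close>,
  \<open>omega\<close>, \<open>hlift\<close>, \<open>curvature\<close>, \<open>B_map\<close>,
  \<open>canonical_flip\<close>). Each must be shown to denote before it can be replaced by a
  formula in a chart. The chart formulas rest on four smooth families of linear maps:
  \<open>Z\<close> for fundamental fields, \<open>P\<close> for the projection, \<open>W\<close> for
  \<open>omega\<close> and \<open>H\<close> for horizontal lifts.

  The element \<open>b(t) = omega(\<xi>(t))\<close> varies with time, whereas the second condition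
  tests fixed elements of the Lie algebra. Expanding \<open>b(t)\<close> in an orthonormal basis of
  the model space writes the vertical part of a generator as a finite sum of scalar functions times
  fixed fundamental fields, and linearity of the variation in the generator reduces everything to
  those.

  Two features of the setting shape the calculus. Model spaces may have dimension 0, so coordinates
  refer to a possibly empty orthonormal basis. Curves live on a closed interval, so derivatives are
  taken within a set and their uniqueness there has to be secured.\<close>

instance fin_dim_inner \<subseteq> banach ..

section \<open>Orthonormal bases as coordinates on the model spaces\<close>

definition onb :: "'a::fin_dim_inner set" where
  "onb = (SOME B. finite B \<and> (\<forall>b\<in>B. norm b = 1) \<and> pairwise orthogonal B \<and> span B = UNIV)"

text \<open>Orthogonalisation yields a finite orthogonal spanning set that may contain 0; that
  vector is dropped and the others are normalised. In dimension 0 the result is the empty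
  set.\<close>

lemma onb_exists:
  "\<exists>B::'a::fin_dim_inner set. finite B \<and> (\<forall>b\<in>B. norm b = 1) \<and> pairwise orthogonal B \<and> span B = UNIV"
proof -
  obtain B :: "'a set" where B: "finite B" "span B = UNIV" using finite_spanning by blast
  obtain C where C: "finite C" "span C = span B" "pairwise orthogonal C"
    using basis_orthogonal[OF B(1)] by blast
  let ?N = "\<lambda>x::'a. inverse (norm x) *\<^sub>R x"
  let ?D = "?N ` (C - {0})"
  have "x \<in> span ?D" if "x \<in> C" for x
  proof (cases "x = 0")
    case False
    then have "norm x *\<^sub>R ?N x \<in> span ?D" using that by (intro span_scale span_base) auto
    then show ?thesis using False by simp
  qed (simp add: span_zero)
  then have "span C \<subseteq> span ?D" by (simp add: span_minimal subsetI)
  then have "span ?D = UNIV" using B C by auto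
  moreover have "pairwise orthogonal ?D"
    using C(3) by (auto simp: pairwise_def orthogonal_def)
  ultimately show ?thesis using C(1) by (intro exI[of _ ?D]) auto
qed

lemma onb:
  shows finite_onb: "finite (onb::'a::fin_dim_inner set)"
    and norm_onb: "\<And>b. b \<in> (onb::'a set) \<Longrightarrow> norm b = 1"
    and orthogonal_onb: "pairwise orthogonal (onb::'a set)"
    and span_onb: "span (onb::'a set) = UNIV"
proof -
  have "finite (onb::'a set) \<and> (\<forall>b\<in>(onb::'a set). norm b = 1) \<and> pairwise orthogonal (onb::'a set)
      \<and> span (onb::'a set) = UNIV"
    using someI_ex[OF onb_exists[where 'a='a]] unfolding onb_def[symmetric] .
  then show "finite (onb::'a set)" "\<And>b. b \<in> (onb::'a set) \<Longrightarrow> norm b = 1"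
    "pairwise orthogonal (onb::'a set)" "span (onb::'a set) = UNIV" by blast+
qed

lemma onb_expand:
  fixes x :: "'a::fin_dim_inner"
  shows "(\<Sum>b\<in>onb. (x \<bullet> b) *\<^sub>R b) = x"
proof -
  obtain r where r: "x = (\<Sum>b\<in>onb. r b *\<^sub>R b)"
    using span_onb[where 'a='a] span_finite[OF finite_onb] by blast
  \<comment> \<open>Spanning gives some coefficients; orthonormality identifies them as inner
    products.\<close>
  have "x \<bullet> c = r c" if c: "c \<in> onb" for c
  proof -
    have "x \<bullet> c = (\<Sum>b\<in>onb. r b * (b \<bullet> c))" by (simp add: r inner_sum_left)
    also have "\<dots> = (\<Sum>b\<in>onb. if b = c then r c else 0)"
      using orthogonal_onb norm_onb[OF c] c
      by (intro sum.cong) (auto simp: pairwise_def orthogonal_def dot_square_norm)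
    finally show ?thesis using c by (simp add: finite_onb)
  qed
  then show ?thesis by (simp add: r[symmetric])
qed

lemma linear_onb:
  fixes f :: "'a::fin_dim_inner \<Rightarrow> 'b::real_vector"
  assumes "linear f"
  shows "f x = (\<Sum>b\<in>onb. (x \<bullet> b) *\<^sub>R f b)"
proof -
  have "f x = f (\<Sum>b\<in>onb. (x \<bullet> b) *\<^sub>R b)" by (simp add: onb_expand)
  also have "\<dots> = (\<Sum>b\<in>onb. (x \<bullet> b) *\<^sub>R f b)"
    by (simp add: linear_sum[OF assms] linear_scale[OF assms])
  finally show ?thesis .
qed

text \<open>The bound involves only the values on the basis. For a family of linear maps it is
  therefore controlled by finitely many functions of the parameter, which is how uniform estimates
  arise in \<open>smooth_on_inverse_family\<close> and \<open>smooth_on_lipschitz\<close>.\<close>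

lemma linear_norm_le:
  fixes f :: "'a::fin_dim_inner \<Rightarrow> 'b::real_normed_vector"
  assumes "linear f"
  shows "norm (f x) \<le> (\<Sum>b\<in>onb. norm (f b)) * norm x"
proof -
  have "norm (f x) \<le> (\<Sum>b\<in>onb. norm ((x \<bullet> b) *\<^sub>R f b))"
    unfolding linear_onb[OF assms, of x] by (rule norm_sum)
  also have "\<dots> \<le> (\<Sum>b\<in>onb. norm x * norm (f b))"
  proof (rule sum_mono)
    fix b :: 'a assume "b \<in> onb"
    then have "\<bar>x \<bullet> b\<bar> \<le> norm x" using Cauchy_Schwarz_ineq2[of x b] by (simp add: norm_onb)
    then show "norm ((x \<bullet> b) *\<^sub>R f b) \<le> norm x * norm (f b)" by (simp add: mult_right_mono)
  qed
  finally show ?thesis by (simp add: sum_distrib_left mult.commute)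
qed

lemma linear_imp_bounded_linear:
  fixes f :: "'a::fin_dim_inner \<Rightarrow> 'b::real_normed_vector"
  assumes "linear f"
  shows "bounded_linear f"
  using assms linear_norm_le[OF assms]
  by (intro bounded_linear_intro[where K="\<Sum>b\<in>onb. norm (f b)"])
     (auto simp: linear_add linear_scale mult.commute)

text \<open>On a thick set, derivatives within the set are unique.  Open sets and (relatively open
  subsets of) nondegenerate intervals are thick, so both uses of \<open>smooth_on\<close> are covered at once.\<close>

definition thick :: "'a::real_normed_vector set \<Rightarrow> bool"
  where "thick S \<longleftrightarrow> (\<forall>x\<in>S. \<forall>v. \<forall>e>0. \<exists>d. d \<noteq> 0 \<and> \<bar>d\<bar> < e \<and> x + d *\<^sub>R v \<in> S)"

lemma thick_openin:
  assumes "thick S" "openin (top_of_set S) T"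
  shows "thick T"
  unfolding thick_def
proof safe
  fix x v :: 'a and e :: real assume x: "x \<in> T" and e: "e > 0"
  obtain U where U: "open U" "T = S \<inter> U" using assms(2) openin_open by blast
  obtain r where r: "r > 0" "ball x r \<subseteq> U" using U x open_contains_ball by blast
  \<comment> \<open>The second bound keeps \<open>x + d *\<^sub>R v\<close> inside the ball; the
    summand 1 covers \<open>v = 0\<close>.\<close>
  let ?e = "min e (r / (norm v + 1))"
  have "?e > 0" using e r by (simp add: add_nonneg_pos)
  then obtain d where d: "d \<noteq> 0" "\<bar>d\<bar> < ?e" "x + d *\<^sub>R v \<in> S"
    using assms(1) x U unfolding thick_def by blast
  have "norm v + 1 > 0" by (simp add: add_nonneg_pos)
  then have "\<bar>d\<bar> * (norm v + 1) < r" using d(2) by (simp add: pos_less_divide_eq)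
  moreover have "\<bar>d\<bar> * norm v \<le> \<bar>d\<bar> * (norm v + 1)" by (simp add: mult_left_mono)
  ultimately have "\<bar>d\<bar> * norm v < r" by linarith
  then have "x + d *\<^sub>R v \<in> ball x r" by (simp add: dist_norm)
  then show "\<exists>d. d \<noteq> 0 \<and> \<bar>d\<bar> < e \<and> x + d *\<^sub>R v \<in> T"
    using d r U by (intro exI[of _ d]) auto
qed

lemma thick_UNIV: "thick UNIV"
  unfolding thick_def by (metis UNIV_I dense abs_of_pos less_numeral_extra(3))

lemma thick_open: "open S \<Longrightarrow> thick S"
  using thick_openin[OF thick_UNIV] by simp

lemma thick_Icc:
  fixes a b :: real
  assumes "a < b"
  shows "thick {a..b}"
  unfolding thick_def
proof safe
  fix x v e :: real assume x: "x \<in> {a..b}" and e: "e > 0"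
  show "\<exists>d. d \<noteq> 0 \<and> \<bar>d\<bar> < e \<and> x + d *\<^sub>R v \<in> {a..b}"
  proof (cases "v = 0")
    case True then show ?thesis using e x by (intro exI[of _ "e/2"]) auto
  next
    case False
    \<comment> \<open>A move of length \<open>h\<close> from \<open>x\<close> towards the farther
      end stays in the interval, since \<open>h\<close> is at most half its length. Dividing by
      \<open>v\<close> gives the required \<open>d\<close>, and \<open>h < e * \<bar>v\<bar>\<close>
      makes it smaller than \<open>e\<close>.\<close>
    define h where "h = min (e/2 * \<bar>v\<bar>) (b - a) / 2"
    have h: "h > 0" "h < e * \<bar>v\<bar>" "h \<le> (b-a)/2" using False e assms by (auto simp: h_def min_def)
    define y where "y = (if x \<le> (a+b)/2 then h else - h)"
    have "x + y \<in> {a..b}" using h x by (auto simp: y_def field_simps)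
    moreover have "y \<noteq> 0" "\<bar>y\<bar> < e * \<bar>v\<bar>" using h by (auto simp: y_def)
    ultimately show ?thesis using False by (intro exI[of _ "y / v"]) (auto simp: field_simps)
  qed
qed

text \<open>Along each direction \<open>v\<close> thickness makes 0 a limit point of the admissible
  parameters, so the directional derivative at \<open>x\<close> is a genuine limit and determines
  \<open>F v\<close>.\<close>

lemma thick_unique:
  assumes "thick S" "x \<in> S" and F: "(f has_derivative F) (at x within S)"
    and G: "(f has_derivative G) (at x within S)"
  shows "F = G"
proof
  fix v
  let ?D = "{d. x + d *\<^sub>R v \<in> S}"
  have l: "((\<lambda>d. f (x + d *\<^sub>R v)) has_vector_derivative H v) (at 0 within ?D)"
    if "(f has_derivative H) (at x within S)" for H
  proof -
    interpret bounded_linear H using that by (rule has_derivative_bounded_linear)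
    have "((\<lambda>d. f (x + d *\<^sub>R v)) has_derivative (\<lambda>d. H (d *\<^sub>R v))) (at 0 within ?D)"
      by (rule has_derivative_in_compose[of "\<lambda>d. x + d *\<^sub>R v"])
         (auto intro!: derivative_eq_intros has_derivative_subset[OF that])
    then show ?thesis by (simp add: has_vector_derivative_def scaleR)
  qed
  have "at 0 within ?D \<noteq> bot"
    using assms(1,2) by (simp add: trivial_limit_within islimpt_approachable thick_def) blast
  then show "F v = G v"
    using vector_derivative_unique_within l[OF F] l[OF G] by blast
qed

lemma frechet_derivative_thick:
  assumes "thick S" "x \<in> S" "(f has_derivative F) (at x within S)"
  shows "frechet_derivative f (at x within S) = F"
  using assms thick_unique frechet_derivative_works differentiableI by metis

lemma trivial_limit_thick:
  fixes S :: "real set"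
  assumes "thick S" "x \<in> S"
  shows "at x within S \<noteq> bot"
proof -
  have "\<exists>x'\<in>S. x' \<noteq> x \<and> dist x' x < e" if e: "e > 0" for e
  proof -
    obtain d where "d \<noteq> 0" "\<bar>d\<bar> < e" "x + d *\<^sub>R 1 \<in> S"
      using assms(1)[unfolded thick_def, rule_format, OF assms(2) e] by blast
    then show ?thesis by (intro bexI[of _ "x + d"]) (auto simp: dist_norm)
  qed
  then show ?thesis unfolding trivial_limit_within islimpt_approachable by blast
qed

lemma vector_derivative_thick:
  fixes S :: "real set"
  assumes "thick S" "x \<in> S" "(f has_vector_derivative F) (at x within S)"
  shows "vector_derivative f (at x within S) = F"
  using vector_derivative_within[OF trivial_limit_thick] assms by blast

lemma at_within_openin:
  assumes "openin (top_of_set S) T" "x \<in> T"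
  shows "at x within T = at x within S"
proof -
  obtain U where "open U" "T = S \<inter> U" using assms(1) openin_open by blast
  then show ?thesis using assms(2) by (intro at_within_nhd[of x U]) auto
qed

section \<open>Closure properties of \<open>Ck_on\<close> and of smooth functions\<close>

lemma Ck_on_cong:
  assumes "\<And>x. x \<in> S \<Longrightarrow> f x = g x"
  shows "Ck_on k S f \<longleftrightarrow> Ck_on k S g"
proof (cases k)
  case 0 then show ?thesis using assms by (auto intro: continuous_on_cong)
next
  case (Suc j)
  have "(f has_derivative F) (at x within S) \<longleftrightarrow> (g has_derivative F) (at x within S)" if "x \<in> S" for x F
    using that assms by (metis has_derivative_transform)
  then show ?thesis by (simp add: Suc)
qed

text \<open>\<open>Ck_on\<close> only asserts that some derivative exists. On a thick set it is
  unique, so it can be named by \<open>frechet_derivative\<close>, and different orders and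
  neighbourhoods then refer to the same function.\<close>

lemma Ck_on_Suc:
  assumes "Ck_on (Suc k) S f" "thick S"
  shows "\<And>x. x \<in> S \<Longrightarrow> (f has_derivative frechet_derivative f (at x within S)) (at x within S)"
    and "Ck_on k S (\<lambda>x. frechet_derivative f (at x within S) v)"
proof -
  obtain f' where f': "\<And>x. x \<in> S \<Longrightarrow> (f has_derivative f' x) (at x within S)" "\<And>v. Ck_on k S (\<lambda>x. f' x v)"
    using assms by auto
  show "(f has_derivative frechet_derivative f (at x within S)) (at x within S)" if "x \<in> S" for x
    using f'(1)[OF that] frechet_derivative_works differentiableI by blast
  have "frechet_derivative f (at x within S) = f' x" if "x \<in> S" for x
    using frechet_derivative_thick assms(2) that f'(1) by blast
  then show "Ck_on k S (\<lambda>x. frechet_derivative f (at x within S) v)"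
    using f'(2)[of v] by (subst Ck_on_cong[where g="\<lambda>x. f' x v"]) auto
qed

lemma Ck_on_Suc_imp: "Ck_on (Suc k) S f \<Longrightarrow> Ck_on k S f"
proof (induction k arbitrary: f)
  case 0 then show ?case by (auto intro: has_derivative_continuous_on)
next
  case (Suc k)
  obtain f' where f': "\<And>x. x \<in> S \<Longrightarrow> (f has_derivative f' x) (at x within S)" "\<And>v. Ck_on (Suc k) S (\<lambda>x. f' x v)"
    using Suc.prems unfolding Ck_on.simps(2)[of "Suc k"] by blast
  then show ?case using Suc.IH unfolding Ck_on.simps(2)[of k] by blast
qed

lemma Ck_on_imp_continuous: "Ck_on k S f \<Longrightarrow> continuous_on S f"
  by (induction k) (simp, blast dest: Ck_on_Suc_imp)

lemma Ck_on_subset: "Ck_on k S f \<Longrightarrow> T \<subseteq> S \<Longrightarrow> Ck_on k T f"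
proof (induction k arbitrary: f)
  case 0 then show ?case by (auto intro: continuous_on_subset)
next
  case (Suc k) then show ?case by simp (meson has_derivative_subset subsetD)
qed

text \<open>The locally given derivatives agree because each is the derivative within
  \<open>S\<close>: a relatively open \<open>T\<close> has the same filter
  \<open>at x within T\<close>. Hence the derivative can be fixed once on all of \<open>S\<close>
  before the induction hypothesis is applied to it.\<close>

lemma Ck_on_local:
  assumes "thick S" "\<And>x. x \<in> S \<Longrightarrow> \<exists>T. openin (top_of_set S) T \<and> x \<in> T \<and> Ck_on k T f"
  shows "Ck_on k S f"
  using assms
proof (induction k arbitrary: S f)
  case 0
  show ?case unfolding Ck_on.simps continuous_on_eq_continuous_within
  proof
    fix x assume "x \<in> S"
    then obtain T where T: "openin (top_of_set S) T" "x \<in> T" "continuous_on T f" using 0 by auto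
    then show "continuous (at x within S) f"
      using at_within_openin[OF T(1,2)] by (auto simp: continuous_on_eq_continuous_within)
  qed
next
  case (Suc k)
  let ?D = "\<lambda>x. frechet_derivative f (at x within S)"
  have *: "\<exists>T. openin (top_of_set S) T \<and> x \<in> T \<and> (f has_derivative ?D x) (at x within S)
      \<and> (\<forall>v. Ck_on k T (\<lambda>x. ?D x v))" if x: "x \<in> S" for x
  proof -
    obtain T where T: "openin (top_of_set S) T" "x \<in> T" "Ck_on (Suc k) T f" using Suc.prems(2)[OF x] by blast
    have th: "thick T" using thick_openin Suc.prems T by blast
    note C = Ck_on_Suc[OF T(3) th]
    have "\<And>y. y \<in> T \<Longrightarrow> at y within T = at y within S" using at_within_openin T by blast
    then show ?thesis using T C(1)[OF T(2)] C(2) by (intro exI[of _ T]) (auto cong: Ck_on_cong)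
  qed
  show ?case unfolding Ck_on.simps
  proof (intro exI[of _ ?D] conjI allI ballI)
    fix x assume "x \<in> S" then show "(f has_derivative ?D x) (at x within S)" using * by blast
  next
    fix v show "Ck_on k S (\<lambda>x. ?D x v)"
      using * by (intro Suc.IH Suc.prems(1)) blast
  qed
qed

lemma Ck_on_SucI:
  "(\<And>x. x \<in> S \<Longrightarrow> (f has_derivative f' x) (at x within S)) \<Longrightarrow> (\<And>v. Ck_on k S (\<lambda>x. f' x v)) \<Longrightarrow> Ck_on (Suc k) S f"
  unfolding Ck_on.simps by blast

lemma Ck_on_const: "Ck_on k S (\<lambda>x. c)"
  by (induction k arbitrary: c) (simp, rule Ck_on_SucI[where f'="\<lambda>_ _. 0"], simp_all)

lemma Ck_on_linear: "bounded_linear h \<Longrightarrow> Ck_on k S h"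
  by (cases k) (simp add: linear_continuous_on, clarify, rule Ck_on_SucI[where f'="\<lambda>_. h"],
     auto intro: Ck_on_const bounded_linear_imp_has_derivative)

lemma Ck_on_compose_linear: "bounded_linear h \<Longrightarrow> Ck_on k S f \<Longrightarrow> Ck_on k S (\<lambda>x. h (f x))"
proof (induction k arbitrary: f)
  case 0 then show ?case by (simp add: bounded_linear.continuous_on)
next
  case (Suc k)
  obtain f' where f': "\<And>x. x \<in> S \<Longrightarrow> (f has_derivative f' x) (at x within S)" "\<And>v. Ck_on k S (\<lambda>x. f' x v)"
    using Suc.prems by auto
  show ?case
    by (rule Ck_on_SucI[where f'="\<lambda>x v. h (f' x v)"])
       (intro bounded_linear.has_derivative[OF Suc.prems(1)] f' Suc.IH Suc.prems(1) | assumption)+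
qed

lemma Ck_on_add: "Ck_on k S f \<Longrightarrow> Ck_on k S g \<Longrightarrow> Ck_on k S (\<lambda>x. f x + g x)"
proof (induction k arbitrary: f g)
  case 0 then show ?case by (simp add: continuous_on_add)
next
  case (Suc k)
  obtain f' where f': "\<And>x. x \<in> S \<Longrightarrow> (f has_derivative f' x) (at x within S)" "\<And>v. Ck_on k S (\<lambda>x. f' x v)"
    using Suc.prems by auto
  obtain g' where g': "\<And>x. x \<in> S \<Longrightarrow> (g has_derivative g' x) (at x within S)" "\<And>v. Ck_on k S (\<lambda>x. g' x v)"
    using Suc.prems by auto
  show ?case
    by (rule Ck_on_SucI[where f'="\<lambda>x v. f' x v + g' x v"])
       (intro has_derivative_add f' g' Suc.IH | assumption)+
qed

lemma Ck_on_scaleR: "Ck_on k S r \<Longrightarrow> Ck_on k S g \<Longrightarrow> Ck_on k S (\<lambda>x. r x *\<^sub>R g x)"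
proof (induction k arbitrary: r g)
  case 0 then show ?case by (simp add: continuous_on_scaleR)
next
  case (Suc k)
  obtain f' where f': "\<And>x. x \<in> S \<Longrightarrow> (r has_derivative f' x) (at x within S)" "\<And>v. Ck_on k S (\<lambda>x. f' x v)"
    using Suc.prems by auto
  obtain g' where g': "\<And>x. x \<in> S \<Longrightarrow> (g has_derivative g' x) (at x within S)" "\<And>v. Ck_on k S (\<lambda>x. g' x v)"
    using Suc.prems by auto
  show ?case
    by (rule Ck_on_SucI[where f'="\<lambda>x v. r x *\<^sub>R g' x v + f' x v *\<^sub>R g x"])
       (intro has_derivative_scaleR Ck_on_add f' g' Suc.IH Suc.prems[THEN Ck_on_Suc_imp] | assumption)+
qed

lemma Ck_on_sum: "(\<And>i. i \<in> I \<Longrightarrow> Ck_on k S (f i)) \<Longrightarrow> Ck_on k S (\<lambda>x. \<Sum>i\<in>I. f i x)"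
  by (induction I rule: infinite_finite_induct) (auto intro: Ck_on_const Ck_on_add)

lemma Ck_on_Pair: "Ck_on k S f \<Longrightarrow> Ck_on k S g \<Longrightarrow> Ck_on k S (\<lambda>x. (f x, g x))"
proof (induction k arbitrary: f g)
  case 0 then show ?case by (simp add: continuous_on_Pair)
next
  case (Suc k)
  obtain f' where f': "\<And>x. x \<in> S \<Longrightarrow> (f has_derivative f' x) (at x within S)" "\<And>v. Ck_on k S (\<lambda>x. f' x v)"
    using Suc.prems by auto
  obtain g' where g': "\<And>x. x \<in> S \<Longrightarrow> (g has_derivative g' x) (at x within S)" "\<And>v. Ck_on k S (\<lambda>x. g' x v)"
    using Suc.prems by auto
  show ?case
    by (rule Ck_on_SucI[where f'="\<lambda>x v. (f' x v, g' x v)"])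
       (intro has_derivative_Pair f' g' Suc.IH | assumption)+
qed

text \<open>\<open>Ck_on\<close> treats an operator-valued map through its evaluations at fixed
  vectors. Expanding the argument in the orthonormal basis reduces a varying argument to finitely
  many of these.\<close>

lemma Ck_on_apply:
  fixes A :: "'a::real_normed_vector \<Rightarrow> 'b::fin_dim_inner \<Rightarrow> 'c::real_normed_vector"
  assumes "\<And>b. Ck_on k S (\<lambda>y. A y b)" "Ck_on k S g" "\<And>y. y \<in> S \<Longrightarrow> linear (A y)"
  shows "Ck_on k S (\<lambda>y. A y (g y))"
proof -
  have "Ck_on k S (\<lambda>y. \<Sum>b\<in>onb. (g y \<bullet> b) *\<^sub>R A y b)"
    by (intro Ck_on_sum Ck_on_scaleR assms Ck_on_compose_linear[of "\<lambda>x. x \<bullet> _"] bounded_linear_inner_left)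
  then show ?thesis
    by (rule iffD1[OF Ck_on_cong, rotated]) (metis linear_onb assms(3))
qed

lemma Ck_on_compose:
  fixes f :: "'a::real_normed_vector \<Rightarrow> 'b::fin_dim_inner" and g :: "'b \<Rightarrow> 'c::real_normed_vector"
  shows "Ck_on k T g \<Longrightarrow> Ck_on k S f \<Longrightarrow> f ` S \<subseteq> T \<Longrightarrow> Ck_on k S (\<lambda>x. g (f x))"
proof (induction k arbitrary: f g)
  case 0 then show ?case using continuous_on_compose2[of T g S f] by (simp add: image_subset_iff)
next
  case (Suc k)
  obtain f' where f': "\<And>x. x \<in> S \<Longrightarrow> (f has_derivative f' x) (at x within S)" "\<And>v. Ck_on k S (\<lambda>x. f' x v)"
    using Suc.prems(2) by auto
  obtain g' where g': "\<And>x. x \<in> T \<Longrightarrow> (g has_derivative g' x) (at x within T)" "\<And>v. Ck_on k T (\<lambda>x. g' x v)"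
    using Suc.prems(1) by auto
  \<comment> \<open>The derivative given by the chain rule evaluates a varying operator at a varying
    vector, the situation of \<open>Ck_on_apply\<close>.\<close>
  have "Ck_on k S (\<lambda>x. g' (f x) (f' x v))" for v
  proof (rule Ck_on_apply[where A="\<lambda>x. g' (f x)"])
    show "Ck_on k S (\<lambda>y. g' (f y) b)" for b
      by (rule Suc.IH[OF g'(2) Ck_on_Suc_imp]) (use Suc.prems in auto)
    show "linear (g' (f y))" if "y \<in> S" for y
      using g'(1)[of "f y"] Suc.prems(3) that has_derivative_linear by blast
  qed (rule f'(2))
  moreover have "((\<lambda>x. g (f x)) has_derivative (\<lambda>v. g' (f x) (f' x v))) (at x within S)" if "x \<in> S" for x
    by (rule has_derivative_in_compose2[OF g'(1) Suc.prems(3) that f'(1)[OF that]])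
  ultimately show ?case unfolding Ck_on.simps
    by (intro exI[of _ "\<lambda>x v. g' (f x) (f' x v)"] conjI ballI allI)
qed

lemma smooth_on_cong: "(\<And>x. x \<in> S \<Longrightarrow> f x = g x) \<Longrightarrow> smooth_on S f \<longleftrightarrow> smooth_on S g"
  unfolding smooth_on_def using Ck_on_cong by blast

lemma smooth_on_eq: "smooth_on S f \<Longrightarrow> (\<And>x. x \<in> S \<Longrightarrow> g x = f x) \<Longrightarrow> smooth_on S g"
  using smooth_on_cong by blast

lemma smooth_on_subset: "smooth_on S f \<Longrightarrow> T \<subseteq> S \<Longrightarrow> smooth_on T f"
  unfolding smooth_on_def using Ck_on_subset by blast

lemma smooth_on_imp_continuous_on: "smooth_on S f \<Longrightarrow> continuous_on S f"
  unfolding smooth_on_def using Ck_on_imp_continuous by blast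

lemma smooth_on_local:
  assumes "thick S" "\<And>x. x \<in> S \<Longrightarrow> \<exists>T. openin (top_of_set S) T \<and> x \<in> T \<and> smooth_on T f"
  shows "smooth_on S f"
  unfolding smooth_on_def using Ck_on_local assms by (metis smooth_on_def)

lemma smooth_on_const: "smooth_on S (\<lambda>x. c)"
  by (simp add: smooth_on_def Ck_on_const)

lemma smooth_on_linear: "bounded_linear h \<Longrightarrow> smooth_on S h"
  by (simp add: smooth_on_def Ck_on_linear)

lemma smooth_on_compose_linear: "bounded_linear h \<Longrightarrow> smooth_on S f \<Longrightarrow> smooth_on S (\<lambda>x. h (f x))"
  by (simp add: smooth_on_def Ck_on_compose_linear)

lemma smooth_on_add: "smooth_on S f \<Longrightarrow> smooth_on S g \<Longrightarrow> smooth_on S (\<lambda>x. f x + g x)"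
  by (simp add: smooth_on_def Ck_on_add)

lemma smooth_on_scaleR: "smooth_on S r \<Longrightarrow> smooth_on S g \<Longrightarrow> smooth_on S (\<lambda>x. r x *\<^sub>R g x)"
  by (simp add: smooth_on_def Ck_on_scaleR)

lemma smooth_on_sum: "(\<And>i. i \<in> I \<Longrightarrow> smooth_on S (f i)) \<Longrightarrow> smooth_on S (\<lambda>x. \<Sum>i\<in>I. f i x)"
  by (simp add: smooth_on_def Ck_on_sum)

lemma smooth_on_Pair: "smooth_on S f \<Longrightarrow> smooth_on S g \<Longrightarrow> smooth_on S (\<lambda>x. (f x, g x))"
  by (simp add: smooth_on_def Ck_on_Pair)

lemma smooth_on_id: "smooth_on S (\<lambda>x. x)"
  by (rule smooth_on_linear) (rule bounded_linear_ident)

lemma smooth_on_minus: "smooth_on S f \<Longrightarrow> smooth_on S g \<Longrightarrow> smooth_on S (\<lambda>x. f x - g x)"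
  using smooth_on_add[of S f "\<lambda>x. (-1) *\<^sub>R g x"] smooth_on_scaleR[OF smooth_on_const[of S "-1"], of g]
  by simp

lemma smooth_on_mult:
  fixes f g :: "'a::real_normed_vector \<Rightarrow> real"
  shows "smooth_on S f \<Longrightarrow> smooth_on S g \<Longrightarrow> smooth_on S (\<lambda>x. f x * g x)"
  using smooth_on_scaleR[of S f g] by simp

lemma smooth_on_fst: "smooth_on S f \<Longrightarrow> smooth_on S (\<lambda>x. fst (f x))"
  by (rule smooth_on_compose_linear[OF bounded_linear_fst])

lemma smooth_on_snd: "smooth_on S f \<Longrightarrow> smooth_on S (\<lambda>x. snd (f x))"
  by (rule smooth_on_compose_linear[OF bounded_linear_snd])

lemma smooth_on_apply:
  fixes A :: "'a::real_normed_vector \<Rightarrow> 'b::fin_dim_inner \<Rightarrow> 'c::real_normed_vector"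
  assumes "\<And>b. smooth_on S (\<lambda>y. A y b)" "smooth_on S g" "\<And>y. y \<in> S \<Longrightarrow> linear (A y)"
  shows "smooth_on S (\<lambda>y. A y (g y))"
  using assms Ck_on_apply unfolding smooth_on_def by blast

lemma smooth_on_compose:
  fixes f :: "'a::real_normed_vector \<Rightarrow> 'b::fin_dim_inner" and g :: "'b \<Rightarrow> 'c::real_normed_vector"
  shows "smooth_on T g \<Longrightarrow> smooth_on S f \<Longrightarrow> (\<And>x. x \<in> S \<Longrightarrow> f x \<in> T) \<Longrightarrow> smooth_on S (\<lambda>x. g (f x))"
  unfolding smooth_on_def using Ck_on_compose[where S=S and T=T and f=f and g=g] by (simp add: image_subset_iff)

lemma smooth_on_has_derivative:
  assumes "smooth_on S f" "thick S" "x \<in> S"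
  shows "(f has_derivative frechet_derivative f (at x within S)) (at x within S)"
  using assms Ck_on_Suc unfolding smooth_on_def by blast

lemma smooth_on_frechet_derivative:
  assumes "smooth_on S f" "thick S"
  shows "smooth_on S (\<lambda>x. frechet_derivative f (at x within S) v)"
  using assms Ck_on_Suc unfolding smooth_on_def by blast

lemma smooth_on_has_derivative_open:
  assumes "smooth_on S f" "open S" "x \<in> S"
  shows "(f has_derivative frechet_derivative f (at x)) (at x)"
  using smooth_on_has_derivative[OF assms(1) thick_open[OF assms(2)] assms(3)]
  unfolding at_within_open[OF assms(3,2)] .

lemma linear_frechet_derivative_smooth:
  assumes "smooth_on S f" "open S" "x \<in> S"
  shows "linear (frechet_derivative f (at x))"
  using smooth_on_has_derivative_open[OF assms] has_derivative_linear by blast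

lemma smooth_on_frechet_derivative_open:
  assumes "smooth_on S f" "open S"
  shows "smooth_on S (\<lambda>x. frechet_derivative f (at x) v)"
  by (rule smooth_on_eq[OF smooth_on_frechet_derivative[OF assms(1) thick_open[OF assms(2)], of v]])
     (simp only: at_within_open[OF _ assms(2)])

lemma smooth_on_frechet_derivative_apply:
  fixes f :: "'a::fin_dim_inner \<Rightarrow> 'b::real_normed_vector"
  assumes "smooth_on S f" "open S" "smooth_on T g" "smooth_on T w" "\<And>x. x \<in> T \<Longrightarrow> g x \<in> S"
  shows "smooth_on T (\<lambda>x. frechet_derivative f (at (g x)) (w x))"
proof (rule smooth_on_apply[where A="\<lambda>x. frechet_derivative f (at (g x))", OF _ assms(4)])
  show "smooth_on T (\<lambda>y. frechet_derivative f (at (g y)) b)" for b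
    using smooth_on_compose[OF smooth_on_frechet_derivative_open[OF assms(1,2)] assms(3,5)] .
  show "linear (frechet_derivative f (at (g y)))" if "y \<in> T" for y
    using linear_frechet_derivative_smooth[OF assms(1,2) assms(5)[OF that]] .
qed

lemma smooth_on_vector_derivative:
  fixes f :: "real \<Rightarrow> 'b::real_normed_vector"
  assumes "smooth_on S f" "thick S"
  shows "\<And>x. x \<in> S \<Longrightarrow> (f has_vector_derivative vector_derivative f (at x within S)) (at x within S)"
    and "smooth_on S (\<lambda>x. vector_derivative f (at x within S))"
proof -
  show 1: "(f has_vector_derivative vector_derivative f (at x within S)) (at x within S)" if "x \<in> S" for x
    using smooth_on_has_derivative[OF assms that] differentiableI vector_derivative_works by blast
  have "frechet_derivative f (at x within S) 1 = vector_derivative f (at x within S)" if "x \<in> S" for x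
    using frechet_derivative_thick[OF assms(2) that 1[OF that, unfolded has_vector_derivative_def]] by simp
  then show "smooth_on S (\<lambda>x. vector_derivative f (at x within S))"
    by (intro smooth_on_eq[OF smooth_on_frechet_derivative[OF assms, of 1]]) simp
qed

text \<open>The identities expressing linearity in \<open>b\<close> hold at each \<open>y\<close>,
  so both sides have the same derivative in \<open>y\<close> by uniqueness on a thick set.\<close>

lemma derivative_family_linear:
  assumes th: "thick S" "x \<in> S" and lin: "\<And>y. y \<in> S \<Longrightarrow> linear (A y)"
    and der: "\<And>b. ((\<lambda>y. A y b) has_derivative (\<lambda>u. A' u b)) (at x within S)"
  shows "linear (A' u)"
proof -
  have "(\<lambda>u. A' u (b + c)) = (\<lambda>u. A' u b + A' u c)" for b c
    by (rule thick_unique[OF th der])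
       (rule has_derivative_transform[OF th(2) _ has_derivative_add[OF der der]], simp add: linear_add[OF lin])
  moreover have "(\<lambda>u. A' u (r *\<^sub>R b)) = (\<lambda>u. r *\<^sub>R A' u b)" for r b
    by (rule thick_unique[OF th der])
       (rule has_derivative_transform[OF th(2) _ has_derivative_scaleR_right[OF der]], simp add: linear_scale[OF lin])
  ultimately show ?thesis by (intro linearI) (simp_all add: fun_eq_iff)
qed

text \<open>The product rule for evaluation, obtained by differentiating the expansion of
  \<open>g s\<close> in the orthonormal basis. It is used whenever a coordinate expression is linear
  in a vector that moves together with the base point.\<close>

lemma has_derivative_apply:
  fixes A :: "'a::real_normed_vector \<Rightarrow> 'b::fin_dim_inner \<Rightarrow> 'c::real_normed_vector"
  assumes th: "thick S" and lin: "\<And>y. y \<in> S \<Longrightarrow> linear (A y)"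
    and der: "\<And>b. ((\<lambda>y. A y b) has_derivative (\<lambda>u. A' u b)) (at (f x) within S)"
    and f: "f ` T \<subseteq> S" "x \<in> T" "(f has_derivative f') (at x within T)"
    and g: "(g has_derivative g') (at x within T)"
  shows "((\<lambda>s. A (f s) (g s)) has_derivative (\<lambda>h. A' (f' h) (g x) + A (f x) (g' h))) (at x within T)"
proof -
  have fx: "f x \<in> S" using f by blast
  have d: "((\<lambda>s. A (f s) b) has_derivative (\<lambda>h. A' (f' h) b)) (at x within T)" for b
    by (rule has_derivative_in_compose[OF f(3)]) (rule has_derivative_subset[OF der f(1)])
  have "((\<lambda>s. \<Sum>b\<in>onb. (g s \<bullet> b) *\<^sub>R A (f s) b) has_derivative
     (\<lambda>h. \<Sum>b\<in>onb. (g x \<bullet> b) *\<^sub>R A' (f' h) b + (g' h \<bullet> b) *\<^sub>R A (f x) b)) (at x within T)"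
    by (intro has_derivative_sum has_derivative_scaleR has_derivative_inner_left g d)
  also have "(\<lambda>h. \<Sum>b\<in>onb. (g x \<bullet> b) *\<^sub>R A' (f' h) b + (g' h \<bullet> b) *\<^sub>R A (f x) b) =
     (\<lambda>h. A' (f' h) (g x) + A (f x) (g' h))"
    using derivative_family_linear[OF th fx lin der] lin[OF fx]
    by (simp add: sum.distrib linear_onb[symmetric])
  finally show ?thesis
    by (rule has_derivative_transform[OF f(2), rotated]) (use f lin in \<open>auto intro: linear_onb\<close>)
qed

subsection \<open>Symmetry of second derivatives\<close>

text \<open>The mean value theorem is applied to the first difference in direction \<open>u\<close>,
  then to its derivative in direction \<open>v\<close>. The second difference on the left is
  symmetric in \<open>u\<close> and \<open>v\<close>, which the next lemma exploits.\<close>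

lemma mixed_difference:
  fixes f :: "'a::real_normed_vector \<Rightarrow> real"
  assumes h: "h > 0"
    and S: "\<And>a b. 0 \<le> a \<Longrightarrow> a \<le> h \<Longrightarrow> 0 \<le> b \<Longrightarrow> b \<le> h \<Longrightarrow> x + a *\<^sub>R u + b *\<^sub>R v \<in> S"
    and f': "\<And>y. y \<in> S \<Longrightarrow> (f has_derivative f' y) (at y)"
    and f'': "\<And>y. y \<in> S \<Longrightarrow> ((\<lambda>y. f' y u) has_derivative f'' y) (at y)"
  obtains a b where "0 < a" "a < h" "0 < b" "b < h"
    "f (x + h *\<^sub>R u + h *\<^sub>R v) - f (x + h *\<^sub>R u) - f (x + h *\<^sub>R v) + f x = h * h * f'' (x + a *\<^sub>R u + b *\<^sub>R v) v"
proof -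
  define g where "g a = f (x + a *\<^sub>R u + h *\<^sub>R v) - f (x + a *\<^sub>R u + 0 *\<^sub>R v)" for a
  have d: "((\<lambda>a. f (x + a *\<^sub>R u + b *\<^sub>R v)) has_field_derivative f' (x + a *\<^sub>R u + b *\<^sub>R v) u) (at a)"
    if "0 \<le> a" "a \<le> h" "0 \<le> b" "b \<le> h" for a b
  proof -
    have "((\<lambda>a. f (x + a *\<^sub>R u + b *\<^sub>R v)) has_derivative (\<lambda>d. f' (x + a *\<^sub>R u + b *\<^sub>R v) (d *\<^sub>R u))) (at a)"
      by (rule has_derivative_compose[where g=f and f="\<lambda>a. x + a *\<^sub>R u + b *\<^sub>R v", OF _ f'[OF S[OF that]]])
         (auto intro!: derivative_eq_intros)
    moreover have "f' (x + a *\<^sub>R u + b *\<^sub>R v) (d *\<^sub>R u) = f' (x + a *\<^sub>R u + b *\<^sub>R v) u * d" for d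
      using linear_scale[OF has_derivative_linear[OF f'[OF S[OF that]]], of d u] by simp
    ultimately show ?thesis by (simp add: has_field_derivative_def fun_eq_iff)
  qed
  obtain a where a: "0 < a" "a < h"
    "g h - g 0 = h * (f' (x + a *\<^sub>R u + h *\<^sub>R v) u - f' (x + a *\<^sub>R u + 0 *\<^sub>R v) u)"
  proof -
    have "\<exists>z>0. z < h \<and> g h - g 0 = (h - 0) * (f' (x + z *\<^sub>R u + h *\<^sub>R v) u - f' (x + z *\<^sub>R u + 0 *\<^sub>R v) u)"
      by (rule MVT2[OF h]) (unfold g_def, rule DERIV_diff; rule d; use h in simp)
    then show thesis using that by auto
  qed
  have d2: "((\<lambda>b. f' (x + a *\<^sub>R u + b *\<^sub>R v) u) has_field_derivative f'' (x + a *\<^sub>R u + b *\<^sub>R v) v) (at b)"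
    if "0 \<le> b" "b \<le> h" for b
  proof -
    have y: "x + a *\<^sub>R u + b *\<^sub>R v \<in> S" using S a that by simp
    have "((\<lambda>b. f' (x + a *\<^sub>R u + b *\<^sub>R v) u) has_derivative (\<lambda>d. f'' (x + a *\<^sub>R u + b *\<^sub>R v) (d *\<^sub>R v))) (at b)"
      by (rule has_derivative_compose[where g="\<lambda>y. f' y u" and f="\<lambda>b. x + a *\<^sub>R u + b *\<^sub>R v", OF _ f''[OF y]])
         (auto intro!: derivative_eq_intros)
    moreover have "f'' (x + a *\<^sub>R u + b *\<^sub>R v) (d *\<^sub>R v) = f'' (x + a *\<^sub>R u + b *\<^sub>R v) v * d" for d
      using linear_scale[OF has_derivative_linear[OF f''[OF y]], of d v] by simp
    ultimately show ?thesis by (simp add: has_field_derivative_def fun_eq_iff)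
  qed
  obtain b where b: "0 < b" "b < h"
    "f' (x + a *\<^sub>R u + h *\<^sub>R v) u - f' (x + a *\<^sub>R u + 0 *\<^sub>R v) u = h * f'' (x + a *\<^sub>R u + b *\<^sub>R v) v"
    using MVT2[OF h d2] by auto
  show thesis by (rule that[OF a(1,2) b(1,2)]) (use a(3) b(3) in \<open>simp add: g_def algebra_simps\<close>)
qed

lemma second_derivative_symmetric_real:
  fixes f :: "'a::real_normed_vector \<Rightarrow> real"
  assumes S: "open S" "x \<in> S"
    and f': "\<And>y. y \<in> S \<Longrightarrow> (f has_derivative f' y) (at y)"
    and f'': "\<And>y v. y \<in> S \<Longrightarrow> ((\<lambda>y. f' y v) has_derivative f'' y v) (at y)"
    and cont: "\<And>u v. continuous_on S (\<lambda>y. f'' y u v)"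
  shows "f'' x u v = f'' x v u"
proof (rule ccontr)
  assume ne: "f'' x u v \<noteq> f'' x v u"
  \<comment> \<open>Half the gap: values within \<open>e\<close> of the two second derivatives
    cannot coincide.\<close>
  define e where "e = \<bar>f'' x u v - f'' x v u\<bar> / 2"
  have e: "e > 0" using ne by (simp add: e_def)
  define P where "P y \<longleftrightarrow> y \<in> S \<and> dist (f'' y u v) (f'' x u v) < e \<and> dist (f'' y v u) (f'' x v u) < e" for y
  have "\<forall>\<^sub>F y in nhds x. P y"
    unfolding P_def
  proof (intro eventually_conj)
    show "\<forall>\<^sub>F y in nhds x. y \<in> S" using S eventually_nhds by blast
    have "isCont (\<lambda>y. f'' y u v) x" "isCont (\<lambda>y. f'' y v u) x"
      using cont S continuous_on_eq_continuous_at by blast+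
    moreover have "(h \<longlongrightarrow> h x) (nhds x)" if "isCont h x" for h :: "'a \<Rightarrow> real"
      using that by (simp add: continuous_at tendsto_at_iff_tendsto_nhds)
    ultimately have "((\<lambda>y. f'' y u v) \<longlongrightarrow> f'' x u v) (nhds x)" "((\<lambda>y. f'' y v u) \<longlongrightarrow> f'' x v u) (nhds x)"
      by blast+
    then show "\<forall>\<^sub>F y in nhds x. dist (f'' y u v) (f'' x u v) < e" "\<forall>\<^sub>F y in nhds x. dist (f'' y v u) (f'' x v u) < e"
      using e by (blast dest: tendstoD)+
  qed
  then obtain r where r: "r > 0" "\<And>y. dist y x < r \<Longrightarrow> P y" unfolding eventually_nhds_metric by blast
  \<comment> \<open>With this step the whole parallelogram spanned by \<open>h *\<^sub>R u\<close>
    and \<open>h *\<^sub>R v\<close> lies in the ball of radius \<open>r\<close>; the summand 1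
    avoids division by 0.\<close>
  define h where "h = r / (2 * (norm u + norm v + 1))"
  have pos: "norm u + norm v + 1 > 0" by (simp add: add_nonneg_pos)
  have h: "h > 0" using r pos by (simp add: h_def)
  have P: "P (x + a *\<^sub>R u + b *\<^sub>R v)" if ab: "0 \<le> a" "a \<le> h" "0 \<le> b" "b \<le> h" for a b
  proof (rule r(2))
    have "dist (x + a *\<^sub>R u + b *\<^sub>R v) x \<le> norm (a *\<^sub>R u) + norm (b *\<^sub>R v)"
      using norm_triangle_ineq[of "a *\<^sub>R u" "b *\<^sub>R v"] by (simp add: dist_norm add.assoc)
    also have "\<dots> \<le> h * norm u + h * norm v" using ab by (simp add: add_mono mult_right_mono)
    also have "\<dots> \<le> h * (norm u + norm v + 1)" using h by (simp add: algebra_simps)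
    also have "\<dots> = r / 2"
    proof -
      have "r / (2 * N) * N = r / 2" if "N > 0" for N :: real using that by simp
      then show ?thesis unfolding h_def using pos by blast
    qed
    finally show "dist (x + a *\<^sub>R u + b *\<^sub>R v) x < r" using r by simp
  qed
  have P': "P (x + a *\<^sub>R v + b *\<^sub>R u)" if "0 \<le> a" "a \<le> h" "0 \<le> b" "b \<le> h" for a b
    using P[of b a] that by (simp add: ac_simps)
  obtain a b where ab: "0 < a" "a < h" "0 < b" "b < h"
    "f (x + h *\<^sub>R u + h *\<^sub>R v) - f (x + h *\<^sub>R u) - f (x + h *\<^sub>R v) + f x = h * h * f'' (x + a *\<^sub>R u + b *\<^sub>R v) u v"
    by (rule mixed_difference[OF h _ f' f'', of x u v])
       (use P in \<open>auto simp: P_def\<close>)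
  obtain a' b' where ab': "0 < a'" "a' < h" "0 < b'" "b' < h"
    "f (x + h *\<^sub>R v + h *\<^sub>R u) - f (x + h *\<^sub>R v) - f (x + h *\<^sub>R u) + f x = h * h * f'' (x + a' *\<^sub>R v + b' *\<^sub>R u) v u"
    by (rule mixed_difference[OF h _ f' f'', of x v u])
       (use P' in \<open>auto simp: P_def\<close>)
  have "f (x + h *\<^sub>R v + h *\<^sub>R u) = f (x + h *\<^sub>R u + h *\<^sub>R v)" by (simp add: ac_simps)
  then have "h * h * f'' (x + a *\<^sub>R u + b *\<^sub>R v) u v = h * h * f'' (x + a' *\<^sub>R v + b' *\<^sub>R u) v u"
    using ab(5) ab'(5) by linarith
  then have "f'' (x + a *\<^sub>R u + b *\<^sub>R v) u v = f'' (x + a' *\<^sub>R v + b' *\<^sub>R u) v u"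
    using h by simp
  moreover have "P (x + a *\<^sub>R u + b *\<^sub>R v)" "P (x + a' *\<^sub>R v + b' *\<^sub>R u)"
    using P[of a b] P'[of a' b'] ab(1-4) ab'(1-4) by simp_all
  ultimately have "\<bar>f'' x u v - f'' x v u\<bar> < 2 * e" unfolding P_def dist_real_def by linarith
  then show False by (simp add: e_def)
qed

lemma second_derivative_symmetric:
  fixes f :: "'a::real_normed_vector \<Rightarrow> 'b::real_inner"
  assumes f: "smooth_on S f" and S: "open S" "x \<in> S"
  shows "frechet_derivative (\<lambda>y. frechet_derivative f (at y) u) (at x) v
       = frechet_derivative (\<lambda>y. frechet_derivative f (at y) v) (at x) u"
proof -
  define F where "F y v = frechet_derivative f (at y) v" for y v
  define G where "G y u v = frechet_derivative (\<lambda>y. F y u) (at y) v" for y u v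
  have sF: "smooth_on S (\<lambda>y. F y u)" for u
    unfolding F_def by (rule smooth_on_frechet_derivative_open[OF f S(1)])
  have F: "(f has_derivative F y) (at y)" if "y \<in> S" for y
    unfolding F_def by (rule smooth_on_has_derivative_open[OF f S(1) that])
  have G: "((\<lambda>y. F y u) has_derivative G y u) (at y)" if "y \<in> S" for y u
    unfolding G_def by (rule smooth_on_has_derivative_open[OF sF S(1) that])
  have sG: "smooth_on S (\<lambda>y. G y u v)" for u v
    unfolding G_def by (rule smooth_on_frechet_derivative_open[OF sF S(1)])
  \<comment> \<open>Pairing with every \<open>b\<close> reduces vector values to the real
    case.\<close>
  have "G x u v \<bullet> b = G x v u \<bullet> b" for b
  proof (rule second_derivative_symmetric_real[OF S, where f'="\<lambda>y v. F y v \<bullet> b"])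
    show "((\<lambda>y. f y \<bullet> b) has_derivative (\<lambda>v. F y v \<bullet> b)) (at y)" if "y \<in> S" for y
      by (rule has_derivative_inner_left[OF F[OF that]])
    show "((\<lambda>y. F y v \<bullet> b) has_derivative (\<lambda>u. G y v u \<bullet> b)) (at y)" if "y \<in> S" for y v
      by (rule has_derivative_inner_left[OF G[OF that]])
    show "continuous_on S (\<lambda>y. G y u v \<bullet> b)" for u v
      using smooth_on_imp_continuous_on[OF sG] by (rule continuous_on_inner) (rule continuous_on_const)
  qed
  then have "G x u v = G x v u" using vector_eq_rdot by blast
  then show ?thesis by (simp add: G_def F_def)
qed

subsection \<open>Inverses of smooth families of linear maps\<close>

text \<open>Because \<open>r\<close> vanishes at \<open>x\<close>, continuity of \<open>k\<close>
  there is enough: the remainder \<open>r y *\<^sub>R (k y - k x)\<close> has as difference quotient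
  a bounded factor times a null function. This is applied to an inverse map before its
  differentiability is known.\<close>

lemma has_derivative_scaleR_zero:
  fixes r :: "'a::real_normed_vector \<Rightarrow> real" and k :: "'a \<Rightarrow> 'b::real_normed_vector"
  assumes r: "(r has_derivative r') (at x within S)" "r x = 0"
    and k: "(k \<longlongrightarrow> k x) (at x within S)"
  shows "((\<lambda>y. r y *\<^sub>R k y) has_derivative (\<lambda>u. r' u *\<^sub>R k x)) (at x within S)"
proof -
  interpret r': bounded_linear r' using r(1) by (rule has_derivative_bounded_linear)
  obtain M where M: "\<And>u. norm (r' u) \<le> norm u * M" using r'.bounded by blast
  let ?q = "\<lambda>y. norm ((r y - r x) - r' (y - x)) / norm (y - x)"
  have q: "(?q \<longlongrightarrow> 0) (at x within S)" using r(1) has_derivative_iff_norm by blast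
  have "((\<lambda>y. norm (k y - k x)) \<longlongrightarrow> 0) (at x within S)"
    using k by (simp add: tendsto_norm_zero_iff LIM_zero_iff)
  from tendsto_mult[OF tendsto_add[OF q tendsto_const[of M]] this]
  have lim: "((\<lambda>y. (?q y + M) * norm (k y - k x)) \<longlongrightarrow> 0) (at x within S)" by simp
  have "((\<lambda>y. norm (r y *\<^sub>R (k y - k x) - 0) / norm (y - x)) \<longlongrightarrow> 0) (at x within S)"
  proof (rule Lim_null_comparison[OF _ lim], rule always_eventually, rule allI)
    fix y
    show "norm (norm (r y *\<^sub>R (k y - k x) - 0) / norm (y - x)) \<le> (?q y + M) * norm (k y - k x)"
    proof (cases "y = x")
      case False
      have "\<bar>r y\<bar> \<le> norm ((r y - r x) - r' (y - x)) + norm (y - x) * M"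
        using M[of "y - x"] r(2) by simp
      then have "\<bar>r y\<bar> / norm (y - x) \<le> ?q y + M" using False by (simp add: field_simps)
      then have "\<bar>r y\<bar> / norm (y - x) * norm (k y - k x) \<le> (?q y + M) * norm (k y - k x)"
        by (rule mult_right_mono) simp
      then show ?thesis by simp
    qed simp
  qed
  then have 0: "((\<lambda>y. r y *\<^sub>R (k y - k x)) has_derivative (\<lambda>_. 0)) (at x within S)"
    by (simp add: has_derivative_iff_norm r(2))
  have "((\<lambda>y. r y *\<^sub>R k x + r y *\<^sub>R (k y - k x)) has_derivative (\<lambda>u. r' u *\<^sub>R k x + 0)) (at x within S)"
    by (rule has_derivative_add[OF has_derivative_scaleR_left[OF r(1)] 0])
  then show ?thesis by (simp add: scaleR_add_right[symmetric])
qed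

text \<open>Everything rests on the identity \<open>B y = B x + B y (A x - A y) B x\<close>. It
  turns continuity of the inverse into differentiability with derivative \<open>- B A' B\<close>,
  and this formula then raises the order of smoothness step by step.\<close>

lemma smooth_on_inverse_family:
  fixes A :: "'a::real_normed_vector \<Rightarrow> 'b::fin_dim_inner \<Rightarrow> 'c::fin_dim_inner"
  assumes th: "thick S" and lin: "\<And>y. y \<in> S \<Longrightarrow> linear (A y)"
    and BA: "\<And>y v. y \<in> S \<Longrightarrow> B y (A y v) = v" and AB: "\<And>y w. y \<in> S \<Longrightarrow> A y (B y w) = w"
    and smooth: "\<And>v. smooth_on S (\<lambda>y. A y v)"
  shows "smooth_on S (\<lambda>y. B y w)"
proof -
  have linB: "linear (B y)" if "y \<in> S" for y
    by (intro linearI) (metis linear_add[OF lin[OF that]] BA[OF that] AB[OF that],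
        metis linear_scale[OF lin[OF that]] BA[OF that] AB[OF that])
  \<comment> \<open>Continuity of the inverse: for \<open>y\<close> close to \<open>x\<close> the
    error term \<open>K * E y * norm ?v\<close> is at most half of \<open>norm ?v\<close> and can be
    absorbed into the left-hand side.\<close>
  have cont: "((\<lambda>y. B y w) \<longlongrightarrow> B x w) (at x within S)" if x: "x \<in> S" for x w
  proof -
    define E where "E y = (\<Sum>b\<in>onb. norm (A y b - A x b))" for y
    define K where "K = (\<Sum>b\<in>onb. norm (B x b))"
    have K: "norm (B x w) \<le> K * norm w" for w using linear_norm_le[OF linB[OF x]] by (simp add: K_def)
    have K0: "K \<ge> 0" by (simp add: K_def sum_nonneg)
    have "((\<lambda>y. A y b) \<longlongrightarrow> A x b) (at x within S)" for b
      using smooth_on_imp_continuous_on[OF smooth] x by (auto simp: continuous_on_def)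
    then have lim: "(E \<longlongrightarrow> 0) (at x within S)"
      unfolding E_def by (intro tendsto_null_sum) (simp add: tendsto_norm_zero_iff LIM_zero_iff)
    then have "((\<lambda>y. K * E y) \<longlongrightarrow> K * 0) (at x within S)" by (intro tendsto_mult tendsto_const)
    then have "\<forall>\<^sub>F y in at x within S. K * E y < 1/2" by (rule order_tendstoD) simp
    moreover have "\<forall>\<^sub>F y in at x within S. y \<in> S" by (simp add: eventually_at_filter)
    ultimately have ev: "\<forall>\<^sub>F y in at x within S. norm (B y w - B x w) \<le> 2 * K * E y * norm (B x w)"
    proof eventually_elim
      case (elim y)
      have E: "norm (A y v - A x v) \<le> E y * norm v" for v
        unfolding E_def by (rule linear_norm_le[of "\<lambda>v. A y v - A x v"])
          (intro linear_compose_sub lin elim x)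
      let ?v = "B y w - B x w"
      have 1: "A y ?v = A x (B x w) - A y (B x w)"
        using AB[OF elim(2)] AB[OF x] by (simp add: linear_diff[OF lin[OF elim(2)]])
      have "norm (A x ?v) \<le> norm (A y ?v) + E y * norm ?v"
        using E[of ?v] norm_triangle_sub[of "A x ?v" "A y ?v"] by (simp add: norm_minus_commute)
      then have "K * norm (A x ?v) \<le> K * (norm (A y ?v) + E y * norm ?v)" using K0 by (rule mult_left_mono)
      then have "norm ?v \<le> K * norm (A y ?v) + (K * E y) * norm ?v"
        using K[of "A x ?v"] BA[OF x] by (simp add: algebra_simps)
      moreover have "(K * E y) * norm ?v \<le> 1/2 * norm ?v" using elim by (intro mult_right_mono) auto
      ultimately have "norm ?v \<le> 2 * K * norm (A y ?v)" by simp
      also have "\<dots> \<le> 2 * K * (E y * norm (B x w))"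
        unfolding 1 using E[of "B x w"] K0 by (intro mult_left_mono) (auto simp: norm_minus_commute)
      finally show ?case by (simp add: mult.assoc)
    qed
    have "((\<lambda>y. 2 * K * E y * norm (B x w)) \<longlongrightarrow> 2 * K * 0 * norm (B x w)) (at x within S)"
      by (intro tendsto_mult tendsto_const lim)
    then have "((\<lambda>y. B y w - B x w) \<longlongrightarrow> 0) (at x within S)" using Lim_null_comparison[OF ev] by simp
    then show ?thesis by (simp add: LIM_zero_iff)
  qed
  define A' where "A' y u b = frechet_derivative (\<lambda>y. A y b) (at y within S) u" for y u b
  have A': "((\<lambda>y. A y b) has_derivative (\<lambda>u. A' x u b)) (at x within S)" if "x \<in> S" for x b
    unfolding A'_def by (rule smooth_on_has_derivative[OF smooth th that])
  have linA': "linear (A' x u)" if "x \<in> S" for x u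
    by (rule derivative_family_linear[OF th that lin A'[OF that]])
  have der: "((\<lambda>y. B y w) has_derivative (\<lambda>u. - B x (A' x u (B x w)))) (at x within S)" if x: "x \<in> S" for x w
  proof -
    let ?g = "\<lambda>y. A x (B x w) - A y (B x w)"
    have g: "(?g has_derivative (\<lambda>u. 0 - A' x u (B x w))) (at x within S)"
      by (intro has_derivative_diff has_derivative_const A' x)
    \<comment> \<open>Each coefficient \<open>?g y \<bullet> c\<close> vanishes at \<open>x\<close>,
      so \<open>has_derivative_scaleR_zero\<close> applies although only continuity of
      \<open>B\<close> is available.\<close>
    have "((\<lambda>y. B x w + (\<Sum>c\<in>onb. (?g y \<bullet> c) *\<^sub>R B y c)) has_derivative
        (\<lambda>u. 0 + (\<Sum>c\<in>onb. ((0 - A' x u (B x w)) \<bullet> c) *\<^sub>R B x c))) (at x within S)"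
      by (intro has_derivative_add has_derivative_const has_derivative_sum has_derivative_scaleR_zero
          has_derivative_inner_left[OF g] cont x) simp
    also have "(\<lambda>u. 0 + (\<Sum>c\<in>onb. ((0 - A' x u (B x w)) \<bullet> c) *\<^sub>R B x c)) = (\<lambda>u. - B x (A' x u (B x w)))"
      by (simp only: linear_onb[OF linB[OF x], symmetric] diff_0 linear_neg[OF linB[OF x]] add_0)
    finally show ?thesis
    proof (rule has_derivative_transform[OF x, rotated])
      fix y assume y: "y \<in> S"
      show "B y w = B x w + (\<Sum>c\<in>onb. (?g y \<bullet> c) *\<^sub>R B y c)"
        using BA[OF y] AB[OF x]
        by (simp only: linear_onb[OF linB[OF y], symmetric] linear_diff[OF linB[OF y]]) simp
    qed
  qed
  \<comment> \<open>Bootstrapping: the derivative of \<open>B\<close> is built from \<open>B\<close>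
    and \<open>A'\<close>, so order \<open>k\<close> for all \<open>w\<close> gives order
    \<open>Suc k\<close>.\<close>
  have "\<forall>w. Ck_on k S (\<lambda>y. B y w)" for k
  proof (induction k)
    case 0 show ?case using cont by (simp add: continuous_on_def)
  next
    case (Suc k)
    show ?case
    proof (rule allI, rule Ck_on_SucI[OF der], assumption)
      fix w u
      have "Ck_on k S (\<lambda>y. A' y u b)" for b
        unfolding A'_def by (rule Ck_on_Suc[OF _ th]) (use smooth smooth_on_def in blast)
      then have "Ck_on k S (\<lambda>y. A' y u (B y w))"
        by (rule Ck_on_apply[where A="\<lambda>y. A' y u", OF _ _ linA']) (use Suc in simp_all)
      then have "Ck_on k S (\<lambda>y. B y (A' y u (B y w)))"
        by (rule Ck_on_apply[where A=B, rotated, OF _ linB]) (use Suc in simp_all)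
      then show "Ck_on k S (\<lambda>y. - B y (A' y u (B y w)))"
        by (rule Ck_on_compose_linear[OF bounded_linear_minus[OF bounded_linear_ident]])
    qed
  qed
  then show ?thesis by (simp add: smooth_on_def)
qed

subsection \<open>Bump functions\<close>

text \<open>The functions \<open>g n\<close> are closed under differentiation up to linear
  combinations, the derivative of \<open>g n\<close> being \<open>- n * g (n+1) + g (n+2)\<close>;
  so one induction on the order handles all of them at once.\<close>

lemma smooth_exp_minus_inverse:
  "smooth_on UNIV (\<lambda>x::real. if x > 0 then exp (- (1/x)) else 0)"
proof -
  define g where "g n x = (if x > 0 then (1/x)^n * exp (- (1/x)) else 0)" for n :: nat and x :: real
  have der: "(g n has_real_derivative (- real n * g (n+1) x + g (n+2) x)) (at x)" for n x
  proof (cases x "0::real" rule: linorder_cases)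
    case less
    have "((\<lambda>x. 0) has_real_derivative 0) (at x)" by simp
    then have "(g n has_real_derivative 0) (at x)"
      by (rule has_field_derivative_transform_within_open[of _ _ _ "{..<0}"]) (use less in \<open>auto simp: g_def\<close>)
    then show ?thesis using less by (simp add: g_def)
  next
    case greater
    have inv: "((\<lambda>x::real. 1/x) has_real_derivative (- ((1/x)^2))) (at x)"
      using greater by (auto intro!: derivative_eq_intros simp: power2_eq_square)
    have "((\<lambda>x. (1/x)^n * exp (- (1/x))) has_real_derivative
        real n * (- ((1/x)^2) * (1/x)^(n - Suc 0)) * exp (- (1/x)) + exp (- (1/x)) * (- (- ((1/x)^2))) * (1/x)^n) (at x)"
      by (rule DERIV_mult[OF DERIV_power[OF inv] DERIV_chain2[OF DERIV_exp DERIV_minus[OF inv]]])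
    also have "real n * (- ((1/x)^2) * (1/x)^(n - Suc 0)) * exp (- (1/x)) + exp (- (1/x)) * (- (- ((1/x)^2))) * (1/x)^n
        = - real n * g (n+1) x + g (n+2) x"
    proof -
      have "real n * (- (a^2) * a^(n - Suc 0)) * E + E * (- (- (a^2))) * a^n
          = - real n * (a^(n+1) * E) + a^(n+2) * E" for a E :: real
        by (cases n) (simp_all add: algebra_simps power2_eq_square)
      from this[of "1/x" "exp (- (1/x))"] show ?thesis using greater by (simp only: g_def if_True)
    qed
    finally have "((\<lambda>x. (1/x)^n * exp (- (1/x))) has_real_derivative (- real n * g (n+1) x + g (n+2) x)) (at x)" .
    then show ?thesis
      by (rule has_field_derivative_transform_within_open[of _ _ _ "{0<..}"]) (use greater in \<open>auto simp: g_def\<close>)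
  next
    case equal
    \<comment> \<open>The constant comes from \<open>u / m \<le> exp (u / m)\<close> raised to the
      power \<open>m = n + 2\<close>, with \<open>u = 1 / y\<close>. It gives a quadratic bound on
      \<open>g n\<close> near 0, hence derivative 0 there.\<close>
    define C where "C = real (n+2) ^ (n+2)"
    have bound: "\<bar>g n y\<bar> \<le> C * (\<bar>y\<bar> * \<bar>y\<bar>)" for y
    proof (cases "y > 0")
      case True
      let ?u = "1/y" and ?m = "n + 2"
      have "?u / real ?m \<le> exp (?u / real ?m)" using exp_ge_add_one_self[of "?u / real ?m"] by linarith
      then have "(?u / real ?m) ^ ?m \<le> exp (?u / real ?m) ^ ?m" using True by (intro power_mono) auto
      also have "\<dots> = exp ?u" by (subst exp_of_nat_mult[symmetric]) simp
      finally have "C * (?u / real ?m) ^ ?m \<le> C * exp ?u" by (rule mult_left_mono) (simp add: C_def)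
      moreover have "C * (?u / real ?m) ^ ?m = ?u ^ ?m"
        by (simp only: C_def power_mult_distrib[symmetric]) simp
      ultimately have "?u ^ ?m \<le> C * exp ?u" by (simp only:)
      then have "?u ^ ?m * exp (- ?u) \<le> C * exp ?u * exp (- ?u)" by (rule mult_right_mono) simp
      then have "?u ^ ?m * exp (- ?u) \<le> C" by (simp add: mult.assoc exp_add[symmetric])
      then have "?u ^ n * exp (- ?u) / (y * y) \<le> C" by (simp add: power_add power2_eq_square)
      then show ?thesis using True by (simp add: g_def field_simps)
    qed (simp add: g_def C_def)
    have "((\<lambda>y. norm (g n y - 0) / norm (y - 0)) \<longlongrightarrow> 0) (at 0)"
    proof (rule Lim_null_comparison[where g="\<lambda>y. C * \<bar>y\<bar>"], rule always_eventually, rule allI)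
      show "norm (norm (g n y - 0) / norm (y - 0)) \<le> C * \<bar>y\<bar>" for y
        using bound[of y] by (cases "y = 0") (simp_all add: field_simps)
      show "((\<lambda>y. C * \<bar>y\<bar>) \<longlongrightarrow> 0) (at 0)" by (auto intro!: tendsto_eq_intros)
    qed
    then have "(g n has_derivative (\<lambda>_. 0)) (at 0)"
      by (simp add: has_derivative_iff_norm g_def)
    then show ?thesis using equal by (simp add: g_def has_field_derivative_def lambda_zero[symmetric])
  qed
  have "\<forall>n. Ck_on k UNIV (g n)" for k
  proof (induction k)
    case 0
    show ?case using der by (auto intro!: continuous_at_imp_continuous_on DERIV_isCont)
  next
    case (Suc k)
    show ?case
    proof (rule allI, rule Ck_on_SucI)
      fix n x
      show "(g n has_derivative (\<lambda>u. u *\<^sub>R (- real n *\<^sub>R g (n+1) x + g (n+2) x))) (at x within UNIV)"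
        using der[of n x] by (simp add: has_field_derivative_def mult_commute_abs)
    next
      fix n v
      show "Ck_on k UNIV (\<lambda>x. v *\<^sub>R (- real n *\<^sub>R g (n+1) x + g (n+2) x))"
        by (intro Ck_on_scaleR Ck_on_add Ck_on_const) (use Suc in simp_all)
    qed
  qed
  then have "smooth_on UNIV (g 0)" by (simp add: smooth_on_def)
  then show ?thesis by (rule smooth_on_eq) (simp add: g_def)
qed

text \<open>The squared norm is used because it is smooth at the centre; division by
  \<open>h (r * r)\<close> normalises the value there to 1.\<close>

lemma bump_function:
  fixes u :: "'a::fin_dim_inner"
  assumes r: "r > 0"
  obtains \<rho> :: "'a \<Rightarrow> real" where "smooth_on UNIV \<rho>" "\<rho> u = 1" "\<And>y. \<rho> y \<ge> 0"
    "\<And>y. dist u y \<ge> r \<Longrightarrow> \<rho> y = 0"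
proof -
  define h where "h x = (if x > 0 then exp (- (1/x)) else 0)" for x :: real
  define \<rho> where "\<rho> y = (1 / h (r * r)) *\<^sub>R h (r * r - (y - u) \<bullet> (y - u))" for y
  have 1: "smooth_on UNIV (\<lambda>y. (y - u) \<bullet> (y - u))"
    by (rule smooth_on_apply[where A="\<lambda>y v. (y - u) \<bullet> v"])
       (intro smooth_on_compose_linear[OF bounded_linear_inner_left] smooth_on_minus smooth_on_id smooth_on_const
         bounded_linear.linear[OF bounded_linear_inner_right])+
  have 2: "smooth_on UNIV (\<lambda>y. r * r - (y - u) \<bullet> (y - u))"
    by (intro smooth_on_minus smooth_on_const 1)
  have "smooth_on UNIV (\<lambda>y. h (r * r - (y - u) \<bullet> (y - u)))"
    by (rule smooth_on_compose[where g=h and T=UNIV, OF _ 2])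
       (use smooth_exp_minus_inverse in \<open>simp_all add: h_def[abs_def]\<close>)
  then have s: "smooth_on UNIV \<rho>"
    unfolding \<rho>_def by (rule smooth_on_scaleR[OF smooth_on_const])
  have z: "\<rho> y = 0" if "dist u y \<ge> r" for y
  proof -
    have "norm (y - u) * norm (y - u) \<ge> r * r"
      using that r by (intro mult_mono) (auto simp: dist_norm norm_minus_commute)
    then have "(y - u) \<bullet> (y - u) \<ge> r * r" by (simp add: dot_square_norm power2_eq_square)
    then show ?thesis by (simp add: \<rho>_def h_def)
  qed
  have o: "\<rho> u = 1" using r by (simp add: \<rho>_def h_def)
  have p: "\<rho> y \<ge> 0" for y by (simp add: \<rho>_def h_def)
  show thesis using that[OF s o p z] .
qed

subsection \<open>Ordinary differential equations\<close>

lemma continuous_on_has_vector_derivative: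
  "(\<And>t. t \<in> S \<Longrightarrow> (f has_vector_derivative f' t) (at t within S)) \<Longrightarrow> continuous_on S f"
  unfolding continuous_on_eq_continuous_within by (blast intro: has_vector_derivative_continuous)

text \<open>The primitive is normalised at 0 rather than at the left end because the solutions below
  run in both time directions.\<close>

lemma integral_solution:
  fixes v :: "real \<Rightarrow> 'a::banach"
  assumes "a \<le> 0" "0 \<le> b" and v: "continuous_on {a..b} v"
  defines "F \<equiv> \<lambda>t. integral {a..t} v - integral {a..0} v"
  shows "\<And>t. t \<in> {a..b} \<Longrightarrow> (F has_vector_derivative v t) (at t within {a..b})" and "F 0 = 0"
proof -
  show "(F has_vector_derivative v t) (at t within {a..b})" if "t \<in> {a..b}" for t
    using has_vector_derivative_diff[OF integral_has_vector_derivative[OF v that]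
        has_vector_derivative_const[of "integral {a..0} v"]]
    unfolding F_def by simp
  show "F 0 = 0" by (simp add: F_def)
qed

lemma norm_le_from_derivative:
  fixes F :: "real \<Rightarrow> 'a::real_normed_vector"
  assumes d: "\<And>t. t \<in> {-\<tau>..\<tau>} \<Longrightarrow> (F has_vector_derivative v t) (at t within {-\<tau>..\<tau>})"
    and F0: "F 0 = 0" and t: "t \<in> {-\<tau>..\<tau>}" and B: "\<And>s. s \<in> {-\<tau>..\<tau>} \<Longrightarrow> norm (v s) \<le> B"
  shows "norm (F t) \<le> B * \<bar>t\<bar>"
proof -
  have z: "0 \<in> {-\<tau>..\<tau>}" using t by auto
  have "onorm (\<lambda>h. h *\<^sub>R v s) \<le> B" if "s \<in> {-\<tau>..\<tau>}" for s
  proof -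
    have "onorm (\<lambda>h::real. h *\<^sub>R v s) \<le> norm (v s)"
      by (rule onorm_bound) (auto simp: mult.commute)
    then show ?thesis using B[OF that] by simp
  qed
  then have "norm (F t - F 0) \<le> B * norm (t - 0)"
    by (intro differentiable_bound[OF convex_real_interval(5) d[unfolded has_vector_derivative_def] _ t z]) auto
  then show ?thesis using F0 by simp
qed

text \<open>At the time \<open>m\<close> where \<open>norm (u t - v t)\<close> is largest, the mean
  value inequality bounds the maximum by \<open>C * \<tau>\<close> times itself; since
  \<open>C * \<tau> < 1\<close> it is 0.\<close>

lemma ode_unique:
  fixes u v :: "real \<Rightarrow> 'a::real_normed_vector"
  assumes tau: "\<tau> \<ge> 0" "C * \<tau> < 1" and C: "C \<ge> 0"
    and u: "\<And>t. t \<in> {-\<tau>..\<tau>} \<Longrightarrow> (u has_vector_derivative f (u t)) (at t within {-\<tau>..\<tau>})"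
    and v: "\<And>t. t \<in> {-\<tau>..\<tau>} \<Longrightarrow> (v has_vector_derivative f (v t)) (at t within {-\<tau>..\<tau>})"
    and eq: "u 0 = v 0"
    and B: "\<And>t. t \<in> {-\<tau>..\<tau>} \<Longrightarrow> u t \<in> B" "\<And>t. t \<in> {-\<tau>..\<tau>} \<Longrightarrow> v t \<in> B"
    and lip: "\<And>x y. x \<in> B \<Longrightarrow> y \<in> B \<Longrightarrow> norm (f x - f y) \<le> C * norm (x - y)"
    and t: "t \<in> {-\<tau>..\<tau>}"
  shows "u t = v t"
proof -
  let ?I = "{-\<tau>..\<tau>}"
  let ?w = "\<lambda>t. u t - v t"
  have d: "(?w has_vector_derivative (f (u t) - f (v t))) (at t within ?I)" if "t \<in> ?I" for t
    by (rule has_vector_derivative_diff[OF u[OF that] v[OF that]])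
  have "continuous_on ?I ?w"
    by (rule continuous_on_has_vector_derivative[OF d])
  then have c: "continuous_on ?I (\<lambda>t. norm (?w t))" by (rule continuous_on_norm)
  obtain m where m: "m \<in> ?I" "\<And>t. t \<in> ?I \<Longrightarrow> norm (?w t) \<le> norm (?w m)"
    using continuous_attains_sup[OF compact_Icc _ c] tau(1) by fastforce
  have "norm (f (u s) - f (v s)) \<le> C * norm (?w m)" if "s \<in> ?I" for s
    using order_trans[OF lip[OF B[OF that]] mult_left_mono[OF m(2)[OF that] C]] .
  from norm_le_from_derivative[OF d _ m(1) this]
  have "norm (?w m) \<le> C * norm (?w m) * \<bar>m\<bar>" using eq by simp
  also have "\<dots> \<le> C * norm (?w m) * \<tau>" using m(1) C by (intro mult_left_mono) auto
  finally have "norm (?w m) * (1 - C * \<tau>) \<le> 0" by (simp add: algebra_simps)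
  then have "norm (?w m) \<le> 0" using tau(2) by (simp add: mult_le_0_iff)
  then show ?thesis using m(2)[OF t] by simp
qed

text \<open>Picard iteration: \<open>M * \<tau> \<le> r\<close> keeps the iterates in the ball, and
  \<open>C * \<tau> < 1\<close> makes the integral operator a contraction.\<close>

lemma ode_exists:
  fixes f :: "'a::banach \<Rightarrow> 'a"
  assumes r: "r > 0" and lip: "\<And>x y. x \<in> cball u0 r \<Longrightarrow> y \<in> cball u0 r \<Longrightarrow> norm (f x - f y) \<le> C * norm (x - y)"
    and bd: "\<And>x. x \<in> cball u0 r \<Longrightarrow> norm (f x) \<le> M"
    and tau: "\<tau> \<ge> 0" "C * \<tau> < 1" "M * \<tau> \<le> r" and C: "C \<ge> 0"
  obtains u where "u 0 = u0" "\<And>t. t \<in> {-\<tau>..\<tau>} \<Longrightarrow> u t \<in> cball u0 r"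
    "\<And>t. t \<in> {-\<tau>..\<tau>} \<Longrightarrow> (u has_vector_derivative f (u t)) (at t within {-\<tau>..\<tau>})"
proof -
  let ?I = "{-\<tau>..\<tau>}"
  \<comment> \<open>Freezing time outside the interval turns curves on \<open>?I\<close> into
    bounded continuous functions on the whole line, a complete space to which Banach's fixed point
    theorem applies.\<close>
  define cl where "cl t = max (-\<tau>) (min \<tau> t)" for t
  have cl: "cl t \<in> ?I" for t using tau(1) by (auto simp: cl_def)
  have cl_id: "cl t = t" if "t \<in> ?I" for t using that by (auto simp: cl_def)
  have ccl: "continuous_on UNIV cl" unfolding cl_def by (intro continuous_intros)
  define W where "W = PiC UNIV (\<lambda>_::real. cball u0 r)"
  define J where "J w t = integral {-\<tau>..t} (\<lambda>s. f (w s)) - integral {-\<tau>..0} (\<lambda>s. f (w s))" for w :: "real \<Rightarrow> 'a" and t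
  have W: "apply_bcontfun w t \<in> cball u0 r" if "w \<in> W" for w t
    using that by (auto simp: W_def mem_PiC_iff)
  have cf: "continuous_on (cball u0 r) f"
    by (rule lipschitz_on_continuous_on[where L=C]) (use lip C in \<open>auto simp: dist_norm intro!: lipschitz_onI\<close>)
  have cw: "continuous_on ?I (\<lambda>s. f (apply_bcontfun w s))" if "w \<in> W" for w
    by (rule continuous_on_compose2[OF cf]) (use W[OF that] in \<open>auto intro: continuous_on_apply_bcontfun\<close>)
  have J: "(J (apply_bcontfun w) has_vector_derivative f (apply_bcontfun w t)) (at t within ?I)"
    "J (apply_bcontfun w) 0 = 0" if "w \<in> W" "t \<in> ?I" for w t
    using integral_solution[OF _ _ cw[OF that(1)]] tau(1) that(2) unfolding J_def by auto
  have zI: "0 \<in> ?I" using tau(1) by simp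
  have Jb: "norm (J (apply_bcontfun w) t) \<le> r" if w: "w \<in> W" and t: "t \<in> ?I" for w t
  proof -
    have M: "0 \<le> M" using bd[of u0] r norm_ge_zero order_trans by (metis centre_in_cball less_imp_le)
    have "norm (J (apply_bcontfun w) t) \<le> M * \<bar>t\<bar>"
      by (rule norm_le_from_derivative[OF J(1)[OF w] J(2)[OF w zI] t bd[OF W[OF w]]])
    also have "\<dots> \<le> M * \<tau>" using t M by (intro mult_left_mono) auto
    finally show ?thesis using tau by simp
  qed
  have cJ: "continuous_on ?I (J (apply_bcontfun w))" if "w \<in> W" for w
    by (rule continuous_on_has_vector_derivative[OF J(1)[OF that]])
  have bc: "(\<lambda>t. u0 + J (apply_bcontfun w) (cl t)) \<in> bcontfun" if w: "w \<in> W" for w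
    unfolding bcontfun_def
  proof (intro CollectI conjI)
    show "continuous_on UNIV (\<lambda>t. u0 + J (apply_bcontfun w) (cl t))"
      by (intro continuous_on_add continuous_on_const continuous_on_compose2[OF cJ[OF w] ccl]) (use cl in auto)
    show "bounded (range (\<lambda>t. u0 + J (apply_bcontfun w) (cl t)))"
      unfolding bounded_def
      by (rule exI[of _ u0], rule exI[of _ r]) (use Jb[OF w cl] in \<open>auto simp: dist_norm\<close>)
  qed
  define P where "P w = Bcontfun (\<lambda>t. u0 + J (apply_bcontfun w) (cl t))" for w
  have P: "apply_bcontfun (P w) t = u0 + J (apply_bcontfun w) (cl t)" if "w \<in> W" for w t
    unfolding P_def by (simp add: Bcontfun_inverse[OF bc[OF that]])
  have "\<exists>!w\<in>W. P w = w"
  proof (rule Banach_fix)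
    show "complete W" unfolding complete_eq_closed W_def by (rule closed_PiC) simp
    have "const_bcontfun u0 \<in> W" using r by (simp add: W_def mem_PiC_iff)
    then show "W \<noteq> {}" by blast
    show "0 \<le> C * \<tau>" using C tau by simp
    show "C * \<tau> < 1" by fact
    show "P ` W \<subseteq> W"
    proof
      fix w assume "w \<in> P ` W"
      then obtain w' where w': "w' \<in> W" "w = P w'" by blast
      have "apply_bcontfun w t \<in> cball u0 r" for t
        using Jb[OF w'(1) cl] by (simp add: w' P dist_norm)
      then show "w \<in> W" by (simp add: W_def mem_PiC_iff)
    qed
    show "dist (P w) (P w') \<le> C * \<tau> * dist w w'" if w: "w \<in> W" and w': "w' \<in> W" for w w'
    proof (rule dist_bound)
      fix t
      let ?w = "apply_bcontfun w" and ?w' = "apply_bcontfun w'"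
      have "norm (J ?w (cl t) - J ?w' (cl t)) \<le> (C * dist w w') * \<bar>cl t\<bar>"
      proof (rule norm_le_from_derivative[OF _ _ cl])
        show "((\<lambda>t. J ?w t - J ?w' t) has_vector_derivative (f (?w t) - f (?w' t))) (at t within ?I)" if "t \<in> ?I" for t
          by (rule has_vector_derivative_diff[OF J(1)[OF w that] J(1)[OF w' that]])
        show "J ?w 0 - J ?w' 0 = 0" using J(2)[OF w zI] J(2)[OF w' zI] by simp
        show "norm (f (?w s) - f (?w' s)) \<le> C * dist w w'" for s
          using lip[OF W[OF w] W[OF w']] dist_bounded[of w s w'] C
          by (metis dist_norm mult_left_mono order_trans)
      qed
      also have "\<dots> \<le> (C * dist w w') * \<tau>" using cl[of t] C by (intro mult_left_mono) auto
      finally show "dist (apply_bcontfun (P w) t) (apply_bcontfun (P w') t) \<le> C * \<tau> * dist w w'"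
        by (simp add: P w w' dist_norm mult.commute mult.left_commute)
    qed
  qed
  then obtain w where w: "w \<in> W" "P w = w" by blast
  have eq: "apply_bcontfun w t = u0 + J (apply_bcontfun w) (cl t)" for t using P[OF w(1)] w(2) by simp
  show thesis
  proof (rule that[of "apply_bcontfun w"])
    show "apply_bcontfun w 0 = u0" using eq[of 0] J(2)[OF w(1) zI] cl_id[OF zI] by simp
    show "apply_bcontfun w t \<in> cball u0 r" for t by (rule W[OF w(1)])
    fix t assume t: "t \<in> ?I"
    have "((\<lambda>t. u0 + J (apply_bcontfun w) t) has_vector_derivative (0 + f (apply_bcontfun w t))) (at t within ?I)"
      by (rule has_vector_derivative_add[OF has_vector_derivative_const J(1)[OF w(1) t]])
    then show "(apply_bcontfun w has_vector_derivative f (apply_bcontfun w t)) (at t within ?I)"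
      unfolding add_0
    proof (rule has_vector_derivative_transform[OF t, rotated])
      fix s assume "s \<in> ?I"
      then show "apply_bcontfun w s = u0 + J (apply_bcontfun w) s" using eq[of s] cl_id[of s] by simp
    qed
  qed
qed

text \<open>\<open>N\<close> dominates the operator norm of the derivative and is continuous, so
  \<open>N u0 + 1\<close> is a Lipschitz constant on a small ball, which is convex.\<close>

lemma smooth_on_lipschitz:
  fixes f :: "'a::fin_dim_inner \<Rightarrow> 'b::real_normed_vector"
  assumes f: "smooth_on S f" and S: "open S" "u0 \<in> S"
  obtains r C M where "r > 0" "C \<ge> 0" "cball u0 r \<subseteq> S"
    "\<And>x y. x \<in> cball u0 r \<Longrightarrow> y \<in> cball u0 r \<Longrightarrow> norm (f x - f y) \<le> C * norm (x - y)"
    "\<And>x. x \<in> cball u0 r \<Longrightarrow> norm (f x) \<le> M"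
proof -
  define F where "F y = frechet_derivative f (at y)" for y
  define N where "N y = (\<Sum>b\<in>onb. norm (F y b))" for y
  have "continuous_on S (\<lambda>y. F y b)" for b
    unfolding F_def using smooth_on_imp_continuous_on[OF smooth_on_frechet_derivative_open[OF f S(1)]] .
  then have "continuous_on S N" unfolding N_def by (intro continuous_on_sum continuous_on_norm)
  then have "isCont N u0" using S continuous_on_eq_continuous_at by blast
  moreover have "isCont f u0" using smooth_on_imp_continuous_on[OF f] S continuous_on_eq_continuous_at by blast
  ultimately obtain d1 d2 where d: "d1 > 0" "\<And>y. dist y u0 < d1 \<Longrightarrow> dist (N y) (N u0) < 1"
     "d2 > 0" "\<And>y. dist y u0 < d2 \<Longrightarrow> dist (f y) (f u0) < 1"
    unfolding continuous_at_eps_delta by (metis zero_less_one)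
  obtain d3 where d3: "d3 > 0" "cball u0 d3 \<subseteq> S" using S open_contains_cball by blast
  define r where "r = min d3 (min d1 d2 / 2)"
  have r: "r > 0" "r < d1" "r < d2" "r \<le> d3" using d d3 by (auto simp: r_def min_def)
  have sub: "cball u0 r \<subseteq> S" using d3(2) r(4) by (auto simp: subset_iff)
  show thesis
  proof (rule that[OF r(1) _ sub])
    show "0 \<le> N u0 + 1" by (simp add: N_def sum_nonneg add_nonneg_nonneg)
    show "norm (f x) \<le> norm (f u0) + 1" if "x \<in> cball u0 r" for x
    proof -
      have "dist (f x) (f u0) < 1" using d(4)[of x] that r by (simp add: dist_commute)
      then show ?thesis using norm_triangle_ineq2[of "f x" "f u0"] by (simp add: dist_norm)
    qed
    show "norm (f x - f y) \<le> (N u0 + 1) * norm (x - y)" if "x \<in> cball u0 r" "y \<in> cball u0 r" for x y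
    proof (rule differentiable_bound[OF convex_cball _ _ that])
      fix z assume z: "z \<in> cball u0 r"
      then have zS: "z \<in> S" using sub by blast
      show "(f has_derivative F z) (at z within cball u0 r)"
        unfolding F_def using smooth_on_has_derivative_open[OF f S(1) zS] by (rule has_derivative_at_withinI)
      have "norm (F z h) \<le> (N u0 + 1) * norm h" for h
      proof -
        have "norm (F z h) \<le> N z * norm h"
          unfolding N_def F_def by (rule linear_norm_le[OF linear_frechet_derivative_smooth[OF f S(1) zS]])
        also have "N z \<le> N u0 + 1" using d(2)[of z] z r by (simp add: dist_commute dist_real_def)
        finally show ?thesis by (simp add: mult_right_mono)
      qed
      then show "onorm (F z) \<le> N u0 + 1" by (intro onorm_bound) (simp_all add: N_def sum_nonneg)
    qed
  qed
qed

text \<open>The right-hand side \<open>f (u t)\<close> is as smooth as \<open>u\<close>, so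
  \<open>u\<close> gains one order at each step.\<close>

lemma smooth_on_ode_solution:
  fixes f :: "'a::fin_dim_inner \<Rightarrow> 'a"
  assumes f: "smooth_on S f" and I: "thick I" and uS: "\<And>t. t \<in> I \<Longrightarrow> u t \<in> S"
    and u: "\<And>t. t \<in> I \<Longrightarrow> (u has_vector_derivative f (u t)) (at t within I)"
  shows "smooth_on I u"
proof -
  have "Ck_on k I u" for k
  proof (induction k)
    case 0 then show ?case using continuous_on_has_vector_derivative[OF u] by simp
  next
    case (Suc k)
    show ?case
    proof (rule Ck_on_SucI[OF u[unfolded has_vector_derivative_def]], assumption)
      fix v
      have "Ck_on k I (\<lambda>t. f (u t))"
        by (rule Ck_on_compose[OF _ Suc]) (use f uS smooth_on_def in blast)+
      then show "Ck_on k I (\<lambda>t. v *\<^sub>R f (u t))" by (rule Ck_on_scaleR[OF Ck_on_const])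
    qed
  qed
  then show ?thesis by (simp add: smooth_on_def)
qed

subsection \<open>Fundamental lemma of the calculus of variations\<close>

lemma fundamental_lemma_variations:
  fixes g :: "real \<Rightarrow> real"
  assumes ab: "a < b" and g: "continuous_on {a..b} g"
    and z: "\<And>\<phi>. smooth_on UNIV \<phi> \<Longrightarrow> \<phi> a = 0 \<Longrightarrow> \<phi> b = 0 \<Longrightarrow> integral {a..b} (\<lambda>t. \<phi> t * g t) = 0"
    and t: "t \<in> {a..b}"
  shows "g t = 0"
proof -
  have pos: "\<not> g s > 0" if s: "a < s" "s < b" and g: "continuous_on {a..b} g"
    and z: "\<And>\<phi>. smooth_on UNIV \<phi> \<Longrightarrow> \<phi> a = 0 \<Longrightarrow> \<phi> b = 0 \<Longrightarrow> integral {a..b} (\<lambda>t. \<phi> t * g t) = 0"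
    for s and g :: "real \<Rightarrow> real"
  proof
    assume gs: "g s > 0"
    have sI: "s \<in> {a..b}" using s by simp
    obtain d where d: "d > 0" "\<And>x. x \<in> {a..b} \<Longrightarrow> dist x s < d \<Longrightarrow> dist (g x) (g s) < g s"
      using g[unfolded continuous_on_iff] sI gs by blast
    \<comment> \<open>Small enough that the bump vanishes at both end-points and is supported where
      \<open>g\<close> is positive.\<close>
    define r where "r = min d (min (s - a) (b - s))"
    have r: "r > 0" using d s by (simp add: r_def)
    obtain \<rho> :: "real \<Rightarrow> real" where \<rho>: "smooth_on UNIV \<rho>" "\<rho> s = 1" "\<And>y. \<rho> y \<ge> 0"
      "\<And>y. dist s y \<ge> r \<Longrightarrow> \<rho> y = 0" using bump_function[OF r] by blast
    have "r \<le> dist s a" "r \<le> dist s b" using s by (auto simp: dist_real_def r_def)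
    then have "\<rho> a = 0" "\<rho> b = 0" using \<rho>(4) by blast+
    then have "integral {a..b} (\<lambda>t. \<rho> t * g t) = 0" by (rule z[OF \<rho>(1)])
    moreover have c: "continuous_on {a..b} (\<lambda>t. \<rho> t * g t)"
      by (intro continuous_on_mult g continuous_on_subset[OF smooth_on_imp_continuous_on[OF \<rho>(1)]]) simp
    moreover have "\<rho> x * g x \<ge> 0" if "x \<in> {a..b}" for x
    proof (cases "dist s x \<ge> r")
      case False
      then have "dist (g x) (g s) < g s" by (intro d(2) that) (simp add: r_def dist_commute)
      then have "g x > 0" by (simp add: dist_real_def)
      then show ?thesis using \<rho>(3) by simp
    qed (simp add: \<rho>(4))
    ultimately have "\<forall>x\<in>{a..b}. \<rho> x * g x = 0"
      using integral_eq_0_iff[OF c ab] by blast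
    then show False using sI gs \<rho>(2) by fastforce
  qed
  have int: "g s = 0" if "a < s" "s < b" for s
  proof (rule ccontr)
    assume "g s \<noteq> 0"
    then consider "g s > 0" | "- g s > 0" by linarith
    then show False
    proof cases
      case 1 then show False using pos[OF that g z] by blast
    next
      case 2
      then show False using pos[OF that continuous_on_minus[OF g]] z by simp
    qed
  qed
  \<comment> \<open>A bump vanishing at \<open>a\<close> and \<open>b\<close> can be centred at
    interior points only; the end-points follow by continuity.\<close>
  show ?thesis
  proof (rule continuous_constant_on_closure[of "{a<..<b}" g 0 t])
    show "continuous_on (closure {a<..<b}) g" using g ab by simp
    show "t \<in> closure {a<..<b}" using t ab by simp
  qed (use int in auto)
qed

section \<open>Charts and tangent vectors\<close>

lemma smooth_atlasD:
  assumes "smooth_atlas A" "c \<in> A"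
  shows inj_on_chart: "inj_on (snd c) (fst c)"
    and open_chart_image: "open (snd c ` fst c)"
    and open_transition_domain: "d \<in> A \<Longrightarrow> open (snd c ` (fst c \<inter> fst d))"
    and smooth_on_transition: "d \<in> A \<Longrightarrow> smooth_on (snd c ` (fst c \<inter> fst d)) (snd d \<circ> inv_chart c)"
  using assms unfolding smooth_atlas_def by blast+

lemma inv_chart_chart:
  assumes "smooth_atlas A" "c \<in> A" "x \<in> fst c"
  shows "inv_chart c (snd c x) = x"
  unfolding inv_chart_def using inv_into_f_f[OF inj_on_chart[OF assms(1,2)] assms(3)] .

lemma inv_chart_in: "y \<in> snd c ` fst c \<Longrightarrow> inv_chart c y \<in> fst c"
  by (simp add: inv_chart_def inv_into_into)

lemma chart_inv_chart: "y \<in> snd c ` fst c \<Longrightarrow> snd c (inv_chart c y) = y"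
  by (simp add: inv_chart_def f_inv_into_f)

lemma mem_chart_image:
  assumes "smooth_atlas A" "c \<in> A"
  shows "y \<in> snd c ` (fst c \<inter> W) \<longleftrightarrow> y \<in> snd c ` fst c \<and> inv_chart c y \<in> W"
proof
  assume "y \<in> snd c ` (fst c \<inter> W)"
  then obtain x where x: "x \<in> fst c" "x \<in> W" "y = snd c x" by blast
  then have "inv_chart c y = x" using inv_chart_chart[OF assms] by blast
  then show "y \<in> snd c ` fst c \<and> inv_chart c y \<in> W" using x by blast
next
  assume y: "y \<in> snd c ` fst c \<and> inv_chart c y \<in> W"
  show "y \<in> snd c ` (fst c \<inter> W)"
    by (rule image_eqI[of _ _ "inv_chart c y"]) (use y chart_inv_chart[of y c] inv_chart_in[of y c] in simp_all)
qed

lemma mem_chart_imageD: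
  assumes "smooth_atlas A" "c \<in> A" "y \<in> snd c ` (fst c \<inter> W)"
  shows "y \<in> snd c ` fst c" "inv_chart c y \<in> W"
  using mem_chart_image[OF assms(1,2), THEN iffD1, OF assms(3)] by simp_all

lemma mem_charts_at: "c \<in> charts_at A x \<longleftrightarrow> c \<in> A \<and> x \<in> fst c"
  by (simp add: charts_at_def)

lemma charts_at_nonempty: "x \<in> points A \<Longrightarrow> \<exists>c. c \<in> charts_at A x"
  by (auto simp: points_def charts_at_def)

lemma points_charts_at: "c \<in> charts_at A x \<Longrightarrow> x \<in> points A"
  by (auto simp: points_def charts_at_def)

lemma chart_at_in: "c \<in> charts_at A x \<Longrightarrow> chart_at A x \<in> charts_at A x"
  unfolding chart_at_def by (rule someI)

abbreviation trD :: "('a, 'e::fin_dim_inner) chart \<Rightarrow> ('a, 'e) chart \<Rightarrow> 'a \<Rightarrow> 'e \<Rightarrow> 'e"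
  where "trD c d x \<equiv> frechet_derivative (snd d \<circ> inv_chart c) (at (snd c x))"

lemma has_derivative_transition:
  assumes "smooth_atlas A" "c \<in> charts_at A x" "d \<in> charts_at A x"
  shows "((snd d \<circ> inv_chart c) has_derivative trD c d x) (at (snd c x))"
  using assms smooth_on_has_derivative_open[OF smooth_on_transition open_transition_domain]
  by (metis IntI image_eqI mem_charts_at)

lemma linear_trD:
  assumes "smooth_atlas A" "c \<in> charts_at A x" "d \<in> charts_at A x"
  shows "linear (trD c d x)"
  using has_derivative_linear[OF has_derivative_transition[OF assms]] .

text \<open>The definitions of \<open>differential\<close> and \<open>tangent_map\<close> read
  coordinates in the arbitrary chart \<open>chart_at\<close>. This chain rule makes their values
  independent of that choice.\<close>

lemma has_derivative_change_chart:
  assumes A: "smooth_atlas A" and c: "c \<in> charts_at A x" and d: "d \<in> charts_at A x"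
    and h: "((h \<circ> inv_chart d) has_derivative D) (at (snd d x))"
  shows "((h \<circ> inv_chart c) has_derivative (\<lambda>v. D (trD c d x v))) (at (snd c x))"
proof -
  have cd: "c \<in> A" "d \<in> A" "x \<in> fst c" "x \<in> fst d" using c d by (auto simp: mem_charts_at)
  have "(snd d \<circ> inv_chart c) (snd c x) = snd d x" by (simp add: inv_chart_chart[OF A cd(1,3)])
  then have "((\<lambda>y. (h \<circ> inv_chart d) ((snd d \<circ> inv_chart c) y)) has_derivative (\<lambda>v. D (trD c d x v))) (at (snd c x))"
    by (intro has_derivative_compose[OF has_derivative_transition[OF A c d]]) (simp only: h)
  then show ?thesis
  proof (rule has_derivative_transform_within_open[OF _ open_transition_domain[OF A cd(1,2)]])
    show "snd c x \<in> snd c ` (fst c \<inter> fst d)" using cd by blast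
    fix y assume "y \<in> snd c ` (fst c \<inter> fst d)"
    from mem_chart_imageD(2)[OF A cd(1) this] have "inv_chart c y \<in> fst d" .
    then show "(h \<circ> inv_chart d) ((snd d \<circ> inv_chart c) y) = (h \<circ> inv_chart c) y"
      by (simp add: inv_chart_chart[OF A cd(2)])
  qed
qed

lemma trD_cocycle:
  assumes "smooth_atlas A" "c \<in> charts_at A x" "d \<in> charts_at A x" "e \<in> charts_at A x"
  shows "trD d e x (trD c d x v) = trD c e x v"
  using frechet_derivative_at[OF has_derivative_change_chart[OF assms(1-3) has_derivative_transition[OF assms(1,3,4)]]]
  by metis

lemma trD_same:
  assumes A: "smooth_atlas A" and c: "c \<in> charts_at A x"
  shows "trD c c x v = v"
proof -
  have cA: "c \<in> A" "x \<in> fst c" using c by (auto simp: mem_charts_at)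
  have "((snd c \<circ> inv_chart c) has_derivative (\<lambda>v. v)) (at (snd c x))"
  proof (rule has_derivative_transform_within_open[OF has_derivative_ident open_chart_image[OF A cA(1)]])
    show "snd c x \<in> snd c ` fst c" using cA by simp
    show "y = (snd c \<circ> inv_chart c) y" if "y \<in> snd c ` fst c" for y
      using chart_inv_chart[OF that] by simp
  qed
  from frechet_derivative_at[OF this] show ?thesis by metis
qed

lemma tangent_spaceD:
  "v \<in> tangent_space A x \<Longrightarrow> c \<in> charts_at A x \<Longrightarrow> d \<in> charts_at A x \<Longrightarrow> v d = trD c d x (v c)"
  unfolding tangent_space_def by blast

lemma tangent_spaceI:
  "(\<And>c d. c \<in> charts_at A x \<Longrightarrow> d \<in> charts_at A x \<Longrightarrow> v d = trD c d x (v c)) \<Longrightarrow>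
   (\<And>c. c \<notin> charts_at A x \<Longrightarrow> v c = 0) \<Longrightarrow> v \<in> tangent_space A x"
  unfolding tangent_space_def by blast

lemma tangent_space_outside: "v \<in> tangent_space A x \<Longrightarrow> c \<notin> charts_at A x \<Longrightarrow> v c = 0"
  unfolding tangent_space_def by blast

lemma tangent_space_eqI:
  assumes "v \<in> tangent_space A x" "w \<in> tangent_space A x" "c \<in> charts_at A x" "v c = w c"
  shows "v = w"
proof
  fix d show "v d = w d"
  proof (cases "d \<in> charts_at A x")
    case True
    then show ?thesis
      using tangent_spaceD[OF assms(1,3) True] tangent_spaceD[OF assms(2,3) True] assms(4) by simp
  next
    case False
    then show ?thesis using tangent_space_outside assms(1,2) by metis
  qed
qed

lemma scaleR_fun_apply: "(r *\<^sub>R v) c = r *\<^sub>R v c"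
  by (simp add: scaleR_fun_def)

lemma subspace_tangent_space:
  assumes "smooth_atlas A"
  shows "subspace (tangent_space A x)"
proof (rule subspaceI)
  note tD = tangent_spaceD and tO = tangent_space_outside
  show "0 \<in> tangent_space A x"
    unfolding tangent_space_def by (simp add: linear_0[OF linear_trD[OF assms]])
  show "v + w \<in> tangent_space A x" if v: "v \<in> tangent_space A x" and w: "w \<in> tangent_space A x" for v w
  proof -
    have "v d + w d = trD c d x (v c + w c)" if c: "c \<in> charts_at A x" and d: "d \<in> charts_at A x" for c d
      by (simp only: tD[OF v c d] tD[OF w c d] linear_add[OF linear_trD[OF assms c d]])
    moreover have "v c + w c = 0" if "c \<notin> charts_at A x" for c
      by (simp only: tO[OF v that] tO[OF w that] add_0)
    ultimately show ?thesis unfolding tangent_space_def plus_fun_apply by blast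
  qed
  show "r *\<^sub>R v \<in> tangent_space A x" if v: "v \<in> tangent_space A x" for r v
  proof -
    have "r *\<^sub>R v d = trD c d x (r *\<^sub>R v c)" if c: "c \<in> charts_at A x" and d: "d \<in> charts_at A x" for c d
      by (simp only: tD[OF v c d] linear_scale[OF linear_trD[OF assms c d]])
    moreover have "r *\<^sub>R v c = 0" if "c \<notin> charts_at A x" for c
      by (simp only: tO[OF v that] scaleR_zero_right)
    ultimately show ?thesis unfolding tangent_space_def scaleR_fun_apply by blast
  qed
qed

lemmas tangent_space_0 = subspace_0[OF subspace_tangent_space]
lemmas tangent_space_add = subspace_add[OF subspace_tangent_space]
lemmas tangent_space_diff = subspace_diff[OF subspace_tangent_space]
lemmas tangent_space_scaleR = subspace_scale[OF subspace_tangent_space]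

text \<open>For \<open>c\<close> around \<open>x\<close> this is the inverse of evaluation at
  \<open>c\<close>: a coordinate vector is spread over all charts by the transition
  derivatives.\<close>

definition tvec_of :: "('a, 'e::fin_dim_inner) atlas \<Rightarrow> ('a, 'e) chart \<Rightarrow> 'a \<Rightarrow> 'e \<Rightarrow> ('a, 'e) tvec"
  where "tvec_of A c x w = (\<lambda>d. if d \<in> charts_at A x then trD c d x w else 0)"

lemma tvec_of_in:
  assumes "smooth_atlas A" "c \<in> charts_at A x"
  shows "tvec_of A c x w \<in> tangent_space A x"
proof (rule tangent_spaceI)
  show "tvec_of A c x w e = trD d e x (tvec_of A c x w d)" if "d \<in> charts_at A x" "e \<in> charts_at A x" for d e
    unfolding tvec_of_def if_P[OF that(1)] if_P[OF that(2)] by (rule trD_cocycle[OF assms that, symmetric])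
qed (simp add: tvec_of_def)

lemma tvec_of_same:
  assumes "smooth_atlas A" "c \<in> charts_at A x"
  shows "tvec_of A c x w c = w"
  unfolding tvec_of_def using trD_same[OF assms] assms by simp

lemma tvec_of_chart:
  assumes "smooth_atlas A" "c \<in> charts_at A x" "v \<in> tangent_space A x"
  shows "tvec_of A c x (v c) = v"
  by (rule tangent_space_eqI[OF tvec_of_in[OF assms(1,2)] assms(3,2)]) (rule tvec_of_same[OF assms(1,2)])

lemma differential_eq:
  assumes A: "smooth_atlas A" and c: "c \<in> charts_at A x" and v: "v \<in> tangent_space A x"
    and F: "((f \<circ> inv_chart c) has_derivative F) (at (snd c x))"
  shows "differential A f (x, v) = F (v c)"
proof -
  note c0 = chart_at_in[OF c]
  have "frechet_derivative (f \<circ> inv_chart (chart_at A x)) (at (snd (chart_at A x) x)) = (\<lambda>v. F (trD (chart_at A x) c x v))"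
    using frechet_derivative_at[OF has_derivative_change_chart[OF A c0 c F]] by simp
  then show ?thesis using tangent_spaceD[OF v c0 c] by (simp add: differential_def Let_def)
qed

section \<open>Smooth maps\<close>

lemma openin_chart_domain:
  assumes "smooth_atlas A" "c \<in> A"
  shows "openin (manifold_topology A) (fst c)"
  unfolding openin_manifold_topology[OF assms(1)]
  using assms open_transition_domain[OF assms(1)] by (auto simp: points_def Int_commute)

lemma smooth_map_points:
  assumes "smooth_map A B f" "smooth_atlas A" "smooth_atlas B" "x \<in> points A"
  shows "f x \<in> points B"
  using assms continuous_map_image_subset_topspace
  unfolding smooth_map_def by (fastforce simp: topspace_manifold_topology)

lemma open_smooth_map_domain:
  assumes f: "smooth_map A B f" and A: "smooth_atlas A" and B: "smooth_atlas B" and c: "c \<in> A" and d: "d \<in> B"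
  shows "open (snd c ` (fst c \<inter> f -` fst d))"
proof -
  have "continuous_map (manifold_topology A) (manifold_topology B) f" using f by (simp add: smooth_map_def)
  from openin_continuous_map_preimage[OF this openin_chart_domain[OF B d]]
  have "open (snd c ` ({x \<in> points A. f x \<in> fst d} \<inter> fst c))"
    unfolding openin_manifold_topology[OF A] topspace_manifold_topology[OF A] using c by blast
  also have "{x \<in> points A. f x \<in> fst d} \<inter> fst c = fst c \<inter> f -` fst d" using c by (auto simp: points_def)
  finally show ?thesis .
qed

lemma smooth_on_coordinate_map:
  assumes "smooth_map A B f" "c \<in> A" "d \<in> B"
  shows "smooth_on (snd c ` (fst c \<inter> f -` fst d)) (snd d \<circ> f \<circ> inv_chart c)"
  using assms by (simp add: smooth_map_def)

lemma has_derivative_coordinate_map: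
  assumes f: "smooth_map A B f" and A: "smooth_atlas A" and B: "smooth_atlas B"
    and c: "c \<in> charts_at A x" and d: "d \<in> charts_at B (f x)"
  shows "((snd d \<circ> f \<circ> inv_chart c) has_derivative
     frechet_derivative (snd d \<circ> f \<circ> inv_chart c) (at (snd c x))) (at (snd c x))"
  by (rule smooth_on_has_derivative_open[OF smooth_on_coordinate_map[OF f] open_smooth_map_domain[OF f A B]])
     (use c d in \<open>auto simp: mem_charts_at\<close>)

lemma tangent_map_eq:
  assumes f: "smooth_map A B f" and A: "smooth_atlas A" and B: "smooth_atlas B"
    and c: "c \<in> charts_at A x" and d: "d \<in> charts_at B (f x)" and v: "v \<in> tangent_space A x"
  shows "tangent_map A B f x v d = frechet_derivative (snd d \<circ> f \<circ> inv_chart c) (at (snd c x)) (v c)"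
proof -
  note c0 = chart_at_in[OF c]
  have "frechet_derivative (snd d \<circ> f \<circ> inv_chart (chart_at A x)) (at (snd (chart_at A x) x))
      = (\<lambda>v. frechet_derivative (snd d \<circ> f \<circ> inv_chart c) (at (snd c x)) (trD (chart_at A x) c x v))"
    using frechet_derivative_at[OF has_derivative_change_chart[OF A c0 c has_derivative_coordinate_map[OF f A B c d]]]
    by simp
  then show ?thesis using tangent_spaceD[OF v c0 c] d by (simp add: tangent_map_def Let_def)
qed

lemma tangent_map_in:
  assumes f: "smooth_map A B f" and A: "smooth_atlas A" and B: "smooth_atlas B"
    and c: "c \<in> charts_at A x" and v: "v \<in> tangent_space A x"
  shows "tangent_map A B f x v \<in> tangent_space B (f x)"
proof -
  have cA: "c \<in> A" "x \<in> fst c" using c by (auto simp: mem_charts_at)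
  have "tangent_map A B f x v e = trD d e (f x) (tangent_map A B f x v d)"
    if d: "d \<in> charts_at B (f x)" and e: "e \<in> charts_at B (f x)" for d e
  proof -
    have de: "d \<in> B" "f x \<in> fst d" using d by (auto simp: mem_charts_at)
    have "(snd d \<circ> f \<circ> inv_chart c) (snd c x) = snd d (f x)" by (simp add: inv_chart_chart[OF A cA])
    then have "((\<lambda>y. (snd e \<circ> inv_chart d) ((snd d \<circ> f \<circ> inv_chart c) y)) has_derivative
       (\<lambda>v. trD d e (f x) (frechet_derivative (snd d \<circ> f \<circ> inv_chart c) (at (snd c x)) v))) (at (snd c x))"
      by (intro has_derivative_compose[OF has_derivative_coordinate_map[OF f A B c d]])
         (simp only: has_derivative_transition[OF B d e])
    then have "((snd e \<circ> f \<circ> inv_chart c) has_derivative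
       (\<lambda>v. trD d e (f x) (frechet_derivative (snd d \<circ> f \<circ> inv_chart c) (at (snd c x)) v))) (at (snd c x))"
    proof (rule has_derivative_transform_within_open[OF _ open_smooth_map_domain[OF f A B cA(1) de(1)]])
      show "snd c x \<in> snd c ` (fst c \<inter> f -` fst d)" by (rule imageI) (simp add: cA(2) de(2))
      fix y assume "y \<in> snd c ` (fst c \<inter> f -` fst d)"
      from mem_chart_imageD(2)[OF A cA(1) this] have "f (inv_chart c y) \<in> fst d" by simp
      then show "(snd e \<circ> inv_chart d) ((snd d \<circ> f \<circ> inv_chart c) y) = (snd e \<circ> f \<circ> inv_chart c) y"
        by (simp add: inv_chart_chart[OF B de(1)])
    qed
    from frechet_derivative_at[OF this]
    show ?thesis unfolding tangent_map_eq[OF f A B c d v] tangent_map_eq[OF f A B c e v] by (rule fun_cong[symmetric])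
  qed
  then show ?thesis by (rule tangent_spaceI) (assumption+, simp add: tangent_map_def)
qed

text \<open>One pair of charts per point is enough, since changing charts on both sides composes the
  given expression with smooth transitions.\<close>

lemma smooth_mapI:
  assumes A: "smooth_atlas A" and B: "smooth_atlas B"
    and loc: "\<And>x. x \<in> points A \<Longrightarrow> \<exists>c\<in>charts_at A x. \<exists>d\<in>B. \<exists>V. open V \<and> snd c x \<in> V \<and> V \<subseteq> snd c ` fst c \<and>
      (\<forall>y\<in>V. f (inv_chart c y) \<in> fst d) \<and> smooth_on V (snd d \<circ> f \<circ> inv_chart c)"
  shows "smooth_map A B f"
proof -
  \<comment> \<open>One local statement serves both halves of \<open>smooth_map\<close>: arbitrary
    open \<open>W\<close> gives continuity, and \<open>W = fst d\<close> gives smoothness in the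
    charts \<open>c\<close> and \<open>d\<close>.\<close>
  have loc2: "\<exists>U. open U \<and> snd c x \<in> U \<and> U \<subseteq> snd c ` (fst c \<inter> f -` W) \<and> (\<forall>d\<in>B. W = fst d \<longrightarrow> smooth_on U (snd d \<circ> f \<circ> inv_chart c))"
    if c: "c \<in> charts_at A x" and W: "openin (manifold_topology B) W" "f x \<in> W" for c x W
  proof -
    obtain c' d' V where c': "c' \<in> charts_at A x" "d' \<in> B" "open V" "snd c' x \<in> V" "V \<subseteq> snd c' ` fst c'"
      "\<And>y. y \<in> V \<Longrightarrow> f (inv_chart c' y) \<in> fst d'" "smooth_on V (snd d' \<circ> f \<circ> inv_chart c')"
      using loc[OF points_charts_at[OF c]] by blast
    have cA: "c \<in> A" "x \<in> fst c" "c' \<in> A" "x \<in> fst c'" using c c' by (auto simp: mem_charts_at)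
    let ?S = "snd c ` (fst c \<inter> fst c')" and ?\<phi> = "snd c' \<circ> inv_chart c"
    have oW: "open (snd d' ` (W \<inter> fst d'))" using W(1) c'(2) openin_manifold_topology[OF B] by blast
    let ?V = "V \<inter> (snd d' \<circ> f \<circ> inv_chart c') -` (snd d' ` (W \<inter> fst d'))"
    have oV: "open ?V"
      using continuous_on_open_vimage[OF c'(3)] smooth_on_imp_continuous_on[OF c'(7)] oW
      by (metis Int_commute)
    have VW: "f (inv_chart c' y) \<in> W" if y: "y \<in> ?V" for y
    proof -
      have "f (inv_chart c' y) \<in> fst d'" using c'(6) that by blast
      moreover obtain w where "w \<in> W" "w \<in> fst d'" "snd d' (f (inv_chart c' y)) = snd d' w" using y by auto
      ultimately show ?thesis using inj_on_chart[OF B c'(2)] by (metis inj_onD)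
    qed
    let ?U = "?S \<inter> ?\<phi> -` ?V"
    have oU: "open ?U"
      using continuous_on_open_vimage[OF open_transition_domain[OF A cA(1,3)]]
        smooth_on_imp_continuous_on[OF smooth_on_transition[OF A cA(1,3)]] oV
      by (metis Int_commute)
    have y: "inv_chart c y \<in> fst c" "inv_chart c y \<in> fst c'" "snd c (inv_chart c y) = y"
      "inv_chart c' (?\<phi> y) = inv_chart c y" if "y \<in> ?U" for y
    proof -
      have "y \<in> snd c ` (fst c \<inter> fst c')" using that by simp
      note yS = mem_chart_imageD[OF A cA(1) this]
      show "inv_chart c y \<in> fst c" "inv_chart c y \<in> fst c'" "snd c (inv_chart c y) = y"
        using inv_chart_in[OF yS(1)] chart_inv_chart[OF yS(1)] yS(2) by simp_all
      show "inv_chart c' (?\<phi> y) = inv_chart c y" using inv_chart_chart[OF A cA(3) yS(2)] by simp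
    qed
    have 1: "snd c x \<in> ?U"
    proof -
      have "f x \<in> fst d'" using c'(6)[OF c'(4)] by (simp add: inv_chart_chart[OF A cA(3,4)])
      then show ?thesis using cA c'(4) W(2)
        by (auto simp: inv_chart_chart[OF A cA(1,2)] inv_chart_chart[OF A cA(3,4)])
    qed
    have 2: "?U \<subseteq> snd c ` (fst c \<inter> f -` W)"
    proof
      fix y assume yU: "y \<in> ?U"
      have "f (inv_chart c' (?\<phi> y)) \<in> W" using VW yU by blast
      then have "f (inv_chart c y) \<in> W" using y(4)[OF yU] by simp
      then show "y \<in> snd c ` (fst c \<inter> f -` W)"
        using y[OF yU] by (intro image_eqI[of _ _ "inv_chart c y"]) auto
    qed
    have 3: "smooth_on ?U (snd d \<circ> f \<circ> inv_chart c)" if d: "d \<in> B" "W = fst d" for d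
    proof (rule smooth_on_eq)
      have s1: "smooth_on ?U ?\<phi>"
        by (rule smooth_on_subset[OF smooth_on_transition[OF A cA(1,3)]]) blast
      have s2: "smooth_on ?U (\<lambda>y. (snd d' \<circ> f \<circ> inv_chart c') (?\<phi> y))"
        by (rule smooth_on_compose[OF c'(7) s1]) auto
      show "smooth_on ?U (\<lambda>y. (snd d \<circ> inv_chart d') ((snd d' \<circ> f \<circ> inv_chart c') (?\<phi> y)))"
      proof (rule smooth_on_compose[OF smooth_on_transition[OF B c'(2) d(1)] s2])
        fix y assume "y \<in> ?U"
        then have "?\<phi> y \<in> ?V" by blast
        then have "f (inv_chart c' (?\<phi> y)) \<in> fst d" "f (inv_chart c' (?\<phi> y)) \<in> fst d'" using VW c'(6) d by auto
        then show "(snd d' \<circ> f \<circ> inv_chart c') (?\<phi> y) \<in> snd d' ` (fst d' \<inter> fst d)" by auto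
      qed
      fix y assume yU: "y \<in> ?U"
      then have "?\<phi> y \<in> ?V" by blast
      then have "f (inv_chart c' (?\<phi> y)) \<in> fst d'" using c'(6) by blast
      then show "(snd d \<circ> f \<circ> inv_chart c) y = (snd d \<circ> inv_chart d') ((snd d' \<circ> f \<circ> inv_chart c') (?\<phi> y))"
        using y(4)[OF yU] by (simp add: inv_chart_chart[OF B c'(2)])
    qed
    show ?thesis using oU 1 2 3 by (intro exI[of _ ?U]) blast
  qed
  show ?thesis unfolding smooth_map_def
  proof (intro conjI ballI)
    have pts: "f x \<in> points B" if x: "x \<in> points A" for x
    proof -
      obtain c d V where "c \<in> charts_at A x" "d \<in> B" "snd c x \<in> V" "\<forall>y\<in>V. f (inv_chart c y) \<in> fst d"
        using loc[OF x] by blast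
      then have "f x \<in> fst d" "d \<in> B" using inv_chart_chart[OF A, of c x] by (auto simp: mem_charts_at)
      then show ?thesis by (auto simp: points_def)
    qed
    show "continuous_map (manifold_topology A) (manifold_topology B) f"
      unfolding continuous_map topspace_manifold_topology[OF A] topspace_manifold_topology[OF B]
    proof (intro conjI allI impI)
      show "f ` points A \<subseteq> points B" using pts by blast
      fix W assume W: "openin (manifold_topology B) W"
      show "openin (manifold_topology A) {x \<in> points A. f x \<in> W}"
        unfolding openin_manifold_topology[OF A]
      proof (intro conjI ballI)
        fix c assume cA: "c \<in> A"
        have eq: "{x \<in> points A. f x \<in> W} \<inter> fst c = fst c \<inter> f -` W" using cA by (auto simp: points_def)
        show "open (snd c ` ({x \<in> points A. f x \<in> W} \<inter> fst c))"
          unfolding eq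
        proof (subst open_subopen, safe)
          fix x assume x: "x \<in> fst c" "f x \<in> W"
          have "c \<in> charts_at A x" using x cA by (simp add: mem_charts_at)
          from loc2[OF this W x(2)]
          show "\<exists>T. open T \<and> snd c x \<in> T \<and> T \<subseteq> snd c ` (fst c \<inter> f -` W)" by blast
        qed
      qed blast
    qed
    fix c d assume cd: "c \<in> A" "d \<in> B"
    let ?S = "snd c ` (fst c \<inter> f -` fst d)"
    have *: "\<exists>U. open U \<and> y \<in> U \<and> U \<subseteq> ?S \<and> smooth_on U (snd d \<circ> f \<circ> inv_chart c)" if y: "y \<in> ?S" for y
    proof -
      obtain x where x: "x \<in> fst c" "f x \<in> fst d" "y = snd c x" using y by blast
      have "c \<in> charts_at A x" using x cd by (simp add: mem_charts_at)
      from loc2[OF this openin_chart_domain[OF B cd(2)] x(2)] show ?thesis using cd(2) x(3) by blast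
    qed
    have "open ?S" using * by (subst open_subopen) blast
    then show "smooth_on ?S (snd d \<circ> f \<circ> inv_chart c)"
    proof (intro smooth_on_local thick_open)
      fix y assume "y \<in> ?S"
      from *[OF this] obtain U where U: "open U" "y \<in> U" "U \<subseteq> ?S" "smooth_on U (snd d \<circ> f \<circ> inv_chart c)" by blast
      from open_subset[OF U(3,1)] U show "\<exists>T. openin (top_of_set ?S) T \<and> y \<in> T \<and> smooth_on T (snd d \<circ> f \<circ> inv_chart c)"
        by blast
    qed
  qed
qed

section \<open>Curves\<close>

lemma smooth_curve_points:
  assumes "smooth_curve A I q" "smooth_atlas A" "t \<in> I"
  shows "q t \<in> points A"
  using assms continuous_map_image_subset_topspace
  unfolding smooth_curve_def by (fastforce simp: topspace_manifold_topology)

lemma smooth_curve_openin: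
  assumes q: "smooth_curve A I q" and A: "smooth_atlas A" and c: "c \<in> A"
  shows "openin (top_of_set I) {t \<in> I. q t \<in> fst c}"
proof -
  have "continuous_map (top_of_set I) (manifold_topology A) q" using q by (simp add: smooth_curve_def)
  from openin_continuous_map_preimage[OF this openin_chart_domain[OF A c]] show ?thesis by simp
qed

lemma smooth_curveI:
  assumes A: "smooth_atlas A" and I: "thick I"
    and loc: "\<And>t. t \<in> I \<Longrightarrow> \<exists>c\<in>A. \<exists>J. openin (top_of_set I) J \<and> t \<in> J \<and> (\<forall>s\<in>J. q s \<in> fst c) \<and> smooth_on J (snd c \<circ> q)"
  shows "smooth_curve A I q"
proof -
  \<comment> \<open>The device of \<open>smooth_mapI\<close> again: \<open>W\<close> ranges over
    open sets for continuity and over chart domains for smoothness.\<close>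
  have loc2: "\<exists>J. openin (top_of_set I) J \<and> t \<in> J \<and> (\<forall>s\<in>J. q s \<in> W) \<and> (\<forall>d\<in>A. W = fst d \<longrightarrow> smooth_on J (snd d \<circ> q))"
    if t: "t \<in> I" and W: "openin (manifold_topology A) W" "q t \<in> W" for t W
  proof -
    obtain c J where c: "c \<in> A" "openin (top_of_set I) J" "t \<in> J" "\<And>s. s \<in> J \<Longrightarrow> q s \<in> fst c" "smooth_on J (snd c \<circ> q)"
      using loc[OF t] by blast
    have oW: "open (snd c ` (W \<inter> fst c))" using W(1) c(1) openin_manifold_topology[OF A] by blast
    let ?K = "J \<inter> (snd c \<circ> q) -` (snd c ` (W \<inter> fst c))"
    have "openin (top_of_set J) ?K"
      using continuous_openin_preimage_gen[OF smooth_on_imp_continuous_on[OF c(5)] oW] .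
    then have oK: "openin (top_of_set I) ?K" using c(2) openin_trans by blast
    have KW: "q s \<in> W" if s: "s \<in> ?K" for s
    proof -
      obtain w where "w \<in> W" "w \<in> fst c" "snd c (q s) = snd c w" using s by auto
      moreover have "q s \<in> fst c" using c(4) s by blast
      ultimately show ?thesis using inj_on_chart[OF A c(1)] by (metis inj_onD)
    qed
    have s: "smooth_on ?K (snd d \<circ> q)" if d: "d \<in> A" "W = fst d" for d
    proof (rule smooth_on_eq)
      show "smooth_on ?K (\<lambda>s. (snd d \<circ> inv_chart c) ((snd c \<circ> q) s))"
        by (rule smooth_on_compose[OF smooth_on_transition[OF A c(1) d(1)] smooth_on_subset[OF c(5)]])
           (use d KW c(4) in auto)
      show "(snd d \<circ> q) s = (snd d \<circ> inv_chart c) ((snd c \<circ> q) s)" if "s \<in> ?K" for s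
        using c(4) that by (simp add: inv_chart_chart[OF A c(1)])
    qed
    have "t \<in> ?K" using c(3,4) W(2) by auto
    then show ?thesis using oK KW s by blast
  qed
  show ?thesis unfolding smooth_curve_def
  proof (intro conjI ballI)
    have pts: "q t \<in> points A" if "t \<in> I" for t using loc[OF that] by (auto simp: points_def)
    show "continuous_map (top_of_set I) (manifold_topology A) q"
      unfolding continuous_map topspace_manifold_topology[OF A]
    proof (intro conjI allI impI)
      show "q ` topspace (top_of_set I) \<subseteq> points A" using pts by auto
      fix W assume W: "openin (manifold_topology A) W"
      show "openin (top_of_set I) {x \<in> topspace (top_of_set I). q x \<in> W}"
      proof (subst openin_subopen, safe)
        fix t assume t: "t \<in> topspace (top_of_set I)" "q t \<in> W"
        then have "t \<in> I" by simp
        from loc2[OF this W t(2)]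
        obtain J where J: "openin (top_of_set I) J" "t \<in> J" "\<forall>s\<in>J. q s \<in> W" by blast
        have "J \<subseteq> {x \<in> topspace (top_of_set I). q x \<in> W}" using openin_subset[OF J(1)] J(3) by blast
        then show "\<exists>T. openin (top_of_set I) T \<and> t \<in> T \<and> T \<subseteq> {x \<in> topspace (top_of_set I). q x \<in> W}" using J by blast
      qed
    qed
    fix d assume d: "d \<in> A"
    let ?S = "{t \<in> I. q t \<in> fst d}"
    have *: "\<exists>U. openin (top_of_set I) U \<and> t \<in> U \<and> U \<subseteq> ?S \<and> smooth_on U (snd d \<circ> q)" if t: "t \<in> ?S" for t
    proof -
      have t': "t \<in> I" "q t \<in> fst d" using t by simp_all
      from loc2[OF t'(1) openin_chart_domain[OF A d] t'(2)] d
      obtain J where J: "openin (top_of_set I) J" "t \<in> J" "\<forall>s\<in>J. q s \<in> fst d" "smooth_on J (snd d \<circ> q)"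
        by blast
      have "J \<subseteq> ?S" using openin_subset[OF J(1)] J(3) by auto
      then show ?thesis using J by blast
    qed
    have oS: "openin (top_of_set I) ?S" using * by (subst openin_subopen) blast
    show "smooth_on ?S (snd d \<circ> q)"
    proof (rule smooth_on_local[OF thick_openin[OF I oS]])
      fix t assume "t \<in> ?S"
      then obtain U where U: "openin (top_of_set I) U" "t \<in> U" "U \<subseteq> ?S" "smooth_on U (snd d \<circ> q)" using * by blast
      then show "\<exists>T. openin (top_of_set ?S) T \<and> t \<in> T \<and> smooth_on T (snd d \<circ> q)"
        using openin_subset_trans[OF U(1,3)] by auto
    qed
  qed
qed

lemma smooth_on_curve_chart:
  "smooth_curve A I q \<Longrightarrow> c \<in> A \<Longrightarrow> smooth_on {t \<in> I. q t \<in> fst c} (\<lambda>t. snd c (q t))"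
  by (simp add: smooth_curve_def o_def)

lemma velocity_chart:
  assumes q: "smooth_curve A I q" and A: "smooth_atlas A" and I: "thick I" and t: "t \<in> I" and c: "c \<in> charts_at A (q t)"
  shows "((\<lambda>t. snd c (q t)) has_vector_derivative velocity A I q t c) (at t within I)"
proof -
  have cA: "c \<in> A" "q t \<in> fst c" using c by (auto simp: mem_charts_at)
  note o = smooth_curve_openin[OF q A cA(1)]
  have at: "at t within {t \<in> I. q t \<in> fst c} = at t within I" using at_within_openin[OF o] t cA by blast
  show ?thesis
    using smooth_on_vector_derivative(1)[OF smooth_on_curve_chart[OF q cA(1)] thick_openin[OF I o], of t] t cA c
    by (simp add: at velocity_def o_def)
qed

lemma velocity_in:
  assumes q: "smooth_curve A I q" and A: "smooth_atlas A" and I: "thick I" and t: "t \<in> I"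
  shows "velocity A I q t \<in> tangent_space A (q t)"
proof -
  have "velocity A I q t d = trD c d (q t) (velocity A I q t c)"
    if c: "c \<in> charts_at A (q t)" and d: "d \<in> charts_at A (q t)" for c d
  proof -
    have cA: "c \<in> A" "q t \<in> fst c" "d \<in> A" "q t \<in> fst d" using c d by (auto simp: mem_charts_at)
    note o = smooth_curve_openin[OF q A cA(1)]
    let ?v = "velocity A I q t c"
    have "((\<lambda>s. (snd d \<circ> inv_chart c) (snd c (q s))) has_derivative (\<lambda>h. trD c d (q t) (h *\<^sub>R ?v))) (at t within I)"
      by (rule has_derivative_compose[OF velocity_chart[OF q A I t c, unfolded has_vector_derivative_def]
          has_derivative_transition[OF A c d]])
    then have "((\<lambda>s. (snd d \<circ> inv_chart c) (snd c (q s))) has_vector_derivative trD c d (q t) ?v) (at t within I)"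
      by (simp add: has_vector_derivative_def linear_scale[OF linear_trD[OF A c d]])
    moreover have "((\<lambda>s. (snd d \<circ> inv_chart c) (snd c (q s))) has_vector_derivative velocity A I q t d) (at t within I)"
    proof -
      have at: "at t within {t \<in> I. q t \<in> fst c} = at t within I" using at_within_openin[OF o] t cA by blast
      have "((\<lambda>s. (snd d \<circ> inv_chart c) (snd c (q s))) has_vector_derivative velocity A I q t d) (at t within {t \<in> I. q t \<in> fst c})"
        by (rule has_vector_derivative_transform[OF _ _ velocity_chart[OF q A I t d, folded at]])
           (use t cA in \<open>auto simp: inv_chart_chart[OF A cA(1)]\<close>)
      then show ?thesis unfolding at .
    qed
    ultimately show ?thesis
      using vector_derivative_unique_within[OF trivial_limit_thick[OF I t]] by blast
  qed
  then show ?thesis by (rule tangent_spaceI) (assumption+, simp add: velocity_def)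
qed

section \<open>The tangent bundle\<close>

lemma mem_tangent_chart: "(x, v) \<in> fst (tangent_chart A c) \<longleftrightarrow> x \<in> fst c \<and> v \<in> tangent_space A x"
  by (simp add: tangent_chart_def)

lemma tangent_chart_apply: "snd (tangent_chart A c) (x, v) = (snd c x, v c)"
  by (simp add: tangent_chart_def)

lemma inv_chart_eqI:
  "inj_on (snd C) (fst C) \<Longrightarrow> z \<in> fst C \<Longrightarrow> snd C z = p \<Longrightarrow> inv_chart C p = z"
  unfolding inv_chart_def by (rule inv_into_f_eq)

lemma image_tangent_chart:
  assumes A: "smooth_atlas A" and c: "c \<in> A"
  shows "snd (tangent_chart A c) ` (fst (tangent_chart A c) \<inter> fst (tangent_chart A d)) = snd c ` (fst c \<inter> fst d) \<times> UNIV"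
    (is "?L = ?R")
proof (rule equalityI; rule subsetI)
  fix p assume "p \<in> ?L"
  then obtain x v where "(x, v) \<in> fst (tangent_chart A c)" "(x, v) \<in> fst (tangent_chart A d)"
     "p = snd (tangent_chart A c) (x, v)" by force
  then show "p \<in> ?R" by (simp add: mem_tangent_chart tangent_chart_apply)
next
  fix p assume "p \<in> ?R"
  then obtain x w where x: "x \<in> fst c" "x \<in> fst d" and p: "p = (snd c x, w)" by force
  have cx: "c \<in> charts_at A x" using x c by (simp add: mem_charts_at)
  show "p \<in> ?L"
    by (rule image_eqI[of _ _ "(x, tvec_of A c x w)"])
       (simp_all add: p x tangent_chart_apply mem_tangent_chart tvec_of_same[OF A cx] tvec_of_in[OF A cx])
qed

lemma image_tangent_chart_self:
  assumes "smooth_atlas A" "c \<in> A"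
  shows "snd (tangent_chart A c) ` fst (tangent_chart A c) = snd c ` fst c \<times> UNIV"
  using image_tangent_chart[OF assms, of c] by simp

lemma inj_on_tangent_chart:
  assumes A: "smooth_atlas A" and c: "c \<in> A"
  shows "inj_on (snd (tangent_chart A c)) (fst (tangent_chart A c))"
proof (rule inj_onI)
  fix p p' assume p: "p \<in> fst (tangent_chart A c)" and p': "p' \<in> fst (tangent_chart A c)"
    and eq: "snd (tangent_chart A c) p = snd (tangent_chart A c) p'"
  obtain x v x' v' where pp: "p = (x, v)" "p' = (x', v')" by fastforce
  have m: "x \<in> fst c" "v \<in> tangent_space A x" "x' \<in> fst c" "v' \<in> tangent_space A x'"
    "snd c x = snd c x'" "v c = v' c"
    using p p' eq unfolding pp mem_tangent_chart tangent_chart_apply by simp_all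
  have "x = x'" using inj_onD[OF inj_on_chart[OF A c] m(5,1,3)] .
  moreover from this have "v = v'"
    using tangent_space_eqI[of v A x v' c] m c by (simp add: mem_charts_at)
  ultimately show "p = p'" using pp by simp
qed

lemma inv_tangent_chart:
  assumes A: "smooth_atlas A" and c: "c \<in> A" and y: "y \<in> snd c ` fst c"
  shows "inv_chart (tangent_chart A c) (y, w) = (inv_chart c y, tvec_of A c (inv_chart c y) w)"
proof (rule inv_chart_eqI[OF inj_on_tangent_chart[OF A c]])
  have cx: "c \<in> charts_at A (inv_chart c y)" using c inv_chart_in[OF y] by (simp add: mem_charts_at)
  show "(inv_chart c y, tvec_of A c (inv_chart c y) w) \<in> fst (tangent_chart A c)"
    using inv_chart_in[OF y] tvec_of_in[OF A cx] by (simp add: mem_tangent_chart)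
  show "snd (tangent_chart A c) (inv_chart c y, tvec_of A c (inv_chart c y) w) = (y, w)"
    by (simp add: tangent_chart_apply chart_inv_chart[OF y] tvec_of_same[OF A cx])
qed

lemma tangent_transition:
  assumes A: "smooth_atlas A" and c: "c \<in> A" and d: "d \<in> A" and y: "y \<in> snd c ` (fst c \<inter> fst d)"
  shows "(snd (tangent_chart A d) \<circ> inv_chart (tangent_chart A c)) (y, w) =
    ((snd d \<circ> inv_chart c) y, frechet_derivative (snd d \<circ> inv_chart c) (at y) w)"
proof -
  note y' = mem_chart_imageD[OF A c y]
  have "d \<in> charts_at A (inv_chart c y)" using d y'(2) by (simp add: mem_charts_at)
  then show ?thesis
    by (simp add: inv_tangent_chart[OF A c y'(1)] tangent_chart_apply tvec_of_def chart_inv_chart[OF y'(1)])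
qed

lemma smooth_atlas_tangent_bundle:
  assumes A: "smooth_atlas A"
  shows "smooth_atlas (tangent_bundle A)"
proof -
  have 1: "inj_on (snd (tangent_chart A c)) (fst (tangent_chart A c)) \<and>
    open (snd (tangent_chart A c) ` fst (tangent_chart A c))" if c: "c \<in> A" for c
    using inj_on_tangent_chart[OF A c] open_chart_image[OF A c]
    by (simp add: image_tangent_chart_self[OF A c] open_Times)
  have 2: "open (snd (tangent_chart A c) ` (fst (tangent_chart A c) \<inter> fst (tangent_chart A d))) \<and>
    smooth_on (snd (tangent_chart A c) ` (fst (tangent_chart A c) \<inter> fst (tangent_chart A d)))
      (snd (tangent_chart A d) \<circ> inv_chart (tangent_chart A c))" if c: "c \<in> A" and d: "d \<in> A" for c d
  proof -
    let ?S = "snd c ` (fst c \<inter> fst d)" and ?\<phi> = "snd d \<circ> inv_chart c"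
    have o: "open ?S" by (rule open_transition_domain[OF A c d])
    note s = smooth_on_transition[OF A c d]
    have f: "smooth_on (?S \<times> UNIV) (\<lambda>p. fst p)" "smooth_on (?S \<times> UNIV) (\<lambda>p. snd p)"
      by (rule smooth_on_fst[OF smooth_on_id], rule smooth_on_snd[OF smooth_on_id])
    have "smooth_on (?S \<times> UNIV) (\<lambda>p. (?\<phi> (fst p), frechet_derivative ?\<phi> (at (fst p)) (snd p)))"
      by (rule smooth_on_Pair[OF smooth_on_compose[OF s f(1)] smooth_on_frechet_derivative_apply[OF s o f]]) auto
    then have "smooth_on (?S \<times> UNIV) (snd (tangent_chart A d) \<circ> inv_chart (tangent_chart A c))"
    proof (rule smooth_on_eq)
      fix p :: "'b \<times> 'b" assume "p \<in> ?S \<times> UNIV"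
      then show "(snd (tangent_chart A d) \<circ> inv_chart (tangent_chart A c)) p
          = (?\<phi> (fst p), frechet_derivative ?\<phi> (at (fst p)) (snd p))"
        using tangent_transition[OF A c d, of "fst p" "snd p"] by auto
    qed
    then show ?thesis using o by (simp add: image_tangent_chart[OF A c] open_Times)
  qed
  show ?thesis unfolding smooth_atlas_def tangent_bundle_def ball_simps using 1 2 by blast
qed

lemma tangent_chart_charts_at:
  assumes "c \<in> charts_at A x" "v \<in> tangent_space A x"
  shows "tangent_chart A c \<in> charts_at (tangent_bundle A) (x, v)"
  using assms by (simp add: mem_charts_at tangent_bundle_def mem_tangent_chart)

lemma mem_points_tangent_bundle:
  "(x, v) \<in> points (tangent_bundle A) \<longleftrightarrow> x \<in> points A \<and> v \<in> tangent_space A x"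
proof
  assume "(x, v) \<in> points (tangent_bundle A)"
  then show "x \<in> points A \<and> v \<in> tangent_space A x"
    by (auto simp: points_def tangent_bundle_def mem_tangent_chart)
next
  assume *: "x \<in> points A \<and> v \<in> tangent_space A x"
  then obtain c where "c \<in> charts_at A x" using charts_at_nonempty[of x A] by blast
  from points_charts_at[OF tangent_chart_charts_at[OF this conjunct2[OF *]]] show "(x, v) \<in> points (tangent_bundle A)" .
qed

text \<open>The tangent transition \<open>(y, w) \<mapsto> (\<phi> y, D\<phi>(y) w)\<close> has the
  second derivative of \<open>\<phi>\<close> in the lower left block of its Jacobian. Chart
  independence of the canonical flip hinges on this term.\<close>

lemma trD_tangent_chart:
  assumes A: "smooth_atlas A" and c: "c \<in> charts_at A x" and d: "d \<in> charts_at A x"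
  shows "trD (tangent_chart A c) (tangent_chart A d) (x, v) (u, w) = (trD c d x u,
    frechet_derivative (\<lambda>y. frechet_derivative (snd d \<circ> inv_chart c) (at y) (v c)) (at (snd c x)) u + trD c d x w)"
proof -
  have cd: "c \<in> A" "x \<in> fst c" "d \<in> A" "x \<in> fst d" using c d by (simp_all add: mem_charts_at)
  let ?S = "snd c ` (fst c \<inter> fst d)" and ?\<phi> = "snd d \<circ> inv_chart c"
  have o: "open ?S" by (rule open_transition_domain[OF A cd(1,3)])
  have oU: "open (?S \<times> (UNIV :: 'b set))" using o by (simp add: open_Times)
  note s = smooth_on_transition[OF A cd(1,3)]
  let ?p = "(snd c x, v c)"
  have xS: "snd c x \<in> ?S" using cd by blast
  have pS: "?p \<in> ?S \<times> UNIV" using xS by simp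
  have d1: "((\<lambda>p. ?\<phi> (fst p)) has_derivative (\<lambda>h. trD c d x (fst h))) (at ?p)"
    by (rule has_derivative_compose[OF has_derivative_fst[OF has_derivative_ident]])
       (simp add: has_derivative_transition[OF A c d, unfolded o_def] o_def)
  have lin: "linear (frechet_derivative ?\<phi> (at y))" if "y \<in> ?S" for y
    by (rule linear_frechet_derivative_smooth[OF s o that])
  have der: "((\<lambda>y. frechet_derivative ?\<phi> (at y) b) has_derivative
      (\<lambda>u. frechet_derivative (\<lambda>y. frechet_derivative ?\<phi> (at y) b) (at (snd c x)) u)) (at (snd c x) within ?S)" for b
    by (rule has_derivative_at_withinI) (rule smooth_on_has_derivative_open[OF smooth_on_frechet_derivative_open[OF s o] o xS])
  have d2: "((\<lambda>p. frechet_derivative ?\<phi> (at (fst p)) (snd p)) has_derivative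
      (\<lambda>h. frechet_derivative (\<lambda>y. frechet_derivative ?\<phi> (at y) (snd ?p)) (at (snd c x)) (fst h)
        + frechet_derivative ?\<phi> (at (fst ?p)) (snd h))) (at ?p within ?S \<times> UNIV)"
    by (rule has_derivative_apply[where S="?S" and f=fst and g=snd and x="?p" and f'=fst and g'=snd and
          A'="\<lambda>u b. frechet_derivative (\<lambda>y. frechet_derivative ?\<phi> (at y) b) (at (snd c x)) u", OF thick_open[OF o] lin])
       (use der pS in \<open>simp_all add: has_derivative_fst[OF has_derivative_ident] has_derivative_snd[OF has_derivative_ident]\<close>)
  from has_derivative_Pair[OF d1 d2[unfolded at_within_open[OF pS oU]]]
  have "((snd (tangent_chart A d) \<circ> inv_chart (tangent_chart A c)) has_derivative (\<lambda>h. (trD c d x (fst h),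
     frechet_derivative (\<lambda>y. frechet_derivative ?\<phi> (at y) (snd ?p)) (at (snd c x)) (fst h)
        + frechet_derivative ?\<phi> (at (fst ?p)) (snd h)))) (at ?p)"
  proof (rule has_derivative_transform_within_open[OF _ oU pS])
    fix p :: "'b \<times> 'b" assume "p \<in> ?S \<times> UNIV"
    then show "(?\<phi> (fst p), frechet_derivative ?\<phi> (at (fst p)) (snd p)) =
       (snd (tangent_chart A d) \<circ> inv_chart (tangent_chart A c)) p"
      using tangent_transition[OF A cd(1,3), of "fst p" "snd p"] by auto
  qed
  from frechet_derivative_at[OF this, symmetric] show ?thesis by (simp add: tangent_chart_apply)
qed

text \<open>That the coordinate expression of the flip does not depend on the chart is the symmetry of
  the second derivatives of the transition maps.\<close>

lemma canonical_flip_eq: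
  assumes A: "smooth_atlas A" and c: "c \<in> charts_at A x" and v: "v \<in> tangent_space A x"
    and w: "w \<in> tangent_space (tangent_bundle A) (x, v)"
  defines "v' \<equiv> tvec_of A c x (fst (w (tangent_chart A c)))"
  obtains w' where "canonical_flip A ((x, v), w) = ((x, v'), w')"
    "w' \<in> tangent_space (tangent_bundle A) (x, v')"
    "w' (tangent_chart A c) = (v c, snd (w (tangent_chart A c)))"
proof -
  let ?T = "tangent_chart A" and ?B = "tangent_bundle A"
  note B = smooth_atlas_tangent_bundle[OF A] and BB = smooth_atlas_tangent_bundle[OF smooth_atlas_tangent_bundle[OF A]]
  define w' where "w' = tvec_of ?B (?T c) (x, v') (v c, snd (w (?T c)))"
  have v': "v' \<in> tangent_space A x" unfolding v'_def by (rule tvec_of_in[OF A c])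
  have Tc': "?T c \<in> charts_at ?B (x, v')" by (rule tangent_chart_charts_at[OF c v'])
  have w': "w' \<in> tangent_space ?B (x, v')" "w' (?T c) = (v c, snd (w (?T c)))"
    unfolding w'_def by (rule tvec_of_in[OF B Tc'], rule tvec_of_same[OF B Tc'])
  have cA: "c \<in> A" "x \<in> fst c" using c by (simp_all add: mem_charts_at)
  define P where "P W' \<longleftrightarrow> W' \<in> points (tangent_bundle ?B) \<and>
    (\<forall>d\<in>charts_at A x. W' \<in> fst (tangent_chart ?B (?T d)) \<and>
       snd (tangent_chart ?B (?T d)) W' = ((snd d x, fst (w (?T d))), (v d, snd (w (?T d)))))" for W'
  have "P ((x, v'), w')"
    unfolding P_def
  proof (intro conjI ballI)
    show "((x, v'), w') \<in> points (tangent_bundle ?B)"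
      using points_charts_at[OF c] v' w'(1) by (simp add: mem_points_tangent_bundle)
    fix d assume d: "d \<in> charts_at A x"
    then have dA: "d \<in> A" "x \<in> fst d" by (simp_all add: mem_charts_at)
    show "((x, v'), w') \<in> fst (tangent_chart ?B (?T d))"
      using v' w'(1) dA by (simp add: mem_tangent_chart)
    note Td = tangent_chart_charts_at[OF d v] and Tc = tangent_chart_charts_at[OF c v]
    note Td' = tangent_chart_charts_at[OF d v']
    let ?D = "\<lambda>a b. frechet_derivative (\<lambda>y. frechet_derivative (snd d \<circ> inv_chart c) (at y) a) (at (snd c x)) b"
    have o: "open (snd c ` (fst c \<inter> fst d))" by (rule open_transition_domain[OF A cA(1) dA(1)])
    have xS: "snd c x \<in> snd c ` (fst c \<inter> fst d)" using cA dA by blast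
    have sym: "?D a b = ?D b a" for a b
      by (rule second_derivative_symmetric[OF smooth_on_transition[OF A cA(1) dA(1)] o xS])
    have v'c: "v' c = fst (w (?T c))" unfolding v'_def by (rule tvec_of_same[OF A c])
    have wd: "w (?T d) = (trD c d x (fst (w (?T c))), ?D (v c) (fst (w (?T c))) + trD c d x (snd (w (?T c))))"
      unfolding tangent_spaceD[OF w Tc Td] trD_tangent_chart[OF A c d, symmetric] by simp
    have w'd: "w' (?T d) = (trD c d x (v c), ?D (v' c) (v c) + trD c d x (snd (w (?T c))))"
      unfolding tangent_spaceD[OF w'(1) Tc' Td'] w'(2) trD_tangent_chart[OF A c d] ..
    have v'd: "v' d = trD c d x (v' c)" by (rule tangent_spaceD[OF v' c d])
    have vd: "v d = trD c d x (v c)" by (rule tangent_spaceD[OF v c d])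
    show "snd (tangent_chart ?B (?T d)) ((x, v'), w') = ((snd d x, fst (w (?T d))), (v d, snd (w (?T d))))"
      unfolding tangent_chart_apply w'd wd v'd vd v'c sym[of "fst (w (?T c))"] by simp
  qed
  \<comment> \<open>Uniqueness: the coordinates in a single chart already determine a point of the
    iterated bundle.\<close>
  moreover have "W' = ((x, v'), w')" if W': "P W'" and P2: "P ((x, v'), w')" for W'
  proof (rule inj_onD[OF inj_on_tangent_chart[OF B]])
    show "?T c \<in> ?B" using cA by (simp add: tangent_bundle_def)
    show "snd (tangent_chart ?B (?T c)) W' = snd (tangent_chart ?B (?T c)) ((x, v'), w')"
      using W' P2 c unfolding P_def by metis
    show "W' \<in> fst (tangent_chart ?B (?T c))" "((x, v'), w') \<in> fst (tangent_chart ?B (?T c))"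
      using W' P2 c unfolding P_def by blast+
  qed
  ultimately have "(THE W'. P W') = ((x, v'), w')" by (intro the_equality) blast+
  moreover have "canonical_flip A ((x, v), w) = (THE W'. P W')"
    unfolding canonical_flip_def P_def fst_conv Let_def tangent_chart_apply by (simp add: case_prod_unfold)
  ultimately show thesis using that[OF _ w'] by simp
qed

lemma generator_curve: "generator A I q \<xi> \<Longrightarrow> smooth_curve (tangent_bundle A) I (\<lambda>t. (q t, \<xi> t))"
  and generator_in: "generator A I q \<xi> \<Longrightarrow> t \<in> I \<Longrightarrow> \<xi> t \<in> tangent_space A (q t)"
  by (simp_all add: generator_def)

lemma generator_domain:
  assumes "generator A I q \<xi>"
  shows "{t \<in> I. (q t, \<xi> t) \<in> fst (tangent_chart A c)} = {t \<in> I. q t \<in> fst c}"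
  using generator_in[OF assms] by (auto simp: mem_tangent_chart)

lemma smooth_on_generator_chart:
  assumes g: "generator A I q \<xi>" and c: "c \<in> A"
  shows "smooth_on {t \<in> I. q t \<in> fst c} (\<lambda>t. \<xi> t c)"
proof -
  have "tangent_chart A c \<in> tangent_bundle A" using c by (simp add: tangent_bundle_def)
  from smooth_on_snd[OF smooth_on_curve_chart[OF generator_curve[OF g] this]]
  show ?thesis unfolding generator_domain[OF g] by (simp add: tangent_chart_apply)
qed

lemma generatorI:
  assumes A: "smooth_atlas A" and I: "thick I" and q: "smooth_curve A I q"
    and in_T: "\<And>t. t \<in> I \<Longrightarrow> \<xi> t \<in> tangent_space A (q t)"
    and loc: "\<And>t. t \<in> I \<Longrightarrow> \<exists>c\<in>A. \<exists>J. openin (top_of_set I) J \<and> t \<in> J \<and> (\<forall>s\<in>J. q s \<in> fst c) \<and> smooth_on J (\<lambda>s. \<xi> s c)"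
  shows "generator A I q \<xi>"
  unfolding generator_def
proof (intro conjI ballI)
  show "smooth_curve (tangent_bundle A) I (\<lambda>t. (q t, \<xi> t))"
  proof (rule smooth_curveI[OF smooth_atlas_tangent_bundle[OF A] I])
    fix t assume "t \<in> I"
    from loc[OF this] obtain c J where J: "c \<in> A" "openin (top_of_set I) J" "t \<in> J" "\<And>s. s \<in> J \<Longrightarrow> q s \<in> fst c"
      "smooth_on J (\<lambda>s. \<xi> s c)" by blast
    have JI: "J \<subseteq> I" using openin_subset[OF J(2)] by simp
    have "smooth_on J (\<lambda>s. (snd c (q s), \<xi> s c))"
      by (rule smooth_on_Pair[OF smooth_on_subset[OF smooth_on_curve_chart[OF q J(1)]] J(5)]) (use J(4) JI in auto)
    then have "smooth_on J (snd (tangent_chart A c) \<circ> (\<lambda>t. (q t, \<xi> t)))"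
      by (rule smooth_on_eq) (simp add: tangent_chart_apply)
    moreover have "\<forall>s\<in>J. (q s, \<xi> s) \<in> fst (tangent_chart A c)" using J(4) JI in_T by (auto simp: mem_tangent_chart)
    moreover have "tangent_chart A c \<in> tangent_bundle A" using J(1) by (simp add: tangent_bundle_def)
    ultimately show "\<exists>c\<in>tangent_bundle A. \<exists>J. openin (top_of_set I) J \<and> t \<in> J \<and>
       (\<forall>s\<in>J. (q s, \<xi> s) \<in> fst c) \<and> smooth_on J (snd c \<circ> (\<lambda>t. (q t, \<xi> t)))" using J(2,3) by blast
  qed
qed (rule in_T)

lemma generator_has_vector_derivative:
  assumes A: "smooth_atlas A" and I: "thick I" and q: "smooth_curve A I q" and g: "generator A I q \<xi>"
    and t: "t \<in> I" and c: "c \<in> charts_at A (q t)"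
  shows "((\<lambda>s. \<xi> s c) has_vector_derivative vector_derivative (\<lambda>s. \<xi> s c) (at t within I)) (at t within I)"
proof -
  have cA: "c \<in> A" "q t \<in> fst c" using c by (simp_all add: mem_charts_at)
  note o = smooth_curve_openin[OF q A cA(1)]
  have tJ: "t \<in> {t \<in> I. q t \<in> fst c}" using t cA by simp
  show ?thesis
    using smooth_on_vector_derivative(1)[OF smooth_on_generator_chart[OF g cA(1)] thick_openin[OF I o] tJ]
    unfolding at_within_openin[OF o tJ] .
qed

text \<open>In a chart the tangent lift of \<open>\<xi>\<close> has coordinates
  \<open>(q, \<xi>, q', \<xi>')\<close>. The flip exchanges the two middle entries, so the
  differential is taken at \<open>(q, q')\<close> in the direction
  \<open>(\<xi>, \<xi>')\<close>.\<close>

lemma differential_admissible_variation: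
  assumes A: "smooth_atlas A" and I: "thick I" and q: "smooth_curve A I q" and g: "generator A I q \<xi>"
    and t: "t \<in> I" and c: "c \<in> charts_at A (q t)"
    and F: "((f \<circ> inv_chart (tangent_chart A c)) has_derivative F) (at (snd c (q t), velocity A I q t c))"
  shows "differential (tangent_bundle A) f (admissible_variation A I q \<xi> t)
    = F (\<xi> t c, vector_derivative (\<lambda>s. \<xi> s c) (at t within I))"
proof -
  let ?T = "tangent_chart A" and ?B = "tangent_bundle A"
  let ?w = "velocity ?B I (\<lambda>s. (q s, \<xi> s)) t"
  note B = smooth_atlas_tangent_bundle[OF A]
  note \<xi> = generator_in[OF g t]
  note Tc = tangent_chart_charts_at[OF c \<xi>]
  have "((\<lambda>s. (snd c (q s), \<xi> s c)) has_vector_derivative ?w (?T c)) (at t within I)"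
    using velocity_chart[OF generator_curve[OF g] B I t Tc] by (simp add: tangent_chart_apply)
  moreover have "((\<lambda>s. (snd c (q s), \<xi> s c)) has_vector_derivative
      (velocity A I q t c, vector_derivative (\<lambda>s. \<xi> s c) (at t within I))) (at t within I)"
    by (rule has_vector_derivative_Pair[OF velocity_chart[OF q A I t c] generator_has_vector_derivative[OF A I q g t c]])
  ultimately have w: "?w (?T c) = (velocity A I q t c, vector_derivative (\<lambda>s. \<xi> s c) (at t within I))"
    using vector_derivative_unique_within[OF trivial_limit_thick[OF I t]] by blast
  have v': "tvec_of A c (q t) (fst (?w (?T c))) = velocity A I q t"
    unfolding w fst_conv by (rule tvec_of_chart[OF A c velocity_in[OF q A I t]])
  obtain w' where w': "canonical_flip A ((q t, \<xi> t), ?w) = ((q t, velocity A I q t), w')"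
    "w' \<in> tangent_space ?B (q t, velocity A I q t)" "w' (?T c) = (\<xi> t c, snd (?w (?T c)))"
    using canonical_flip_eq[OF A c \<xi> velocity_in[OF generator_curve[OF g] B I t]] unfolding v' by blast
  have "differential ?B f ((q t, velocity A I q t), w') = F (w' (?T c))"
    by (rule differential_eq[OF B tangent_chart_charts_at[OF c velocity_in[OF q A I t]] w'(2)])
       (simp only: tangent_chart_apply F)
  then show ?thesis
    unfolding admissible_variation_def tangent_lift_def w'(1) w'(3) w snd_conv .
qed

section \<open>Vector fields\<close>

text \<open>A chartwise form of \<open>smooth_vector_field\<close> that avoids maps into the tangent
  bundle; lifted and fundamental fields are verified in this form.\<close>

definition smooth_field :: "('a, 'e::fin_dim_inner) atlas \<Rightarrow> ('a \<Rightarrow> ('a, 'e) tvec) \<Rightarrow> bool"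
  where "smooth_field A X \<longleftrightarrow> (\<forall>x\<in>points A. X x \<in> tangent_space A x) \<and>
    (\<forall>c\<in>A. smooth_on (snd c ` fst c) (\<lambda>u. X (inv_chart c u) c))"

lemma smooth_fieldD:
  assumes "smooth_field A X"
  shows "x \<in> points A \<Longrightarrow> X x \<in> tangent_space A x"
    and "c \<in> A \<Longrightarrow> smooth_on (snd c ` fst c) (\<lambda>u. X (inv_chart c u) c)"
  using assms by (simp_all add: smooth_field_def)

lemma smooth_vector_field_imp_smooth_field:
  assumes X: "smooth_vector_field A X"
  shows "smooth_field A X"
proof -
  have X_in: "X x \<in> tangent_space A x" if "x \<in> points A" for x using X that by (simp add: smooth_vector_field_def)
  have "smooth_on (snd c ` fst c) (\<lambda>u. X (inv_chart c u) c)" if c: "c \<in> A" for c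
  proof -
    have sm: "smooth_map A (tangent_bundle A) (\<lambda>x. (x, X x))" using X by (simp add: smooth_vector_field_def)
    have Tc: "tangent_chart A c \<in> tangent_bundle A" using c by (simp add: tangent_bundle_def)
    have "fst c \<subseteq> points A" using c by (auto simp: points_def)
    then have "fst c \<inter> (\<lambda>x. (x, X x)) -` fst (tangent_chart A c) = fst c"
      using X_in by (auto simp: mem_tangent_chart)
    then show ?thesis
      using smooth_on_snd[OF smooth_on_coordinate_map[OF sm c Tc]] by (simp add: tangent_chart_apply o_def)
  qed
  then show ?thesis using X_in by (simp add: smooth_field_def)
qed

text \<open>Differentiating the transformation rule \<open>X d = D\<phi> (X c)\<close> produces a
  second derivative of the transition. It prevents the derivative of one field from being a tensor,
  and it cancels in the bracket.\<close>

lemma field_derivative_transform: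
  assumes A: "smooth_atlas A" and X: "smooth_field A X" and c: "c \<in> charts_at A x" and d: "d \<in> charts_at A x"
  shows "frechet_derivative (\<lambda>u. X (inv_chart d u) d) (at (snd d x)) (trD c d x h) =
    frechet_derivative (\<lambda>y. frechet_derivative (snd d \<circ> inv_chart c) (at y) (X x c)) (at (snd c x)) h
    + trD c d x (frechet_derivative (\<lambda>u. X (inv_chart c u) c) (at (snd c x)) h)"
proof -
  have cd: "c \<in> A" "x \<in> fst c" "d \<in> A" "x \<in> fst d" using c d by (simp_all add: mem_charts_at)
  let ?S = "snd c ` (fst c \<inter> fst d)" and ?\<phi> = "snd d \<circ> inv_chart c"
  have o: "open ?S" by (rule open_transition_domain[OF A cd(1,3)])
  note s = smooth_on_transition[OF A cd(1,3)]
  have xS: "snd c x \<in> ?S" using cd by blast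
  have dX: "((\<lambda>u. X (inv_chart e u) e) has_derivative frechet_derivative (\<lambda>u. X (inv_chart e u) e) (at (snd e x))) (at (snd e x))"
    if "e \<in> charts_at A x" for e
    by (rule smooth_on_has_derivative_open[OF smooth_fieldD(2)[OF X] open_chart_image[OF A]])
       (use that in \<open>auto simp: mem_charts_at\<close>)
  have \<phi>x: "?\<phi> (snd c x) = snd d x" by (simp add: inv_chart_chart[OF A cd(1,2)])
  have "((\<lambda>u. X (inv_chart d (?\<phi> u)) d) has_derivative
     (\<lambda>h. frechet_derivative (\<lambda>u. X (inv_chart d u) d) (at (snd d x)) (trD c d x h))) (at (snd c x))"
    by (rule has_derivative_compose[OF has_derivative_transition[OF A c d], where g="\<lambda>u. X (inv_chart d u) d"])
       (simp only: \<phi>x dX[OF d])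
  moreover have "((\<lambda>u. X (inv_chart d (?\<phi> u)) d) has_derivative (\<lambda>h.
     frechet_derivative (\<lambda>y. frechet_derivative ?\<phi> (at y) (X (inv_chart c (snd c x)) c)) (at (snd c x)) h
     + trD c d x (frechet_derivative (\<lambda>u. X (inv_chart c u) c) (at (snd c x)) h))) (at (snd c x))"
  proof (rule has_derivative_transform_within_open[OF _ o xS])
    have "((\<lambda>u. frechet_derivative ?\<phi> (at u) (X (inv_chart c u) c)) has_derivative (\<lambda>h.
       frechet_derivative (\<lambda>y. frechet_derivative ?\<phi> (at y) (X (inv_chart c (snd c x)) c)) (at (snd c x)) h
       + trD c d x (frechet_derivative (\<lambda>u. X (inv_chart c u) c) (at (snd c x)) h))) (at (snd c x) within ?S)"
    proof (rule has_derivative_apply[where f="\<lambda>u. u" and S="?S" and f'="\<lambda>h. h" and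
        A'="\<lambda>u b. frechet_derivative (\<lambda>y. frechet_derivative ?\<phi> (at y) b) (at (snd c x)) u",
        OF thick_open[OF o] linear_frechet_derivative_smooth[OF s o]])
      show "((\<lambda>y. frechet_derivative ?\<phi> (at y) b) has_derivative
         frechet_derivative (\<lambda>y. frechet_derivative ?\<phi> (at y) b) (at (snd c x))) (at (snd c x) within ?S)" for b
        by (rule has_derivative_at_withinI) (rule smooth_on_has_derivative_open[OF smooth_on_frechet_derivative_open[OF s o] o xS])
      show "((\<lambda>u. X (inv_chart c u) c) has_derivative frechet_derivative (\<lambda>u. X (inv_chart c u) c) (at (snd c x))) (at (snd c x) within ?S)"
        by (rule has_derivative_at_withinI[OF dX[OF c]])
    qed (use xS in auto)
    then show "((\<lambda>u. frechet_derivative ?\<phi> (at u) (X (inv_chart c u) c)) has_derivative (\<lambda>h.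
       frechet_derivative (\<lambda>y. frechet_derivative ?\<phi> (at y) (X (inv_chart c (snd c x)) c)) (at (snd c x)) h
       + trD c d x (frechet_derivative (\<lambda>u. X (inv_chart c u) c) (at (snd c x)) h))) (at (snd c x))"
      unfolding at_within_open[OF xS o] .
    fix u assume u: "u \<in> ?S"
    note u' = mem_chart_imageD[OF A cd(1) u]
    have cu: "c \<in> charts_at A (inv_chart c u)" "d \<in> charts_at A (inv_chart c u)"
      using u' inv_chart_in[OF u'(1)] cd by (simp_all add: mem_charts_at)
    have "X (inv_chart c u) d = trD c d (inv_chart c u) (X (inv_chart c u) c)"
      by (rule tangent_spaceD[OF smooth_fieldD(1)[OF X points_charts_at[OF cu(1)]] cu])
    then show "frechet_derivative ?\<phi> (at u) (X (inv_chart c u) c) = X (inv_chart d (?\<phi> u)) d"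
      by (simp add: inv_chart_chart[OF A cd(3) u'(2)] chart_inv_chart[OF u'(1)])
  qed
  ultimately have "(\<lambda>h. frechet_derivative (\<lambda>u. X (inv_chart d u) d) (at (snd d x)) (trD c d x h)) = (\<lambda>h.
     frechet_derivative (\<lambda>y. frechet_derivative ?\<phi> (at y) (X (inv_chart c (snd c x)) c)) (at (snd c x)) h
     + trD c d x (frechet_derivative (\<lambda>u. X (inv_chart c u) c) (at (snd c x)) h))"
    by (rule has_derivative_unique)
  from fun_cong[OF this, of h] show ?thesis by (simp only: inv_chart_chart[OF A cd(1,2)])
qed

lemma lie_bracket_in:
  assumes A: "smooth_atlas A" and X: "smooth_field A X" and Y: "smooth_field A Y"
  shows "lie_bracket A X Y x \<in> tangent_space A x"
proof (rule tangent_spaceI)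
  fix c d assume c: "c \<in> charts_at A x" and d: "d \<in> charts_at A x"
  have cd: "c \<in> A" "x \<in> fst c" "d \<in> A" "x \<in> fst d" using c d by (simp_all add: mem_charts_at)
  note x = points_charts_at[OF c]
  let ?\<phi> = "snd d \<circ> inv_chart c"
  \<comment> \<open>The second-derivative terms contributed by the two fields are equal and cancel
    in the difference.\<close>
  have sym: "frechet_derivative (\<lambda>y. frechet_derivative ?\<phi> (at y) a) (at (snd c x)) b
     = frechet_derivative (\<lambda>y. frechet_derivative ?\<phi> (at y) b) (at (snd c x)) a" for a b
    by (rule second_derivative_symmetric[OF smooth_on_transition[OF A cd(1,3)] open_transition_domain[OF A cd(1,3)]])
       (use cd in blast)
  show "lie_bracket A X Y x d = trD c d x (lie_bracket A X Y x c)"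
    unfolding lie_bracket_def if_P[OF c] if_P[OF d] tangent_spaceD[OF smooth_fieldD(1)[OF X x] c d]
      tangent_spaceD[OF smooth_fieldD(1)[OF Y x] c d] field_derivative_transform[OF A X c d]
      field_derivative_transform[OF A Y c d] linear_diff[OF linear_trD[OF A c d]] sym[of "X x c" "Y x c"]
    by simp
qed (simp add: lie_bracket_def)

section \<open>Extension of a tangent vector to a global vector field\<close>

lemma compact_cball_fin_dim:
  fixes u :: "'a::fin_dim_inner"
  shows "compact (cball u r)"
proof -
  define S where "S B = {\<Sum>b\<in>B. k b *\<^sub>R b |k. \<forall>b\<in>B. \<bar>k b\<bar> \<le> r}" for B :: "'a set"
  have "compact (S B)" if "finite B" for B
    using that
  proof (induction B)
    case empty
    have "S {} = {0}" by (simp add: S_def)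
    then show ?case by simp
  next
    case (insert b B)
    \<comment> \<open>A coordinate box is the Minkowski sum of a segment and a box with one
      direction less, so compactness follows by induction.\<close>
    have "S (insert b B) = {x + y |x y. x \<in> (\<lambda>k. k *\<^sub>R b) ` {-r..r} \<and> y \<in> S B}"
    proof (rule equalityI; rule subsetI)
      fix z assume "z \<in> S (insert b B)"
      then obtain k where k: "\<forall>c\<in>insert b B. \<bar>k c\<bar> \<le> r" "z = (\<Sum>c\<in>insert b B. k c *\<^sub>R c)" by (auto simp: S_def)
      have "z = k b *\<^sub>R b + (\<Sum>c\<in>B. k c *\<^sub>R c)" using k(2) insert by simp
      moreover have "k b *\<^sub>R b \<in> (\<lambda>k. k *\<^sub>R b) ` {-r..r}" using k(1) by (intro imageI) auto
      moreover have "(\<Sum>c\<in>B. k c *\<^sub>R c) \<in> S B" using k(1) by (auto simp: S_def)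
      ultimately show "z \<in> {x + y |x y. x \<in> (\<lambda>k. k *\<^sub>R b) ` {-r..r} \<and> y \<in> S B}" by blast
    next
      fix z assume "z \<in> {x + y |x y. x \<in> (\<lambda>k. k *\<^sub>R b) ` {-r..r} \<and> y \<in> S B}"
      then obtain l k where z: "l \<in> {-r..r}" "\<forall>c\<in>B. \<bar>k c\<bar> \<le> r" "z = l *\<^sub>R b + (\<Sum>c\<in>B. k c *\<^sub>R c)"
        by (auto simp: S_def)
      have "(\<Sum>c\<in>B. k c *\<^sub>R c) = (\<Sum>c\<in>B. (k(b := l)) c *\<^sub>R c)" using insert by (intro sum.cong) auto
      then have "z = (\<Sum>c\<in>insert b B. (k(b := l)) c *\<^sub>R c)" using z insert by simp
      moreover have "\<forall>c\<in>insert b B. \<bar>(k(b := l)) c\<bar> \<le> r" using z by auto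
      ultimately show "z \<in> S (insert b B)" unfolding S_def by blast
    qed
    moreover have "compact ((\<lambda>k. k *\<^sub>R b) ` {-r..r})"
      by (intro compact_continuous_image continuous_intros compact_Icc)
    ultimately show ?case using compact_sums[OF _ insert.IH] by simp
  qed
  then have "compact (S onb)" using finite_onb by blast
  moreover have "cball 0 r \<subseteq> S onb"
  proof
    fix x :: 'a assume "x \<in> cball 0 r"
    then have "\<bar>x \<bullet> b\<bar> \<le> r" if "b \<in> onb" for b
      using Cauchy_Schwarz_ineq2[of x b] norm_onb[OF that] by simp
    then show "x \<in> S onb" unfolding S_def using onb_expand[of x] by (intro CollectI exI[of _ "\<lambda>b. x \<bullet> b"]) auto
  qed
  ultimately have "compact (cball (0::'a) r)" by (metis closed_cball compact_Int_closed inf.absorb_iff2)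
  then have "compact ((+) u ` cball 0 r)" by (rule compact_translation)
  then show ?thesis by (simp add: cball_translation[symmetric])
qed

lemma tvec_of_0:
  assumes A: "smooth_atlas A" and c: "c \<in> charts_at A x"
  shows "tvec_of A c x 0 = 0"
proof
  show "tvec_of A c x 0 d = 0 d" for d
    using linear_0[OF linear_trD[OF A c, of d]] by (cases "d \<in> charts_at A x") (simp_all add: tvec_of_def)
qed

text \<open>A bump function times a constant field in a chart, extended by 0. The definite
  descriptions in \<open>curvature\<close> and \<open>B_map\<close> range over such extensions and
  need at least one.\<close>

lemma vector_field_extension:
  assumes M: "smooth_manifold A" and x: "x \<in> points A" and v: "v \<in> tangent_space A x"
  obtains X where "smooth_vector_field A X" "X x = v"
proof -
  have A: "smooth_atlas A" and haus: "Hausdorff_space (manifold_topology A)"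
    using M by (simp_all add: smooth_manifold_def)
  obtain c where c: "c \<in> charts_at A x" using charts_at_nonempty[OF x] by blast
  have cA: "c \<in> A" "x \<in> fst c" using c by (simp_all add: mem_charts_at)
  obtain r where r: "r > 0" "cball (snd c x) r \<subseteq> snd c ` fst c"
    using open_chart_image[OF A cA(1)] cA(2) open_contains_cball by blast
  obtain \<rho> :: "'b \<Rightarrow> real" where \<rho>: "smooth_on UNIV \<rho>" "\<rho> (snd c x) = 1" "\<And>y. dist (snd c x) y \<ge> r \<Longrightarrow> \<rho> y = 0"
    using bump_function[OF r(1)] by metis
  define X where "X y = (if y \<in> fst c then tvec_of A c y (\<rho> (snd c y) *\<^sub>R v c) else 0)" for y
  define K where "K = inv_chart c ` cball (snd c x) r"
  have ball_in: "inv_chart c u \<in> fst c" if "u \<in> cball (snd c x) r" for u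
    by (rule inv_chart_in[OF subsetD[OF r(2) that]])
  have Ksub: "K \<subseteq> fst c" unfolding K_def by (rule image_subsetI) (rule ball_in)
  have Xin: "X y \<in> tangent_space A y" for y
    unfolding X_def using tvec_of_in[OF A, of c y] tangent_space_0[OF A] cA by (simp add: mem_charts_at)
  have KX: "X y = 0" if "y \<notin> K" for y
  proof (cases "y \<in> fst c")
    case True
    have "snd c y \<notin> cball (snd c x) r"
      using that inv_chart_chart[OF A cA(1) True] unfolding K_def by (metis imageI)
    then have "\<rho> (snd c y) = 0" by (intro \<rho>(3)) simp
    then show ?thesis using True cA(1) by (simp add: X_def tvec_of_0[OF A] mem_charts_at)
  qed (simp add: X_def)
  \<comment> \<open>The field vanishes off the image \<open>K\<close> of a closed ball, which is
    compact and hence closed by the Hausdorff property. This makes the zero extension smooth at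
    points outside the chart domain.\<close>
  have "continuous_map (top_of_set (cball (snd c x) r)) (manifold_topology A) (inv_chart c)"
    unfolding continuous_map topspace_manifold_topology[OF A]
  proof (intro conjI allI impI)
    show "inv_chart c ` topspace (top_of_set (cball (snd c x) r)) \<subseteq> points A"
      using cA(1) Ksub unfolding K_def by (auto simp: points_def)
    fix W assume W: "openin (manifold_topology A) W"
    have "open (snd c ` (W \<inter> fst c))"
      using W[unfolded openin_manifold_topology[OF A]] cA(1) by blast
    moreover have "{u \<in> topspace (top_of_set (cball (snd c x) r)). inv_chart c u \<in> W} = cball (snd c x) r \<inter> snd c ` (W \<inter> fst c)"
    proof -
      have "u \<in> snd c ` (W \<inter> fst c) \<longleftrightarrow> inv_chart c u \<in> W" if "u \<in> cball (snd c x) r" for u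
        using mem_chart_image[OF A cA(1), of u W] subsetD[OF r(2) that] by (simp add: Int_commute)
      then show ?thesis unfolding topspace_euclidean_subtopology by blast
    qed
    ultimately show "openin (top_of_set (cball (snd c x) r)) {u \<in> topspace (top_of_set (cball (snd c x) r)). inv_chart c u \<in> W}"
      by (simp add: openin_open_Int)
  qed
  from image_compactin[OF _ this, of "cball (snd c x) r"]
  have "compactin (manifold_topology A) K"
    unfolding K_def by (simp only: compactin_subtopology compactin_euclidean_iff compact_cball_fin_dim subset_refl simp_thms)
  then have "closedin (manifold_topology A) K" by (rule compactin_imp_closedin[OF haus])
  from openin_diff[OF openin_topspace this] have oK: "openin (manifold_topology A) (points A - K)"
    unfolding topspace_manifold_topology[OF A] .
  have "smooth_map A (tangent_bundle A) (\<lambda>x. (x, X x))"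
  proof (rule smooth_mapI[OF A smooth_atlas_tangent_bundle[OF A]])
    fix y assume y: "y \<in> points A"
    show "\<exists>d\<in>charts_at A y. \<exists>C\<in>tangent_bundle A. \<exists>V. open V \<and> snd d y \<in> V \<and> V \<subseteq> snd d ` fst d \<and>
      (\<forall>u\<in>V. (inv_chart d u, X (inv_chart d u)) \<in> fst C) \<and> smooth_on V (snd C \<circ> (\<lambda>x. (x, X x)) \<circ> inv_chart d)"
    proof (cases "y \<in> fst c")
      case True
      let ?V = "snd c ` fst c"
      have "smooth_on ?V (\<lambda>u. (u, \<rho> u *\<^sub>R v c))"
        by (intro smooth_on_Pair smooth_on_id smooth_on_scaleR smooth_on_const smooth_on_subset[OF \<rho>(1)]) simp
      then have "smooth_on ?V (snd (tangent_chart A c) \<circ> (\<lambda>x. (x, X x)) \<circ> inv_chart c)"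
      proof (rule smooth_on_eq)
        fix u assume u: "u \<in> ?V"
        have "c \<in> charts_at A (inv_chart c u)" using cA inv_chart_in[OF u] by (simp add: mem_charts_at)
        then show "(snd (tangent_chart A c) \<circ> (\<lambda>x. (x, X x)) \<circ> inv_chart c) u = (u, \<rho> u *\<^sub>R v c)"
          using inv_chart_in[OF u]
          by (simp add: tangent_chart_apply chart_inv_chart[OF u] X_def tvec_of_same[OF A])
      qed
      moreover have "\<forall>u\<in>?V. (inv_chart c u, X (inv_chart c u)) \<in> fst (tangent_chart A c)"
        using Xin inv_chart_in[of _ c] by (simp add: mem_tangent_chart)
      moreover have "tangent_chart A c \<in> tangent_bundle A" "c \<in> charts_at A y" "snd c y \<in> ?V"
        using cA True by (simp_all add: tangent_bundle_def mem_charts_at)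
      ultimately show ?thesis using open_chart_image[OF A cA(1)] by blast
    next
      case False
      obtain d where d: "d \<in> charts_at A y" using charts_at_nonempty[OF y] by blast
      have dA: "d \<in> A" "y \<in> fst d" using d by (simp_all add: mem_charts_at)
      let ?V = "snd d ` ((points A - K) \<inter> fst d)"
      have oV: "open ?V" using oK[unfolded openin_manifold_topology[OF A]] dA(1) by blast
      have V: "u \<in> snd d ` fst d" "X (inv_chart d u) = 0" if "u \<in> ?V" for u
      proof -
        have u: "u \<in> snd d ` (fst d \<inter> (points A - K))" using that by (simp add: Int_commute)
        note u' = mem_chart_imageD[OF A dA(1) u]
        show "u \<in> snd d ` fst d" by (rule u'(1))
        show "X (inv_chart d u) = 0" by (rule KX) (use u'(2) in simp)
      qed
      have "smooth_on ?V (\<lambda>u. (u, 0))" by (intro smooth_on_Pair smooth_on_id smooth_on_const)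
      then have "smooth_on ?V (snd (tangent_chart A d) \<circ> (\<lambda>x. (x, X x)) \<circ> inv_chart d)"
        by (rule smooth_on_eq) (simp add: tangent_chart_apply V(2) chart_inv_chart[OF V(1)])
      moreover have "\<forall>u\<in>?V. (inv_chart d u, X (inv_chart d u)) \<in> fst (tangent_chart A d)"
        using Xin inv_chart_in[OF V(1)] by (simp add: mem_tangent_chart)
      moreover have "tangent_chart A d \<in> tangent_bundle A" using dA by (simp add: tangent_bundle_def)
      moreover have "snd d y \<in> ?V" using y dA False Ksub by blast
      moreover have "?V \<subseteq> snd d ` fst d" by blast
      ultimately show ?thesis using oV d by blast
    qed
  qed
  then have "smooth_vector_field A X" using Xin by (simp add: smooth_vector_field_def)
  moreover have "X x = v" using cA \<rho>(2) tvec_of_chart[OF A c v] by (simp add: X_def)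
  ultimately show thesis by (rule that)
qed

section \<open>Products and open submanifolds\<close>

abbreviation prod_chart :: "('a, 'e) chart \<Rightarrow> ('b, 'f) chart \<Rightarrow> ('a \<times> 'b, 'e \<times> 'f) chart"
  where "prod_chart c d \<equiv> (fst c \<times> fst d, map_prod (snd c) (snd d))"

lemma prod_chart_in: "c \<in> A \<Longrightarrow> d \<in> B \<Longrightarrow> prod_chart c d \<in> prod_manifold A B"
  unfolding prod_manifold_def by (rule image_eqI[of _ _ "(c, d)"]) auto

lemma prod_manifoldE:
  assumes "C \<in> prod_manifold A B"
  obtains c d where "c \<in> A" "d \<in> B" "C = prod_chart c d"
  using assms unfolding prod_manifold_def by auto

lemma inv_chart_prod:
  assumes "smooth_atlas A" "smooth_atlas B" "c \<in> A" "d \<in> B" "y \<in> snd c ` fst c" "z \<in> snd d ` fst d"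
  shows "inv_chart (prod_chart c d) (y, z) = (inv_chart c y, inv_chart d z)"
proof (rule inv_chart_eqI)
  show "inj_on (snd (prod_chart c d)) (fst (prod_chart c d))"
    using map_prod_inj_on[OF inj_on_chart[OF assms(1,3)] inj_on_chart[OF assms(2,4)]] by simp
qed (use inv_chart_in[OF assms(5)] inv_chart_in[OF assms(6)] chart_inv_chart[OF assms(5)]
      chart_inv_chart[OF assms(6)] in simp_all)

lemma smooth_atlas_prod_manifold:
  assumes A: "smooth_atlas A" and B: "smooth_atlas B"
  shows "smooth_atlas (prod_manifold A B)"
proof -
  have 1: "inj_on (snd C) (fst C) \<and> open (snd C ` fst C)" if C: "C \<in> prod_manifold A B" for C
  proof -
    obtain c d where cd: "c \<in> A" "d \<in> B" "C = prod_chart c d" using prod_manifoldE[OF C] .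
    have "snd C ` fst C = (snd c ` fst c) \<times> (snd d ` fst d)" unfolding cd(3) by auto
    then show ?thesis
      using map_prod_inj_on[OF inj_on_chart[OF A cd(1)] inj_on_chart[OF B cd(2)]]
        open_chart_image[OF A cd(1)] open_chart_image[OF B cd(2)]
      by (simp add: cd(3) open_Times)
  qed
  have 2: "open (snd C ` (fst C \<inter> fst D)) \<and> smooth_on (snd C ` (fst C \<inter> fst D)) (snd D \<circ> inv_chart C)"
    if C: "C \<in> prod_manifold A B" and D: "D \<in> prod_manifold A B" for C D
  proof -
    obtain c d where cd: "c \<in> A" "d \<in> B" "C = prod_chart c d" using prod_manifoldE[OF C] .
    obtain c' d' where cd': "c' \<in> A" "d' \<in> B" "D = prod_chart c' d'" using prod_manifoldE[OF D] .
    let ?S = "snd c ` (fst c \<inter> fst c')" and ?T = "snd d ` (fst d \<inter> fst d')"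
    have eq: "snd C ` (fst C \<inter> fst D) = ?S \<times> ?T" unfolding cd cd' by auto
    have f: "smooth_on (?S \<times> ?T) (\<lambda>p. fst p)" "smooth_on (?S \<times> ?T) (\<lambda>p. snd p)"
      by (rule smooth_on_fst[OF smooth_on_id], rule smooth_on_snd[OF smooth_on_id])
    have "smooth_on (?S \<times> ?T) (\<lambda>p. ((snd c' \<circ> inv_chart c) (fst p), (snd d' \<circ> inv_chart d) (snd p)))"
      by (rule smooth_on_Pair[OF smooth_on_compose[OF smooth_on_transition[OF A cd(1) cd'(1)] f(1)]
          smooth_on_compose[OF smooth_on_transition[OF B cd(2) cd'(2)] f(2)]]) auto
    then have "smooth_on (?S \<times> ?T) (snd D \<circ> inv_chart C)"
    proof (rule smooth_on_eq)
      fix p :: "'b \<times> 'd" assume "p \<in> ?S \<times> ?T"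
      then obtain y z where p: "p = (y, z)" "y \<in> snd c ` fst c" "z \<in> snd d ` fst d" by auto
      show "(snd D \<circ> inv_chart C) p = ((snd c' \<circ> inv_chart c) (fst p), (snd d' \<circ> inv_chart d) (snd p))"
        unfolding o_apply cd(3) p(1) inv_chart_prod[OF A B cd(1,2) p(2,3)] by (simp add: cd'(3))
    qed
    then show ?thesis
      unfolding eq using open_Times[OF open_transition_domain[OF A cd(1) cd'(1)] open_transition_domain[OF B cd(2) cd'(2)]] by blast
  qed
  show ?thesis unfolding smooth_atlas_def using 1 2 by blast
qed

abbreviation restrict_chart :: "'a set \<Rightarrow> ('a, 'e) chart \<Rightarrow> ('a, 'e) chart"
  where "restrict_chart U c \<equiv> (fst c \<inter> U, snd c)"

lemma inv_restrict_chart: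
  assumes "smooth_atlas A" "c \<in> A" "y \<in> snd c ` (fst c \<inter> U)"
  shows "inv_chart (restrict_chart U c) y = inv_chart c y"
proof (rule inv_chart_eqI)
  note y = mem_chart_imageD[OF assms]
  show "inj_on (snd (restrict_chart U c)) (fst (restrict_chart U c))"
    using inj_on_subset[OF inj_on_chart[OF assms(1,2)], of "fst c \<inter> U"] by simp
  show "inv_chart c y \<in> fst (restrict_chart U c)" "snd (restrict_chart U c) (inv_chart c y) = y"
    using inv_chart_in[OF y(1)] y(2) chart_inv_chart[OF y(1)] by simp_all
qed

lemma restrict_chart_in: "c \<in> A \<Longrightarrow> restrict_chart U c \<in> open_submanifold A U"
  by (simp add: open_submanifold_def)

lemma smooth_atlas_open_submanifold:
  assumes A: "smooth_atlas A" and U: "\<And>c. c \<in> A \<Longrightarrow> open (snd c ` (fst c \<inter> U))"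
  shows "smooth_atlas (open_submanifold A U)"
proof -
  have 1: "inj_on (snd c) (fst c \<inter> U)" if "c \<in> A" for c
    using inj_on_subset[OF inj_on_chart[OF A that], of "fst c \<inter> U"] by simp
  have 2: "open (snd c ` (fst c \<inter> U \<inter> (fst d \<inter> U))) \<and>
     smooth_on (snd c ` (fst c \<inter> U \<inter> (fst d \<inter> U))) (snd d \<circ> inv_chart (restrict_chart U c))"
    if c: "c \<in> A" and d: "d \<in> A" for c d
  proof -
    have eq: "snd c ` (fst c \<inter> U \<inter> (fst d \<inter> U)) = snd c ` (fst c \<inter> fst d) \<inter> snd c ` (fst c \<inter> U)"
      using inj_on_chart[OF A c] by (auto simp: inj_on_def)
    have "smooth_on (snd c ` (fst c \<inter> U \<inter> (fst d \<inter> U))) (snd d \<circ> inv_chart c)"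
      by (rule smooth_on_subset[OF smooth_on_transition[OF A c d]]) blast
    then have "smooth_on (snd c ` (fst c \<inter> U \<inter> (fst d \<inter> U))) (snd d \<circ> inv_chart (restrict_chart U c))"
    proof (rule smooth_on_eq)
      fix y assume "y \<in> snd c ` (fst c \<inter> U \<inter> (fst d \<inter> U))"
      then have "y \<in> snd c ` (fst c \<inter> U)" by blast
      from inv_restrict_chart[OF A c this]
      show "(snd d \<circ> inv_chart (restrict_chart U c)) y = (snd d \<circ> inv_chart c) y" by simp
    qed
    moreover have "open (snd c ` (fst c \<inter> U \<inter> (fst d \<inter> U)))"
      unfolding eq by (intro open_Int open_transition_domain[OF A c d] U c)
    ultimately show ?thesis by blast
  qed
  show ?thesis unfolding smooth_atlas_def open_submanifold_def ball_simps fst_conv snd_conv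
    using 1 2 U by blast
qed

section \<open>Lie group actions\<close>

text \<open>The group laws are used through the map \<open>actc\<close>, the action read in a chart \<open>c\<close> of the
  manifold and a fixed chart \<open>c0\<close> at the unit; \<open>Z c y k\<close> is the value at \<open>y\<close> of the
  infinitesimal generator with initial velocity \<open>k\<close>.  A Lie group acting on itself is the
  instance in which the generators are the left-invariant vector fields.\<close>

locale lie_action =
  fixes G :: "'g monoid" (structure) and A :: "('g, 'k::fin_dim_inner) atlas"
    and B :: "('q, 'e::fin_dim_inner) atlas" and act :: "'q \<Rightarrow> 'g \<Rightarrow> 'q"
  assumes lie: "lie_group G A" and B: "smooth_atlas B"
    and smooth_act: "smooth_map (prod_manifold B A) B (\<lambda>(q, g). act q g)"
    and act_one: "\<And>q. q \<in> points B \<Longrightarrow> act q \<one> = q"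
    and act_assoc: "\<And>q g h. q \<in> points B \<Longrightarrow> g \<in> carrier G \<Longrightarrow> h \<in> carrier G \<Longrightarrow> act (act q g) h = act q (g \<otimes> h)"
begin

lemma group: "group G" and A: "smooth_atlas A" and carrier: "carrier G = points A"
  and smooth_mult: "smooth_map (prod_manifold A A) A (\<lambda>(g, h). g \<otimes> h)"
  using lie by (simp_all add: lie_group_def smooth_manifold_def)

lemma self_action: "lie_action G A A (\<otimes>)"
proof -
  interpret group G by (rule group)
  show ?thesis
    by (unfold_locales; (rule lie A smooth_mult)?) (simp_all add: carrier[symmetric] m_assoc)
qed

abbreviation "c0 \<equiv> chart_at A \<one>"
abbreviation "u0 \<equiv> snd c0 \<one>"

lemma one_in: "\<one> \<in> points A"
  using group.is_monoid[OF group] monoid.one_closed carrier by metis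

lemma c0: "c0 \<in> charts_at A \<one>"
proof -
  obtain c where "c \<in> charts_at A \<one>" using charts_at_nonempty[OF one_in] by blast
  then show ?thesis by (rule chart_at_in)
qed

lemma c0_in: "c0 \<in> A" "\<one> \<in> fst c0"
  using c0 by (simp_all add: mem_charts_at)

lemma u0_in: "u0 \<in> snd c0 ` fst c0"
  using c0_in by blast

lemma c0_carrier: "g \<in> fst c0 \<Longrightarrow> g \<in> carrier G"
  using c0_in(1) by (auto simp: carrier points_def)

lemma chart_points: "c \<in> B \<Longrightarrow> q \<in> fst c \<Longrightarrow> q \<in> points B"
  by (auto simp: points_def)

definition actc :: "('q, 'e) chart \<Rightarrow> 'e \<times> 'k \<Rightarrow> 'e"
  where "actc c p = snd c (act (inv_chart c (fst p)) (inv_chart c0 (snd p)))"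

definition Dom :: "('q, 'e) chart \<Rightarrow> ('e \<times> 'k) set"
  where "Dom c = {p. fst p \<in> snd c ` fst c \<and> snd p \<in> snd c0 ` fst c0 \<and>
    act (inv_chart c (fst p)) (inv_chart c0 (snd p)) \<in> fst c}"

lemma Dom_eq:
  assumes c: "c \<in> B"
  shows "Dom c = snd (prod_chart c c0) ` (fst (prod_chart c c0) \<inter> (\<lambda>(q, g). act q g) -` fst c)"
proof (rule equalityI; rule subsetI)
  fix p assume p: "p \<in> Dom c"
  show "p \<in> snd (prod_chart c c0) ` (fst (prod_chart c c0) \<inter> (\<lambda>(q, g). act q g) -` fst c)"
    by (rule image_eqI[of _ _ "(inv_chart c (fst p), inv_chart c0 (snd p))"])
       (use p in \<open>simp_all add: Dom_def chart_inv_chart inv_chart_in\<close>)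
next
  fix p assume "p \<in> snd (prod_chart c c0) ` (fst (prod_chart c c0) \<inter> (\<lambda>(q, g). act q g) -` fst c)"
  then obtain q g where "q \<in> fst c" "g \<in> fst c0" "act q g \<in> fst c" "p = (snd c q, snd c0 g)" by auto
  then show "p \<in> Dom c" by (simp add: Dom_def inv_chart_chart[OF B c] inv_chart_chart[OF A c0_in(1)])
qed

lemma open_Dom: "c \<in> B \<Longrightarrow> open (Dom c)"
  unfolding Dom_eq
  by (rule open_smooth_map_domain[OF smooth_act smooth_atlas_prod_manifold[OF B A] B prod_chart_in[OF _ c0_in(1)]])

lemma smooth_actc:
  assumes c: "c \<in> B"
  shows "smooth_on (Dom c) (actc c)"
proof (rule smooth_on_eq)
  show "smooth_on (Dom c) (snd c \<circ> (\<lambda>(q, g). act q g) \<circ> inv_chart (prod_chart c c0))"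
    unfolding Dom_eq[OF c] by (rule smooth_on_coordinate_map[OF smooth_act prod_chart_in[OF c c0_in(1)] c])
  fix p assume "p \<in> Dom c"
  then have "fst p \<in> snd c ` fst c" "snd p \<in> snd c0 ` fst c0" by (simp_all add: Dom_def)
  from inv_chart_prod[OF B A c c0_in(1) this]
  show "actc c p = (snd c \<circ> (\<lambda>(q, g). act q g) \<circ> inv_chart (prod_chart c c0)) p"
    by (simp add: actc_def)
qed

lemma mem_Dom:
  assumes "c \<in> B" "q \<in> fst c" "g \<in> fst c0"
  shows "(snd c q, snd c0 g) \<in> Dom c \<longleftrightarrow> act q g \<in> fst c" and "actc c (snd c q, snd c0 g) = snd c (act q g)"
  using assms by (simp_all add: Dom_def actc_def inv_chart_chart[OF B] inv_chart_chart[OF A c0_in(1)])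

lemma u0_Dom:
  assumes "c \<in> B" "y \<in> snd c ` fst c"
  shows "(y, u0) \<in> Dom c" "actc c (y, u0) = y"
proof -
  obtain q where q: "q \<in> fst c" "y = snd c q" using assms by blast
  have "act q \<one> = q" using act_one chart_points assms(1) q by blast
  then show "(y, u0) \<in> Dom c" "actc c (y, u0) = y"
    using mem_Dom[OF assms(1) q(1) c0_in(2)] q by simp_all
qed

lemma actc_in: "p \<in> Dom c \<Longrightarrow> actc c p \<in> snd c ` fst c"
  by (simp add: Dom_def actc_def)

lemma has_derivative_actc:
  assumes c: "c \<in> B" and yu: "(y, u) \<in> Dom c"
  shows "((\<lambda>w. actc c (y, w)) has_derivative (\<lambda>k. frechet_derivative (actc c) (at (y, u)) (0, k))) (at u)"
  by (rule has_derivative_compose[where f="\<lambda>w. (y, w)" and g="actc c",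
        OF has_derivative_Pair[OF has_derivative_const has_derivative_ident]])
     (rule smooth_on_has_derivative_open[OF smooth_actc[OF c] open_Dom[OF c] yu])

definition Z :: "('q, 'e) chart \<Rightarrow> 'e \<Rightarrow> 'k \<Rightarrow> 'e"
  where "Z c y k = frechet_derivative (actc c) (at (y, u0)) (0, k)"

lemma has_derivative_Z:
  "c \<in> B \<Longrightarrow> y \<in> snd c ` fst c \<Longrightarrow> ((\<lambda>w. actc c (y, w)) has_derivative Z c y) (at u0)"
  unfolding Z_def by (rule has_derivative_actc[OF _ u0_Dom(1)])

lemma linear_Z: "c \<in> B \<Longrightarrow> y \<in> snd c ` fst c \<Longrightarrow> linear (Z c y)"
  using has_derivative_linear[OF has_derivative_Z] .

lemma smooth_Z:
  assumes c: "c \<in> B"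
  shows "smooth_on (snd c ` fst c) (\<lambda>y. Z c y k)"
  unfolding Z_def
  by (rule smooth_on_frechet_derivative_apply[OF smooth_actc[OF c] open_Dom[OF c]
      smooth_on_Pair[OF smooth_on_id smooth_on_const] smooth_on_const u0_Dom(1)[OF c]])

end

context lie_action
begin

interpretation self: lie_action G A A "(\<otimes>)" by (rule self_action)

abbreviation "ZG \<equiv> lie_action.Z G A (\<otimes>) c0"

text \<open>Differentiate the associative law \<open>act (act q g) h = act q (g \<otimes> h)\<close>
  in \<open>h\<close> at the unit; on the right the inner derivative is the left-invariant field
  \<open>ZG\<close>.\<close>

lemma Z_equivariant:
  assumes c: "c \<in> B" and yu: "(y, u) \<in> Dom c"
  shows "Z c (actc c (y, u)) k = frechet_derivative (actc c) (at (y, u)) (0, ZG u k)"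
proof -
  let ?N = "(\<lambda>w. (u, w)) -` self.Dom c0 \<inter> (\<lambda>w. (actc c (y, u), w)) -` Dom c"
  have yD: "y \<in> snd c ` fst c" "u \<in> snd c0 ` fst c0" "act (inv_chart c y) (inv_chart c0 u) \<in> fst c"
    using yu by (simp_all add: Dom_def)
  note q = inv_chart_in[OF yD(1)] and g = inv_chart_in[OF yD(2)]
  have "open ?N"
    by (intro open_Int open_vimage self.open_Dom c0_in open_Dom c continuous_intros)
  have u0N: "u0 \<in> ?N"
    using self.u0_Dom(1)[OF c0_in(1) yD(2)] u0_Dom(1)[OF c actc_in[OF yu]] by simp
  have 1: "((\<lambda>w. actc c (actc c (y, u), w)) has_derivative Z c (actc c (y, u))) (at u0)"
    by (rule has_derivative_Z[OF c actc_in[OF yu]])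
  have "((\<lambda>w. actc c (y, self.actc c0 (u, w))) has_derivative
     (\<lambda>k. frechet_derivative (actc c) (at (y, u)) (0, ZG u k))) (at u0)"
    by (rule has_derivative_compose[OF self.has_derivative_Z[OF c0_in(1) yD(2)], where g="\<lambda>w. actc c (y, w)"])
       (unfold self.u0_Dom(2)[OF c0_in(1) yD(2)], rule has_derivative_actc[OF c yu])
  then have 2: "((\<lambda>w. actc c (actc c (y, u), w)) has_derivative
     (\<lambda>k. frechet_derivative (actc c) (at (y, u)) (0, ZG u k))) (at u0)"
  proof (rule has_derivative_transform_within_open[OF _ \<open>open ?N\<close> u0N])
    fix w assume w: "w \<in> ?N"
    have w0: "w \<in> snd c0 ` fst c0" and gh: "inv_chart c0 u \<otimes> inv_chart c0 w \<in> fst c0"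
      using w by (simp_all add: self.Dom_def)
    note h = inv_chart_in[OF w0]
    have "act (act (inv_chart c y) (inv_chart c0 u)) (inv_chart c0 w) =
      act (inv_chart c y) (inv_chart c0 u \<otimes> inv_chart c0 w)"
      by (rule act_assoc[OF chart_points[OF c q] c0_carrier[OF g] c0_carrier[OF h]])
    then show "actc c (y, self.actc c0 (u, w)) = actc c (actc c (y, u), w)"
      by (simp add: actc_def self.actc_def inv_chart_chart[OF A c0_in(1) gh] inv_chart_chart[OF B c yD(3)])
  qed
  from fun_cong[OF has_derivative_unique[OF 1 2]] show ?thesis .
qed

text \<open>Orbit maps carry integral curves of the left-invariant field to integral curves of the
  generator. For the group acting on itself this says that left translates of solutions are
  solutions.\<close>

lemma orbit_derivative:
  assumes c: "c \<in> B" and yu: "(y, u t) \<in> Dom c"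
    and u: "(u has_vector_derivative ZG (u t) k) (at t within I)"
  shows "((\<lambda>t. actc c (y, u t)) has_vector_derivative Z c (actc c (y, u t)) k) (at t within I)"
proof -
  let ?D = "frechet_derivative (actc c) (at (y, u t))"
  have lin: "linear ?D" by (rule linear_frechet_derivative_smooth[OF smooth_actc[OF c] open_Dom[OF c] yu])
  have "((\<lambda>t. actc c (y, u t)) has_derivative (\<lambda>h. ?D (0, h *\<^sub>R ZG (u t) k))) (at t within I)"
    by (rule has_derivative_compose[OF u[unfolded has_vector_derivative_def] has_derivative_actc[OF c yu]])
  moreover have "?D (0, h *\<^sub>R ZG (u t) k) = h *\<^sub>R Z c (actc c (y, u t)) k" for h
    using linear_scale[OF lin, of h "(0, ZG (u t) k)"] by (simp add: Z_equivariant[OF c yu])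
  ultimately show ?thesis by (simp add: has_vector_derivative_def)
qed

end

context lie_action
begin

interpretation self: lie_action G A A "(\<otimes>)" by (rule self_action)

lemma ZG_u0: "ZG u0 k = k"
proof -
  have "((\<lambda>w. self.actc c0 (u0, w)) has_derivative (\<lambda>k. k)) (at u0)"
  proof (rule has_derivative_transform_within_open[OF has_derivative_ident open_chart_image[OF A c0_in(1)] u0_in])
    fix w assume "w \<in> snd c0 ` fst c0"
    then obtain g where g: "g \<in> fst c0" "w = snd c0 g" by blast
    have "\<one> \<otimes> g = g" using group.is_monoid[OF group] c0_carrier[OF g(1)] by (simp add: monoid.l_one)
    then show "w = self.actc c0 (u0, w)" using self.mem_Dom(2)[OF c0_in(1,2) g(1)] g(2) by simp
  qed
  from fun_cong[OF has_derivative_unique[OF self.has_derivative_Z[OF c0_in(1) u0_in] this]]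
  show ?thesis by simp
qed

lemma has_vector_derivative_shift:
  fixes f :: "real \<Rightarrow> 'z::real_normed_vector"
  assumes "(f has_vector_derivative D) (at (s + t))"
  shows "((\<lambda>t. f (s + t)) has_vector_derivative D) (at t)"
proof -
  have "((\<lambda>t. s + t) has_vector_derivative 1) (at t)" by (auto intro!: derivative_eq_intros)
  from vector_diff_chain_at[OF this assms] show ?thesis by (simp add: o_def)
qed

text \<open>For a solution \<open>u\<close> through the unit of the left-invariant equation, the curves
  \<open>u (s + t)\<close> and \<open>u s * u t\<close> solve the same initial value problem in \<open>t\<close>.\<close>

lemma local_subgroup:
  obtains \<delta> u where "\<delta> > 0" "u 0 = u0" "\<And>t. \<bar>t\<bar> \<le> 2 * \<delta> \<Longrightarrow> u t \<in> snd c0 ` fst c0"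
    "\<And>t. \<bar>t\<bar> \<le> 2 * \<delta> \<Longrightarrow> (u has_vector_derivative ZG (u t) k) (at t)"
    "\<And>s t. \<bar>s\<bar> \<le> \<delta> \<Longrightarrow> \<bar>t\<bar> \<le> \<delta> \<Longrightarrow> inv_chart c0 (u (s + t)) = inv_chart c0 (u s) \<otimes> inv_chart c0 (u t)"
proof -
  let ?U = "snd c0 ` fst c0"
  obtain r C M where rC: "r > 0" "C \<ge> 0" "cball u0 r \<subseteq> ?U"
    "\<And>x y. x \<in> cball u0 r \<Longrightarrow> y \<in> cball u0 r \<Longrightarrow> norm (ZG x k - ZG y k) \<le> C * norm (x - y)"
    "\<And>x. x \<in> cball u0 r \<Longrightarrow> norm (ZG x k) \<le> M"
    using smooth_on_lipschitz[OF self.smooth_Z[OF c0_in(1)] open_chart_image[OF A c0_in(1)] u0_in] by blast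
  \<comment> \<open>The two bounds give \<open>C * \<tau> < 1\<close> and
    \<open>M * \<tau> \<le> r\<close>, as \<open>ode_exists\<close> requires.\<close>
  define \<tau> where "\<tau> = min (1 / (C + 1)) (r / (\<bar>M\<bar> + 1))"
  have tau: "\<tau> > 0" using rC by (simp add: \<tau>_def)
  have "C * \<tau> \<le> C * (1 / (C + 1))" using rC(2) by (intro mult_left_mono) (simp_all add: \<tau>_def)
  also have "\<dots> < 1" using rC(2) by (simp add: field_simps)
  finally have C1: "C * \<tau> < 1" .
  have "M * \<tau> \<le> \<bar>M\<bar> * \<tau>" using tau by (intro mult_right_mono) auto
  also have "\<dots> \<le> \<bar>M\<bar> * (r / (\<bar>M\<bar> + 1))" by (intro mult_left_mono) (simp_all add: \<tau>_def)
  also have "\<dots> \<le> r" using rC(1) by (simp add: field_simps)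
  finally have M1: "M * \<tau> \<le> r" .
  obtain u where u: "u 0 = u0" "\<And>t. t \<in> {-\<tau>..\<tau>} \<Longrightarrow> u t \<in> cball u0 r"
    "\<And>t. t \<in> {-\<tau>..\<tau>} \<Longrightarrow> (u has_vector_derivative ZG (u t) k) (at t within {-\<tau>..\<tau>})"
    using ode_exists[OF rC(1,4,5) less_imp_le[OF tau] C1 M1 rC(2)] by blast
  have u': "(u has_vector_derivative ZG (u t) k) (at t)" if "\<bar>t\<bar> < \<tau>" for t
  proof -
    have t: "- \<tau> < t" "t < \<tau>" using that by auto
    show ?thesis using u(3)[of t] t at_within_Icc_at[OF t] by simp
  qed
  \<comment> \<open>Pairs whose product is again in the chart, and moreover in the ball on which the
    Lipschitz estimate holds.\<close>
  let ?N = "self.Dom c0 \<inter> self.actc c0 -` ball u0 r"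
  have "open ?N"
    by (rule continuous_open_preimage[OF smooth_on_imp_continuous_on[OF self.smooth_actc[OF c0_in(1)]]
        self.open_Dom[OF c0_in(1)] open_ball])
  moreover have "(u0, u0) \<in> ?N" using self.u0_Dom[OF c0_in(1) u0_in] rC(1) by simp
  ultimately obtain V W where VW': "open V" "open W" "(u0, u0) \<in> V \<times> W" "V \<times> W \<subseteq> ?N"
    by (rule open_prod_elim)
  then have VW: "open V" "open W" "u0 \<in> V" "u0 \<in> W" "V \<times> W \<subseteq> ?N" by simp_all
  have "isCont u 0" using has_vector_derivative_continuous[OF u'[of 0]] tau by simp
  then have "(u \<longlongrightarrow> u 0) (nhds 0)" by (simp add: isCont_def tendsto_at_iff_tendsto_nhds)
  from topological_tendstoD[OF this open_Int[OF VW(1,2)]]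
  have "\<forall>\<^sub>F t in nhds 0. u t \<in> V \<inter> W" using VW(3,4) u(1) by simp
  then obtain \<eta> where \<eta>: "\<eta> > 0" "\<And>t. dist t 0 < \<eta> \<Longrightarrow> u t \<in> V \<inter> W"
    unfolding eventually_nhds_metric by blast
  \<comment> \<open>\<open>\<delta> < \<eta>\<close> keeps the pairs \<open>(u s, u t)\<close> in
    \<open>?N\<close>, and \<open>2 * \<delta> < \<tau>\<close> keeps \<open>s + t\<close> in the
    interval of existence.\<close>
  define \<delta> where "\<delta> = min (\<eta> / 2) (\<tau> / 4)"
  have d: "\<delta> > 0" "\<delta> < \<eta>" "2 * \<delta> < \<tau>" using \<eta> tau by (auto simp: \<delta>_def min_def)
  show thesis
  proof (rule that[of \<delta> u, OF d(1) u(1)])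
    have U: "u t \<in> ?U" if "\<bar>t\<bar> < \<tau>" for t
      by (rule subsetD[OF rC(3) u(2)]) (use that in auto)
    show "u t \<in> ?U" "(u has_vector_derivative ZG (u t) k) (at t)" if "\<bar>t\<bar> \<le> 2 * \<delta>" for t
      by (rule U, use that d in linarith, rule u', use that d in linarith)
    fix s t assume s: "\<bar>s\<bar> \<le> \<delta>" and t: "\<bar>t\<bar> \<le> \<delta>"
    have N: "(u s, u t) \<in> ?N" if "\<bar>t\<bar> \<le> \<delta>" for t
      using \<eta>(2)[of s] \<eta>(2)[of t] s that d VW(5) by auto
    have "u (s + t) = self.actc c0 (u s, u t)"
    proof (rule ode_unique[where \<tau>="\<delta>" and f="\<lambda>x. ZG x k" and B="cball u0 r" and C=C and u="\<lambda>t. u (s + t)" and v="\<lambda>t. self.actc c0 (u s, u t)"])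
      show "0 \<le> \<delta>" "C \<ge> 0" using d rC by auto
      show "C * \<delta> < 1" using C1 d rC(2) mult_left_mono[of \<delta> \<tau> C] by auto
      show "t \<in> {-\<delta>..\<delta>}" using t by auto
      show "u (s + 0) = self.actc c0 (u s, u 0)"
        using self.u0_Dom(2)[OF c0_in(1) U[of s]] u(1) s d by simp
      fix t assume "t \<in> {-\<delta>..\<delta>}"
      then have t: "\<bar>t\<bar> \<le> \<delta>" by auto
      have st: "\<bar>s + t\<bar> < \<tau>" using s t d by linarith
      show "((\<lambda>t. u (s + t)) has_vector_derivative ZG (u (s + t)) k) (at t within {-\<delta>..\<delta>})"
        by (rule has_vector_derivative_at_within[OF has_vector_derivative_shift[OF u'[OF st]]])
      have tt: "\<bar>t\<bar> < \<tau>" using t d by linarith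
      show "((\<lambda>t. self.actc c0 (u s, u t)) has_vector_derivative ZG (self.actc c0 (u s, u t)) k) (at t within {-\<delta>..\<delta>})"
        by (rule has_vector_derivative_at_within[OF self.orbit_derivative[OF c0_in(1) _ u'[OF tt]]]) (use N[OF t] in blast)
      show "u (s + t) \<in> cball u0 r" by (rule u(2)) (use st in auto)
      show "self.actc c0 (u s, u t) \<in> cball u0 r" using N[OF t] by auto
    qed (rule rC(4))
    moreover have "inv_chart c0 (u s) \<otimes> inv_chart c0 (u t) \<in> fst c0"
      using N[OF t] by (simp add: self.Dom_def)
    ultimately show "inv_chart c0 (u (s + t)) = inv_chart c0 (u s) \<otimes> inv_chart c0 (u t)"
      by (simp add: self.actc_def inv_chart_chart[OF A c0_in(1)])
  qed
qed

section \<open>One-parameter subgroups and the exponential map\<close>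

lemma one_parameter_local:
  assumes th: "one_parameter_subgroup G A \<theta>"
  shows "\<theta> t \<in> carrier G" "\<theta> 0 = \<one>"
    and "\<theta> t \<in> fst c0 \<Longrightarrow> ((\<lambda>t. snd c0 (\<theta> t)) has_vector_derivative ZG (snd c0 (\<theta> t)) (velocity A UNIV \<theta> 0 c0)) (at t)"
    and "open {t. \<theta> t \<in> fst c0}"
proof -
  interpret group G by (rule group)
  have sm: "smooth_curve A UNIV \<theta>" and hom: "\<And>s t. \<theta> (s + t) = \<theta> s \<otimes> \<theta> t"
    using th by (simp_all add: one_parameter_subgroup_def)
  show car: "\<theta> t \<in> carrier G" for t using smooth_curve_points[OF sm A] carrier by simp
  have "\<theta> 0 \<otimes> \<theta> 0 = \<theta> 0" using hom[of 0 0] by simp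
  then show one: "\<theta> 0 = \<one>" using car[of 0] l_cancel_one by blast
  show "open {t. \<theta> t \<in> fst c0}" using smooth_curve_openin[OF sm A c0_in(1)] by simp
  assume t: "\<theta> t \<in> fst c0"
  let ?v = "\<lambda>t. snd c0 (\<theta> t)" and ?a = "velocity A UNIV \<theta> 0 c0"
  have tU: "?v t \<in> snd c0 ` fst c0" using t by blast
  have v0: "(?v has_vector_derivative ?a) (at 0)"
    using velocity_chart[OF sm A thick_UNIV UNIV_I, of c0 0] c0 one by simp
  \<comment> \<open>Differentiating
    \<open>\<theta> (t + h) = \<theta> t \<otimes> \<theta> h\<close> in \<open>h\<close> at 0 shows
    that a one-parameter subgroup solves the left-invariant equation.\<close>
  have "((\<lambda>h. self.actc c0 (?v t, ?v h)) has_derivative (\<lambda>h. ZG (?v t) (h *\<^sub>R ?a))) (at 0)"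
    by (rule has_derivative_compose[OF v0[unfolded has_vector_derivative_def], where g="\<lambda>w. self.actc c0 (?v t, w)"])
       (unfold one, rule self.has_derivative_Z[OF c0_in(1) tU])
  then have "((\<lambda>h. self.actc c0 (?v t, ?v h)) has_vector_derivative ZG (?v t) ?a) (at 0)"
    unfolding has_vector_derivative_def by (simp add: linear_scale[OF self.linear_Z[OF c0_in(1) tU]])
  then have "((\<lambda>h. ?v (t + h)) has_vector_derivative ZG (?v t) ?a) (at 0)"
  proof (rule has_vector_derivative_transform_within_open)
    show "open {h. \<theta> h \<in> fst c0}" by fact
    show "0 \<in> {h. \<theta> h \<in> fst c0}" using one c0_in by simp
    show "self.actc c0 (?v t, ?v h) = ?v (t + h)" if "h \<in> {h. \<theta> h \<in> fst c0}" for h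
      using self.mem_Dom(2)[OF c0_in(1) t, of "\<theta> h"] that by (simp add: hom)
  qed
  then have "((\<lambda>s. ?v (t + (- t + s))) has_vector_derivative ZG (?v t) ?a) (at t)"
    by (intro has_vector_derivative_shift[where f="\<lambda>h. ?v (t + h)"]) simp
  then show "(?v has_vector_derivative ZG (?v t) ?a) (at t)" by simp
qed

lemma hom_pow:
  assumes "\<And>t. \<theta> t \<in> carrier G" "\<And>s t. \<theta> (s + t) = \<theta> s \<otimes> \<theta> (t::real)"
  shows "\<theta> (real n * t) = \<theta> t [^] n"
proof -
  interpret group G by (rule group)
  have "\<theta> 0 \<otimes> \<theta> 0 = \<theta> 0" using assms(2)[of 0 0] by simp
  then have one: "\<theta> 0 = \<one>" using assms(1)[of 0] l_cancel_one by blast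
  show ?thesis
  proof (induction n)
    case 0 then show ?case using one by simp
  next
    case (Suc n)
    have "\<theta> (real (Suc n) * t) = \<theta> (real n * t + t)" by (simp add: algebra_simps)
    then show ?case by (simp add: assms(2) Suc)
  qed
qed

text \<open>Near 0 both subgroups solve the same initial value problem. Elsewhere
  \<open>\<theta> t\<close> is the \<open>n\<close>-th power of \<open>\<theta> (t / n)\<close>,
  with \<open>t / n\<close> near 0.\<close>

lemma one_parameter_unique:
  assumes th1: "one_parameter_subgroup G A \<theta>1" and th2: "one_parameter_subgroup G A \<theta>2"
    and vel: "velocity A UNIV \<theta>1 0 = velocity A UNIV \<theta>2 0"
  shows "\<theta>1 = \<theta>2"
proof -
  note p1 = one_parameter_local[OF th1] and p2 = one_parameter_local[OF th2]
  define k where "k = velocity A UNIV \<theta>1 0 c0"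
  obtain r C M where rC: "r > 0" "C \<ge> 0" "cball u0 r \<subseteq> snd c0 ` fst c0"
    "\<And>x y. x \<in> cball u0 r \<Longrightarrow> y \<in> cball u0 r \<Longrightarrow> norm (ZG x k - ZG y k) \<le> C * norm (x - y)"
    "\<And>x. x \<in> cball u0 r \<Longrightarrow> norm (ZG x k) \<le> M"
    using smooth_on_lipschitz[OF self.smooth_Z[OF c0_in(1)] open_chart_image[OF A c0_in(1)] u0_in] by blast
  have near: "\<exists>\<eta>>0. \<forall>t. \<bar>t\<bar> < \<eta> \<longrightarrow> \<theta> t \<in> fst c0 \<and> snd c0 (\<theta> t) \<in> cball u0 r"
    if th: "one_parameter_subgroup G A \<theta>" for \<theta>
  proof -
    note p = one_parameter_local[OF th]
    have m: "\<theta> 0 \<in> fst c0" using p(2) c0_in by simp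
    have "isCont (\<lambda>t. snd c0 (\<theta> t)) 0" by (rule has_vector_derivative_continuous[OF p(3)[OF m]])
    then obtain e where e: "e > 0" "\<And>t. dist t 0 < e \<Longrightarrow> dist (snd c0 (\<theta> t)) (snd c0 (\<theta> 0)) < r"
      using rC(1) unfolding continuous_at_eps_delta by blast
    obtain e' where e': "e' > 0" "ball 0 e' \<subseteq> {t. \<theta> t \<in> fst c0}"
      using p(4) m open_contains_ball by blast
    show ?thesis
    proof (intro exI[of _ "min e e'"] conjI allI impI)
      show "min e e' > 0" using e e' by simp
      fix t :: real assume t: "\<bar>t\<bar> < min e e'"
      show "\<theta> t \<in> fst c0" using t e'(2) by (auto simp: dist_real_def subset_iff)
      show "snd c0 (\<theta> t) \<in> cball u0 r" using t e(2)[of t] p(2) by (simp add: dist_real_def dist_commute)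
    qed
  qed
  obtain \<eta>1 where e1: "\<eta>1 > 0" "\<And>t. \<bar>t\<bar> < \<eta>1 \<Longrightarrow> \<theta>1 t \<in> fst c0 \<and> snd c0 (\<theta>1 t) \<in> cball u0 r"
    using near[OF th1] by blast
  obtain \<eta>2 where e2: "\<eta>2 > 0" "\<And>t. \<bar>t\<bar> < \<eta>2 \<Longrightarrow> \<theta>2 t \<in> fst c0 \<and> snd c0 (\<theta>2 t) \<in> cball u0 r"
    using near[OF th2] by blast
  define \<tau> where "\<tau> = min (1 / (C + 1)) (min \<eta>1 \<eta>2 / 2)"
  have tau: "\<tau> > 0" "\<tau> < \<eta>1" "\<tau> < \<eta>2" using e1(1) e2(1) rC(2) by (auto simp: \<tau>_def min_def)
  have "C * \<tau> \<le> C * (1 / (C + 1))" using rC(2) by (intro mult_left_mono) (simp_all add: \<tau>_def)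
  also have "\<dots> < 1" using rC(2) by (simp add: field_simps)
  finally have C1: "C * \<tau> < 1" .
  have loc: "\<theta>1 t = \<theta>2 t" if t: "\<bar>t\<bar> \<le> \<tau>" for t
  proof -
    have b: "\<bar>s\<bar> < \<eta>1" "\<bar>s\<bar> < \<eta>2" if "s \<in> {-\<tau>..\<tau>}" for s using that tau by auto
    have "snd c0 (\<theta>1 t) = snd c0 (\<theta>2 t)"
    proof (rule ode_unique[where \<tau>="\<tau>" and f="\<lambda>x. ZG x k" and B="cball u0 r" and C=C and u="\<lambda>t. snd c0 (\<theta>1 t)" and v="\<lambda>t. snd c0 (\<theta>2 t)"])
      show "0 \<le> \<tau>" "C * \<tau> < 1" "0 \<le> C" using tau C1 rC(2) by auto
      show "t \<in> {-\<tau>..\<tau>}" using t by auto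
      show "snd c0 (\<theta>1 0) = snd c0 (\<theta>2 0)" by (simp add: p1(2) p2(2))
      fix s assume s: "s \<in> {-\<tau>..\<tau>}"
      note m1 = e1(2)[OF b(1)[OF s]] and m2 = e2(2)[OF b(2)[OF s]]
      show "((\<lambda>t. snd c0 (\<theta>1 t)) has_vector_derivative ZG (snd c0 (\<theta>1 s)) k) (at s within {-\<tau>..\<tau>})"
        unfolding k_def by (rule has_vector_derivative_at_within[OF p1(3)[OF conjunct1[OF m1]]])
      show "((\<lambda>t. snd c0 (\<theta>2 t)) has_vector_derivative ZG (snd c0 (\<theta>2 s)) k) (at s within {-\<tau>..\<tau>})"
        unfolding k_def vel by (rule has_vector_derivative_at_within[OF p2(3)[OF conjunct1[OF m2]]])
      show "snd c0 (\<theta>1 s) \<in> cball u0 r" "snd c0 (\<theta>2 s) \<in> cball u0 r" using m1 m2 by blast+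
    qed (rule rC(4))
    moreover have "t \<in> {-\<tau>..\<tau>}" using t by auto
    ultimately show ?thesis
      using inj_onD[OF inj_on_chart[OF A c0_in(1)]] e1(2)[OF b(1)] e2(2)[OF b(2)] by blast
  qed
  show ?thesis
  proof
    fix t
    obtain n :: nat where n: "\<bar>t\<bar> / \<tau> < real n" using reals_Archimedean2 by blast
    then have n0: "real n > 0" using tau by (meson divide_nonneg_pos abs_ge_zero le_less_trans)
    have "\<bar>t / real n\<bar> \<le> \<tau>" using n n0 tau by (simp add: field_simps)
    from loc[OF this] have "\<theta>1 (t / real n) [^] n = \<theta>2 (t / real n) [^] n" by simp
    moreover have "\<theta> (real n * (t / real n)) = \<theta> (t / real n) [^] n" if th: "one_parameter_subgroup G A \<theta>" for \<theta>
      using th by (intro hom_pow one_parameter_local(1)[OF th]) (simp add: one_parameter_subgroup_def)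
    ultimately show "\<theta>1 t = \<theta>2 t" using th1 th2 n0 by simp
  qed
qed

text \<open>Smoothness is known near parameter 0 only. The homomorphism property transports it to
  \<open>t1\<close> through \<open>act q (\<theta> s) = act (act q (\<theta> t1)) (\<theta> (s -
  t1))\<close>.\<close>

lemma orbit_smooth_curve:
  assumes car: "\<And>t. \<theta> t \<in> carrier G" and hom: "\<And>s t. \<theta> (s + t) = \<theta> s \<otimes> \<theta> t"
    and d: "\<delta> > 0" and c0\<theta>: "\<And>t. \<bar>t\<bar> < \<delta> \<Longrightarrow> \<theta> t \<in> fst c0"
    and sm: "smooth_on {-\<delta><..<\<delta>} (\<lambda>t. snd c0 (\<theta> t))" and q: "q \<in> points B"
  shows "smooth_curve B UNIV (\<lambda>t. act q (\<theta> t))"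
proof (rule smooth_curveI[OF B thick_UNIV])
  fix t1 :: real
  interpret group G by (rule group)
  let ?q = "act q (\<theta> t1)" and ?v = "\<lambda>t. snd c0 (\<theta> t)"
  have "(q, \<theta> t1) \<in> points (prod_manifold B A)"
  proof -
    obtain c d where "c \<in> charts_at B q" "d \<in> charts_at A (\<theta> t1)"
      using charts_at_nonempty[OF q] charts_at_nonempty[of "\<theta> t1" A] car carrier by blast
    then have "prod_chart c d \<in> prod_manifold B A" "(q, \<theta> t1) \<in> fst (prod_chart c d)"
      by (simp_all add: mem_charts_at prod_chart_in)
    then show ?thesis unfolding points_def by blast
  qed
  from smooth_map_points[OF smooth_act smooth_atlas_prod_manifold[OF B A] B this]
  have "?q \<in> points B" by simp
  from charts_at_nonempty[OF this] obtain c where "c \<in> charts_at B ?q" by blast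
  then have c: "c \<in> B" "?q \<in> fst c" by (simp_all add: mem_charts_at)
  let ?y = "snd c ?q"
  let ?H = "{-\<delta><..<\<delta>} \<inter> (\<lambda>h. (?y, ?v h)) -` Dom c"
  let ?J = "(\<lambda>s. s - t1) -` ?H"
  have "continuous_on {-\<delta><..<\<delta>} (\<lambda>h. (?y, ?v h))"
    by (intro continuous_on_Pair continuous_on_const smooth_on_imp_continuous_on sm)
  then have "open ?H"
    by (rule continuous_open_preimage[OF _ open_greaterThanLessThan open_Dom[OF c(1)]])
  then have oJ: "open ?J" by (rule open_vimage) (intro continuous_intros)
  have \<theta>0: "\<theta> 0 = \<one>"
  proof -
    have "\<theta> 0 \<otimes> \<theta> 0 = \<theta> 0" using hom[of 0 0] by simp
    then show ?thesis using car[of 0] l_cancel_one by blast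
  qed
  have tJ: "t1 \<in> ?J"
    using d u0_Dom(1)[OF c(1), of ?y] c(2) by (simp add: \<theta>0)
  have sh: "act q (\<theta> s) = act ?q (\<theta> (s - t1))" for s
    using act_assoc[OF q car[of t1] car[of "s - t1"]] by (simp add: hom[symmetric])
  have J: "act q (\<theta> s) \<in> fst c \<and> snd c (act q (\<theta> s)) = actc c (?y, ?v (s - t1))" if "s \<in> ?J" for s
  proof -
    have "\<theta> (s - t1) \<in> fst c0" using that c0\<theta>[of "s - t1"] by auto
    note m = mem_Dom[OF c this]
    have "(?y, ?v (s - t1)) \<in> Dom c" using that by simp
    with m(1) have "act ?q (\<theta> (s - t1)) \<in> fst c" by (rule iffD1)
    then show ?thesis unfolding sh[of s] by (rule conjI) (rule m(2)[symmetric])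
  qed
  have "smooth_on ?J (\<lambda>s. actc c (?y, ?v (s - t1)))"
  proof (rule smooth_on_compose[OF smooth_actc[OF c(1)] smooth_on_Pair[OF smooth_on_const smooth_on_compose[OF sm]]])
    show "smooth_on ?J (\<lambda>s. s - t1)" by (rule smooth_on_minus[OF smooth_on_id smooth_on_const])
  qed auto
  then have "smooth_on ?J (snd c \<circ> (\<lambda>t. act q (\<theta> t)))"
    by (rule smooth_on_eq) (unfold o_apply, rule conjunct2[OF J])
  moreover have "openin (top_of_set UNIV) ?J" using oJ by simp
  moreover have "\<forall>s\<in>?J. act q (\<theta> s) \<in> fst c" using J by blast
  ultimately show "\<exists>c\<in>B. \<exists>J. openin (top_of_set UNIV) J \<and> t1 \<in> J \<and> (\<forall>s\<in>J. act q (\<theta> s) \<in> fst c) \<and>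
     smooth_on J (snd c \<circ> (\<lambda>t. act q (\<theta> t)))"
    using c(1) tJ by blast
qed

end

text \<open>The extension at \<open>t\<close> is the \<open>n\<close>-th power of
  \<open>f (t / n)\<close> for large \<open>n\<close>. Two choices \<open>n\<close> and
  \<open>m\<close> agree because both results are powers of the value at the common fraction
  \<open>t / (n * m)\<close>.\<close>

lemma (in group) local_hom_extends:
  fixes f :: "real \<Rightarrow> 'a"
  assumes d: "\<delta> > 0" and car: "\<And>t. \<bar>t\<bar> \<le> \<delta> \<Longrightarrow> f t \<in> carrier G"
    and hom: "\<And>s t. \<bar>s\<bar> \<le> \<delta> \<Longrightarrow> \<bar>t\<bar> \<le> \<delta> \<Longrightarrow> \<bar>s + t\<bar> \<le> \<delta> \<Longrightarrow> f (s + t) = f s \<otimes> f t"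
  obtains \<theta> where "\<And>t. \<theta> t \<in> carrier G" "\<And>s t. \<theta> (s + t) = \<theta> s \<otimes> \<theta> t" "\<And>t. \<bar>t\<bar> \<le> \<delta> \<Longrightarrow> \<theta> t = f t"
proof -
  have f0: "f 0 = \<one>"
  proof -
    have "f 0 \<otimes> f 0 = f 0" using hom[of 0 0] d by simp
    then show ?thesis using car[of 0] d l_cancel_one by simp
  qed
  have pow: "f (real n * a) = f a [^] n" if "\<bar>real n * a\<bar> \<le> \<delta>" for n a
    using that
  proof (induction n)
    case 0 then show ?case using f0 by simp
  next
    case (Suc n)
    have 1: "\<bar>real n * a\<bar> \<le> \<bar>real (Suc n) * a\<bar>" "\<bar>a\<bar> \<le> \<bar>real (Suc n) * a\<bar>"
      by (simp_all add: abs_mult mult_right_mono) (simp add: algebra_simps)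
    have eq: "real n * a + a = real (Suc n) * a" by (simp add: algebra_simps)
    have "f (real n * a + a) = f (real n * a) \<otimes> f a"
      by (rule hom) (use 1 Suc.prems eq in auto)
    then show ?case using Suc.IH 1 Suc.prems eq by simp
  qed
  \<comment> \<open>\<open>Suc\<close> makes the number positive also at \<open>t = 0\<close>; the
    ceiling brings \<open>t / N t\<close> into the interval on which \<open>f\<close> is a local
    homomorphism.\<close>
  define N where "N t = Suc (nat \<lceil>\<bar>t\<bar> / \<delta>\<rceil>)" for t
  define \<theta> where "\<theta> t = f (t / real (N t)) [^] N t" for t
  have small: "\<bar>t / real n\<bar> \<le> \<delta>" if "\<bar>t\<bar> / \<delta> \<le> real n" "n > 0" for t n
    using that d by (simp add: field_simps)
  have N: "\<bar>t\<bar> / \<delta> \<le> real (N t)" "N t > 0" for t unfolding N_def by linarith+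
  have indep: "\<theta> t = f (t / real n) [^] n" if n: "\<bar>t / real n\<bar> \<le> \<delta>" "n > 0" for t n
  proof -
    let ?m = "N t"
    have m: "\<bar>t / real ?m\<bar> \<le> \<delta>" by (rule small[OF N])
    let ?a = "t / (real n * real ?m)"
    have am: "real ?m * ?a = t / real n" "real n * ?a = t / real ?m" using n N(2)[of t] by simp_all
    have "1 * \<bar>?a\<bar> \<le> real n * \<bar>?a\<bar>" by (rule mult_right_mono) (use n(2) in simp_all)
    then have "\<bar>?a\<bar> \<le> \<bar>real n * ?a\<bar>" by (simp only: abs_mult abs_of_nat mult_1)
    then have aC: "f ?a \<in> carrier G" using m am(2) by (intro car) linarith
    have "f (t / real n) [^] n = (f ?a [^] ?m) [^] n" using pow[of ?m ?a] n(1) am by simp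
    also have "\<dots> = (f ?a [^] n) [^] ?m" using aC by (simp add: nat_pow_pow mult.commute)
    also have "\<dots> = f (t / real ?m) [^] ?m" using pow[of n ?a] m am by simp
    finally show ?thesis by (simp add: \<theta>_def)
  qed
  show thesis
  proof (rule that)
    show "\<theta> t \<in> carrier G" for t unfolding \<theta>_def using car[OF small[OF N]] by simp
    show "\<theta> t = f t" if "\<bar>t\<bar> \<le> \<delta>" for t using indep[of t 1] that car[OF that] by simp
    fix s t
    let ?n = "N (\<bar>s\<bar> + \<bar>t\<bar>)"
    have n: "\<bar>s\<bar> / \<delta> \<le> real ?n" "\<bar>t\<bar> / \<delta> \<le> real ?n" "\<bar>s + t\<bar> / \<delta> \<le> real ?n"
      using N(1)[of "\<bar>s\<bar> + \<bar>t\<bar>"] d by (auto elim!: order_trans[rotated] intro!: divide_right_mono)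
    note sm = small[OF n(1) N(2)] small[OF n(2) N(2)] small[OF n(3) N(2)]
    have st: "s / real ?n + t / real ?n = (s + t) / real ?n" by (simp add: add_divide_distrib)
    have h: "f ((s + t) / real ?n) = f (s / real ?n) \<otimes> f (t / real ?n)"
      using hom[OF sm(1,2)] sm(3) st by simp
    \<comment> \<open>Since \<open>s + t = t + s\<close>, the two factors commute, so the power of
      their product splits.\<close>
    have h': "f ((s + t) / real ?n) = f (t / real ?n) \<otimes> f (s / real ?n)"
      using hom[OF sm(2,1)] sm(3) st by (simp add: add.commute)
    have "\<theta> (s + t) = (f (s / real ?n) \<otimes> f (t / real ?n)) [^] ?n"
      using indep[OF sm(3) N(2)] h by simp
    also have "\<dots> = f (s / real ?n) [^] ?n \<otimes> f (t / real ?n) [^] ?n"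
      by (rule pow_mult_distrib) (use h h' car sm in auto)
    also have "\<dots> = \<theta> s \<otimes> \<theta> t" using indep[OF sm(1) N(2)] indep[OF sm(2) N(2)] by simp
    finally show "\<theta> (s + t) = \<theta> s \<otimes> \<theta> t" .
  qed
qed

context lie_action
begin

interpretation self: lie_action G A A "(\<otimes>)" by (rule self_action)

text \<open>The radius \<open>\<delta>\<close> and the smoothness in \<open>c0\<close> are recorded
  because \<open>orbit_smooth_curve\<close> asks for them when the subgroup acts on another
  manifold.\<close>

lemma one_parameter_exists:
  assumes a: "a \<in> tangent_space A \<one>"
  obtains \<theta> \<delta> where "one_parameter_subgroup G A \<theta>" "velocity A UNIV \<theta> 0 = a" "\<delta> > 0"
    "\<And>t. \<bar>t\<bar> < \<delta> \<Longrightarrow> \<theta> t \<in> fst c0" "smooth_on {-\<delta><..<\<delta>} (\<lambda>t. snd c0 (\<theta> t))"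
proof -
  interpret group G by (rule group)
  obtain \<delta> u where u: "\<delta> > 0" "u 0 = u0" "\<And>t. \<bar>t\<bar> \<le> 2 * \<delta> \<Longrightarrow> u t \<in> snd c0 ` fst c0"
    "\<And>t. \<bar>t\<bar> \<le> 2 * \<delta> \<Longrightarrow> (u has_vector_derivative ZG (u t) (a c0)) (at t)"
    "\<And>s t. \<bar>s\<bar> \<le> \<delta> \<Longrightarrow> \<bar>t\<bar> \<le> \<delta> \<Longrightarrow> inv_chart c0 (u (s + t)) = inv_chart c0 (u s) \<otimes> inv_chart c0 (u t)"
    using local_subgroup[of "a c0"] by blast
  have uin: "u t \<in> snd c0 ` fst c0" if "\<bar>t\<bar> \<le> \<delta>" for t using u(1) u(3)[of t] that by simp
  obtain \<theta> where \<theta>: "\<And>t. \<theta> t \<in> carrier G" "\<And>s t. \<theta> (s + t) = \<theta> s \<otimes> \<theta> t"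
    "\<And>t. \<bar>t\<bar> \<le> \<delta> \<Longrightarrow> \<theta> t = inv_chart c0 (u t)"
    using local_hom_extends[OF u(1), of "\<lambda>t. inv_chart c0 (u t)"] c0_carrier[OF inv_chart_in[OF uin]] u(5) by blast
  have c0\<theta>: "\<theta> t \<in> fst c0" "snd c0 (\<theta> t) = u t" if "\<bar>t\<bar> < \<delta>" for t
    using inv_chart_in[OF uin[of t]] chart_inv_chart[OF uin[of t]] \<theta>(3)[of t] that by simp_all
  have "smooth_on {-\<delta><..<\<delta>} u"
  proof (rule smooth_on_ode_solution[OF self.smooth_Z[OF c0_in(1)] thick_open[OF open_greaterThanLessThan]])
    fix t assume "t \<in> {-\<delta><..<\<delta>}"
    then have t: "\<bar>t\<bar> \<le> \<delta>" "\<bar>t\<bar> \<le> 2 * \<delta>" by auto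
    show "u t \<in> snd c0 ` fst c0" by (rule uin[OF t(1)])
    show "(u has_vector_derivative ZG (u t) (a c0)) (at t within {-\<delta><..<\<delta>})"
      by (rule has_vector_derivative_at_within[OF u(4)[OF t(2)]])
  qed
  then have sm: "smooth_on {-\<delta><..<\<delta>} (\<lambda>t. snd c0 (\<theta> t))" by (rule smooth_on_eq) (auto intro: c0\<theta>(2))
  \<comment> \<open>A one-parameter subgroup is its own orbit through the unit, so the orbit lemma
    gives its global smoothness.\<close>
  have "smooth_curve A UNIV (\<lambda>t. \<one> \<otimes> \<theta> t)"
    by (rule self.orbit_smooth_curve[OF \<theta>(1,2) u(1) c0\<theta>(1) sm one_in])
  then have sc: "smooth_curve A UNIV \<theta>" using \<theta>(1) by simp
  then have op: "one_parameter_subgroup G A \<theta>" using \<theta>(2) by (simp add: one_parameter_subgroup_def)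
  note p = one_parameter_local[OF op]
  have "velocity A UNIV \<theta> 0 = a"
  proof (rule tangent_space_eqI[OF _ a c0])
    show "velocity A UNIV \<theta> 0 \<in> tangent_space A \<one>"
      using velocity_in[OF sc A thick_UNIV UNIV_I, of 0] p(2) by simp
    have 1: "((\<lambda>t. snd c0 (\<theta> t)) has_vector_derivative velocity A UNIV \<theta> 0 c0) (at 0)"
      using velocity_chart[OF sc A thick_UNIV UNIV_I, of c0 0] c0 p(2) by simp
    have "(u has_vector_derivative a c0) (at 0)" using u(4)[of 0] u(1,2) by (simp add: ZG_u0)
    then have 2: "((\<lambda>t. snd c0 (\<theta> t)) has_vector_derivative a c0) (at 0)"
      by (rule has_vector_derivative_transform_within_open[of _ _ _ "{-\<delta><..<\<delta>}"])
         (use u(1) in \<open>auto intro: c0\<theta>(2)[symmetric]\<close>)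
    show "velocity A UNIV \<theta> 0 c0 = a c0" by (rule vector_derivative_unique_at[OF 1 2])
  qed
  then show thesis using that[OF op _ u(1) c0\<theta>(1) sm] by blast
qed

text \<open>The curve \<open>s \<mapsto> \<theta> (t * s)\<close> is a subgroup whose initial
  velocity is scaled by \<open>t\<close>. Uniqueness makes the definite description in
  \<open>lie_exp\<close> denote it, and its value at 1 is \<open>\<theta> t\<close>.\<close>

lemma lie_exp_one_parameter:
  assumes th: "one_parameter_subgroup G A \<theta>"
  shows "lie_exp G A (t *\<^sub>R velocity A UNIV \<theta> 0) = \<theta> t"
proof -
  have sc: "smooth_curve A UNIV \<theta>" and hom: "\<And>s t. \<theta> (s + t) = \<theta> s \<otimes> \<theta> t"
    using th by (simp_all add: one_parameter_subgroup_def)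
  note p = one_parameter_local[OF th]
  let ?\<phi> = "\<lambda>s. \<theta> (t * s)"
  have sc': "smooth_curve A UNIV ?\<phi>"
  proof (rule smooth_curveI[OF A thick_UNIV])
    fix s
    obtain d where d: "d \<in> A" "?\<phi> s \<in> fst d"
      using charts_at_nonempty[of "?\<phi> s" A] p(1) carrier by (auto simp: mem_charts_at)
    have o: "open {s. \<theta> s \<in> fst d}" using smooth_curve_openin[OF sc A d(1)] by simp
    let ?J = "(\<lambda>s. t * s) -` {s. \<theta> s \<in> fst d}"
    have "open ?J" by (rule open_vimage[OF o]) (intro continuous_intros)
    moreover have "smooth_on ?J (\<lambda>s. snd d (\<theta> (t * s)))"
      by (rule smooth_on_compose[OF smooth_on_curve_chart[OF sc d(1)]])
         (auto intro: smooth_on_mult smooth_on_const smooth_on_id)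
    ultimately show "\<exists>c\<in>A. \<exists>J. openin (top_of_set UNIV) J \<and> s \<in> J \<and> (\<forall>r\<in>J. ?\<phi> r \<in> fst c) \<and> smooth_on J (snd c \<circ> ?\<phi>)"
      using d by (intro bexI[of _ d] exI[of _ ?J]) (simp_all add: o_def)
  qed
  have op: "one_parameter_subgroup G A ?\<phi>"
    using sc' hom by (simp add: one_parameter_subgroup_def distrib_left)
  have vel: "velocity A UNIV ?\<phi> 0 = t *\<^sub>R velocity A UNIV \<theta> 0"
  proof (rule tangent_space_eqI[OF _ _ c0])
    show "velocity A UNIV ?\<phi> 0 \<in> tangent_space A \<one>"
      using velocity_in[OF sc' A thick_UNIV UNIV_I, of 0] p(2) by simp
    show "t *\<^sub>R velocity A UNIV \<theta> 0 \<in> tangent_space A \<one>"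
      using tangent_space_scaleR[OF A velocity_in[OF sc A thick_UNIV UNIV_I, of 0]] p(2) by simp
    have 1: "((\<lambda>s. snd c0 (?\<phi> s)) has_vector_derivative velocity A UNIV ?\<phi> 0 c0) (at 0)"
      using velocity_chart[OF sc' A thick_UNIV UNIV_I, of c0 0] c0 p(2) by simp
    have v: "((\<lambda>s. snd c0 (\<theta> s)) has_vector_derivative velocity A UNIV \<theta> 0 c0) (at (t * 0))"
      using velocity_chart[OF sc A thick_UNIV UNIV_I, of c0 0] c0 p(2) by simp
    have "((\<lambda>s. t * s) has_vector_derivative t) (at 0)" by (auto intro!: derivative_eq_intros)
    from vector_diff_chain_at[OF this v]
    have 2: "((\<lambda>s. snd c0 (?\<phi> s)) has_vector_derivative t *\<^sub>R velocity A UNIV \<theta> 0 c0) (at 0)" by (simp add: o_def)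
    show "velocity A UNIV ?\<phi> 0 c0 = (t *\<^sub>R velocity A UNIV \<theta> 0) c0"
      unfolding scaleR_fun_apply by (rule vector_derivative_unique_at[OF 1 2])
  qed
  have "(THE \<phi>. one_parameter_subgroup G A \<phi> \<and> velocity A UNIV \<phi> 0 = t *\<^sub>R velocity A UNIV \<theta> 0) = ?\<phi>"
    by (rule the_equality) (use op vel one_parameter_unique in auto)
  then show ?thesis by (simp add: lie_exp_def)
qed

text \<open>Collects what the bundle argument uses about \<open>lie_exp\<close>: smooth orbits whose
  initial velocity is the generator \<open>Z\<close>.\<close>

lemma exp_orbit:
  assumes a: "a \<in> tangent_space A \<one>" and q: "q \<in> points B"
  shows "smooth_curve B UNIV (\<lambda>t. act q (lie_exp G A (t *\<^sub>R a)))"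
    and "lie_exp G A (t *\<^sub>R a) \<in> carrier G" and "act q (lie_exp G A (0 *\<^sub>R a)) = q"
    and "c \<in> charts_at B q \<Longrightarrow> velocity B UNIV (\<lambda>t. act q (lie_exp G A (t *\<^sub>R a))) 0 c = Z c (snd c q) (a c0)"
proof -
  obtain \<theta> \<delta> where \<theta>: "one_parameter_subgroup G A \<theta>" "velocity A UNIV \<theta> 0 = a" "\<delta> > 0"
    "\<And>t. \<bar>t\<bar> < \<delta> \<Longrightarrow> \<theta> t \<in> fst c0" "smooth_on {-\<delta><..<\<delta>} (\<lambda>t. snd c0 (\<theta> t))"
    using one_parameter_exists[OF a] by blast
  note p = one_parameter_local[OF \<theta>(1)]
  have eq: "lie_exp G A (t *\<^sub>R a) = \<theta> t" for t using lie_exp_one_parameter[OF \<theta>(1), of t] \<theta>(2) by simp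
  have hom: "\<And>s t. \<theta> (s + t) = \<theta> s \<otimes> \<theta> t" using \<theta>(1) by (simp add: one_parameter_subgroup_def)
  have sc: "smooth_curve B UNIV (\<lambda>t. act q (\<theta> t))"
    by (rule orbit_smooth_curve[OF p(1) hom \<theta>(3,4,5) q])
  then show "smooth_curve B UNIV (\<lambda>t. act q (lie_exp G A (t *\<^sub>R a)))" by (simp only: eq)
  show "lie_exp G A (t *\<^sub>R a) \<in> carrier G" unfolding eq by (rule p(1))
  have q0: "act q (\<theta> 0) = q" using act_one[OF q] p(2) by simp
  then show "act q (lie_exp G A (0 *\<^sub>R a)) = q" unfolding eq .
  assume c: "c \<in> charts_at B q"
  then have cB: "c \<in> B" "q \<in> fst c" by (simp_all add: mem_charts_at)
  have y: "snd c q \<in> snd c ` fst c" using cB by blast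
  let ?v = "\<lambda>t. snd c0 (\<theta> t)"
  have m: "\<theta> 0 \<in> fst c0" using p(2) c0_in by simp
  have v0: "(?v has_vector_derivative a c0) (at 0)" using p(3)[OF m] p(2) \<theta>(2) by (simp add: ZG_u0)
  have "((\<lambda>t. actc c (snd c q, ?v t)) has_derivative (\<lambda>h. Z c (snd c q) (h *\<^sub>R a c0))) (at 0)"
    by (rule has_derivative_compose[OF v0[unfolded has_vector_derivative_def], where g="\<lambda>w. actc c (snd c q, w)"])
       (unfold p(2), rule has_derivative_Z[OF cB(1) y])
  then have "((\<lambda>t. actc c (snd c q, ?v t)) has_vector_derivative Z c (snd c q) (a c0)) (at 0)"
    unfolding has_vector_derivative_def by (simp add: linear_scale[OF linear_Z[OF cB(1) y]])
  then have 1: "((\<lambda>t. snd c (act q (\<theta> t))) has_vector_derivative Z c (snd c q) (a c0)) (at 0)"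
    by (rule has_vector_derivative_transform_within_open[OF _ p(4)])
       (use m mem_Dom(2)[OF cB] in auto)
  have 2: "((\<lambda>t. snd c (act q (\<theta> t))) has_vector_derivative velocity B UNIV (\<lambda>t. act q (\<theta> t)) 0 c) (at 0)"
    using velocity_chart[OF sc B thick_UNIV UNIV_I, of c 0] c q0 by simp
  show "velocity B UNIV (\<lambda>t. act q (lie_exp G A (t *\<^sub>R a))) 0 c = Z c (snd c q) (a c0)"
    unfolding eq by (rule vector_derivative_unique_at[OF 2 1])
qed

end

section \<open>Principal bundles in coordinates\<close>

text \<open>The chain rule for a left inverse, read in coordinates. Applied to trivializations and
  to left translations it shows that their Jacobians are invertible.\<close>

lemma coordinate_derivative_inverse:
  assumes f: "smooth_map A B f" and f': "smooth_map B A f'" and A: "smooth_atlas A" and B: "smooth_atlas B"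
    and inv: "\<And>z. z \<in> points A \<Longrightarrow> f' (f z) = z"
    and c: "c \<in> charts_at A x" and d: "d \<in> charts_at B (f x)"
  shows "frechet_derivative (snd c \<circ> f' \<circ> inv_chart d) (at (snd d (f x)))
    (frechet_derivative (snd d \<circ> f \<circ> inv_chart c) (at (snd c x)) v) = v"
proof -
  have cd: "c \<in> A" "x \<in> fst c" "d \<in> B" "f x \<in> fst d" using c d by (simp_all add: mem_charts_at)
  let ?S = "snd c ` (fst c \<inter> f -` fst d)"
  have o: "open ?S" by (rule open_smooth_map_domain[OF f A B cd(1,3)])
  have xS: "snd c x \<in> ?S" by (rule imageI) (use cd in simp)
  have fx: "(snd d \<circ> f \<circ> inv_chart c) (snd c x) = snd d (f x)" by (simp add: inv_chart_chart[OF A cd(1,2)])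
  have c': "c \<in> charts_at A (f' (f x))" using c inv[OF points_charts_at[OF c]] by simp
  have "((\<lambda>y. (snd c \<circ> f' \<circ> inv_chart d) ((snd d \<circ> f \<circ> inv_chart c) y)) has_derivative
     (\<lambda>v. frechet_derivative (snd c \<circ> f' \<circ> inv_chart d) (at (snd d (f x)))
       (frechet_derivative (snd d \<circ> f \<circ> inv_chart c) (at (snd c x)) v))) (at (snd c x))"
    by (rule has_derivative_compose[OF has_derivative_coordinate_map[OF f A B c d]])
       (unfold fx, rule has_derivative_coordinate_map[OF f' B A d c'])
  then have "((\<lambda>y. y) has_derivative (\<lambda>v. frechet_derivative (snd c \<circ> f' \<circ> inv_chart d) (at (snd d (f x)))
       (frechet_derivative (snd d \<circ> f \<circ> inv_chart c) (at (snd c x)) v))) (at (snd c x))"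
  proof (rule has_derivative_transform_within_open[OF _ o xS])
    fix y assume y: "y \<in> ?S"
    note y' = mem_chart_imageD[OF A cd(1) y]
    have "inv_chart c y \<in> points A" using inv_chart_in[OF y'(1)] cd(1) by (auto simp: points_def)
    moreover have "f (inv_chart c y) \<in> fst d" using y'(2) by simp
    ultimately show "(snd c \<circ> f' \<circ> inv_chart d) ((snd d \<circ> f \<circ> inv_chart c) y) = y"
      by (simp add: inv_chart_chart[OF B cd(3)] inv chart_inv_chart[OF y'(1)])
  qed
  from fun_cong[OF has_derivative_unique[OF this has_derivative_ident]] show ?thesis .
qed

text \<open>Left translation is the multiplication restricted to the slice on which the first factor
  is \<open>g\<close>.\<close>

lemma (in lie_action) smooth_left_translation:
  assumes g: "g \<in> carrier G"
  shows "smooth_map A A (\<lambda>h. g \<otimes> h)"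
proof (rule smooth_mapI[OF A A])
  fix x assume x: "x \<in> points A"
  interpret group G by (rule group)
  have "g \<otimes> x \<in> points A" using g x carrier by (metis m_closed)
  then obtain d where d: "d \<in> charts_at A (g \<otimes> x)" using charts_at_nonempty[of "g \<otimes> x" A] by blast
  obtain c where c: "c \<in> charts_at A x" using charts_at_nonempty[OF x] by blast
  obtain b where b: "b \<in> charts_at A g" using charts_at_nonempty[of g A] g carrier by blast
  have bcd: "b \<in> A" "g \<in> fst b" "c \<in> A" "x \<in> fst c" "d \<in> A" "g \<otimes> x \<in> fst d"
    using b c d by (simp_all add: mem_charts_at)
  note AA = smooth_atlas_prod_manifold[OF A A] and bc = prod_chart_in[OF bcd(1,3)]
  let ?m = "\<lambda>(g, h). g \<otimes> h" and ?C = "prod_chart b c"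
  let ?D = "snd ?C ` (fst ?C \<inter> ?m -` fst d)"
  have oD: "open ?D" by (rule open_smooth_map_domain[OF smooth_mult AA A bc bcd(5)])
  let ?V = "(\<lambda>y. (snd b g, y)) -` ?D"
  have oV: "open ?V" by (rule open_vimage[OF oD]) (intro continuous_intros)
  have D: "y \<in> snd c ` fst c" "g \<otimes> inv_chart c y \<in> fst d" if y: "y \<in> ?V" for y
  proof -
    have "(snd b g, y) \<in> ?D" using y by simp
    note m = mem_chart_imageD[OF AA bc this]
    show yc: "y \<in> snd c ` fst c" using m(1) by auto
    have "inv_chart ?C (snd b g, y) = (g, inv_chart c y)"
      using inv_chart_prod[OF A A bcd(1,3) imageI[OF bcd(2)] yc] inv_chart_chart[OF A bcd(1,2)] by simp
    then show "g \<otimes> inv_chart c y \<in> fst d" using m(2) by simp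
  qed
  have "smooth_on ?V (\<lambda>y. (snd d \<circ> ?m \<circ> inv_chart ?C) (snd b g, y))"
    by (rule smooth_on_compose[OF smooth_on_coordinate_map[OF smooth_mult bc bcd(5)]
        smooth_on_Pair[OF smooth_on_const smooth_on_id]]) simp
  then have s: "smooth_on ?V (snd d \<circ> (\<lambda>h. g \<otimes> h) \<circ> inv_chart c)"
  proof (rule smooth_on_eq)
    fix y assume y: "y \<in> ?V"
    have "inv_chart ?C (snd b g, y) = (g, inv_chart c y)"
      using inv_chart_prod[OF A A bcd(1,3) imageI[OF bcd(2)] D(1)[OF y]] inv_chart_chart[OF A bcd(1,2)] by simp
    then show "(snd d \<circ> (\<lambda>h. g \<otimes> h) \<circ> inv_chart c) y = (snd d \<circ> ?m \<circ> inv_chart ?C) (snd b g, y)" by simp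
  qed
  have "(g, x) \<in> fst ?C \<inter> ?m -` fst d" using bcd by simp
  then have "snd ?C (g, x) \<in> ?D" by (rule imageI)
  then have xV: "snd c x \<in> ?V" by simp
  have 1: "?V \<subseteq> snd c ` fst c" by (rule subsetI) (rule D(1))
  have 2: "\<forall>y\<in>?V. g \<otimes> inv_chart c y \<in> fst d" by (rule ballI) (rule D(2))
  show "\<exists>c\<in>charts_at A x. \<exists>d\<in>A. \<exists>V. open V \<and> snd c x \<in> V \<and> V \<subseteq> snd c ` fst c \<and>
      (\<forall>y\<in>V. g \<otimes> inv_chart c y \<in> fst d) \<and> smooth_on V (snd d \<circ> (\<lambda>h. g \<otimes> h) \<circ> inv_chart c)"
    by (rule bexI[OF _ c], rule bexI[OF _ bcd(5)], rule exI[of _ ?V]) (intro conjI oV xV 1 2 s)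
qed

locale chaplygin_bundle =
  fixes S :: "('q, 'e::fin_dim_inner, 'm, 'f::fin_dim_inner, 'g, 'k::fin_dim_inner) chaplygin"
  assumes principal: "principal_bundle S" and horizontal: "horizontal_distribution S"
begin

abbreviation "Q \<equiv> mfQ S"
abbreviation "M \<equiv> mfM S"
abbreviation "\<pi> \<equiv> proj S"

lemma Q: "smooth_atlas Q" and M: "smooth_atlas M" and mfM: "smooth_manifold M"
  and smooth_proj: "smooth_map Q M \<pi>"
  using principal by (simp_all add: principal_bundle_def smooth_manifold_def)

lemma proj_act: "q \<in> points Q \<Longrightarrow> g \<in> carrier (grp S) \<Longrightarrow> \<pi> (act S q g) = \<pi> q"
  using principal by (simp add: principal_bundle_def)

lemma local_trivialization:
  assumes "x \<in> points M"
  obtains U \<Phi> where "openin (manifold_topology M) U" "x \<in> U"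
    "diffeomorphism (open_submanifold Q (\<pi> -` U)) (prod_manifold (open_submanifold M U) (mfG S)) \<Phi>"
    "\<And>q. q \<in> points Q \<Longrightarrow> \<pi> q \<in> U \<Longrightarrow> fst (\<Phi> q) = \<pi> q"
    "\<And>q g. q \<in> points Q \<Longrightarrow> \<pi> q \<in> U \<Longrightarrow> g \<in> carrier (grp S) \<Longrightarrow> snd (\<Phi> (act S q g)) = snd (\<Phi> q) \<otimes>\<^bsub>grp S\<^esub> g"
proof -
  have "\<exists>U \<Phi>. openin (manifold_topology M) U \<and> x \<in> U \<and>
      diffeomorphism (open_submanifold Q (\<pi> -` U)) (prod_manifold (open_submanifold M U) (mfG S)) \<Phi> \<and>
      (\<forall>q\<in>points Q \<inter> \<pi> -` U. fst (\<Phi> q) = \<pi> q \<and>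
         (\<forall>g\<in>carrier (grp S). snd (\<Phi> (act S q g)) = snd (\<Phi> q) \<otimes>\<^bsub>grp S\<^esub> g))"
    using principal assms unfolding principal_bundle_def by blast
  then obtain U \<Phi> where *: "openin (manifold_topology M) U" "x \<in> U"
      "diffeomorphism (open_submanifold Q (\<pi> -` U)) (prod_manifold (open_submanifold M U) (mfG S)) \<Phi>"
      "\<forall>q\<in>points Q \<inter> \<pi> -` U. fst (\<Phi> q) = \<pi> q \<and>
         (\<forall>g\<in>carrier (grp S). snd (\<Phi> (act S q g)) = snd (\<Phi> q) \<otimes>\<^bsub>grp S\<^esub> g)" by blast
  show thesis by (rule that[OF *(1,2,3)]) (use *(4) in simp_all)
qed

sublocale la: lie_action "grp S" "mfG S" "mfQ S" "act S"
  using principal by unfold_locales (simp_all add: principal_bundle_def smooth_manifold_def)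

abbreviation "c0 \<equiv> la.c0"

text \<open>The chart at the unit identifies the Lie algebra with its model space, so that
  coordinate formulas such as \<open>Z\<close> and \<open>W\<close> can take arguments and values in
  a fixed vector space.\<close>

definition lie_vec :: "'k \<Rightarrow> ('g, 'k) tvec"
  where "lie_vec k = tvec_of (mfG S) c0 \<one>\<^bsub>grp S\<^esub> k"

lemma lie_vec: "lie_vec k \<in> lie_alg S" "lie_vec k c0 = k"
  unfolding lie_vec_def lie_alg_def by (rule tvec_of_in[OF la.A la.c0], rule tvec_of_same[OF la.A la.c0])

lemma lie_vec_chart: "a \<in> lie_alg S \<Longrightarrow> lie_vec (a c0) = a"
  unfolding lie_vec_def lie_alg_def by (rule tvec_of_chart[OF la.A la.c0])

lemma lie_alg_eqI: "a \<in> lie_alg S \<Longrightarrow> b \<in> lie_alg S \<Longrightarrow> a c0 = b c0 \<Longrightarrow> a = b"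
  by (metis lie_vec_chart)

lemma subspace_lie_alg: "subspace (lie_alg S)"
  unfolding lie_alg_def by (rule subspace_tangent_space[OF la.A])

lemma fundamental_field_in:
  assumes "a \<in> lie_alg S" "q \<in> points Q"
  shows "fundamental_field S a q \<in> tangent_space Q q"
proof -
  note e = la.exp_orbit[OF assms(1)[unfolded lie_alg_def] assms(2)]
  show ?thesis
    using velocity_in[OF e(1) Q thick_UNIV UNIV_I, of 0] e(3) by (simp add: fundamental_field_def exp_act_def)
qed

lemma fundamental_field_chart:
  assumes "a \<in> lie_alg S" "c \<in> charts_at Q q"
  shows "fundamental_field S a q c = la.Z c (snd c q) (a c0)"
  unfolding fundamental_field_def exp_act_def
  by (rule la.exp_orbit(4)[OF assms(1)[unfolded lie_alg_def] points_charts_at[OF assms(2)] assms(2)])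

text \<open>\<open>pr\<close> is the projection read in charts, \<open>P\<close> its Jacobian, and
  \<open>Ud\<close> the open set of coordinates on which both are meaningful.\<close>

abbreviation "pr c d \<equiv> snd d \<circ> \<pi> \<circ> inv_chart c"
abbreviation "P c d y \<equiv> frechet_derivative (pr c d) (at y)"
abbreviation "Ud c d \<equiv> snd c ` (fst c \<inter> \<pi> -` fst d)"

lemma open_Ud: "c \<in> Q \<Longrightarrow> d \<in> M \<Longrightarrow> open (Ud c d)"
  by (rule open_smooth_map_domain[OF smooth_proj Q M])

lemma smooth_pr: "c \<in> Q \<Longrightarrow> d \<in> M \<Longrightarrow> smooth_on (Ud c d) (pr c d)"
  by (rule smooth_on_coordinate_map[OF smooth_proj])

lemma UdD:
  assumes "c \<in> Q" "y \<in> Ud c d"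
  shows "y \<in> snd c ` fst c" "\<pi> (inv_chart c y) \<in> fst d" "inv_chart c y \<in> fst c"
proof -
  note m = mem_chart_imageD[OF Q assms]
  show "y \<in> snd c ` fst c" by (rule m(1))
  show "\<pi> (inv_chart c y) \<in> fst d" using m(2) by simp
  show "inv_chart c y \<in> fst c" by (rule inv_chart_in[OF m(1)])
qed

lemma UdI: "q \<in> fst c \<Longrightarrow> \<pi> q \<in> fst d \<Longrightarrow> snd c q \<in> Ud c d"
  by (rule imageI) simp

lemma linear_P: "c \<in> Q \<Longrightarrow> d \<in> M \<Longrightarrow> y \<in> Ud c d \<Longrightarrow> linear (P c d y)"
  by (rule linear_frechet_derivative_smooth[OF smooth_pr open_Ud])

lemma proj_vec_chart:
  assumes "c \<in> charts_at Q q" "d \<in> charts_at M (\<pi> q)" "v \<in> tangent_space Q q"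
  shows "proj_vec S (q, v) d = P c d (snd c q) (v c)"
  using tangent_map_eq[OF smooth_proj Q M assms] by (simp add: proj_vec_def)

lemma proj_vec_in:
  assumes "q \<in> points Q" "v \<in> tangent_space Q q"
  shows "proj_vec S (q, v) \<in> tangent_space M (\<pi> q)"
proof -
  obtain c where "c \<in> charts_at Q q" using charts_at_nonempty[OF assms(1)] by blast
  from tangent_map_in[OF smooth_proj Q M this assms(2)] show ?thesis by (simp add: proj_vec_def)
qed

lemma proj_points: "q \<in> points Q \<Longrightarrow> \<pi> q \<in> points M"
  by (rule smooth_map_points[OF smooth_proj Q M])

text \<open>The proof compares, in a local trivialization, the derivative of the orbit map with
  that of a left translation of the group.\<close>

lemma vertical_coordinates:
  assumes c: "c \<in> charts_at Q q" and d: "d \<in> charts_at M (\<pi> q)"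
  shows P_Z: "P c d (snd c q) (la.Z c (snd c q) k) = 0"
    and ker_P: "P c d (snd c q) v = 0 \<Longrightarrow> \<exists>k. v = la.Z c (snd c q) k"
    and Z_inj: "la.Z c (snd c q) k = 0 \<Longrightarrow> k = 0"
    and P_surj: "\<exists>v. P c d (snd c q) v = u"
proof -
  have cd: "c \<in> Q" "q \<in> fst c" "d \<in> M" "\<pi> q \<in> fst d" using c d by (simp_all add: mem_charts_at)
  let ?y = "snd c q" and ?A = "mfG S"
  note q = points_charts_at[OF c]
  have yU: "?y \<in> snd c ` fst c" using cd by blast
  obtain U \<Phi> where U: "openin (manifold_topology M) U" "\<pi> q \<in> U"
    "diffeomorphism (open_submanifold Q (\<pi> -` U)) (prod_manifold (open_submanifold M U) ?A) \<Phi>"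
    "\<And>q. q \<in> points Q \<Longrightarrow> \<pi> q \<in> U \<Longrightarrow> fst (\<Phi> q) = \<pi> q"
    "\<And>q g. q \<in> points Q \<Longrightarrow> \<pi> q \<in> U \<Longrightarrow> g \<in> carrier (grp S) \<Longrightarrow> snd (\<Phi> (act S q g)) = snd (\<Phi> q) \<otimes>\<^bsub>grp S\<^esub> g"
    using local_trivialization[OF proj_points[OF q]] by blast
  let ?Qo = "open_submanifold Q (\<pi> -` U)" and ?Mo = "open_submanifold M U"
  let ?P = "prod_manifold ?Mo ?A"
  have contp: "continuous_map (manifold_topology Q) (manifold_topology M) \<pi>" using smooth_proj by (simp add: smooth_map_def)
  have oQ: "open (snd b ` (fst b \<inter> \<pi> -` U))" if b: "b \<in> Q" for b
  proof -
    have "openin (manifold_topology Q) {x \<in> points Q. \<pi> x \<in> U}"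
      using openin_continuous_map_preimage[OF contp U(1)] unfolding topspace_manifold_topology[OF Q] .
    then have "open (snd b ` ({x \<in> points Q. \<pi> x \<in> U} \<inter> fst b))"
      unfolding openin_manifold_topology[OF Q] using b by blast
    moreover have "{x \<in> points Q. \<pi> x \<in> U} \<inter> fst b = fst b \<inter> \<pi> -` U" using b by (auto simp: points_def)
    ultimately show ?thesis by simp
  qed
  have oM: "open (snd b ` (fst b \<inter> U))" if b: "b \<in> M" for b
    using U(1)[unfolded openin_manifold_topology[OF M]] b by (metis Int_commute)
  have Qo: "smooth_atlas ?Qo" by (rule smooth_atlas_open_submanifold[OF Q oQ])
  have Mo: "smooth_atlas ?Mo" by (rule smooth_atlas_open_submanifold[OF M oM])
  have Po: "smooth_atlas ?P" by (rule smooth_atlas_prod_manifold[OF Mo la.A])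
  let ?\<Psi> = "inv_into (points ?Qo) \<Phi>"
  have \<Phi>: "smooth_map ?Qo ?P \<Phi>" "smooth_map ?P ?Qo ?\<Psi>" "bij_betw \<Phi> (points ?Qo) (points ?P)"
    using U(3) by (simp_all add: diffeomorphism_def)
  have \<Psi>\<Phi>: "?\<Psi> (\<Phi> z) = z" if "z \<in> points ?Qo" for z
    by (rule inv_into_f_f[OF bij_betw_imp_inj_on[OF \<Phi>(3)] that])
  have \<Phi>\<Psi>: "\<Phi> (?\<Psi> z) = z" if "z \<in> points ?P" for z
    using that bij_betw_imp_surj_on[OF \<Phi>(3)] by (metis f_inv_into_f)
  let ?c = "restrict_chart (\<pi> -` U) c"
  have cQo: "?c \<in> charts_at ?Qo q" using restrict_chart_in[OF cd(1)] cd U(2) by (simp add: mem_charts_at)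
  have qQo: "q \<in> points ?Qo" by (rule points_charts_at[OF cQo])
  define g where "g = snd (\<Phi> q)"
  have \<Phi>q: "\<Phi> q = (\<pi> q, g)" using U(4)[OF q U(2)] by (simp add: g_def prod_eq_iff)
  have "\<Phi> q \<in> points ?P" by (rule smooth_map_points[OF \<Phi>(1) Qo Po qQo])
  then have gA: "g \<in> points ?A" unfolding \<Phi>q by (auto simp: points_def prod_manifold_def)
  then have gG: "g \<in> carrier (grp S)" using la.carrier by simp
  obtain b where b: "b \<in> charts_at ?A g" using charts_at_nonempty[OF gA] by blast
  then have bA: "b \<in> ?A" "g \<in> fst b" by (simp_all add: mem_charts_at)
  let ?C = "prod_chart (restrict_chart U d) b"
  have CP: "?C \<in> charts_at ?P (\<Phi> q)"
    using prod_chart_in[OF restrict_chart_in[OF cd(3)] bA(1), of U] cd(4) U(2) bA(2) by (simp add: mem_charts_at \<Phi>q)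
  let ?\<phi> = "snd ?C \<circ> \<Phi> \<circ> inv_chart ?c"
  \<comment> \<open>Jacobians of the trivialization and of its inverse; they invert each
    other.\<close>
  define D where "D = frechet_derivative ?\<phi> (at ?y)"
  define E where "E = frechet_derivative (snd ?c \<circ> ?\<Psi> \<circ> inv_chart ?C) (at (snd ?C (\<Phi> q)))"
  have ED: "E (D v) = v" for v
    using coordinate_derivative_inverse[OF \<Phi>(1,2) Qo Po \<Psi>\<Phi> cQo CP] by (simp add: D_def E_def)
  have DE: "D (E w) = w" for w
    using coordinate_derivative_inverse[OF \<Phi>(2,1) Po Qo \<Phi>\<Psi> CP, of ?c] cQo \<Psi>\<Phi>[OF qQo] by (simp add: D_def E_def)
  have D: "(?\<phi> has_derivative D) (at ?y)"
    using has_derivative_coordinate_map[OF \<Phi>(1) Qo Po cQo CP] by (simp add: D_def)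
  let ?N = "snd c ` (fst c \<inter> \<pi> -` (U \<inter> fst d))"
  have oN: "open ?N"
  proof -
    have "?N = snd c ` (fst c \<inter> \<pi> -` U) \<inter> Ud c d" using inj_on_chart[OF Q cd(1)] by (auto simp: inj_on_def)
    then show ?thesis using open_Int[OF oQ[OF cd(1)] open_Ud[OF cd(1,3)]] by simp
  qed
  have yN: "?y \<in> ?N" by (rule imageI) (use cd U(2) in simp)
  have \<phi>_eq: "?\<phi> y = (pr c d y, snd b (snd (\<Phi> (inv_chart c y))))" if y: "y \<in> ?N" for y
  proof -
    have "y \<in> snd c ` (fst c \<inter> \<pi> -` U)" using y by blast
    note i = inv_restrict_chart[OF Q cd(1) this]
    note m = mem_chart_imageD[OF Q cd(1) y]
    have "inv_chart c y \<in> points Q" using inv_chart_in[OF m(1)] cd(1) by (auto simp: points_def)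
    from U(4)[OF this] m(2) have "fst (\<Phi> (inv_chart c y)) = \<pi> (inv_chart c y)" by simp
    then show ?thesis by (simp add: i map_prod_def case_prod_unfold)
  qed
  \<comment> \<open>The trivialization covers the identity of the base, so its first component is
    the projection.\<close>
  have fstD: "fst (D v) = P c d ?y v" for v
  proof -
    have "((\<lambda>y. fst (?\<phi> y)) has_derivative (\<lambda>v. fst (D v))) (at ?y)" by (rule has_derivative_fst[OF D])
    then have "(pr c d has_derivative (\<lambda>v. fst (D v))) (at ?y)"
    proof (rule has_derivative_transform_within_open[OF _ oN yN])
      fix y assume "y \<in> ?N"
      from arg_cong[OF \<phi>_eq[OF this], of fst] show "fst (?\<phi> y) = pr c d y" by (simp only: fst_conv)
    qed
    from frechet_derivative_at[OF this] show ?thesis by (rule fun_cong)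
  qed
  interpret self: lie_action "grp S" ?A ?A "mult (grp S)" by (rule la.self_action)
  interpret group "grp S" by (rule la.group)
  have bg: "snd b g \<in> snd b ` fst b" using bA by blast
  define K where "K = self.Z b (snd b g)"
  \<comment> \<open>In the trivialization the group acts by right multiplication on the second
    factor. A generator therefore has no base component, and its group component is the Jacobian at
    the unit of left translation by \<open>g\<close>.\<close>
  have DZ: "D (la.Z c ?y k) = (0, K k)" for k
  proof -
    have 1: "((\<lambda>w. ?\<phi> (la.actc c (?y, w))) has_derivative (\<lambda>k. D (la.Z c ?y k))) (at la.u0)"
      by (rule has_derivative_compose[OF la.has_derivative_Z[OF cd(1) yU]])
         (unfold la.u0_Dom(2)[OF cd(1) yU], rule D)
    let ?V = "(\<lambda>w. (?y, w)) -` la.Dom c \<inter> (\<lambda>w. (snd b g, w)) -` self.Dom b"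
    have oV: "open ?V"
      by (intro open_Int open_vimage la.open_Dom self.open_Dom cd bA continuous_intros)
    have uV: "la.u0 \<in> ?V" using la.u0_Dom(1)[OF cd(1) yU] self.u0_Dom(1)[OF bA(1) bg] by simp
    have "((\<lambda>w. (snd d (\<pi> q), self.actc b (snd b g, w))) has_derivative (\<lambda>k. (0, K k))) (at la.u0)"
      unfolding K_def by (rule has_derivative_Pair[OF has_derivative_const self.has_derivative_Z[OF bA(1) bg]])
    then have 2: "((\<lambda>w. ?\<phi> (la.actc c (?y, w))) has_derivative (\<lambda>k. (0, K k))) (at la.u0)"
    proof (rule has_derivative_transform_within_open[OF _ oV uV])
      fix w assume w: "w \<in> ?V"
      have wc: "w \<in> snd c0 ` fst c0" "act S q (inv_chart c0 w) \<in> fst c"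
        using w by (simp_all add: la.Dom_def inv_chart_chart[OF Q cd(1,2)])
      let ?h = "inv_chart c0 w"
      have h: "?h \<in> carrier (grp S)" by (rule la.c0_carrier[OF inv_chart_in[OF wc(1)]])
      have a: "la.actc c (?y, w) = snd c (act S q ?h)" by (simp add: la.actc_def inv_chart_chart[OF Q cd(1,2)])
      have p: "\<pi> (act S q ?h) = \<pi> q" by (rule proj_act[OF q h])
      have "snd c (act S q ?h) \<in> ?N" by (rule imageI) (use wc(2) p U(2) cd(4) in simp)
      from \<phi>_eq[OF this] have "?\<phi> (la.actc c (?y, w)) = (snd d (\<pi> q), snd b (g \<otimes>\<^bsub>grp S\<^esub> ?h))"
        unfolding a by (simp add: inv_chart_chart[OF Q cd(1) wc(2)] p U(5)[OF q U(2) h] g_def)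
      then show "(snd d (\<pi> q), self.actc b (snd b g, w)) = ?\<phi> (la.actc c (?y, w))"
        by (simp add: self.actc_def inv_chart_chart[OF la.A bA])
    qed
    from fun_cong[OF has_derivative_unique[OF 1 2]] show ?thesis .
  qed
  let ?L = "\<lambda>h. g \<otimes>\<^bsub>grp S\<^esub> h" and ?L' = "\<lambda>h. inv\<^bsub>grp S\<^esub> g \<otimes>\<^bsub>grp S\<^esub> h"
  have ginv: "inv\<^bsub>grp S\<^esub> g \<in> carrier (grp S)" using gG by simp
  have L: "smooth_map ?A ?A ?L" "smooth_map ?A ?A ?L'"
    by (rule la.smooth_left_translation[OF gG], rule la.smooth_left_translation[OF ginv])
  have L'L: "?L' (?L z) = z" and LL': "?L (?L' z) = z" if "z \<in> points ?A" for z
  proof -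
    have z: "z \<in> carrier (grp S)" using that la.carrier by simp
    show "?L' (?L z) = z" using m_assoc[OF ginv gG z] l_inv[OF gG] l_one[OF z] by simp
    show "?L (?L' z) = z" using m_assoc[OF gG ginv z] r_inv[OF gG] l_one[OF z] by simp
  qed
  have gone: "?L \<one>\<^bsub>grp S\<^esub> = g" using gG by simp
  \<comment> \<open>The inverse of \<open>K\<close>, from left translation by the inverse of
    \<open>g\<close>.\<close>
  define K' where "K' = frechet_derivative (snd c0 \<circ> ?L' \<circ> inv_chart b) (at (snd b g))"
  have "K = frechet_derivative (snd b \<circ> ?L \<circ> inv_chart c0) (at la.u0)"
  proof -
    have "((snd b \<circ> ?L \<circ> inv_chart c0) has_derivative K) (at la.u0)"
      using self.has_derivative_Z[OF bA(1) bg] by (simp add: K_def self.actc_def inv_chart_chart[OF la.A bA] o_def)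
    from frechet_derivative_at[OF this] show ?thesis .
  qed
  then have K'K: "K' (K k) = k" and KK': "K (K' w) = w" for k w
    using coordinate_derivative_inverse[OF L la.A la.A L'L la.c0, of b k] b gone
      coordinate_derivative_inverse[OF L(2,1) la.A la.A LL', of b g c0 w] la.c0 gG by (simp_all add: K'_def)
  have linD: "linear D" by (rule has_derivative_linear[OF D])
  have linK: "linear K" unfolding K_def by (rule self.linear_Z[OF bA(1) bg])
  show "P c d ?y (la.Z c ?y k) = 0" using DZ[of k] fstD[of "la.Z c ?y k"] by simp
  show "\<exists>k. v = la.Z c ?y k" if "P c d ?y v = 0"
  proof -
    have "D v = D (la.Z c ?y (K' (snd (D v))))"
      using fstD[of v] that by (simp add: DZ KK' prod_eq_iff)
    then have "v = la.Z c ?y (K' (snd (D v)))" using ED by metis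
    then show ?thesis by blast
  qed
  show "k = 0" if "la.Z c ?y k = 0"
  proof -
    have "K k = 0" using DZ[of k] linear_0[OF linD] that by (simp add: zero_prod_def)
    then have "K' (K k) = K' (K 0)" by (simp add: linear_0[OF linK])
    then show ?thesis by (simp only: K'K)
  qed
  show "\<exists>v. P c d ?y v = u" using fstD[of "E (u, 0)"] DE[of "(u, 0)"] by (intro exI[of _ "E (u, 0)"]) simp
qed

subsection \<open>The connection form\<close>

lemma hor_subspace: "q \<in> points Q \<Longrightarrow> subspace (hor S q)"
  and hor_tangent: "q \<in> points Q \<Longrightarrow> h \<in> hor S q \<Longrightarrow> h \<in> tangent_space Q q"
  and hor_vertical: "q \<in> points Q \<Longrightarrow> hor S q \<inter> vertical_space S q = {0}"
  and tangent_split: "q \<in> points Q \<Longrightarrow> tangent_space Q q = {h + v | h v. h \<in> hor S q \<and> v \<in> vertical_space S q}"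
proof -
  note h = horizontal[unfolded horizontal_distribution_def]
  note sd = conjunct1[OF conjunct1[OF h, unfolded smooth_distribution_def], rule_format]
  note sp = conjunct2[OF h, rule_format]
  show "q \<in> points Q \<Longrightarrow> subspace (hor S q)" by (rule conjunct1[OF sd])
  show "q \<in> points Q \<Longrightarrow> h \<in> hor S q \<Longrightarrow> h \<in> tangent_space Q q" by (rule subsetD[OF conjunct2[OF sd]])
  show "q \<in> points Q \<Longrightarrow> hor S q \<inter> vertical_space S q = {0}" by (rule conjunct1[OF sp])
  show "q \<in> points Q \<Longrightarrow> tangent_space Q q = {h + v | h v. h \<in> hor S q \<and> v \<in> vertical_space S q}"
    by (rule conjunct2[OF sp])
qed

text \<open>Both conditions say that the coordinates of \<open>v\<close> lie in the kernel of
  \<open>P\<close>, which \<open>vertical_coordinates\<close> identifies with the range of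
  \<open>Z\<close>.\<close>

lemma vertical_iff:
  assumes q: "q \<in> points Q" and v: "v \<in> tangent_space Q q"
  shows "v \<in> vertical_space S q \<longleftrightarrow> (\<exists>a\<in>lie_alg S. v = fundamental_field S a q)"
proof -
  obtain c where c: "c \<in> charts_at Q q" using charts_at_nonempty[OF q] by blast
  obtain d where d: "d \<in> charts_at M (\<pi> q)" using charts_at_nonempty[OF proj_points[OF q]] by blast
  have "v \<in> vertical_space S q \<longleftrightarrow> P c d (snd c q) (v c) = 0"
  proof
    assume "v \<in> vertical_space S q"
    then have "proj_vec S (q, v) = 0" by (simp add: vertical_space_def)
    then show "P c d (snd c q) (v c) = 0" using proj_vec_chart[OF c d v] by simp
  next
    assume "P c d (snd c q) (v c) = 0"
    then have "proj_vec S (q, v) d = 0 d" using proj_vec_chart[OF c d v] by simp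
    from tangent_space_eqI[OF proj_vec_in[OF q v] tangent_space_0[OF M] d this]
    show "v \<in> vertical_space S q" unfolding vertical_space_def using v by blast
  qed
  also have "\<dots> \<longleftrightarrow> (\<exists>a\<in>lie_alg S. v = fundamental_field S a q)"
  proof
    assume "P c d (snd c q) (v c) = 0"
    from ker_P[OF c d this] obtain k where k: "v c = la.Z c (snd c q) k" by blast
    have "v = fundamental_field S (lie_vec k) q"
      by (rule tangent_space_eqI[OF v fundamental_field_in[OF lie_vec(1) q] c])
         (simp add: k fundamental_field_chart[OF lie_vec(1) c] lie_vec(2))
    then show "\<exists>a\<in>lie_alg S. v = fundamental_field S a q" using lie_vec(1) by blast
  next
    assume "\<exists>a\<in>lie_alg S. v = fundamental_field S a q"
    then obtain a where a: "a \<in> lie_alg S" "v = fundamental_field S a q" by blast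
    show "P c d (snd c q) (v c) = 0"
      unfolding a(2) fundamental_field_chart[OF a(1) c] by (rule P_Z[OF c d])
  qed
  finally show ?thesis .
qed

lemma fundamental_field_linear:
  assumes q: "q \<in> points Q" and a: "a \<in> lie_alg S" and b: "b \<in> lie_alg S"
  shows "fundamental_field S (a + b) q = fundamental_field S a q + fundamental_field S b q"
    and "fundamental_field S (r *\<^sub>R a) q = r *\<^sub>R fundamental_field S a q"
    and "fundamental_field S (a - b) q = fundamental_field S a q - fundamental_field S b q"
    and "fundamental_field S 0 q = 0"
proof -
  obtain c where c: "c \<in> charts_at Q q" using charts_at_nonempty[OF q] by blast
  then have cQ: "c \<in> Q" "snd c q \<in> snd c ` fst c" by (auto simp: mem_charts_at)
  note lin = la.linear_Z[OF cQ] and T = fundamental_field_in[OF _ q] and sl = subspace_lie_alg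
  note t = tangent_space_eqI[OF T _ c]
  show "fundamental_field S (a + b) q = fundamental_field S a q + fundamental_field S b q"
    by (rule t[OF subspace_add[OF sl a b] tangent_space_add[OF Q T[OF a] T[OF b]]])
       (simp add: fundamental_field_chart[OF _ c] a b subspace_add[OF sl] linear_add[OF lin])
  show "fundamental_field S (r *\<^sub>R a) q = r *\<^sub>R fundamental_field S a q"
    by (rule t[OF subspace_scale[OF sl a] tangent_space_scaleR[OF Q T[OF a]]])
       (simp add: scaleR_fun_apply fundamental_field_chart[OF _ c] a subspace_scale[OF sl] linear_scale[OF lin])
  show "fundamental_field S (a - b) q = fundamental_field S a q - fundamental_field S b q"
    by (rule t[OF subspace_diff[OF sl a b] tangent_space_diff[OF Q T[OF a] T[OF b]]])
       (simp add: fundamental_field_chart[OF _ c] a b subspace_diff[OF sl] linear_diff[OF lin])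
  show "fundamental_field S 0 q = 0"
    by (rule t[OF subspace_0[OF sl] tangent_space_0[OF Q]])
       (simp add: fundamental_field_chart[OF subspace_0[OF sl] c] linear_0[OF lin])
qed

lemma fundamental_field_inj:
  assumes q: "q \<in> points Q" and a: "a \<in> lie_alg S" and z: "fundamental_field S a q = 0"
  shows "a = 0"
proof -
  obtain c where c: "c \<in> charts_at Q q" using charts_at_nonempty[OF q] by blast
  obtain d where d: "d \<in> charts_at M (\<pi> q)" using charts_at_nonempty[OF proj_points[OF q]] by blast
  have "la.Z c (snd c q) (a c0) = 0" using z fundamental_field_chart[OF a c] by simp
  from Z_inj[OF c d this] show ?thesis
    using lie_alg_eqI[OF a subspace_0[OF subspace_lie_alg]] by simp
qed

text \<open>The difference of two candidates yields a fundamental vector that is both vertical and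
  horizontal, hence 0; and a fundamental vector vanishes only for the zero element.\<close>

lemma omega_unique:
  assumes q: "q \<in> points Q" and a: "a \<in> lie_alg S" "v - fundamental_field S a q \<in> hor S q"
    and b: "b \<in> lie_alg S" "v - fundamental_field S b q \<in> hor S q"
  shows "a = b"
proof -
  let ?w = "fundamental_field S (b - a) q"
  have ba: "b - a \<in> lie_alg S" by (rule subspace_diff[OF subspace_lie_alg b(1) a(1)])
  have "?w = (v - fundamental_field S a q) - (v - fundamental_field S b q)"
    using fundamental_field_linear(3)[OF q b(1) a(1)] by simp
  then have "?w \<in> hor S q" using subspace_diff[OF hor_subspace[OF q] a(2) b(2)] by simp
  moreover have "?w \<in> vertical_space S q"
    using vertical_iff[OF q fundamental_field_in[OF ba q]] ba by blast
  ultimately have "?w = 0" using hor_vertical[OF q] by blast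
  from fundamental_field_inj[OF q ba this] show ?thesis by simp
qed

lemma omega_eqI:
  assumes q: "q \<in> points Q" and a: "a \<in> lie_alg S" "v - fundamental_field S a q \<in> hor S q"
  shows "omega S (q, v) = a"
  unfolding omega_def fst_conv snd_conv
  by (rule the_equality) (use a omega_unique[OF q] in blast)+

lemma omega:
  assumes q: "q \<in> points Q" and v: "v \<in> tangent_space Q q"
  shows "omega S (q, v) \<in> lie_alg S" "v - fundamental_field S (omega S (q, v)) q \<in> hor S q"
proof -
  from v obtain h w where hw: "h \<in> hor S q" "w \<in> vertical_space S q" "v = h + w"
    unfolding tangent_split[OF q] by blast
  have "w \<in> tangent_space Q q" using hw(2) by (simp add: vertical_space_def)
  from vertical_iff[OF q this] hw(2) obtain a where a: "a \<in> lie_alg S" "w = fundamental_field S a q" by blast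
  have h: "v - fundamental_field S a q \<in> hor S q" using hw a by simp
  have "omega S (q, v) = a" by (rule omega_eqI[OF q a(1) h])
  then show "omega S (q, v) \<in> lie_alg S" "v - fundamental_field S (omega S (q, v)) q \<in> hor S q" using a(1) h by simp_all
qed

lemma omega_linear:
  assumes q: "q \<in> points Q" and v: "v \<in> tangent_space Q q" and w: "w \<in> tangent_space Q q"
  shows "omega S (q, v + w) = omega S (q, v) + omega S (q, w)"
    and "omega S (q, r *\<^sub>R v) = r *\<^sub>R omega S (q, v)"
proof -
  note o = omega[OF q v] omega[OF q w] and sl = subspace_lie_alg and sh = hor_subspace[OF q]
  show "omega S (q, v + w) = omega S (q, v) + omega S (q, w)"
  proof (rule omega_eqI[OF q subspace_add[OF sl o(1,3)]])
    show "v + w - fundamental_field S (omega S (q, v) + omega S (q, w)) q \<in> hor S q"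
      using subspace_add[OF sh o(2,4)] fundamental_field_linear(1)[OF q o(1,3)] by (simp add: algebra_simps)
  qed
  show "omega S (q, r *\<^sub>R v) = r *\<^sub>R omega S (q, v)"
  proof (rule omega_eqI[OF q subspace_scale[OF sl o(1)]])
    show "r *\<^sub>R v - fundamental_field S (r *\<^sub>R omega S (q, v)) q \<in> hor S q"
      using subspace_scale[OF sh o(2), of r] fundamental_field_linear(2)[OF q o(1,1), of r]
      by (simp add: scaleR_diff_right)
  qed
qed

lemma hor_iff_omega:
  assumes q: "q \<in> points Q" and v: "v \<in> tangent_space Q q"
  shows "v \<in> hor S q \<longleftrightarrow> omega S (q, v) = 0"
proof
  assume h: "v \<in> hor S q"
  show "omega S (q, v) = 0"
    by (rule omega_eqI[OF q subspace_0[OF subspace_lie_alg]])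
       (use h fundamental_field_linear(4)[OF q] subspace_0[OF subspace_lie_alg] in simp)
next
  assume "omega S (q, v) = 0"
  then show "v \<in> hor S q"
    using omega(2)[OF q v] fundamental_field_linear(4)[OF q] subspace_0[OF subspace_lie_alg] by simp
qed

text \<open>The connection form read in the charts \<open>c\<close> and \<open>c0\<close>.\<close>

definition W :: "('q, 'e) chart \<Rightarrow> 'e \<Rightarrow> 'e \<Rightarrow> 'k"
  where "W c y v = omega S (inv_chart c y, tvec_of Q c (inv_chart c y) v) c0"

lemma chart_point:
  assumes c: "c \<in> Q" and y: "y \<in> snd c ` fst c"
  shows "c \<in> charts_at Q (inv_chart c y)" "inv_chart c y \<in> points Q" "snd c (inv_chart c y) = y"
proof -
  show 1: "c \<in> charts_at Q (inv_chart c y)" using c inv_chart_in[OF y] by (simp add: mem_charts_at)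
  show "inv_chart c y \<in> points Q" by (rule points_charts_at[OF 1])
  show "snd c (inv_chart c y) = y" by (rule chart_inv_chart[OF y])
qed

lemma omega_chart:
  assumes c: "c \<in> charts_at Q q" and v: "v \<in> tangent_space Q q"
  shows "omega S (q, v) c0 = W c (snd c q) (v c)"
proof -
  have "inv_chart c (snd c q) = q" using c inv_chart_chart[OF Q] by (simp add: mem_charts_at)
  then show ?thesis by (simp add: W_def tvec_of_chart[OF Q c v])
qed

lemma tvec_of_linear:
  assumes "smooth_atlas A" "c \<in> charts_at A x"
  shows "tvec_of A c x (v + w) = tvec_of A c x v + tvec_of A c x w"
    and "tvec_of A c x (r *\<^sub>R v) = r *\<^sub>R tvec_of A c x v"
proof -
  note t = tvec_of_in[OF assms] and s = tvec_of_same[OF assms]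
  show "tvec_of A c x (v + w) = tvec_of A c x v + tvec_of A c x w"
    by (rule tangent_space_eqI[OF t tangent_space_add[OF assms(1) t t] assms(2)]) (simp add: s)
  show "tvec_of A c x (r *\<^sub>R v) = r *\<^sub>R tvec_of A c x v"
    by (rule tangent_space_eqI[OF t tangent_space_scaleR[OF assms(1) t] assms(2)]) (simp add: s scaleR_fun_apply)
qed

lemma linear_W:
  assumes c: "c \<in> Q" and y: "y \<in> snd c ` fst c"
  shows "linear (W c y)"
proof -
  note p = chart_point[OF assms]
  note t = tvec_of_in[OF Q p(1)]
  show ?thesis
    by (rule linearI)
       (simp_all add: W_def tvec_of_linear[OF Q p(1)] omega_linear[OF p(2) t t] scaleR_fun_apply)
qed

lemma W_Z:
  assumes c: "c \<in> Q" and y: "y \<in> snd c ` fst c"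
  shows "W c y (la.Z c y k) = k"
proof -
  note p = chart_point[OF assms]
  let ?q = "inv_chart c y" and ?v = "fundamental_field S (lie_vec k) (inv_chart c y)"
  note v = fundamental_field_in[OF lie_vec(1)[of k] p(2)]
  have "?v c = la.Z c y k" using fundamental_field_chart[OF lie_vec(1) p(1), of k] by (simp add: p(3) lie_vec(2))
  then have 1: "W c y (la.Z c y k) = omega S (?q, ?v) c0" using omega_chart[OF p(1) v] by (simp add: p(3))
  have 2: "omega S (?q, ?v) = lie_vec k"
    by (rule omega_eqI[OF p(2) lie_vec(1)]) (simp add: subspace_0[OF hor_subspace[OF p(2)]])
  show ?thesis unfolding 1 2 by (rule lie_vec(2))
qed

lemma W_hor:
  assumes c: "c \<in> charts_at Q q" and v: "v \<in> hor S q"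
  shows "W c (snd c q) (v c) = 0"
proof -
  note q = points_charts_at[OF c]
  note vT = hor_tangent[OF q v]
  show ?thesis using omega_chart[OF c vT] hor_iff_omega[OF q vT] v by simp
qed

lemma hor_W:
  assumes c: "c \<in> charts_at Q q" and v: "v \<in> tangent_space Q q" and z: "W c (snd c q) (v c) = 0"
  shows "v \<in> hor S q"
proof -
  note q = points_charts_at[OF c]
  have "omega S (q, v) = 0"
    by (rule lie_alg_eqI[OF omega(1)[OF q v] subspace_0[OF subspace_lie_alg]]) (simp add: omega_chart[OF c v] z)
  then show ?thesis using hor_iff_omega[OF q v] by simp
qed

lemma horizontal_frame:
  assumes "q \<in> points Q"
  obtains U n X where "openin (manifold_topology Q) U" "q \<in> U"
    "\<And>i. i < n \<Longrightarrow> smooth_map (open_submanifold Q U) (tangent_bundle Q) (\<lambda>y. (y, X i y))"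
    "\<And>y. y \<in> U \<Longrightarrow> inj_on (\<lambda>i. X i y) {..<n::nat}"
    "\<And>y. y \<in> U \<Longrightarrow> independent ((\<lambda>i. X i y) ` {..<n})"
    "\<And>y. y \<in> U \<Longrightarrow> hor S y = span ((\<lambda>i. X i y) ` {..<n})"
proof -
  note h = horizontal[unfolded horizontal_distribution_def]
  note sd = bspec[OF conjunct2[OF conjunct1[OF h, unfolded smooth_distribution_def]] assms]
  from sd obtain U n X where *: "openin (manifold_topology Q) U" "q \<in> U"
    "\<forall>i<n. smooth_map (open_submanifold Q U) (tangent_bundle Q) (\<lambda>y. (y, X i y))"
    "\<forall>y\<in>U. inj_on (\<lambda>i. X i y) {..<n::nat} \<and> independent ((\<lambda>i. X i y) ` {..<n}) \<and>
      hor S y = span ((\<lambda>i. X i y) ` {..<n})"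
    by (elim exE conjE)
  show thesis by (rule that[OF *(1,2), of n X]) (use *(3,4) in simp_all)
qed

text \<open>Frames are indexed by numbers while \<open>independent\<close> speaks of sets;
  injectivity transfers the coefficients from one to the other.\<close>

lemma frame_zero:
  fixes f :: "nat \<Rightarrow> 'v::real_vector"
  assumes "inj_on f {..<n}" "independent (f ` {..<n})" "(\<Sum>i<n. r i *\<^sub>R f i) = 0" "i < n"
  shows "r i = 0"
proof -
  let ?g = "\<lambda>v. r (the_inv_into {..<n} f v)"
  have "(\<Sum>v\<in>f ` {..<n}. ?g v *\<^sub>R v) = (\<Sum>i<n. r i *\<^sub>R f i)"
    unfolding sum.reindex[OF assms(1)] o_def
    by (rule sum.cong) (simp_all add: the_inv_into_f_f[OF assms(1)])
  then have "?g v = 0" if "v \<in> f ` {..<n}" for v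
    using independentD[OF assms(2), of "f ` {..<n}" ?g v] that assms(3) by simp
  then show ?thesis using the_inv_into_f_f[OF assms(1), of i] assms(4) by fastforce
qed

lemma frame_span:
  fixes f :: "nat \<Rightarrow> 'v::real_vector"
  assumes "v \<in> span (f ` {..<n})"
  obtains r where "v = (\<Sum>i<n. r i *\<^sub>R f i)"
proof -
  have "\<exists>r. v = (\<Sum>i<n. r i *\<^sub>R f i)"
    using assms
  proof (induction rule: span_induct_alt)
    case base
    show ?case by (rule exI[of _ "\<lambda>_. 0"]) simp
  next
    case (step k x y)
    from step(2) obtain r where r: "y = (\<Sum>i<n. r i *\<^sub>R f i)" by blast
    from step(1) obtain j where j: "j < n" "x = f j" by blast
    have "(\<Sum>i<n. (r i + (if i = j then k else 0)) *\<^sub>R f i) = y + (\<Sum>i<n. (if i = j then k *\<^sub>R f i else 0))"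
      unfolding r sum.distrib[symmetric] by (rule sum.cong) (auto simp: scaleR_add_left)
    also have "\<dots> = k *\<^sub>R x + y" using j by simp
    finally show ?case by metis
  qed
  then show thesis using that by blast
qed

text \<open>Near a point \<open>y0\<close> the connection form is obtained from its value at \<open>y0\<close> by
  transporting with the linear maps that carry a local frame adapted to the splitting at \<open>y0\<close>
  to the one at \<open>y\<close>.\<close>

lemma smooth_W:
  assumes c: "c \<in> Q"
  shows "smooth_on (snd c ` fst c) (\<lambda>y. W c y v)"
proof (rule smooth_on_local[OF thick_open[OF open_chart_image[OF Q c]]])
  fix y0 assume y0: "y0 \<in> snd c ` fst c"
  note p0 = chart_point[OF c y0]
  let ?q0 = "inv_chart c y0"
  obtain U n X where U: "openin (manifold_topology Q) U" "?q0 \<in> U"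
    and smX: "\<And>i. i < n \<Longrightarrow> smooth_map (open_submanifold Q U) (tangent_bundle Q) (\<lambda>y. (y, X i y))"
    and inj: "\<And>y. y \<in> U \<Longrightarrow> inj_on (\<lambda>i. X i y) {..<n::nat}"
    and ind: "\<And>y. y \<in> U \<Longrightarrow> independent ((\<lambda>i. X i y) ` {..<n})"
    and sp: "\<And>y. y \<in> U \<Longrightarrow> hor S y = span ((\<lambda>i. X i y) ` {..<n})"
    using horizontal_frame[OF p0(2)] by blast
  let ?N = "snd c ` (fst c \<inter> U)"
  have oN: "open ?N" using U(1)[unfolded openin_manifold_topology[OF Q]] c by (metis Int_commute)
  have N: "y \<in> snd c ` fst c" "inv_chart c y \<in> U" if "y \<in> ?N" for y using mem_chart_imageD[OF Q c that] .
  have y0N: "y0 \<in> ?N" using mem_chart_image[OF Q c, of y0 U] y0 U(2) by blast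
  have Xhor: "X i (inv_chart c y) \<in> hor S (inv_chart c y)" if "y \<in> ?N" "i < n" for y i
    unfolding sp[OF N(2)[OF that(1)]] by (rule span_base) (use that in blast)
  define F where "F i y = X i (inv_chart c y) c" for i y
  have smF: "smooth_on ?N (F i)" if i: "i < n" for i
  proof -
    let ?c = "restrict_chart U c"
    have Tc: "tangent_chart Q c \<in> tangent_bundle Q" using c by (simp add: tangent_bundle_def)
    have "fst ?c \<inter> (\<lambda>y. (y, X i y)) -` fst (tangent_chart Q c) = fst c \<inter> U"
    proof -
      have "X i x \<in> tangent_space Q x" if x: "x \<in> fst c" "x \<in> U" for x
      proof -
        have "x \<in> points Q" using x c by (auto simp: points_def)
        moreover have "X i x \<in> hor S x" unfolding sp[OF x(2)] by (rule span_base) (use i in blast)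
        ultimately show ?thesis by (rule hor_tangent)
      qed
      then show ?thesis by (auto simp: mem_tangent_chart)
    qed
    then have "smooth_on ?N (\<lambda>y. snd ((snd (tangent_chart Q c) \<circ> (\<lambda>y. (y, X i y)) \<circ> inv_chart ?c) y))"
      using smooth_on_snd[OF smooth_on_coordinate_map[OF smX[OF i] restrict_chart_in[OF c] Tc]] by simp
    then show ?thesis
      by (rule smooth_on_eq) (simp add: F_def tangent_chart_apply inv_restrict_chart[OF Q c])
  qed
  have comb: "(\<Sum>i<n. r i *\<^sub>R F i y) = (\<Sum>i<n. r i *\<^sub>R X i (inv_chart c y)) c" for r y
    by (induction n) (simp_all add: F_def scaleR_fun_apply)
  have combhor: "(\<Sum>i<n. r i *\<^sub>R X i (inv_chart c y)) \<in> hor S (inv_chart c y)" if "y \<in> ?N" for r y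
    using Xhor[OF that]
    by (intro subspace_sum[OF hor_subspace[OF chart_point(2)[OF c N(1)[OF that]]]]
        subspace_scale[OF hor_subspace[OF chart_point(2)[OF c N(1)[OF that]]]]) simp
  have Wcomb: "W c y (\<Sum>i<n. r i *\<^sub>R F i y) = 0" if y: "y \<in> ?N" for r y
    unfolding comb using W_hor[OF chart_point(1)[OF c N(1)[OF y]] combhor[OF y]] chart_point(3)[OF c N(1)[OF y]] by simp
  have indF: "r i = 0" if y: "y \<in> ?N" and z: "(\<Sum>i<n. r i *\<^sub>R F i y) = 0" and i: "i < n" for r y i
  proof -
    note p = chart_point[OF c N(1)[OF y]]
    have "(\<Sum>i<n. r i *\<^sub>R X i (inv_chart c y)) = 0"
      by (rule tangent_space_eqI[OF hor_tangent[OF p(2) combhor[OF y]] tangent_space_0[OF Q] p(1)])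
         (use z comb in simp)
    from frame_zero[OF inj[OF N(2)[OF y]] ind[OF N(2)[OF y]] this i] show ?thesis .
  qed
  have split: "\<exists>r. w = (\<Sum>i<n. r i *\<^sub>R F i y) + la.Z c y (W c y w)" if y: "y \<in> ?N" for w y
  proof -
    note p = chart_point[OF c N(1)[OF y]]
    let ?q = "inv_chart c y" and ?w = "tvec_of Q c (inv_chart c y) w"
    have wT: "?w \<in> tangent_space Q ?q" by (rule tvec_of_in[OF Q p(1)])
    from omega(2)[OF p(2) wT] obtain r where r: "?w - fundamental_field S (omega S (?q, ?w)) ?q = (\<Sum>i<n. r i *\<^sub>R X i ?q)"
      unfolding sp[OF N(2)[OF y]] by (rule frame_span)
    have "(?w - fundamental_field S (omega S (?q, ?w)) ?q) c = (\<Sum>i<n. r i *\<^sub>R F i y)"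
      unfolding r comb ..
    moreover have "fundamental_field S (omega S (?q, ?w)) ?q c = la.Z c y (W c y w)"
      using fundamental_field_chart[OF omega(1)[OF p(2) wT] p(1)] by (simp add: p(3) W_def)
    ultimately have "w = (\<Sum>i<n. r i *\<^sub>R F i y) + la.Z c y (W c y w)"
      using tvec_of_same[OF Q p(1), of w] by (simp add: algebra_simps)
    then show ?thesis by blast
  qed
  \<comment> \<open>Coefficients of \<open>w\<close> in the frame at \<open>y0\<close>. They are
    picked by \<open>SOME\<close>, but \<open>uniq\<close> shows that they are determined, and hence
    linear in \<open>w\<close>.\<close>
  define \<gamma> where "\<gamma> w = (SOME r. w = (\<Sum>i<n. r i *\<^sub>R F i y0) + la.Z c y0 (W c y0 w))" for w
  have \<gamma>: "w = (\<Sum>i<n. \<gamma> w i *\<^sub>R F i y0) + la.Z c y0 (W c y0 w)" for w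
    unfolding \<gamma>_def by (rule someI_ex[OF split[OF y0N]])
  note linZ = la.linear_Z[OF c] and linW = linear_W[OF c]
  have uniq: "\<gamma> w i = r i" if "w = (\<Sum>i<n. r i *\<^sub>R F i y0) + la.Z c y0 k" "i < n" for w r i k
  proof -
    have "W c y0 w = k"
      unfolding that(1) by (simp add: linear_add[OF linW[OF y0]] Wcomb[OF y0N] W_Z[OF c y0])
    then have "(\<Sum>i<n. \<gamma> w i *\<^sub>R F i y0) = (\<Sum>i<n. r i *\<^sub>R F i y0)" using \<gamma>[of w] that(1) by (metis add_right_cancel)
    then have "(\<Sum>i<n. (\<gamma> w i - r i) *\<^sub>R F i y0) = 0" by (simp add: scaleR_diff_left sum_subtractf)
    from indF[OF y0N this that(2)] show ?thesis by simp
  qed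
  have \<gamma>add: "\<gamma> (v + w) i = \<gamma> v i + \<gamma> w i" if "i < n" for v w i
  proof (rule uniq[OF _ that])
    show "v + w = (\<Sum>i<n. (\<gamma> v i + \<gamma> w i) *\<^sub>R F i y0) + la.Z c y0 (W c y0 v + W c y0 w)"
      using \<gamma>[of v] \<gamma>[of w] by (simp add: scaleR_add_left sum.distrib linear_add[OF linZ[OF y0]] algebra_simps)
  qed
  have \<gamma>scale: "\<gamma> (s *\<^sub>R v) i = s * \<gamma> v i" if "i < n" for s v i
  proof (rule uniq[OF _ that])
    have "s *\<^sub>R v = s *\<^sub>R ((\<Sum>i<n. \<gamma> v i *\<^sub>R F i y0) + la.Z c y0 (W c y0 v))" using \<gamma>[of v] by simp
    then show "s *\<^sub>R v = (\<Sum>i<n. (s * \<gamma> v i) *\<^sub>R F i y0) + la.Z c y0 (s *\<^sub>R W c y0 v)"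
      by (simp only: scaleR_add_right scaleR_sum_right scaleR_scaleR linear_scale[OF linZ[OF y0]])
  qed
  \<comment> \<open>Takes the coefficients of \<open>v\<close> in the adapted frame at
    \<open>y0\<close> and reuses them in the frame at \<open>y\<close>; this preserves the value of
    the connection form.\<close>
  define T where "T y v = (\<Sum>i<n. \<gamma> v i *\<^sub>R F i y) + la.Z c y (W c y0 v)" for y v
  have linT: "linear (T y)" if y: "y \<in> ?N" for y
  proof (rule linearI)
    show "T y (v + w) = T y v + T y w" for v w
    proof -
      have "(\<Sum>i<n. \<gamma> (v + w) i *\<^sub>R F i y) = (\<Sum>i<n. \<gamma> v i *\<^sub>R F i y) + (\<Sum>i<n. \<gamma> w i *\<^sub>R F i y)"
        unfolding sum.distrib[symmetric] by (rule sum.cong) (simp_all add: \<gamma>add scaleR_add_left)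
      then show ?thesis by (simp add: T_def linear_add[OF linW[OF y0]] linear_add[OF linZ[OF N(1)[OF y]]])
    qed
    show "T y (s *\<^sub>R v) = s *\<^sub>R T y v" for s v
    proof -
      have "(\<Sum>i<n. \<gamma> (s *\<^sub>R v) i *\<^sub>R F i y) = s *\<^sub>R (\<Sum>i<n. \<gamma> v i *\<^sub>R F i y)"
        unfolding scaleR_sum_right by (rule sum.cong) (simp_all add: \<gamma>scale)
      then show ?thesis by (simp add: T_def linear_scale[OF linW[OF y0]] linear_scale[OF linZ[OF N(1)[OF y]]] scaleR_add_right)
    qed
  qed
  have WT: "W c y (T y v) = W c y0 v" if y: "y \<in> ?N" for y v
    by (simp add: T_def linear_add[OF linW[OF N(1)[OF y]]] Wcomb[OF y] W_Z[OF c N(1)[OF y]])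
  have injT: "v = 0" if y: "y \<in> ?N" and z: "T y v = 0" for y v
  proof -
    have w0: "W c y0 v = 0" using WT[OF y, of v] z linear_0[OF linW[OF N(1)[OF y]]] by simp
    then have "(\<Sum>i<n. \<gamma> v i *\<^sub>R F i y) = 0" using z by (simp add: T_def linear_0[OF linZ[OF N(1)[OF y]]])
    from indF[OF y this] have "\<gamma> v i = 0" if "i < n" for i using that .
    then show "v = 0" using \<gamma>[of v] w0 by (simp add: linear_0[OF linZ[OF y0]])
  qed
  have bij: "bij (T y)" if y: "y \<in> ?N" for y
  proof (rule bijI)
    show "inj (T y)" unfolding linear_injective_0[OF linT[OF y]] using injT[OF y] by blast
    show "surj (T y)"
      unfolding surj_def
    proof
      fix w
      obtain r where r: "w = (\<Sum>i<n. r i *\<^sub>R F i y) + la.Z c y (W c y w)" using split[OF y] by blast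
      let ?v = "(\<Sum>i<n. r i *\<^sub>R F i y0) + la.Z c y0 (W c y w)"
      have "W c y0 ?v = W c y w" by (simp add: linear_add[OF linW[OF y0]] Wcomb[OF y0N] W_Z[OF c y0])
      moreover have "(\<Sum>i<n. \<gamma> ?v i *\<^sub>R F i y) = (\<Sum>i<n. r i *\<^sub>R F i y)"
        by (rule sum.cong) (simp_all add: uniq[OF refl])
      ultimately have "T y ?v = w" using r by (simp only: T_def)
      then show "\<exists>v. w = T y v" by metis
    qed
  qed
  have smT: "smooth_on ?N (\<lambda>y. T y v)" for v
    unfolding T_def
  proof (rule smooth_on_add[OF smooth_on_sum smooth_on_subset[OF la.smooth_Z[OF c]]])
    show "smooth_on ?N (\<lambda>y. \<gamma> v i *\<^sub>R F i y)" if "i \<in> {..<n}" for i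
      by (rule smooth_on_scaleR[OF smooth_on_const smF]) (use that in simp)
  qed blast
  \<comment> \<open>\<open>W c y\<close> is the fixed linear map \<open>W c y0\<close> after the
    inverse of \<open>T y\<close>, so its smoothness is that of an inverse family.\<close>
  have "smooth_on ?N (\<lambda>y. inv_into UNIV (T y) v)"
    by (rule smooth_on_inverse_family[OF thick_open[OF oN] linT _ _ smT])
       (simp_all add: inv_f_f[OF bij_is_inj[OF bij]] surj_f_inv_f[OF bij_is_surj[OF bij]])
  then have "smooth_on ?N (\<lambda>y. W c y0 (inv_into UNIV (T y) v))"
    by (rule smooth_on_compose_linear[OF linear_imp_bounded_linear[OF linW[OF y0]]])
  then have "smooth_on ?N (\<lambda>y. W c y v)"
  proof (rule smooth_on_eq)
    fix y assume y: "y \<in> ?N"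
    show "W c y v = W c y0 (inv_into UNIV (T y) v)"
      using WT[OF y, of "inv_into UNIV (T y) v"] by (simp add: surj_f_inv_f[OF bij_is_surj[OF bij[OF y]]])
  qed
  moreover have "openin (top_of_set (snd c ` fst c)) ?N" by (rule open_subset[OF _ oN]) blast
  ultimately show "\<exists>T. openin (top_of_set (snd c ` fst c)) T \<and> y0 \<in> T \<and> smooth_on T (\<lambda>y. W c y v)" using y0N by blast
qed

subsection \<open>Horizontal lifts\<close>

text \<open>The horizontal lift in coordinates, as the inverse of the splitting map on pairs with
  vanishing connection form.\<close>

definition H :: "('q, 'e) chart \<Rightarrow> ('m, 'f) chart \<Rightarrow> 'e \<Rightarrow> 'f \<Rightarrow> 'e"
  where "H c d y u = inv_into UNIV (\<lambda>v. (P c d y v, W c y v)) (u, 0)"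

text \<open>\<open>P\<close> is onto with kernel the range of \<open>Z\<close>, and \<open>W\<close>
  inverts \<open>Z\<close>; so the two together are linear coordinates on each tangent
  space.\<close>

lemma bij_splitting:
  assumes c: "c \<in> Q" and d: "d \<in> M" and y: "y \<in> Ud c d"
  shows "bij (\<lambda>v. (P c d y v, W c y v))" "linear (\<lambda>v. (P c d y v, W c y v))"
proof -
  note y' = UdD[OF c y]
  note p = chart_point[OF c y'(1)]
  have d': "d \<in> charts_at M (\<pi> (inv_chart c y))" using d y'(2) by (simp add: mem_charts_at)
  note linP = linear_P[OF c d y] and linW = linear_W[OF c y'(1)]
  show lin: "linear (\<lambda>v. (P c d y v, W c y v))"
    by (rule linearI) (simp_all add: linear_add[OF linP] linear_add[OF linW] linear_scale[OF linP] linear_scale[OF linW])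
  note v = vertical_coordinates[OF p(1) d', unfolded p(3)]
  show "bij (\<lambda>v. (P c d y v, W c y v))"
  proof (rule bijI)
    show "inj (\<lambda>v. (P c d y v, W c y v))"
      unfolding linear_injective_0[OF lin]
    proof (intro allI impI)
      fix w assume "(P c d y w, W c y w) = 0"
      then have z: "P c d y w = 0" "W c y w = 0" by (simp_all add: zero_prod_def)
      from v(2)[OF z(1)] obtain k where k: "w = la.Z c y k" by blast
      then have "k = 0" using z(2) W_Z[OF c y'(1)] by simp
      then show "w = 0" using k linear_0[OF la.linear_Z[OF c y'(1)]] by simp
    qed
    show "surj (\<lambda>v. (P c d y v, W c y v))"
      unfolding surj_def
    proof
      fix x :: "'f \<times> 'k"
      obtain w where w: "P c d y w = fst x" using v(4) by blast
      let ?v = "w + la.Z c y (snd x - W c y w)"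
      have "(P c d y ?v, W c y ?v) = x"
        by (simp add: linear_add[OF linP] linear_add[OF linW] w v(1) W_Z[OF c y'(1)])
      then show "\<exists>v. x = (P c d y v, W c y v)" by metis
    qed
  qed
qed

lemma H:
  assumes c: "c \<in> Q" and d: "d \<in> M" and y: "y \<in> Ud c d"
  shows P_H: "P c d y (H c d y u) = u" and W_H: "W c y (H c d y u) = 0"
    and H_unique: "P c d y v = u \<Longrightarrow> W c y v = 0 \<Longrightarrow> v = H c d y u"
    and linear_H: "linear (H c d y)"
proof -
  note b = bij_splitting[OF assms]
  let ?T = "\<lambda>v. (P c d y v, W c y v)"
  have T: "?T (H c d y u) = (u, 0)" for u unfolding H_def by (rule surj_f_inv_f[OF bij_is_surj[OF b(1)]])
  then show PH: "P c d y (H c d y u) = u" and WH: "W c y (H c d y u) = 0" for u by simp_all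
  show un: "v = H c d y u" if "P c d y v = u" "W c y v = 0" for v u
    by (rule injD[OF bij_is_inj[OF b(1)]]) (use that T in simp)
  note linP = linear_P[OF c d y] and linW = linear_W[OF c UdD(1)[OF c y]]
  show "linear (H c d y)"
  proof (rule linearI)
    show "H c d y (u + w) = H c d y u + H c d y w" for u w
      by (rule un[symmetric]) (simp_all add: linear_add[OF linP] linear_add[OF linW] PH WH)
    show "H c d y (r *\<^sub>R u) = r *\<^sub>R H c d y u" for r u
      by (rule un[symmetric]) (simp_all add: linear_scale[OF linP] linear_scale[OF linW] PH WH)
  qed
qed

text \<open>\<open>P\<close> and \<open>W\<close> form a smooth family of invertible maps, so the
  inverse family is smooth as well.\<close>

lemma smooth_H:
  assumes c: "c \<in> Q" and d: "d \<in> M"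
  shows "smooth_on (Ud c d) (\<lambda>y. H c d y u)"
  unfolding H_def
proof (rule smooth_on_inverse_family[OF thick_open[OF open_Ud[OF c d]] bij_splitting(2)[OF c d]])
  fix y assume y: "y \<in> Ud c d"
  note b = bij_splitting(1)[OF c d y]
  show "inv_into UNIV (\<lambda>v. (P c d y v, W c y v)) (P c d y v, W c y v) = v" for v
    using inv_f_f[OF bij_is_inj[OF b], of v] .
  show "(P c d y (inv_into UNIV (\<lambda>v. (P c d y v, W c y v)) w), W c y (inv_into UNIV (\<lambda>v. (P c d y v, W c y v)) w)) = w" for w
    using surj_f_inv_f[OF bij_is_surj[OF b], of w] .
next
  show "smooth_on (Ud c d) (\<lambda>y. (P c d y v, W c y v))" for v
    by (rule smooth_on_Pair[OF smooth_on_frechet_derivative_open[OF smooth_pr[OF c d] open_Ud[OF c d]]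
        smooth_on_subset[OF smooth_W[OF c]]]) blast
qed

text \<open>The vector with coordinates \<open>H\<close> is horizontal and projects to
  \<open>X\<close>, and injectivity of the splitting makes it the only one; so the definite
  description in \<open>hlift\<close> denotes it.\<close>

lemma hlift:
  assumes c: "c \<in> charts_at Q q" and d: "d \<in> charts_at M (\<pi> q)" and X: "X \<in> tangent_space M (\<pi> q)"
  shows hlift_chart: "hlift S q X c = H c d (snd c q) (X d)"
    and hlift_hor: "hlift S q X \<in> hor S q" and hlift_proj: "proj_vec S (q, hlift S q X) = X"
proof -
  have cd: "c \<in> Q" "q \<in> fst c" "d \<in> M" "\<pi> q \<in> fst d" using c d by (simp_all add: mem_charts_at)
  note q = points_charts_at[OF c]
  note H' = H[OF cd(1,3) UdI[OF cd(2,4)]]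
  define v where "v = tvec_of Q c q (H c d (snd c q) (X d))"
  have v: "v \<in> tangent_space Q q" "v c = H c d (snd c q) (X d)"
    unfolding v_def by (rule tvec_of_in[OF Q c], rule tvec_of_same[OF Q c])
  have vh: "v \<in> hor S q" by (rule hor_W[OF c v(1)]) (simp add: v(2) H'(2))
  have vp: "proj_vec S (q, v) = X"
    by (rule tangent_space_eqI[OF proj_vec_in[OF q v(1)] X d]) (simp add: proj_vec_chart[OF c d v(1)] v(2) H'(1))
  have "hlift S q X = v"
    unfolding hlift_def
  proof (rule the_equality)
    show "v \<in> hor S q \<and> proj_vec S (q, v) = X" using vh vp by blast
    fix w assume w: "w \<in> hor S q \<and> proj_vec S (q, w) = X"
    then have wT: "w \<in> tangent_space Q q" using hor_tangent[OF q] by blast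
    have "w c = H c d (snd c q) (X d)"
    proof (rule H'(3))
      show "P c d (snd c q) (w c) = X d" using w proj_vec_chart[OF c d wT] by simp
      show "W c (snd c q) (w c) = 0" using W_hor[OF c] w by blast
    qed
    then show "w = v" using tangent_space_eqI[OF wT v(1) c] v(2) by simp
  qed
  then show "hlift S q X c = H c d (snd c q) (X d)" "hlift S q X \<in> hor S q" "proj_vec S (q, hlift S q X) = X"
    using v vh vp by simp_all
qed

end

section \<open>Curvature\<close>

text \<open>The product rule applied to a constant function. It trades the derivative of a field for
  the derivative of a form that is constant on it, as \<open>W\<close> is on lifts and on
  fundamental fields.\<close>

lemma derivative_of_constant_pairing:
  fixes A :: "'a::real_normed_vector \<Rightarrow> 'b::fin_dim_inner \<Rightarrow> 'c::real_normed_vector"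
  assumes o: "open S" and x: "x \<in> S" and lin: "\<And>y. y \<in> S \<Longrightarrow> linear (A y)"
    and sA: "\<And>v. smooth_on S (\<lambda>y. A y v)" and sg: "smooth_on S g" and const: "\<And>y. y \<in> S \<Longrightarrow> A y (g y) = k"
  shows "frechet_derivative (\<lambda>y. A y (g x)) (at x) h + A x (frechet_derivative g (at x) h) = 0"
proof -
  have "((\<lambda>y. A y (g y)) has_derivative (\<lambda>h. frechet_derivative (\<lambda>y. A y (g x)) (at x) h
      + A x (frechet_derivative g (at x) h))) (at x within S)"
  proof (rule has_derivative_apply[where f="\<lambda>y. y" and S=S and f'="\<lambda>h. h" and
        A'="\<lambda>u b. frechet_derivative (\<lambda>y. A y b) (at x) u", OF thick_open[OF o] lin])
    show "((\<lambda>y. A y b) has_derivative (\<lambda>u. frechet_derivative (\<lambda>y. A y b) (at x) u)) (at x within S)" for b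
      by (rule has_derivative_at_withinI[OF smooth_on_has_derivative_open[OF sA o x]])
    show "(g has_derivative frechet_derivative g (at x)) (at x within S)"
      by (rule has_derivative_at_withinI[OF smooth_on_has_derivative_open[OF sg o x]])
  qed (use x in auto)
  moreover have "((\<lambda>y. A y (g y)) has_derivative (\<lambda>h. 0)) (at x within S)"
    by (rule has_derivative_transform[OF x const has_derivative_const])
  ultimately have "(\<lambda>h. frechet_derivative (\<lambda>y. A y (g x)) (at x) h + A x (frechet_derivative g (at x) h)) = (\<lambda>h. 0)"
    by (rule thick_unique[OF thick_open[OF o] x])
  from fun_cong[OF this] show ?thesis .
qed

context chaplygin_bundle
begin

text \<open>In a chart, \<open>Om c y u v\<close> is \<open>d\<omega>(v, u)\<close>.\<close>

definition Om :: "('q, 'e) chart \<Rightarrow> 'e \<Rightarrow> 'e \<Rightarrow> 'e \<Rightarrow> 'k"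
  where "Om c y u v = frechet_derivative (\<lambda>y. W c y u) (at y) v - frechet_derivative (\<lambda>y. W c y v) (at y) u"

text \<open>In the formula for \<open>d\<omega>\<close> on two fields the terms that differentiate
  \<open>\<omega>\<close> of a field vanish, since \<open>\<omega>\<close> is constant on each of
  them. The bracket term remains.\<close>

lemma W_bracket:
  assumes c: "c \<in> charts_at Q q" and F1: "smooth_field Q F1" and F2: "smooth_field Q F2"
    and k1: "\<And>y. y \<in> snd c ` fst c \<Longrightarrow> W c y (F1 (inv_chart c y) c) = k1"
    and k2: "\<And>y. y \<in> snd c ` fst c \<Longrightarrow> W c y (F2 (inv_chart c y) c) = k2"
  shows "W c (snd c q) (lie_bracket Q F1 F2 q c) = Om c (snd c q) (F1 q c) (F2 q c)"
proof -
  have cQ: "c \<in> Q" "q \<in> fst c" using c by (simp_all add: mem_charts_at)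
  have y: "snd c q \<in> snd c ` fst c" using cQ by blast
  have i: "inv_chart c (snd c q) = q" by (rule inv_chart_chart[OF Q cQ])
  note lin = linear_W[OF cQ(1)] and s = smooth_W[OF cQ(1)] and o = open_chart_image[OF Q cQ(1)]
  note d1 = derivative_of_constant_pairing[OF o y lin s smooth_fieldD(2)[OF F1 cQ(1)] k1, unfolded i]
  note d2 = derivative_of_constant_pairing[OF o y lin s smooth_fieldD(2)[OF F2 cQ(1)] k2, unfolded i]
  show ?thesis
    unfolding lie_bracket_def if_P[OF c] linear_diff[OF lin[OF y]] Om_def
    using d1[of "F2 q c"] d2[of "F1 q c"] by (simp add: add_eq_0_iff algebra_simps)
qed

lemma smooth_field_fundamental:
  assumes a: "a \<in> lie_alg S"
  shows "smooth_field Q (fundamental_field S a)"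
  unfolding smooth_field_def
proof (intro conjI ballI)
  show "fundamental_field S a x \<in> tangent_space Q x" if "x \<in> points Q" for x
    by (rule fundamental_field_in[OF a that])
  fix c assume c: "c \<in> Q"
  show "smooth_on (snd c ` fst c) (\<lambda>u. fundamental_field S a (inv_chart c u) c)"
    by (rule smooth_on_eq[OF la.smooth_Z[OF c, of "a c0"]])
       (simp add: fundamental_field_chart[OF a chart_point(1)[OF c]] chart_point(3)[OF c])
qed

lemma hlift_in:
  assumes q: "q \<in> points Q" and X: "X \<in> tangent_space M (\<pi> q)"
  shows "hlift S q X \<in> hor S q" "hlift S q X \<in> tangent_space Q q"
proof -
  obtain c where c: "c \<in> charts_at Q q" using charts_at_nonempty[OF q] by blast
  obtain d where d: "d \<in> charts_at M (\<pi> q)" using charts_at_nonempty[OF proj_points[OF q]] by blast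
  show "hlift S q X \<in> hor S q" by (rule hlift_hor[OF c d X])
  then show "hlift S q X \<in> tangent_space Q q" by (rule hor_tangent[OF q])
qed

text \<open>In charts the lifted field is \<open>H\<close> applied to the coordinates of
  \<open>X\<close> at the projected point. The chart of the base changes from point to point, so the
  argument is local.\<close>

lemma smooth_field_hlift:
  assumes X: "smooth_field M X"
  shows "smooth_field Q (hlift_field S X)"
  unfolding smooth_field_def
proof (intro conjI ballI)
  have XT: "X (\<pi> q) \<in> tangent_space M (\<pi> q)" if "q \<in> points Q" for q
    by (rule smooth_fieldD(1)[OF X proj_points[OF that]])
  show "hlift S x (X (\<pi> x)) \<in> tangent_space Q x" if "x \<in> points Q" for x
    by (rule hlift_in(2)[OF that XT[OF that]])
  fix c assume c: "c \<in> Q"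
  show "smooth_on (snd c ` fst c) (\<lambda>u. hlift S (inv_chart c u) (X (\<pi> (inv_chart c u))) c)"
  proof (rule smooth_on_local[OF thick_open[OF open_chart_image[OF Q c]]])
    fix y0 assume y0: "y0 \<in> snd c ` fst c"
    obtain d where "d \<in> charts_at M (\<pi> (inv_chart c y0))"
      using charts_at_nonempty[OF proj_points[OF chart_point(2)[OF c y0]]] by blast
    then have d: "d \<in> M" "\<pi> (inv_chart c y0) \<in> fst d" by (simp_all add: mem_charts_at)
    have y0U: "y0 \<in> Ud c d" using mem_chart_image[OF Q c, of y0 "\<pi> -` fst d"] y0 d(2) by simp
    have "smooth_on (Ud c d) (\<lambda>y. X (inv_chart d (pr c d y)) d)"
      by (rule smooth_on_compose[OF smooth_fieldD(2)[OF X d(1)] smooth_pr[OF c d(1)]])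
         (unfold o_apply, rule imageI, erule UdD(2)[OF c])
    from smooth_on_apply[where A="H c d", OF smooth_H[OF c d(1)] this linear_H[OF c d(1)]]
    have "smooth_on (Ud c d) (\<lambda>u. hlift S (inv_chart c u) (X (\<pi> (inv_chart c u))) c)"
    proof (rule smooth_on_eq)
      fix y assume y: "y \<in> Ud c d"
      note y' = UdD[OF c y]
      note p = chart_point[OF c y'(1)]
      have d': "d \<in> charts_at M (\<pi> (inv_chart c y))" using d y'(2) by (simp add: mem_charts_at)
      show "hlift S (inv_chart c y) (X (\<pi> (inv_chart c y))) c = H c d y (X (inv_chart d (pr c d y)) d)"
        using hlift_chart[OF p(1) d' XT[OF p(2)]] by (simp add: p(3) inv_chart_chart[OF M d(1) y'(2)])
    qed
    moreover have "openin (top_of_set (snd c ` fst c)) (Ud c d)" by (rule open_subset[OF _ open_Ud[OF c d(1)]]) blast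
    ultimately show "\<exists>T. openin (top_of_set (snd c ` fst c)) T \<and> y0 \<in> T \<and>
        smooth_on T (\<lambda>u. hlift S (inv_chart c u) (X (\<pi> (inv_chart c u))) c)" using y0U by blast
  qed
qed

lemma W_hlift_field:
  assumes X: "smooth_field M X" and c: "c \<in> Q" and y: "y \<in> snd c ` fst c"
  shows "W c y (hlift S (inv_chart c y) (X (\<pi> (inv_chart c y))) c) = 0"
  using W_hor[OF chart_point(1)[OF c y] hlift_in(1)[OF chart_point(2)[OF c y]
      smooth_fieldD(1)[OF X proj_points[OF chart_point(2)[OF c y]]]]]
  by (simp add: chart_point(3)[OF c y])

lemma W_fundamental:
  assumes a: "a \<in> lie_alg S" and c: "c \<in> Q" and y: "y \<in> snd c ` fst c"
  shows "W c y (fundamental_field S a (inv_chart c y) c) = a c0"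
  using fundamental_field_chart[OF a chart_point(1)[OF c y]] by (simp add: chart_point(3)[OF c y] W_Z[OF c y])

text \<open>The bracket is evaluated by \<open>W_bracket\<close>, whose result depends on the
  extensions only through their values at \<open>q\<close>; hence the definite description
  denotes.\<close>

lemma curvature_chart:
  assumes c: "c \<in> charts_at Q q" and X: "X \<in> tangent_space M (\<pi> q)" and Y: "Y \<in> tangent_space M (\<pi> q)"
  shows "curvature S q X Y = lie_vec (Om c (snd c q) (hlift S q X c) (hlift S q Y c))"
proof -
  have cQ: "c \<in> Q" using c by (simp add: mem_charts_at)
  note q = points_charts_at[OF c]
  have val: "omega S (q, lie_bracket Q (hlift_field S X') (hlift_field S Y') q - hlift_field S (lie_bracket M X' Y') q)
      = lie_vec (Om c (snd c q) (hlift S q X c) (hlift S q Y c))"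
    if ext: "smooth_vector_field M X'" "X' (\<pi> q) = X" "smooth_vector_field M Y'" "Y' (\<pi> q) = Y" for X' Y'
  proof -
    note sX = smooth_vector_field_imp_smooth_field[OF ext(1)] and sY = smooth_vector_field_imp_smooth_field[OF ext(3)]
    note hX = smooth_field_hlift[OF sX] and hY = smooth_field_hlift[OF sY]
    let ?br = "lie_bracket Q (hlift_field S X') (hlift_field S Y') q" and ?hl = "hlift_field S (lie_bracket M X' Y') q"
    have br: "?br \<in> tangent_space Q q" by (rule lie_bracket_in[OF Q hX hY])
    note hl = hlift_in[OF q lie_bracket_in[OF M sX sY]]
    have y: "snd c q \<in> snd c ` fst c" using c by (auto simp: mem_charts_at)
    have Wbr: "W c (snd c q) (?br c) = Om c (snd c q) (hlift S q X c) (hlift S q Y c)"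
      using W_bracket[OF c hX hY W_hlift_field[OF sX cQ] W_hlift_field[OF sY cQ]] by (simp add: ext)
    have Whl: "W c (snd c q) (?hl c) = 0" by (rule W_hor[OF c hl(1)])
    have d: "?br - ?hl \<in> tangent_space Q q" by (rule tangent_space_diff[OF Q br hl(2)])
    have "omega S (q, ?br - ?hl) c0 = W c (snd c q) (?br c - ?hl c)"
      using omega_chart[OF c d] by simp
    also have "\<dots> = Om c (snd c q) (hlift S q X c) (hlift S q Y c)"
      by (simp only: linear_diff[OF linear_W[OF cQ y]] Wbr Whl diff_0_right)
    finally show ?thesis
      by (intro lie_alg_eqI[OF omega(1)[OF q d] lie_vec(1)]) (simp only: lie_vec(2))
  qed
  obtain X' where X': "smooth_vector_field M X'" "X' (\<pi> q) = X"
    using vector_field_extension[OF mfM proj_points[OF q] X] by blast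
  obtain Y' where Y': "smooth_vector_field M Y'" "Y' (\<pi> q) = Y"
    using vector_field_extension[OF mfM proj_points[OF q] Y] by blast
  show ?thesis
    unfolding curvature_def
  proof (rule the_equality)
    show "\<exists>X' Y'. smooth_vector_field M X' \<and> X' (\<pi> q) = X \<and> smooth_vector_field M Y' \<and> Y' (\<pi> q) = Y \<and>
      lie_vec (Om c (snd c q) (hlift S q X c) (hlift S q Y c)) =
      omega S (q, lie_bracket Q (hlift_field S X') (hlift_field S Y') q - hlift_field S (lie_bracket M X' Y') q)"
      by (intro exI[of _ X'] exI[of _ Y'] conjI X' Y' val[OF X' Y', symmetric])
  next
    fix r
    assume "\<exists>X' Y'. smooth_vector_field M X' \<and> X' (\<pi> q) = X \<and> smooth_vector_field M Y' \<and> Y' (\<pi> q) = Y \<and>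
      r = omega S (q, lie_bracket Q (hlift_field S X') (hlift_field S Y') q - hlift_field S (lie_bracket M X' Y') q)"
    then obtain X' Y' where "smooth_vector_field M X'" "X' (\<pi> q) = X" "smooth_vector_field M Y'" "Y' (\<pi> q) = Y"
      and r: "r = omega S (q, lie_bracket Q (hlift_field S X') (hlift_field S Y') q - hlift_field S (lie_bracket M X' Y') q)"
      by (elim exE conjE)
    from val[OF this(1-4)] show "r = lie_vec (Om c (snd c q) (hlift S q X c) (hlift S q Y c))" unfolding r .
  qed
qed

text \<open>As for the curvature, with a fundamental second field: \<open>\<omega>\<close> is the
  constant \<open>a\<close> on it, so \<open>W_bracket\<close> applies again.\<close>

lemma B_map_chart:
  assumes c: "c \<in> charts_at Q q" and X: "X \<in> tangent_space M (\<pi> q)" and a: "a \<in> lie_alg S"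
  shows "B_map S q X a = lie_vec (Om c (snd c q) (hlift S q X c) (fundamental_field S a q c))"
proof -
  have cQ: "c \<in> Q" using c by (simp add: mem_charts_at)
  note q = points_charts_at[OF c]
  have val: "omega S (q, lie_bracket Q (hlift_field S X') (fundamental_field S a) q)
      = lie_vec (Om c (snd c q) (hlift S q X c) (fundamental_field S a q c))"
    if ext: "smooth_vector_field M X'" "X' (\<pi> q) = X" for X'
  proof -
    note sX = smooth_vector_field_imp_smooth_field[OF ext(1)]
    note hX = smooth_field_hlift[OF sX] and fa = smooth_field_fundamental[OF a]
    let ?br = "lie_bracket Q (hlift_field S X') (fundamental_field S a) q"
    have br: "?br \<in> tangent_space Q q" by (rule lie_bracket_in[OF Q hX fa])
    have "omega S (q, ?br) c0 = Om c (snd c q) (hlift S q X c) (fundamental_field S a q c)"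
      using omega_chart[OF c br] W_bracket[OF c hX fa W_hlift_field[OF sX cQ] W_fundamental[OF a cQ]] by (simp add: ext)
    then show ?thesis by (intro lie_alg_eqI[OF omega(1)[OF q br] lie_vec(1)]) (simp only: lie_vec(2))
  qed
  obtain X' where X': "smooth_vector_field M X'" "X' (\<pi> q) = X"
    using vector_field_extension[OF mfM proj_points[OF q] X] by blast
  show ?thesis
    unfolding B_map_def
  proof (rule the_equality)
    show "\<exists>X'. smooth_vector_field M X' \<and> X' (\<pi> q) = X \<and>
      lie_vec (Om c (snd c q) (hlift S q X c) (fundamental_field S a q c)) =
      omega S (q, lie_bracket Q (hlift_field S X') (fundamental_field S a) q)"
      by (intro exI[of _ X'] conjI X' val[OF X', symmetric])
  next
    fix r
    assume "\<exists>X'. smooth_vector_field M X' \<and> X' (\<pi> q) = X \<and>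
      r = omega S (q, lie_bracket Q (hlift_field S X') (fundamental_field S a) q)"
    then obtain X' where "smooth_vector_field M X'" "X' (\<pi> q) = X"
      and r: "r = omega S (q, lie_bracket Q (hlift_field S X') (fundamental_field S a) q)"
      by (elim exE conjE)
    from val[OF this(1-2)] show "r = lie_vec (Om c (snd c q) (hlift S q X c) (fundamental_field S a q c))" unfolding r .
  qed
qed

text \<open>The directional derivative of \<open>W c y u\<close> is linear in \<open>u\<close> too,
  so the vector, the direction and the base point may all vary with the parameter.\<close>

lemma smooth_DW:
  assumes c: "c \<in> Q" and f: "smooth_on T f" "\<And>s. s \<in> T \<Longrightarrow> f s \<in> snd c ` fst c"
    and u: "smooth_on T u" and h: "smooth_on T h"
  shows "smooth_on T (\<lambda>s. frechet_derivative (\<lambda>y. W c y (u s)) (at (f s)) (h s))"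
proof (rule smooth_on_apply[where A="\<lambda>s w. frechet_derivative (\<lambda>y. W c y w) (at (f s)) (h s)", OF _ u])
  note o = open_chart_image[OF Q c]
  show "smooth_on T (\<lambda>s. frechet_derivative (\<lambda>y. W c y b) (at (f s)) (h s))" for b
    by (rule smooth_on_frechet_derivative_apply[OF smooth_W[OF c] o f(1) h f(2)])
  show "linear (\<lambda>w. frechet_derivative (\<lambda>y. W c y w) (at (f s)) (h s))" if "s \<in> T" for s
    by (rule derivative_family_linear[where A="W c", OF thick_open[OF o] f(2)[OF that] linear_W[OF c]])
       (assumption, rule has_derivative_at_withinI[OF smooth_on_has_derivative_open[OF smooth_W[OF c] o f(2)[OF that]]])
qed

lemma smooth_Om:
  assumes "c \<in> Q" "smooth_on T f" "\<And>s. s \<in> T \<Longrightarrow> f s \<in> snd c ` fst c" "smooth_on T u" "smooth_on T v"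
  shows "smooth_on T (\<lambda>s. Om c (f s) (u s) (v s))"
  unfolding Om_def
  by (rule smooth_on_minus[OF smooth_DW[OF assms(1,2,3,4,5)] smooth_DW[OF assms(1,2,3,5,4)]])

lemma Om_scaleR:
  assumes c: "c \<in> Q" and y: "y \<in> snd c ` fst c"
  shows "Om c y u (r *\<^sub>R v) = r *\<^sub>R Om c y u v"
proof -
  note o = open_chart_image[OF Q c]
  have 1: "linear (\<lambda>h. frechet_derivative (\<lambda>y. W c y u) (at y) h)"
    by (rule linear_frechet_derivative_smooth[OF smooth_W[OF c] o y])
  have 2: "linear (\<lambda>w. frechet_derivative (\<lambda>y. W c y w) (at y) u)"
    by (rule derivative_family_linear[where A="W c", OF thick_open[OF o] y linear_W[OF c]])
       (assumption, rule has_derivative_at_withinI[OF smooth_on_has_derivative_open[OF smooth_W[OF c] o y]])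
  show ?thesis by (simp add: Om_def linear_scale[OF 1] linear_scale[OF 2] scaleR_diff_right)
qed

text \<open>The bracket of a horizontal lift and a fundamental field is vertical.  This turns the
  variation generated by a fundamental field into the derivative of the horizontal lift along the
  orbit (whence \<open>HL\<close>) plus a vertical vector (whence \<open>FL\<close> and \<open>\<B>\<close>).\<close>

lemma lift_vs_generator:
  assumes c: "c \<in> Q" and d: "d \<in> M" and y: "y \<in> Ud c d" and v: "v = H c d y u"
  shows "frechet_derivative (\<lambda>y. la.Z c y k) (at y) v =
    frechet_derivative (\<lambda>y. H c d y u) (at y) (la.Z c y k) + la.Z c y (Om c y v (la.Z c y k))"
proof -
  note oU = open_Ud[OF c d]
  have sub: "y \<in> snd c ` fst c" if "y \<in> Ud c d" for y by (rule UdD(1)[OF c that])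
  have sW: "smooth_on (Ud c d) (\<lambda>y. W c y w)" for w by (rule smooth_on_subset[OF smooth_W[OF c]]) blast
  have sZ: "smooth_on (Ud c d) (\<lambda>y. la.Z c y k)" by (rule smooth_on_subset[OF la.smooth_Z[OF c]]) blast
  note sH = smooth_H[OF c d, of u]
  have sP: "smooth_on (Ud c d) (\<lambda>y. P c d y w)" for w by (rule smooth_on_frechet_derivative_open[OF smooth_pr[OF c d] oU])
  have PZ: "P c d y (la.Z c y k') = 0" if y: "y \<in> Ud c d" for y k'
  proof -
    note p = chart_point[OF c sub[OF y]]
    have "d \<in> charts_at M (\<pi> (inv_chart c y))" using d UdD(2)[OF c y] by (simp add: mem_charts_at)
    from P_Z[OF p(1) this] show ?thesis by (simp add: p(3))
  qed
  note linP = linear_P[OF c d] and linW = linear_W[OF c sub]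
  let ?Z = "la.Z c y k"
  let ?DZ = "frechet_derivative (\<lambda>y. la.Z c y k) (at y) v" and ?DH = "frechet_derivative (\<lambda>y. H c d y u) (at y) ?Z"
  \<comment> \<open>\<open>P\<close> and \<open>W\<close> are constant on the generator field and on
    the lifted field. Each of the four identities trades a derivative of a field for a derivative of
    \<open>P\<close> or \<open>W\<close>.\<close>
  note WZ = derivative_of_constant_pairing[OF oU y linW sW sZ W_Z[OF c sub], of v]
  note WH = derivative_of_constant_pairing[OF oU y linW sW sH W_H[OF c d], of ?Z, folded v]
  note PZ' = derivative_of_constant_pairing[OF oU y linP sP sZ PZ, of v]
  note PH = derivative_of_constant_pairing[OF oU y linP sP sH P_H[OF c d], of ?Z, folded v]
  have sym: "frechet_derivative (\<lambda>y. P c d y a) (at y) b = frechet_derivative (\<lambda>y. P c d y b) (at y) a" for a b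
    by (rule second_derivative_symmetric[OF smooth_pr[OF c d] oU y])
  note b = bij_splitting(1)[OF c d y]
  show ?thesis
  proof (rule injD[OF bij_is_inj[OF b]])
    \<comment> \<open>The base components agree by symmetry of the second derivative of the
      projection.\<close>
    have "P c d y ?DZ = P c d y ?DH" using PZ' PH sym[of ?Z v] by (metis add_left_cancel)
    then have 1: "P c d y ?DZ = P c d y (?DH + la.Z c y (Om c y v ?Z))"
      by (simp add: linear_add[OF linP[OF y]] PZ[OF y])
    \<comment> \<open>The vertical components differ by the antisymmetrised derivative of
      \<open>W\<close>, which is \<open>Om\<close>.\<close>
    have 2: "W c y ?DZ = W c y (?DH + la.Z c y (Om c y v ?Z))"
      using WZ WH by (simp add: linear_add[OF linW[OF y]] W_Z[OF c sub[OF y]] Om_def add_eq_0_iff)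
    show "(P c d y ?DZ, W c y ?DZ) =
      (P c d y (?DH + la.Z c y (Om c y v ?Z)), W c y (?DH + la.Z c y (Om c y v ?Z)))"
      unfolding 1 2 ..
  qed
qed

lemma linear_lie_vec: "linear lie_vec"
  unfolding lie_vec_def by (rule linearI) (rule tvec_of_linear[OF la.A la.c0])+

end

section \<open>The variational equations\<close>

lemma smooth_curve_compose:
  assumes f: "smooth_map A B f" and A: "smooth_atlas A" and B: "smooth_atlas B" and I: "thick I"
    and q: "smooth_curve A I q"
  shows "smooth_curve B I (\<lambda>t. f (q t))"
proof (rule smooth_curveI[OF B I])
  fix t assume t: "t \<in> I"
  note qt = smooth_curve_points[OF q A t]
  obtain c where "c \<in> charts_at A (q t)" using charts_at_nonempty[OF qt] by blast
  then have c: "c \<in> A" "q t \<in> fst c" by (simp_all add: mem_charts_at)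
  obtain d where "d \<in> charts_at B (f (q t))"
    using charts_at_nonempty[OF smooth_map_points[OF f A B qt]] by blast
  then have d: "d \<in> B" "f (q t) \<in> fst d" by (simp_all add: mem_charts_at)
  let ?U = "snd c ` (fst c \<inter> f -` fst d)" and ?K = "{s \<in> I. q s \<in> fst c}"
  let ?J = "?K \<inter> (\<lambda>s. snd c (q s)) -` ?U"
  note oJ0 = smooth_curve_openin[OF q A c(1)]
  note sx = smooth_on_curve_chart[OF q c(1)]
  have "openin (top_of_set ?K) ?J"
    by (rule continuous_openin_preimage_gen[OF smooth_on_imp_continuous_on[OF sx] open_smooth_map_domain[OF f A B c(1) d(1)]])
  from openin_trans[OF this oJ0] have oJ: "openin (top_of_set I) ?J" .
  have tJ: "t \<in> ?J" using t c d by auto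
  have J: "f (q s) \<in> fst d" "q s \<in> fst c" if s: "s \<in> ?J" for s
  proof -
    show qc: "q s \<in> fst c" using s by simp
    have "snd c (q s) \<in> ?U" using s by simp
    from mem_chart_imageD(2)[OF A c(1) this] show "f (q s) \<in> fst d" by (simp add: inv_chart_chart[OF A c(1) qc])
  qed
  have "smooth_on ?J (\<lambda>s. (snd d \<circ> f \<circ> inv_chart c) (snd c (q s)))"
    by (rule smooth_on_compose[OF smooth_on_coordinate_map[OF f c(1) d(1)] smooth_on_subset[OF sx]]) auto
  then have "smooth_on ?J (snd d \<circ> (\<lambda>t. f (q t)))"
    by (rule smooth_on_eq) (simp add: inv_chart_chart[OF A c(1) J(2)])
  then show "\<exists>c\<in>B. \<exists>J. openin (top_of_set I) J \<and> t \<in> J \<and> (\<forall>s\<in>J. f (q s) \<in> fst c) \<and> smooth_on J (snd c \<circ> (\<lambda>t. f (q t)))"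
    using d(1) oJ tJ J(1) by blast
qed

section \<open>Charts along the path and the local form of the Lagrangian\<close>

locale chaplygin_path = chaplygin_bundle S
  for S :: "('q, 'e::fin_dim_inner, 'm, 'f::fin_dim_inner, 'g, 'k::fin_dim_inner) chaplygin" +
  fixes L :: "('q, 'e) tan \<Rightarrow> real" and q :: "real \<Rightarrow> 'q" and Xt :: "real \<Rightarrow> ('q, 'e) tan"
    and lam :: "real \<Rightarrow> ('g, 'k) tvec \<Rightarrow> real" and t0 t1 :: real
  assumes t01: "t0 < t1" and smooth_L: "smooth_fun (tangent_bundle Q) L"
    and path: "horizontal_admissible_path S {t0..t1} q Xt" and lam: "smooth_dual_curve S {t0..t1} lam"
begin

abbreviation "I \<equiv> {t0..t1}"
abbreviation "TQ \<equiv> tangent_bundle Q"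
abbreviation "vel t \<equiv> velocity Q I q t"
abbreviation "\<delta> \<xi> \<equiv> admissible_variation Q I q \<xi>"
abbreviation "gen \<equiv> generator Q I q"
abbreviation "J c \<equiv> {s \<in> I. q s \<in> fst c}"
abbreviation "dt g t \<equiv> vector_derivative g (at t within I)"

lemma thick_I: "thick I"
  by (rule thick_Icc[OF t01])

lemma q: "smooth_curve Q I q" and Xt: "t \<in> I \<Longrightarrow> Xt t = (q t, vel t)" and vel_hor: "t \<in> I \<Longrightarrow> vel t \<in> hor S (q t)"
proof -
  note p = path[unfolded horizontal_admissible_path_def tangent_lift_def]
  show "smooth_curve Q I q" by (rule conjunct1[OF p])
  show 1: "Xt t = (q t, vel t)" if "t \<in> I" for t using bspec[OF conjunct2[OF p] that] by blast
  show "vel t \<in> hor S (q t)" if "t \<in> I" using bspec[OF conjunct2[OF p] that] unfolding 1[OF that] by simp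
qed

lemma q_points: "t \<in> I \<Longrightarrow> q t \<in> points Q"
  by (rule smooth_curve_points[OF q Q])

lemma vel_in: "t \<in> I \<Longrightarrow> vel t \<in> tangent_space Q (q t)"
  by (rule velocity_in[OF q Q thick_I])

lemma ex_chart: "t \<in> I \<Longrightarrow> \<exists>c. c \<in> charts_at Q (q t)"
  by (rule charts_at_nonempty[OF q_points])

lemma openin_J: "c \<in> Q \<Longrightarrow> openin (top_of_set I) (J c)"
  by (rule smooth_curve_openin[OF q Q])

lemma smooth_x: "c \<in> Q \<Longrightarrow> smooth_on (J c) (\<lambda>s. snd c (q s))"
  by (rule smooth_on_curve_chart[OF q])

lemma at_J: "c \<in> Q \<Longrightarrow> t \<in> J c \<Longrightarrow> at t within J c = at t within I"
  by (rule at_within_openin[OF openin_J])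

lemma chart_J: "c \<in> Q \<Longrightarrow> t \<in> J c \<Longrightarrow> c \<in> charts_at Q (q t)"
  by (simp add: mem_charts_at)

lemma smooth_on_dt:
  fixes g :: "real \<Rightarrow> 'z::real_normed_vector"
  assumes c: "c \<in> Q" and g: "smooth_on (J c) g"
  shows "smooth_on (J c) (dt g)" and "t \<in> J c \<Longrightarrow> (g has_vector_derivative dt g t) (at t within I)"
proof -
  note v = smooth_on_vector_derivative[OF g thick_openin[OF thick_I openin_J[OF c]]]
  show "smooth_on (J c) (dt g)" by (rule smooth_on_eq[OF v(2)]) (simp only: at_J[OF c])
  show "(g has_vector_derivative dt g t) (at t within I)" if "t \<in> J c" using v(1)[OF that] unfolding at_J[OF c that] .
qed

lemma smooth_vel:
  assumes c: "c \<in> Q"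
  shows "smooth_on (J c) (\<lambda>s. vel s c)"
proof (rule smooth_on_eq[OF smooth_on_dt(1)[OF c smooth_x[OF c]]])
  fix s assume s: "s \<in> J c"
  show "vel s c = dt (\<lambda>s. snd c (q s)) s"
    using chart_J[OF c s] by (simp add: velocity_def o_def)
qed

lemma smooth_on_I:
  assumes "\<And>c. c \<in> Q \<Longrightarrow> smooth_on (J c) g"
  shows "smooth_on I g"
proof (rule smooth_on_local[OF thick_I])
  fix t assume t: "t \<in> I"
  from ex_chart[OF t] obtain c where c: "c \<in> Q" "q t \<in> fst c" by (auto simp: mem_charts_at)
  show "\<exists>T. openin (top_of_set I) T \<and> t \<in> T \<and> smooth_on T g"
    by (rule exI[of _ "J c"]) (use openin_J[OF c(1)] assms[OF c(1)] t c(2) in simp)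
qed

lemma dt_unique: "t \<in> I \<Longrightarrow> (g has_vector_derivative D) (at t within I) \<Longrightarrow> dt g t = D"
  by (rule vector_derivative_thick[OF thick_I])

abbreviation "Lc c \<equiv> L \<circ> inv_chart (tangent_chart Q c)"
abbreviation "DL c t \<equiv> frechet_derivative (Lc c) (at (snd c (q t), vel t c))"
abbreviation "lm t k \<equiv> lam t (lie_vec k)"

lemma smooth_Lc: "c \<in> Q \<Longrightarrow> smooth_on (snd c ` fst c \<times> UNIV) (Lc c)"
proof -
  assume c: "c \<in> Q"
  then have "tangent_chart Q c \<in> TQ" by (simp add: tangent_bundle_def)
  from bspec[OF smooth_L[unfolded smooth_fun_def] this]
  show ?thesis unfolding image_tangent_chart_self[OF Q c] .
qed

lemma open_Lc: "c \<in> Q \<Longrightarrow> open (snd c ` fst c \<times> (UNIV :: 'e set))"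
  by (rule open_Times[OF open_chart_image[OF Q] open_UNIV])

lemma in_Lc: "t \<in> J c \<Longrightarrow> (snd c (q t), w) \<in> snd c ` fst c \<times> UNIV"
  by auto

lemma has_derivative_Lc: "c \<in> Q \<Longrightarrow> t \<in> J c \<Longrightarrow> (Lc c has_derivative DL c t) (at (snd c (q t), vel t c))"
  by (rule smooth_on_has_derivative_open[OF smooth_Lc open_Lc in_Lc])

lemma linear_DL: "c \<in> Q \<Longrightarrow> t \<in> J c \<Longrightarrow> linear (DL c t)"
  by (rule has_derivative_linear[OF has_derivative_Lc])

lemma smooth_DL:
  assumes c: "c \<in> Q" and "smooth_on (J c) u" "smooth_on (J c) w"
  shows "smooth_on (J c) (\<lambda>t. DL c t (u t, w t))"
  by (rule smooth_on_frechet_derivative_apply[OF smooth_Lc[OF c] open_Lc[OF c]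
      smooth_on_Pair[OF smooth_x[OF c] smooth_vel[OF c]] smooth_on_Pair[OF assms(2,3)] in_Lc])

lemma linear_lm: "t \<in> I \<Longrightarrow> linear (lm t)"
  using lam lie_vec(1) linear_add[OF linear_lie_vec] linear_scale[OF linear_lie_vec]
  by (intro linearI) (simp_all add: smooth_dual_curve_def lie_alg_dual_def)

lemma smooth_lm:
  assumes "smooth_on T k" "T \<subseteq> I"
  shows "smooth_on T (\<lambda>t. lm t (k t))"
proof (rule smooth_on_apply[where A="lm", OF _ assms(1)])
  show "smooth_on T (\<lambda>t. lm t b)" for b
    by (rule smooth_on_subset[OF _ assms(2)]) (use lam lie_vec(1) in \<open>simp add: smooth_dual_curve_def\<close>)
qed (use linear_lm assms(2) in blast)

lemma smooth_gen_chart: "gen \<xi> \<Longrightarrow> c \<in> Q \<Longrightarrow> smooth_on (J c) (\<lambda>t. \<xi> t c)"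
  by (rule smooth_on_generator_chart)

lemma variation_L:
  assumes g: "gen \<xi>" and c: "c \<in> Q" and t: "t \<in> J c"
  shows "differential TQ L (\<delta> \<xi> t) = DL c t (\<xi> t c, dt (\<lambda>s. \<xi> s c) t)"
  by (rule differential_admissible_variation[OF Q thick_I q g _ chart_J[OF c t] has_derivative_Lc[OF c t]]) (use t in simp)

abbreviation "Lm \<equiv> modified_lagrangian S L lam"

text \<open>In a tangent chart \<open>\<omega>\<close> becomes \<open>W c y w\<close>, linear in
  \<open>w\<close>, so the product rule for evaluation applies. Time is frozen in the differential,
  and \<open>lam t\<close> acts as a fixed linear map.\<close>

lemma has_derivative_modified:
  assumes c: "c \<in> Q" and t: "t \<in> J c"
  shows "((Lm t \<circ> inv_chart (tangent_chart Q c)) has_derivative (\<lambda>h. DL c t h -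
     lm t (frechet_derivative (\<lambda>y. W c y (vel t c)) (at (snd c (q t))) (fst h) + W c (snd c (q t)) (snd h))))
     (at (snd c (q t), vel t c))"
proof -
  let ?S = "snd c ` fst c" and ?p = "(snd c (q t), vel t c)"
  have tI: "t \<in> I" and y: "snd c (q t) \<in> ?S" using t by auto
  note o = open_chart_image[OF Q c] and oU = open_Lc[OF c]
  have "((\<lambda>p. W c (fst p) (snd p)) has_derivative (\<lambda>h.
     frechet_derivative (\<lambda>y. W c y (snd ?p)) (at (snd c (q t))) (fst h) + W c (fst ?p) (snd h))) (at ?p within ?S \<times> UNIV)"
    by (rule has_derivative_apply[where S="?S" and f=fst and g=snd and x="?p" and f'=fst and g'=snd and
          A'="\<lambda>u b. frechet_derivative (\<lambda>y. W c y b) (at (snd c (q t))) u", OF thick_open[OF o] linear_W[OF c]])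
       (use y has_derivative_at_withinI[OF smooth_on_has_derivative_open[OF smooth_W[OF c] o y]]
         in \<open>simp_all add: has_derivative_fst[OF has_derivative_ident] has_derivative_snd[OF has_derivative_ident]\<close>)
  note dW = this[unfolded at_within_open[OF in_Lc[OF t] oU] fst_conv snd_conv]
  note dl = bounded_linear.has_derivative[OF linear_imp_bounded_linear[OF linear_lm[OF tI]] dW]
  show ?thesis
  proof (rule has_derivative_transform_within_open[OF has_derivative_diff[OF has_derivative_Lc[OF c t] dl] oU in_Lc[OF t]])
    fix p :: "'e \<times> 'e" assume "p \<in> ?S \<times> UNIV"
    then obtain y w where p: "p = (y, w)" "y \<in> ?S" by auto
    note cp = chart_point[OF c p(2)]
    have "omega S (inv_chart c y, tvec_of Q c (inv_chart c y) w) \<in> lie_alg S"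
      by (rule omega(1)[OF cp(2) tvec_of_in[OF Q cp(1)]])
    from lie_vec_chart[OF this] have "lie_vec (W c y w) = omega S (inv_chart c y, tvec_of Q c (inv_chart c y) w)"
      by (simp add: W_def)
    then show "Lc c p - lm t (W c (fst p) (snd p)) = (Lm t \<circ> inv_chart (tangent_chart Q c)) p"
      by (simp add: p(1) modified_lagrangian_def inv_tangent_chart[OF Q c p(2)])
  qed
qed

text \<open>The direction \<open>(\<xi>, \<xi>')\<close> depends linearly on the generator, hence so
  does the variation. Finite sums are treated because a generator will be split into a horizontal
  piece and one vertical piece per basis vector.\<close>

lemma variation_sum:
  assumes K: "finite K" and g: "\<And>i. i \<in> K \<Longrightarrow> gen (\<xi> i)" and gs: "gen \<zeta>"
    and sum: "\<And>t. t \<in> I \<Longrightarrow> \<zeta> t = (\<Sum>i\<in>K. \<xi> i t)" and t: "t \<in> I"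
  shows "differential TQ (Lm t) (\<delta> \<zeta> t) = (\<Sum>i\<in>K. differential TQ (Lm t) (\<delta> (\<xi> i) t))"
proof -
  obtain c where c: "c \<in> charts_at Q (q t)" using ex_chart[OF t] by blast
  then have cQ: "c \<in> Q" "t \<in> J c" using t by (simp_all add: mem_charts_at)
  note F = has_derivative_modified[OF cQ]
  note dav = differential_admissible_variation[OF Q thick_I q _ t c F]
  have eval: "(\<Sum>i\<in>K. \<xi> i s) c = (\<Sum>i\<in>K. \<xi> i s c)" for s
    using K by (induction K rule: finite_induct) simp_all
  have "((\<lambda>s. \<Sum>i\<in>K. \<xi> i s c) has_vector_derivative (\<Sum>i\<in>K. dt (\<lambda>s. \<xi> i s c) t)) (at t within I)"
    by (rule has_vector_derivative_sum[OF generator_has_vector_derivative[OF Q thick_I q g t c]])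
  then have "((\<lambda>s. \<zeta> s c) has_vector_derivative (\<Sum>i\<in>K. dt (\<lambda>s. \<xi> i s c) t)) (at t within I)"
    by (rule has_vector_derivative_transform[OF t, rotated]) (simp add: sum eval)
  from dt_unique[OF t this] have "(\<zeta> t c, dt (\<lambda>s. \<zeta> s c) t) = (\<Sum>i\<in>K. (\<xi> i t c, dt (\<lambda>s. \<xi> i s c) t))"
    by (simp add: sum[OF t] eval sum_prod)
  then show ?thesis
    unfolding dav[OF gs]
    by (simp only: linear_sum[OF has_derivative_linear[OF F]]) (rule sum.cong[OF refl dav[OF g, symmetric]])
qed

text \<open>The correction term is the variation of \<open>\<omega>\<close> along a horizontal path: with
  \<open>\<omega>(vel) = 0\<close>, Cartan's formula reads
  \<open>\<delta>(\<omega>(vel)) = d/dt \<omega>(\<xi>) + d\<omega>(\<xi>, vel)\<close>.\<close>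

lemma variation_modified:
  assumes g: "gen \<xi>" and c: "c \<in> Q" and t: "t \<in> J c"
  shows "differential TQ (Lm t) (\<delta> \<xi> t) = differential TQ L (\<delta> \<xi> t)
     - lm t (dt (\<lambda>s. omega S (q s, \<xi> s) c0) t + Om c (snd c (q t)) (vel t c) (\<xi> t c))"
proof -
  have tI: "t \<in> I" and y: "snd c (q t) \<in> snd c ` fst c" using t by auto
  note ct = chart_J[OF c t] and o = open_chart_image[OF Q c]
  \<comment> \<open>The derivative of \<open>\<omega>(\<xi>)\<close> along the path; its term
    \<open>W (\<xi>')\<close> also occurs in the variation of the modified Lagrangian.\<close>
  have "((\<lambda>s. W c (snd c (q s)) (\<xi> s c)) has_derivative (\<lambda>h.
      frechet_derivative (\<lambda>y. W c y (\<xi> t c)) (at (snd c (q t))) (h *\<^sub>R vel t c)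
      + W c (snd c (q t)) (h *\<^sub>R dt (\<lambda>s. \<xi> s c) t))) (at t within J c)"
  proof (rule has_derivative_apply[where S="snd c ` fst c" and f="\<lambda>s. snd c (q s)" and
          A'="\<lambda>u b. frechet_derivative (\<lambda>y. W c y b) (at (snd c (q t))) u", OF thick_open[OF o] linear_W[OF c]])
    show "((\<lambda>y. W c y b) has_derivative (\<lambda>u. frechet_derivative (\<lambda>y. W c y b) (at (snd c (q t))) u))
        (at (snd c (q t)) within snd c ` fst c)" for b
      by (rule has_derivative_at_withinI[OF smooth_on_has_derivative_open[OF smooth_W[OF c] o y]])
    show "((\<lambda>s. snd c (q s)) has_derivative (\<lambda>h. h *\<^sub>R vel t c)) (at t within J c)"
      using velocity_chart[OF q Q thick_I tI ct] unfolding has_vector_derivative_def at_J[OF c t] .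
    show "((\<lambda>s. \<xi> s c) has_derivative (\<lambda>h. h *\<^sub>R dt (\<lambda>s. \<xi> s c) t)) (at t within J c)"
      using smooth_on_dt(2)[OF c smooth_gen_chart[OF g c] t] unfolding has_vector_derivative_def at_J[OF c t] .
  qed (use t in auto)
  then have "((\<lambda>s. W c (snd c (q s)) (\<xi> s c)) has_vector_derivative
      frechet_derivative (\<lambda>y. W c y (\<xi> t c)) (at (snd c (q t))) (vel t c)
      + W c (snd c (q t)) (dt (\<lambda>s. \<xi> s c) t)) (at t within J c)"
    unfolding has_vector_derivative_def
    by (simp add: linear_scale[OF linear_W[OF c y]] scaleR_add_right
        linear_scale[OF linear_frechet_derivative_smooth[OF smooth_W[OF c] o y]])
  then have "((\<lambda>s. omega S (q s, \<xi> s) c0) has_vector_derivative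
      frechet_derivative (\<lambda>y. W c y (\<xi> t c)) (at (snd c (q t))) (vel t c)
      + W c (snd c (q t)) (dt (\<lambda>s. \<xi> s c) t)) (at t within J c)"
    by (rule has_vector_derivative_transform[OF t, rotated])
       (use omega_chart[OF chart_J[OF c] generator_in[OF g]] in simp)
  \<comment> \<open>Eliminating \<open>W (\<xi>')\<close> leaves the difference of two derivatives
    of \<open>W\<close>, which is \<open>Om\<close>.\<close>
  note b' = dt_unique[OF tI this[unfolded at_J[OF c t]]]
  show ?thesis
    unfolding differential_admissible_variation[OF Q thick_I q g tI ct has_derivative_modified[OF c t]]
      variation_L[OF g c t] b' Om_def by (simp add: algebra_simps)
qed

lemma smooth_variation_L:
  assumes g: "gen \<xi>"
  shows "smooth_on I (\<lambda>t. differential TQ L (\<delta> \<xi> t))"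
proof (rule smooth_on_I)
  fix c assume c: "c \<in> Q"
  note s = smooth_gen_chart[OF g c]
  show "smooth_on (J c) (\<lambda>t. differential TQ L (\<delta> \<xi> t))"
    by (rule smooth_on_eq[OF smooth_DL[OF c s smooth_on_dt(1)[OF c s]]]) (rule variation_L[OF g c])
qed

text \<open>A horizontal vector is the lift of its own projection. This turns the argument
  \<open>X\<close> of \<open>curvature\<close> and \<open>B_map\<close> back into the velocity of
  the path.\<close>

lemma lift_velocity:
  assumes t: "t \<in> I"
  shows "proj_vec S (Xt t) \<in> tangent_space M (\<pi> (q t))" "hlift S (q t) (proj_vec S (Xt t)) = vel t"
proof -
  note qt = q_points[OF t] and v = vel_in[OF t]
  show X: "proj_vec S (Xt t) \<in> tangent_space M (\<pi> (q t))" unfolding Xt[OF t] by (rule proj_vec_in[OF qt v])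
  obtain c where c: "c \<in> charts_at Q (q t)" using ex_chart[OF t] by blast
  obtain d where d: "d \<in> charts_at M (\<pi> (q t))" using charts_at_nonempty[OF proj_points[OF qt]] by blast
  have cd: "c \<in> Q" "q t \<in> fst c" "d \<in> M" "\<pi> (q t) \<in> fst d" using c d by (simp_all add: mem_charts_at)
  have "vel t c = H c d (snd c (q t)) (proj_vec S (Xt t) d)"
    by (rule H_unique[OF cd(1,3) UdI[OF cd(2,4)]])
       (simp_all add: Xt[OF t] proj_vec_chart[OF c d v] W_hor[OF c vel_hor[OF t]])
  then show "hlift S (q t) (proj_vec S (Xt t)) = vel t"
    by (intro tangent_space_eqI[OF hlift_in(2)[OF qt X] v c]) (simp add: hlift_chart[OF c d X])
qed

lemma pq: "smooth_curve M I (\<lambda>t. \<pi> (q t))"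
  by (rule smooth_curve_compose[OF smooth_proj Q M thick_I q])

lemma ex_charts:
  assumes t: "t \<in> I"
  obtains c d K where "c \<in> Q" "d \<in> M" "openin (top_of_set I) K" "t \<in> K" "K \<subseteq> J c" "K \<subseteq> {s \<in> I. \<pi> (q s) \<in> fst d}"
proof -
  obtain c where c: "c \<in> Q" "q t \<in> fst c" using ex_chart[OF t] by (auto simp: mem_charts_at)
  obtain d where d: "d \<in> M" "\<pi> (q t) \<in> fst d"
    using charts_at_nonempty[OF proj_points[OF q_points[OF t]]] by (auto simp: mem_charts_at)
  show thesis
    by (rule that[OF c(1) d(1) openin_Int[OF openin_J[OF c(1)] smooth_curve_openin[OF pq M d(1)]]]) (use t c d in auto)
qed

section \<open>Horizontal variations\<close>

abbreviation "lift Y \<equiv> (\<lambda>t. hlift S (q t) (Y t))"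

lemma lift_generator:
  assumes Y: "generator M I (\<lambda>t. \<pi> (q t)) Y"
  shows "gen (lift Y)"
proof (rule generatorI[OF Q thick_I q])
  show "hlift S (q t) (Y t) \<in> tangent_space Q (q t)" if "t \<in> I" for t
    by (rule hlift_in(2)[OF q_points[OF that] generator_in[OF Y that]])
  fix t assume "t \<in> I"
  from ex_charts[OF this] obtain c d K where K: "c \<in> Q" "d \<in> M" "openin (top_of_set I) K" "t \<in> K" "K \<subseteq> J c"
    "K \<subseteq> {s \<in> I. \<pi> (q s) \<in> fst d}" .
  have KU: "snd c (q s) \<in> Ud c d" if "s \<in> K" for s by (rule UdI) (use that K(5,6) in auto)
  have "smooth_on K (\<lambda>s. H c d (snd c (q s)) (Y s d))"
  proof (rule smooth_on_apply[where A="\<lambda>s. H c d (snd c (q s))"])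
    show "smooth_on K (\<lambda>s. H c d (snd c (q s)) b)" for b
      by (rule smooth_on_compose[OF smooth_H[OF K(1,2)] smooth_on_subset[OF smooth_x[OF K(1)] K(5)] KU])
    show "smooth_on K (\<lambda>s. Y s d)" by (rule smooth_on_subset[OF smooth_on_generator_chart[OF Y K(2)] K(6)])
    show "linear (H c d (snd c (q s)))" if "s \<in> K" for s by (rule linear_H[OF K(1,2) KU[OF that]])
  qed
  then have "smooth_on K (\<lambda>s. hlift S (q s) (Y s) c)"
  proof (rule smooth_on_eq)
    fix s assume s: "s \<in> K"
    have m: "s \<in> I" "c \<in> charts_at Q (q s)" "d \<in> charts_at M (\<pi> (q s))" using s K by (auto simp: mem_charts_at)
    show "hlift S (q s) (Y s) c = H c d (snd c (q s)) (Y s d)"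
      by (rule hlift_chart[OF m(2,3) generator_in[OF Y m(1)]])
  qed
  moreover have "\<forall>s\<in>K. q s \<in> fst c" using K(5) by auto
  ultimately show "\<exists>c\<in>Q. \<exists>J. openin (top_of_set I) J \<and> t \<in> J \<and> (\<forall>s\<in>J. q s \<in> fst c) \<and>
      smooth_on J (\<lambda>s. hlift S (q s) (Y s) c)" using K(1,3,4) by blast
qed

lemma projection_generator:
  assumes g: "gen \<xi>"
  shows "generator M I (\<lambda>t. \<pi> (q t)) (\<lambda>t. proj_vec S (q t, \<xi> t))"
proof (rule generatorI[OF M thick_I pq])
  show "proj_vec S (q t, \<xi> t) \<in> tangent_space M (\<pi> (q t))" if "t \<in> I" for t
    by (rule proj_vec_in[OF q_points[OF that] generator_in[OF g that]])
  fix t assume "t \<in> I"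
  from ex_charts[OF this] obtain c d K where K: "c \<in> Q" "d \<in> M" "openin (top_of_set I) K" "t \<in> K" "K \<subseteq> J c"
    "K \<subseteq> {s \<in> I. \<pi> (q s) \<in> fst d}" .
  have KU: "snd c (q s) \<in> Ud c d" if "s \<in> K" for s by (rule UdI) (use that K(5,6) in auto)
  have "smooth_on K (\<lambda>s. P c d (snd c (q s)) (\<xi> s c))"
    by (rule smooth_on_frechet_derivative_apply[OF smooth_pr[OF K(1,2)] open_Ud[OF K(1,2)]
        smooth_on_subset[OF smooth_x[OF K(1)] K(5)] smooth_on_subset[OF smooth_gen_chart[OF g K(1)] K(5)] KU])
  then have "smooth_on K (\<lambda>s. proj_vec S (q s, \<xi> s) d)"
  proof (rule smooth_on_eq)
    fix s assume s: "s \<in> K"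
    have m: "s \<in> I" "c \<in> charts_at Q (q s)" "d \<in> charts_at M (\<pi> (q s))" using s K by (auto simp: mem_charts_at)
    show "proj_vec S (q s, \<xi> s) d = P c d (snd c (q s)) (\<xi> s c)"
      by (rule proj_vec_chart[OF m(2,3) generator_in[OF g m(1)]])
  qed
  moreover have "\<forall>s\<in>K. \<pi> (q s) \<in> fst d" using K(6) by auto
  ultimately show "\<exists>c\<in>M. \<exists>J. openin (top_of_set I) J \<and> t \<in> J \<and> (\<forall>s\<in>J. \<pi> (q s) \<in> fst c) \<and>
      smooth_on J (\<lambda>s. proj_vec S (q s, \<xi> s) c)" using K(2,3,4) by blast
qed

text \<open>On a horizontal lift \<open>\<omega>\<close> is 0 at every time, so the time derivative
  in \<open>variation_modified\<close> drops out and the \<open>Om\<close> term is the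
  curvature.\<close>

lemma variation_lift:
  assumes Y: "generator M I (\<lambda>t. \<pi> (q t)) Y" and t: "t \<in> I"
  shows "differential TQ (Lm t) (\<delta> (lift Y) t) = differential TQ L (\<delta> (lift Y) t)
    - lam t (curvature S (q t) (proj_vec S (Xt t)) (Y t))"
proof -
  obtain c where c: "c \<in> charts_at Q (q t)" using ex_chart[OF t] by blast
  then have cQ: "c \<in> Q" "t \<in> J c" using t by (simp_all add: mem_charts_at)
  note g = lift_generator[OF Y]
  have "((\<lambda>s. omega S (q s, lift Y s) c0) has_vector_derivative 0) (at t within I)"
  proof (rule has_vector_derivative_transform[OF t _ has_vector_derivative_const])
    fix s assume s: "s \<in> I"
    note h = hlift_in[OF q_points[OF s] generator_in[OF Y s]]
    show "omega S (q s, lift Y s) c0 = 0" using hor_iff_omega[OF q_points[OF s] h(2)] h(1) by simp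
  qed
  note z = dt_unique[OF t this]
  have "curvature S (q t) (proj_vec S (Xt t)) (Y t) = lie_vec (Om c (snd c (q t)) (vel t c) (lift Y t c))"
    unfolding curvature_chart[OF c lift_velocity(1)[OF t] generator_in[OF Y t]] lift_velocity(2)[OF t] ..
  then show ?thesis unfolding variation_modified[OF g cQ] z by simp
qed

lemma smooth_curvature:
  assumes Y: "generator M I (\<lambda>t. \<pi> (q t)) Y"
  shows "smooth_on I (\<lambda>t. lam t (curvature S (q t) (proj_vec S (Xt t)) (Y t)))"
proof (rule smooth_on_I)
  fix c assume c: "c \<in> Q"
  have "smooth_on (J c) (\<lambda>t. lm t (Om c (snd c (q t)) (vel t c) (lift Y t c)))"
    by (rule smooth_lm[OF smooth_Om[OF c smooth_x[OF c] _ smooth_vel[OF c] smooth_gen_chart[OF lift_generator[OF Y] c]]]) auto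
  then show "smooth_on (J c) (\<lambda>t. lam t (curvature S (q t) (proj_vec S (Xt t)) (Y t)))"
  proof (rule smooth_on_eq)
    fix t assume t: "t \<in> J c"
    then have tI: "t \<in> I" by simp
    show "lam t (curvature S (q t) (proj_vec S (Xt t)) (Y t)) = lm t (Om c (snd c (q t)) (vel t c) (lift Y t c))"
      unfolding curvature_chart[OF chart_J[OF c t] lift_velocity(1)[OF tI] generator_in[OF Y tI]] lift_velocity(2)[OF tI] ..
  qed
qed

section \<open>Vertical variations and the momentum equation\<close>

abbreviation "fund b t \<equiv> fundamental_field S b (q t)"

lemma fund_chart: "b \<in> lie_alg S \<Longrightarrow> c \<in> Q \<Longrightarrow> t \<in> J c \<Longrightarrow> fund b t c = la.Z c (snd c (q t)) (b c0)"
  by (rule fundamental_field_chart[OF _ chart_J])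

lemma smooth_fund_chart:
  assumes b: "b \<in> lie_alg S" and c: "c \<in> Q"
  shows "smooth_on (J c) (\<lambda>t. fund b t c)"
proof (rule smooth_on_eq[OF smooth_on_compose[OF la.smooth_Z[OF c] smooth_x[OF c]]])
  show "snd c (q s) \<in> snd c ` fst c" if "s \<in> J c" for s using that by auto
qed (rule fund_chart[OF b c])

lemma fund_generator:
  assumes b: "b \<in> lie_alg S" and \<phi>: "smooth_on I \<phi>"
  shows "gen (\<lambda>t. \<phi> t *\<^sub>R fund b t)"
proof (rule generatorI[OF Q thick_I q])
  show "\<phi> t *\<^sub>R fund b t \<in> tangent_space Q (q t)" if "t \<in> I" for t
    by (rule tangent_space_scaleR[OF Q fundamental_field_in[OF b q_points[OF that]]])
  fix t assume t: "t \<in> I"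
  obtain c where c: "c \<in> Q" "q t \<in> fst c" using ex_chart[OF t] by (auto simp: mem_charts_at)
  have "smooth_on (J c) (\<lambda>s. (\<phi> s *\<^sub>R fund b s) c)"
    unfolding scaleR_fun_apply
    by (rule smooth_on_scaleR[OF smooth_on_subset[OF \<phi>] smooth_fund_chart[OF b c(1)]]) auto
  moreover have "t \<in> J c" "\<forall>s\<in>J c. q s \<in> fst c" using t c by auto
  ultimately show "\<exists>c\<in>Q. \<exists>J. openin (top_of_set I) J \<and> t \<in> J \<and> (\<forall>s\<in>J. q s \<in> fst c) \<and>
      smooth_on J (\<lambda>s. (\<phi> s *\<^sub>R fund b s) c)" using openin_J[OF c(1)] c(1) by blast
qed

lemma fund_generator_const: "b \<in> lie_alg S \<Longrightarrow> gen (fund b)"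
  using fund_generator[OF _ smooth_on_const[of I 1], of b] by simp

lemma FL_chart:
  assumes b: "b \<in> lie_alg S" and c: "c \<in> Q" and t: "t \<in> J c"
  shows "FL S L (Xt t) b = DL c t (0, fund b t c)"
proof -
  have tI: "t \<in> I" using t by simp
  note ct = chart_J[OF c t] and qt = q_points[OF tI]
  have y: "snd c (q t) \<in> snd c ` fst c" using t by auto
  have i: "inv_chart c (snd c (q t)) = q t" using t by (intro inv_chart_chart[OF Q c]) simp
  have eq: "L (q t, vel t + \<tau> *\<^sub>R fund b t) = Lc c (snd c (q t), vel t c + \<tau> *\<^sub>R fund b t c)" for \<tau>
  proof -
    have "vel t + \<tau> *\<^sub>R fund b t \<in> tangent_space Q (q t)"
      by (rule tangent_space_add[OF Q vel_in[OF tI] tangent_space_scaleR[OF Q fundamental_field_in[OF b qt]]])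
    from tvec_of_chart[OF Q ct this]
    show ?thesis by (simp add: inv_tangent_chart[OF Q c y] i scaleR_fun_apply)
  qed
  have "((\<lambda>\<tau>. Lc c (snd c (q t), vel t c + \<tau> *\<^sub>R fund b t c)) has_derivative (\<lambda>h. DL c t (0, h *\<^sub>R fund b t c))) (at 0)"
  proof (rule has_derivative_compose[where g="Lc c" and f="\<lambda>\<tau>. (snd c (q t), vel t c + \<tau> *\<^sub>R fund b t c)"])
    show "((\<lambda>\<tau>. (snd c (q t), vel t c + \<tau> *\<^sub>R fund b t c)) has_derivative (\<lambda>h. (0, h *\<^sub>R fund b t c))) (at 0)"
      by (auto intro!: derivative_eq_intros)
    show "(Lc c has_derivative DL c t) (at (snd c (q t), vel t c + 0 *\<^sub>R fund b t c))"
      using has_derivative_Lc[OF c t] by (simp only: scaleR_zero_left add_0_right)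
  qed
  moreover have "DL c t (0, h *\<^sub>R fund b t c) = DL c t (0, fund b t c) * h" for h
    using linear_scale[OF linear_DL[OF c t], of h "(0, fund b t c)"] by simp
  ultimately have "((\<lambda>\<tau>. L (q t, vel t + \<tau> *\<^sub>R fund b t)) has_field_derivative DL c t (0, fund b t c)) (at 0)"
    unfolding eq has_field_derivative_def by simp
  then show ?thesis unfolding FL_def Xt[OF tI] fst_conv snd_conv by (rule DERIV_imp_deriv)
qed

text \<open>Along the orbit the projection is constant, so the lifted vector has coordinates
  \<open>H c d y u\<close> with \<open>u\<close> fixed and only \<open>y\<close> moving. The
  derivative acts on the base point and on \<open>H\<close>.\<close>

lemma HL_chart:
  assumes b: "b \<in> lie_alg S" and c: "c \<in> Q" and t: "t \<in> J c" and d: "d \<in> charts_at M (\<pi> (q t))"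
  shows "HL S L (Xt t) b = DL c t (fund b t c,
    frechet_derivative (\<lambda>y. H c d y (proj_vec S (Xt t) d)) (at (snd c (q t))) (fund b t c))"
proof -
  have tI: "t \<in> I" and qc: "q t \<in> fst c" using t by simp_all
  have dM: "d \<in> M" "\<pi> (q t) \<in> fst d" using d by (simp_all add: mem_charts_at)
  note ct = chart_J[OF c t] and qt = q_points[OF tI]
  let ?q = "\<lambda>\<tau>. exp_act S (q t) (\<tau> *\<^sub>R b)" and ?X = "proj_vec S (Xt t)" and ?y = "snd c (q t)"
  note X = lift_velocity[OF tI]
  note e = la.exp_orbit[OF b[unfolded lie_alg_def] qt, folded exp_act_def]
  have q0: "?q 0 = q t" by (rule e(3))
  have pq: "\<pi> (?q \<tau>) = \<pi> (q t)" for \<tau>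
    unfolding exp_act_def by (rule proj_act[OF qt e(2)])
  let ?V = "{\<tau>. ?q \<tau> \<in> fst c}"
  have oV: "open ?V" using smooth_curve_openin[OF e(1) Q c] by simp
  have V0: "0 \<in> ?V" unfolding mem_Collect_eq q0 by (rule qc)
  have y': "((\<lambda>\<tau>. snd c (?q \<tau>)) has_derivative (\<lambda>h. h *\<^sub>R fund b t c)) (at 0)"
    using velocity_chart[OF e(1) Q thick_UNIV UNIV_I, of c 0] ct q0
    unfolding has_vector_derivative_def by (simp add: fundamental_field_def)
  have yU: "?y \<in> Ud c d" by (rule UdI[OF qc dM(2)])
  have dH: "((\<lambda>y. H c d y (?X d)) has_derivative frechet_derivative (\<lambda>y. H c d y (?X d)) (at ?y)) (at ?y)"
    by (rule smooth_on_has_derivative_open[OF smooth_H[OF c dM(1)] open_Ud[OF c dM(1)] yU])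
  have y0: "snd c (?q 0) = ?y" unfolding q0 ..
  have Hv: "H c d ?y (?X d) = vel t c" using hlift_chart[OF ct d X(1)] X(2) by simp
  let ?DH = "frechet_derivative (\<lambda>y. H c d y (?X d)) (at ?y)"
  have pair: "((\<lambda>\<tau>. (snd c (?q \<tau>), H c d (snd c (?q \<tau>)) (?X d))) has_derivative
      (\<lambda>h. (h *\<^sub>R fund b t c, ?DH (h *\<^sub>R fund b t c)))) (at 0)"
    by (rule has_derivative_Pair[OF y' has_derivative_compose[OF y', where g="\<lambda>y. H c d y (?X d)"]])
       (unfold y0, rule dH)
  have "((\<lambda>\<tau>. Lc c (snd c (?q \<tau>), H c d (snd c (?q \<tau>)) (?X d))) has_derivative
      (\<lambda>h. DL c t (h *\<^sub>R fund b t c, ?DH (h *\<^sub>R fund b t c)))) (at 0)"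
    by (rule has_derivative_compose[OF pair, where g="Lc c"]) (unfold y0 Hv, rule has_derivative_Lc[OF c t])
  then have "((\<lambda>\<tau>. L (?q \<tau>, hlift S (?q \<tau>) ?X)) has_derivative
      (\<lambda>h. DL c t (h *\<^sub>R fund b t c, ?DH (h *\<^sub>R fund b t c)))) (at 0)"
  proof (rule has_derivative_transform_within_open[OF _ oV V0])
    fix \<tau> assume "\<tau> \<in> ?V"
    then have qc': "?q \<tau> \<in> fst c" by simp
    then have c': "c \<in> charts_at Q (?q \<tau>)" using c by (simp add: mem_charts_at)
    have d': "d \<in> charts_at M (\<pi> (?q \<tau>))" and X': "?X \<in> tangent_space M (\<pi> (?q \<tau>))"
      unfolding pq by (rule d, rule X(1))
    have y: "snd c (?q \<tau>) \<in> snd c ` fst c" using qc' by blast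
    have "tvec_of Q c (?q \<tau>) (H c d (snd c (?q \<tau>)) (?X d)) = hlift S (?q \<tau>) ?X"
      using tvec_of_chart[OF Q c' hlift_in(2)[OF points_charts_at[OF c'] X']] hlift_chart[OF c' d' X'] by simp
    then show "Lc c (snd c (?q \<tau>), H c d (snd c (?q \<tau>)) (?X d)) = L (?q \<tau>, hlift S (?q \<tau>) ?X)"
      by (simp add: inv_tangent_chart[OF Q c y] inv_chart_chart[OF Q c qc'])
  qed
  moreover have "DL c t (h *\<^sub>R fund b t c, ?DH (h *\<^sub>R fund b t c)) = DL c t (fund b t c, ?DH (fund b t c)) * h" for h
    using linear_scale[OF linear_DL[OF c t], of h "(fund b t c, ?DH (fund b t c))"]
      linear_scale[OF has_derivative_linear[OF dH]] by simp
  ultimately have "((\<lambda>\<tau>. L (?q \<tau>, hlift S (?q \<tau>) ?X)) has_field_derivative DL c t (fund b t c, ?DH (fund b t c))) (at 0)"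
    unfolding has_field_derivative_def by simp
  from DERIV_imp_deriv[OF this] show ?thesis unfolding HL_def Let_def Xt[OF tI] fst_conv .
qed

abbreviation "Bm t b \<equiv> B_map S (q t) (proj_vec S (Xt t)) b"

lemma Bm_chart:
  assumes b: "b \<in> lie_alg S" and c: "c \<in> Q" and t: "t \<in> J c"
  shows "Bm t b = lie_vec (Om c (snd c (q t)) (vel t c) (fund b t c))"
proof -
  have tI: "t \<in> I" using t by simp
  show ?thesis unfolding B_map_chart[OF chart_J[OF c t] lift_velocity(1)[OF tI] b] lift_velocity(2)[OF tI] ..
qed

text \<open>In coordinates \<open>\<xi>\<close> is \<open>Z\<close> along the path and
  \<open>\<xi>'\<close> its derivative in the direction of the velocity. By
  \<open>lift_vs_generator\<close> the latter is the derivative of the lift along the orbit, which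
  together with \<open>\<xi>\<close> gives \<open>HL\<close>, plus the fundamental vector of
  \<open>Bm t b\<close>, which gives \<open>FL\<close>.\<close>

lemma variation_L_fund:
  assumes b: "b \<in> lie_alg S" and t: "t \<in> I"
  shows "differential TQ L (\<delta> (fund b) t) = HL S L (Xt t) b + FL S L (Xt t) (Bm t b)"
proof -
  obtain c where ct: "c \<in> charts_at Q (q t)" using ex_chart[OF t] by blast
  then have c: "c \<in> Q" "t \<in> J c" and qc: "q t \<in> fst c" using t by (simp_all add: mem_charts_at)
  obtain d where d: "d \<in> charts_at M (\<pi> (q t))" using charts_at_nonempty[OF proj_points[OF q_points[OF t]]] by blast
  then have dM: "d \<in> M" "\<pi> (q t) \<in> fst d" by (simp_all add: mem_charts_at)
  let ?y = "snd c (q t)" and ?k = "b c0" and ?u = "proj_vec S (Xt t) d"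
  have y: "?y \<in> snd c ` fst c" using qc by blast
  have v: "vel t c = H c d ?y ?u" using hlift_chart[OF ct d lift_velocity(1)[OF t]] lift_velocity(2)[OF t] by simp
  have dZ: "((\<lambda>y. la.Z c y ?k) has_derivative frechet_derivative (\<lambda>y. la.Z c y ?k) (at ?y)) (at ?y)"
    by (rule smooth_on_has_derivative_open[OF la.smooth_Z[OF c(1)] open_chart_image[OF Q c(1)] y])
  have "((\<lambda>s. la.Z c (snd c (q s)) ?k) has_derivative (\<lambda>h. frechet_derivative (\<lambda>y. la.Z c y ?k) (at ?y) (h *\<^sub>R vel t c))) (at t within I)"
    by (rule has_derivative_compose[OF velocity_chart[OF q Q thick_I t ct, unfolded has_vector_derivative_def] dZ])
  then have "((\<lambda>s. la.Z c (snd c (q s)) ?k) has_vector_derivative frechet_derivative (\<lambda>y. la.Z c y ?k) (at ?y) (vel t c)) (at t within J c)"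
    unfolding has_vector_derivative_def at_J[OF c] by (simp add: linear_scale[OF has_derivative_linear[OF dZ]])
  then have "((\<lambda>s. fund b s c) has_vector_derivative frechet_derivative (\<lambda>y. la.Z c y ?k) (at ?y) (vel t c)) (at t within J c)"
    by (rule has_vector_derivative_transform[OF c(2), rotated]) (rule fund_chart[OF b c(1)])
  from dt_unique[OF t this[unfolded at_J[OF c]]]
  have dt: "dt (\<lambda>s. fund b s c) t = frechet_derivative (\<lambda>y. H c d y ?u) (at ?y) (fund b t c) + fund (Bm t b) t c"
    unfolding lift_vs_generator[OF c(1) dM(1) UdI[OF qc dM(2)] v, of ?k, folded fund_chart[OF b c]]
      Bm_chart[OF b c] fund_chart[OF lie_vec(1) c] lie_vec(2) .
  have "Bm t b \<in> lie_alg S" unfolding Bm_chart[OF b c] by (rule lie_vec(1))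
  from FL_chart[OF this c] HL_chart[OF b c d] show ?thesis
    unfolding variation_L[OF fund_generator_const[OF b] c] dt
    by (simp add: linear_add[OF linear_DL[OF c], symmetric])
qed

text \<open>The second condition of the theorem is \<open>ham b = d/dt mom b\<close>.\<close>

definition ham :: "('g, 'k) tvec \<Rightarrow> real \<Rightarrow> real"
  where "ham b t = HL S L (Xt t) b + (FL S L (Xt t) - lam t) (Bm t b)"

definition mom :: "('g, 'k) tvec \<Rightarrow> real \<Rightarrow> real"
  where "mom b t = (FL S L (Xt t) - lam t) b"

text \<open>With \<open>b\<close> fixed the time dependence sits in the scalar
  \<open>\<phi>\<close>. The product rule produces \<open>\<phi>'\<close> both in
  \<open>\<xi>'\<close> and in the derivative of \<open>\<omega>(\<xi>) = \<phi> b\<close>; the two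
  terms combine to \<open>mom b\<close>.\<close>

lemma variation_fund:
  assumes b: "b \<in> lie_alg S" and \<phi>: "smooth_on I \<phi>" and t: "t \<in> I"
  shows "differential TQ (Lm t) (\<delta> (\<lambda>s. \<phi> s *\<^sub>R fund b s) t) = \<phi> t * ham b t + dt \<phi> t * mom b t"
proof -
  obtain c where ct: "c \<in> charts_at Q (q t)" using ex_chart[OF t] by blast
  then have c: "c \<in> Q" "t \<in> J c" and qc: "q t \<in> fst c" using t by (simp_all add: mem_charts_at)
  have y: "snd c (q t) \<in> snd c ` fst c" using qc by blast
  note g = fund_generator[OF b \<phi>] and g1 = fund_generator_const[OF b]
  have \<phi>': "(\<phi> has_vector_derivative dt \<phi> t) (at t within I)"
    by (rule smooth_on_vector_derivative(1)[OF \<phi> thick_I t])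
  have sc: "(h has_field_derivative D) F \<longleftrightarrow> (h has_vector_derivative D) F" for h :: "real \<Rightarrow> real" and D F
    by (rule has_real_derivative_iff_has_vector_derivative)
  have "((\<lambda>s. \<phi> s *\<^sub>R fund b s c) has_vector_derivative (\<phi> t *\<^sub>R dt (\<lambda>s. fund b s c) t + dt \<phi> t *\<^sub>R fund b t c)) (at t within I)"
    by (rule has_vector_derivative_scaleR[OF \<phi>'[folded sc] generator_has_vector_derivative[OF Q thick_I q g1 t ct]])
  note d1 = dt_unique[OF t this]
  have "(\<phi> t *\<^sub>R fund b t c, \<phi> t *\<^sub>R dt (\<lambda>s. fund b s c) t + dt \<phi> t *\<^sub>R fund b t c) =
     \<phi> t *\<^sub>R (fund b t c, dt (\<lambda>s. fund b s c) t) + dt \<phi> t *\<^sub>R (0, fund b t c)" by simp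
  then have L: "differential TQ L (\<delta> (\<lambda>s. \<phi> s *\<^sub>R fund b s) t) =
      \<phi> t * differential TQ L (\<delta> (fund b) t) + dt \<phi> t * FL S L (Xt t) b"
    unfolding variation_L[OF g c] variation_L[OF g1 c] FL_chart[OF b c] scaleR_fun_apply d1
    by (simp only: linear_add[OF linear_DL[OF c]] linear_scale[OF linear_DL[OF c]] real_scaleR_def)
  have "((\<lambda>s. omega S (q s, \<phi> s *\<^sub>R fund b s) c0) has_vector_derivative dt \<phi> t *\<^sub>R b c0) (at t within I)"
  proof (rule has_vector_derivative_transform[OF t])
    show "((\<lambda>s. \<phi> s *\<^sub>R b c0) has_vector_derivative dt \<phi> t *\<^sub>R b c0) (at t within I)"
      using has_vector_derivative_scaleR[OF \<phi>'[folded sc] has_vector_derivative_const[of "b c0"]] by simp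
    fix s assume s: "s \<in> I"
    note qs = q_points[OF s] and fT = fundamental_field_in[OF b q_points[OF s]]
    have "omega S (q s, fund b s) = b"
      by (rule omega_eqI[OF qs b]) (simp add: subspace_0[OF hor_subspace[OF qs]])
    then show "omega S (q s, \<phi> s *\<^sub>R fund b s) c0 = \<phi> s *\<^sub>R b c0"
      using omega_linear(2)[OF qs fT fT] by (simp add: scaleR_fun_apply)
  qed
  note d2 = dt_unique[OF t this]
  have "lm t (dt \<phi> t *\<^sub>R b c0 + Om c (snd c (q t)) (vel t c) (\<phi> t *\<^sub>R fund b t c)) = dt \<phi> t * lam t b + \<phi> t * lam t (Bm t b)"
    by (simp add: Om_scaleR[OF c(1) y] linear_add[OF linear_lm[OF t]] linear_scale[OF linear_lm[OF t]]
        lie_vec_chart[OF b] Bm_chart[OF b c])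
  then show ?thesis
    unfolding variation_modified[OF g c] L d2 scaleR_fun_apply variation_L_fund[OF b t] ham_def mom_def
    by (simp add: algebra_simps)
qed

text \<open>Smoothness of \<open>HL\<close> is not examined separately: together with the
  \<open>FL\<close> term it is the variation of \<open>L\<close> generated by the fundamental field,
  which is already known to be smooth.\<close>

lemma smooth_ham:
  assumes b: "b \<in> lie_alg S"
  shows "smooth_on I (ham b)"
proof -
  have "smooth_on I (\<lambda>t. lam t (Bm t b))"
  proof (rule smooth_on_I)
    fix c assume c: "c \<in> Q"
    have "smooth_on (J c) (\<lambda>t. lm t (Om c (snd c (q t)) (vel t c) (fund b t c)))"
      by (rule smooth_lm[OF smooth_Om[OF c smooth_x[OF c] _ smooth_vel[OF c] smooth_fund_chart[OF b c]]]) auto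
    then show "smooth_on (J c) (\<lambda>t. lam t (Bm t b))" by (rule smooth_on_eq) (simp only: Bm_chart[OF b c])
  qed
  from smooth_on_minus[OF smooth_variation_L[OF fund_generator_const[OF b]] this]
  show ?thesis by (rule smooth_on_eq) (simp add: ham_def variation_L_fund[OF b])
qed

lemma smooth_mom:
  assumes b: "b \<in> lie_alg S"
  shows "smooth_on I (mom b)"
proof -
  have "smooth_on I (\<lambda>t. FL S L (Xt t) b)"
  proof (rule smooth_on_I)
    fix c assume c: "c \<in> Q"
    show "smooth_on (J c) (\<lambda>t. FL S L (Xt t) b)"
      by (rule smooth_on_eq[OF smooth_DL[OF c smooth_on_const smooth_fund_chart[OF b c]]]) (rule FL_chart[OF b c])
  qed
  moreover have "smooth_on I (\<lambda>t. lam t b)" using lam b by (simp add: smooth_dual_curve_def)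
  ultimately have "smooth_on I (\<lambda>t. FL S L (Xt t) b - lam t b)" by (rule smooth_on_minus)
  then show ?thesis by (rule smooth_on_eq) (simp add: mom_def)
qed

lemma smooth_integrable: "smooth_on I g \<Longrightarrow> g integrable_on I" for g :: "real \<Rightarrow> real"
  by (rule integrable_continuous_real[OF smooth_on_imp_continuous_on])

lemma smooth_on_dt_I: "smooth_on I g \<Longrightarrow> smooth_on I (dt g)" for g :: "real \<Rightarrow> real"
  by (rule smooth_on_vector_derivative(2)[OF _ thick_I])

text \<open>Integration by parts; the boundary terms vanish because \<open>\<phi>\<close> does at
  both ends.\<close>

lemma integral_fund:
  assumes b: "b \<in> lie_alg S" and \<phi>: "smooth_on I \<phi>" and ends: "\<phi> t0 = 0" "\<phi> t1 = 0"
  shows "((\<lambda>t. \<phi> t * ham b t + dt \<phi> t * mom b t) has_integral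
    integral I (\<lambda>t. \<phi> t * (ham b t - dt (mom b) t))) I"
proof -
  note m = smooth_mom[OF b] and h = smooth_ham[OF b]
  have "((\<lambda>t. \<phi> t * mom b t) has_vector_derivative (\<phi> t * dt (mom b) t + dt \<phi> t * mom b t)) (at t within I)"
    if "t \<in> I" for t
    by (rule has_vector_derivative_mult[OF smooth_on_vector_derivative(1)[OF \<phi> thick_I that]
        smooth_on_vector_derivative(1)[OF m thick_I that]])
  from fundamental_theorem_of_calculus[OF less_imp_le[OF t01] this]
  have "((\<lambda>t. \<phi> t * dt (mom b) t + dt \<phi> t * mom b t) has_integral 0) I" using ends by simp
  moreover have "((\<lambda>t. \<phi> t * (ham b t - dt (mom b) t)) has_integral
      integral I (\<lambda>t. \<phi> t * (ham b t - dt (mom b) t))) I"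
    by (rule integrable_integral[OF smooth_integrable[OF smooth_on_mult[OF \<phi> smooth_on_minus[OF h smooth_on_dt_I[OF m]]]]])
  ultimately have "((\<lambda>t. \<phi> t * dt (mom b) t + dt \<phi> t * mom b t + \<phi> t * (ham b t - dt (mom b) t)) has_integral
      0 + integral I (\<lambda>t. \<phi> t * (ham b t - dt (mom b) t))) I"
    by (rule has_integral_add)
  then show ?thesis by (simp add: algebra_simps)
qed

lemma vertical_condition_iff:
  assumes b: "b \<in> lie_alg S" and t: "t \<in> I"
  shows "(HL S L (Xt t) - dual_deriv I (\<lambda>s. FL S L (Xt s) - lam s) t) b + (FL S L (Xt t) - lam t) (Bm t b) = 0
    \<longleftrightarrow> ham b t - dt (mom b) t = 0"
  unfolding ham_def mom_def[abs_def] dual_deriv_def by auto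

section \<open>Equivalence of extremality with the two conditions\<close>

lemma hlift_0: "t \<in> I \<Longrightarrow> hlift S (q t) 0 = 0"
proof -
  assume t: "t \<in> I"
  note qt = q_points[OF t]
  obtain c where c: "c \<in> charts_at Q (q t)" using ex_chart[OF t] by blast
  obtain d where d: "d \<in> charts_at M (\<pi> (q t))" using charts_at_nonempty[OF proj_points[OF qt]] by blast
  have cd: "c \<in> Q" "q t \<in> fst c" "d \<in> M" "\<pi> (q t) \<in> fst d" using c d by (simp_all add: mem_charts_at)
  note z = tangent_space_0[OF M]
  show "hlift S (q t) 0 = 0"
    by (rule tangent_space_eqI[OF hlift_in(2)[OF qt z] tangent_space_0[OF Q] c])
       (simp add: hlift_chart[OF c d z] linear_0[OF linear_H[OF cd(1,3) UdI[OF cd(2,4)]]])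
qed

text \<open>Lifts and the fields \<open>\<phi> t *\<^sub>R fund b t\<close> are themselves
  generators, and every generator is a finite sum of such fields; so one implication is
  specialisation and the other is linearity.\<close>

lemma extremal_iff:
  "vakonomic_extremal S t0 t1 Lm q Xt \<longleftrightarrow>
    (\<forall>Y. generator M I (\<lambda>t. \<pi> (q t)) Y \<and> Y t0 = 0 \<and> Y t1 = 0 \<longrightarrow>
       action_variation Q I (\<lambda>t. L) (\<delta> (lift Y))
       = integral I (\<lambda>t. lam t (curvature S (q t) (proj_vec S (Xt t)) (Y t)))) \<and>
    (\<forall>b\<in>lie_alg S. \<forall>t\<in>I.
       (HL S L (Xt t) - dual_deriv I (\<lambda>s. FL S L (Xt s) - lam s) t) b + (FL S L (Xt t) - lam t) (Bm t b) = 0)"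
    (is "?E \<longleftrightarrow> ?h \<and> ?v")
proof -
  have E: "?E \<longleftrightarrow> (\<forall>\<xi>. gen \<xi> \<and> \<xi> t0 = 0 \<and> \<xi> t1 = 0 \<longrightarrow> integral I (\<lambda>t. differential TQ (Lm t) (\<delta> \<xi> t)) = 0)"
    unfolding vakonomic_extremal_def unconstrained_extremal_def action_variation_def using path by blast
  have ends: "t0 \<in> I" "t1 \<in> I" using t01 by simp_all
  have lift_int: "((\<lambda>t. differential TQ (Lm t) (\<delta> (lift Y) t)) has_integral
      action_variation Q I (\<lambda>t. L) (\<delta> (lift Y)) - integral I (\<lambda>t. lam t (curvature S (q t) (proj_vec S (Xt t)) (Y t)))) I"
    if Y: "generator M I (\<lambda>t. \<pi> (q t)) Y" for Y
    unfolding action_variation_def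
    by (rule has_integral_eq[OF variation_lift[OF Y, symmetric]
        has_integral_diff[OF integrable_integral[OF smooth_integrable[OF smooth_variation_L[OF lift_generator[OF Y]]]]
          integrable_integral[OF smooth_integrable[OF smooth_curvature[OF Y]]]]])
  have fund_int: "((\<lambda>t. differential TQ (Lm t) (\<delta> (\<lambda>s. \<phi> s *\<^sub>R fund b s) t)) has_integral
      integral I (\<lambda>t. \<phi> t * (ham b t - dt (mom b) t))) I"
    if b: "b \<in> lie_alg S" and \<phi>: "smooth_on I \<phi>" "\<phi> t0 = 0" "\<phi> t1 = 0" for \<phi> b
    by (rule has_integral_eq[OF variation_fund[OF b \<phi>(1), symmetric] integral_fund[OF b \<phi>]])
  show ?thesis
  proof
    assume e: ?E
    have h: ?h
    proof (intro allI impI)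
      fix Y assume Y: "generator M I (\<lambda>t. \<pi> (q t)) Y \<and> Y t0 = 0 \<and> Y t1 = 0"
      then have Yg: "generator M I (\<lambda>t. \<pi> (q t)) Y" by blast
      have "lift Y t0 = 0" "lift Y t1 = 0" using Y hlift_0 ends by simp_all
      then have "integral I (\<lambda>t. differential TQ (Lm t) (\<delta> (lift Y) t)) = 0"
        using e lift_generator[OF Yg] unfolding E by blast
      with integral_unique[OF lift_int[OF Yg]]
      show "action_variation Q I (\<lambda>t. L) (\<delta> (lift Y)) = integral I (\<lambda>t. lam t (curvature S (q t) (proj_vec S (Xt t)) (Y t)))"
        by simp
    qed
    have v: ?v
    proof (intro ballI)
      fix b t assume b: "b \<in> lie_alg S" and t: "t \<in> I"
      have "ham b t - dt (mom b) t = 0"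
      proof (rule fundamental_lemma_variations[OF t01 _ _ t])
        show "continuous_on I (\<lambda>t. ham b t - dt (mom b) t)"
          by (rule smooth_on_imp_continuous_on[OF smooth_on_minus[OF smooth_ham[OF b] smooth_on_dt_I[OF smooth_mom[OF b]]]])
        fix \<phi> :: "real \<Rightarrow> real" assume \<phi>: "smooth_on UNIV \<phi>" "\<phi> t0 = 0" "\<phi> t1 = 0"
        have s: "smooth_on I \<phi>" by (rule smooth_on_subset[OF \<phi>(1)]) simp
        have "integral I (\<lambda>t. differential TQ (Lm t) (\<delta> (\<lambda>s. \<phi> s *\<^sub>R fund b s) t)) = 0"
          using e fund_generator[OF b s] \<phi>(2,3) unfolding E by simp
        with integral_unique[OF fund_int[OF b s \<phi>(2,3)]]
        show "integral I (\<lambda>t. \<phi> t * (ham b t - dt (mom b) t)) = 0" by simp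
      qed
      then show "(HL S L (Xt t) - dual_deriv I (\<lambda>s. FL S L (Xt s) - lam s) t) b + (FL S L (Xt t) - lam t) (Bm t b) = 0"
        using vertical_condition_iff[OF b t] by blast
    qed
    show "?h \<and> ?v" using h v by blast
  next
    assume hv: "?h \<and> ?v"
    show ?E unfolding E
    proof (intro allI impI)
      fix \<xi> assume \<xi>: "gen \<xi> \<and> \<xi> t0 = 0 \<and> \<xi> t1 = 0"
      then have g: "gen \<xi>" by blast
      define Y where "Y t = proj_vec S (q t, \<xi> t)" for t
      \<comment> \<open>Model-space coordinates of \<open>\<omega>(\<xi>)\<close>; their components
        become the scalar factors of the vertical pieces.\<close>
      define \<beta> where "\<beta> t = omega S (q t, \<xi> t) c0" for t
      have Y: "generator M I (\<lambda>t. \<pi> (q t)) Y" unfolding Y_def by (rule projection_generator[OF g])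
      have s\<beta>: "smooth_on I \<beta>"
      proof (rule smooth_on_I)
        fix c assume c: "c \<in> Q"
        have "smooth_on (J c) (\<lambda>s. W c (snd c (q s)) (\<xi> s c))"
        proof (rule smooth_on_apply[where A="\<lambda>s. W c (snd c (q s))", OF _ smooth_gen_chart[OF g c]])
          show "smooth_on (J c) (\<lambda>s. W c (snd c (q s)) b)" for b
            by (rule smooth_on_compose[OF smooth_W[OF c] smooth_x[OF c]]) auto
          show "linear (W c (snd c (q s)))" if "s \<in> J c" for s by (rule linear_W[OF c]) (use that in auto)
        qed
        then show "smooth_on (J c) \<beta>"
          by (rule smooth_on_eq) (use omega_chart[OF chart_J[OF c] generator_in[OF g]] in \<open>simp add: \<beta>_def\<close>)
      qed
      \<comment> \<open>The end-point conditions pass to both parts, since projection and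
        \<open>\<omega>\<close> send the zero vector to 0.\<close>
      have zero: "Y t = 0 \<and> \<beta> t = 0" if t: "t \<in> I" "\<xi> t = 0" for t
      proof -
        note qt = q_points[OF t(1)]
        obtain c where c: "c \<in> charts_at Q (q t)" using ex_chart[OF t(1)] by blast
        obtain d where d: "d \<in> charts_at M (\<pi> (q t))" using charts_at_nonempty[OF proj_points[OF qt]] by blast
        have cd: "c \<in> Q" "q t \<in> fst c" "d \<in> M" "\<pi> (q t) \<in> fst d" using c d by (simp_all add: mem_charts_at)
        note z = tangent_space_0[OF Q]
        have "Y t = 0" unfolding Y_def t(2)
          by (rule tangent_space_eqI[OF proj_vec_in[OF qt z] tangent_space_0[OF M] d])
             (simp add: proj_vec_chart[OF c d z] linear_0[OF linear_P[OF cd(1,3) UdI[OF cd(2,4)]]])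
        moreover have "\<beta> t = 0"
          using hor_iff_omega[OF qt z] subspace_0[OF hor_subspace[OF qt]] by (simp add: \<beta>_def t(2))
        ultimately show ?thesis by blast
      qed
      \<comment> \<open>The pieces of \<open>\<xi>\<close>, indexed by an option type so that one
        finite index set fits \<open>variation_sum\<close>: \<open>None\<close> is the horizontal
        lift, \<open>Some k\<close> the vertical piece along the basis vector
        \<open>k\<close>.\<close>
      define f where "f = case_option (lift Y) (\<lambda>k t. (\<beta> t \<bullet> k) *\<^sub>R fund (lie_vec k) t)"
      let ?K = "insert None (Some ` (onb :: 'k set))"
      have fin: "finite ?K" using finite_onb[where 'a='k] by simp
      have s\<beta>k: "smooth_on I (\<lambda>t. \<beta> t \<bullet> k)" for k by (rule smooth_on_compose_linear[OF bounded_linear_inner_left s\<beta>])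
      have gf: "gen (f i)" for i
        using lift_generator[OF Y] fund_generator[OF lie_vec(1) s\<beta>k] by (cases i) (simp_all add: f_def)
      have sumK: "(\<Sum>i\<in>?K. F i) = F None + (\<Sum>k\<in>onb. F (Some k))" for F :: "'k option \<Rightarrow> 'z::comm_monoid_add"
        using finite_onb[where 'a='k] by (simp add: sum.reindex image_iff)
      have decomp: "\<xi> t = (\<Sum>i\<in>?K. f i t)" if t: "t \<in> I" for t
      proof -
        note qt = q_points[OF t] and x = generator_in[OF g t]
        obtain c where c: "c \<in> charts_at Q (q t)" using ex_chart[OF t] by blast
        obtain d where d: "d \<in> charts_at M (\<pi> (q t))" using charts_at_nonempty[OF proj_points[OF qt]] by blast
        have cd: "c \<in> Q" "q t \<in> fst c" "d \<in> M" "\<pi> (q t) \<in> fst d" using c d by (simp_all add: mem_charts_at)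
        let ?y = "snd c (q t)"
        have y: "?y \<in> snd c ` fst c" using cd by blast
        note U = UdI[OF cd(2,4)]
        have YT: "Y t \<in> tangent_space M (\<pi> (q t))" by (rule generator_in[OF Y t])
        have fT: "f i t \<in> tangent_space Q (q t)" for i by (rule generator_in[OF gf t])
        have "(\<Sum>i\<in>?K. f i t) c = f None t c + (\<Sum>k\<in>onb. f (Some k) t c)"
        proof -
          have "(\<Sum>k\<in>K. f (Some k) t) c = (\<Sum>k\<in>K. f (Some k) t c)" if "finite K" for K
            using that by (induction K rule: finite_induct) simp_all
          then show ?thesis using finite_onb[where 'a='k] by (simp add: sumK)
        qed
        also have "f None t c = H c d ?y (Y t d)" by (simp add: f_def hlift_chart[OF c d YT])
        also have "Y t d = P c d ?y (\<xi> t c)" by (simp add: Y_def proj_vec_chart[OF c d x])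
        also have "(\<Sum>k\<in>onb. f (Some k) t c) = (\<Sum>k\<in>onb. (\<beta> t \<bullet> k) *\<^sub>R la.Z c ?y k)"
          by (simp add: f_def scaleR_fun_apply fundamental_field_chart[OF lie_vec(1) c] lie_vec(2))
        also have "\<dots> = la.Z c ?y (\<beta> t)" by (rule linear_onb[OF la.linear_Z[OF cd(1) y], symmetric])
        also have "\<beta> t = W c ?y (\<xi> t c)" by (simp add: \<beta>_def omega_chart[OF c x])
        \<comment> \<open>\<open>P\<close> and \<open>W\<close> agree on both sides, and together
          they are injective.\<close>
        also have "H c d ?y (P c d ?y (\<xi> t c)) + la.Z c ?y (W c ?y (\<xi> t c)) = \<xi> t c"
        proof (rule injD[OF bij_is_inj[OF bij_splitting(1)[OF cd(1,3) U]]])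
          show "(P c d ?y (H c d ?y (P c d ?y (\<xi> t c)) + la.Z c ?y (W c ?y (\<xi> t c))),
             W c ?y (H c d ?y (P c d ?y (\<xi> t c)) + la.Z c ?y (W c ?y (\<xi> t c)))) = (P c d ?y (\<xi> t c), W c ?y (\<xi> t c))"
            by (simp add: linear_add[OF linear_P[OF cd(1,3) U]] linear_add[OF linear_W[OF cd(1) y]]
                P_H[OF cd(1,3) U] W_H[OF cd(1,3) U] P_Z[OF c d] W_Z[OF cd(1) y])
        qed
        finally have "\<xi> t c = (\<Sum>i\<in>?K. f i t) c" ..
        then show ?thesis
          by (rule tangent_space_eqI[OF x subspace_sum[OF subspace_tangent_space[OF Q] fT] c])
      qed
      have None_int: "((\<lambda>t. differential TQ (Lm t) (\<delta> (f None) t)) has_integral 0) I"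
        using lift_int[OF Y] hv Y zero ends \<xi> by (simp add: f_def)
      have Some_int: "((\<lambda>t. differential TQ (Lm t) (\<delta> (f (Some k)) t)) has_integral 0) I" for k
      proof -
        have e0: "\<beta> t0 \<bullet> k = 0" "\<beta> t1 \<bullet> k = 0" using zero ends \<xi> by simp_all
        have "integral I (\<lambda>t. (\<beta> t \<bullet> k) * (ham (lie_vec k) t - dt (mom (lie_vec k)) t)) = integral I (\<lambda>t. 0)"
        proof (rule integral_cong)
          fix t assume t: "t \<in> I"
          have "ham (lie_vec k) t - dt (mom (lie_vec k)) t = 0"
            using hv vertical_condition_iff[OF lie_vec(1) t] lie_vec(1) t by blast
          then show "(\<beta> t \<bullet> k) * (ham (lie_vec k) t - dt (mom (lie_vec k)) t) = 0" by simp
        qed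
        then have z: "integral I (\<lambda>t. (\<beta> t \<bullet> k) * (ham (lie_vec k) t - dt (mom (lie_vec k)) t)) = 0" by simp
        show ?thesis using fund_int[OF lie_vec(1)[of k] s\<beta>k e0, unfolded z] by (simp add: f_def)
      qed
      have "((\<lambda>t. \<Sum>i\<in>?K. differential TQ (Lm t) (\<delta> (f i) t)) has_integral (\<Sum>i\<in>?K. 0)) I"
      proof (rule has_integral_sum[OF fin])
        fix i assume "i \<in> ?K"
        show "((\<lambda>t. differential TQ (Lm t) (\<delta> (f i) t)) has_integral 0) I"
          using None_int Some_int by (cases i) simp_all
      qed
      then have "((\<lambda>t. differential TQ (Lm t) (\<delta> \<xi> t)) has_integral (\<Sum>i\<in>?K. 0)) I"
        by (rule has_integral_eq[rotated]) (rule variation_sum[OF fin gf g decomp, symmetric])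
      then show "integral I (\<lambda>t. differential TQ (Lm t) (\<delta> \<xi> t)) = 0" by (simp add: integral_unique)
    qed
  qed
qed

end

theorem proposition4p9:
  fixes S :: "('q, 'e::fin_dim_inner, 'm, 'f::fin_dim_inner, 'g, 'k::fin_dim_inner) chaplygin"
    and L :: "('q, 'e) tan \<Rightarrow> real"
    and q :: "real \<Rightarrow> 'q"
    and Xt :: "real \<Rightarrow> ('q, 'e) tan"
    and lam :: "real \<Rightarrow> ('g, 'k) tvec \<Rightarrow> real"
    and t0 t1 :: real
  assumes "t0 < t1"
    and "principal_bundle S"
    and "horizontal_distribution S"
    and "smooth_fun (tangent_bundle (mfQ S)) L"
    and "horizontal_admissible_path S {t0..t1} q Xt"
    and "smooth_dual_curve S {t0..t1} lam"
  shows "vakonomic_extremal S t0 t1 (modified_lagrangian S L lam) q Xt \<longleftrightarrow>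
    (\<forall>Y. generator (mfM S) {t0..t1} (\<lambda>t. proj S (q t)) Y \<and> Y t0 = 0 \<and> Y t1 = 0 \<longrightarrow>
       action_variation (mfQ S) {t0..t1} (\<lambda>t. L)
         (admissible_variation (mfQ S) {t0..t1} q (\<lambda>t. hlift S (q t) (Y t)))
       = integral {t0..t1} (\<lambda>t. lam t (curvature S (q t) (proj_vec S (Xt t)) (Y t)))) \<and>
    (\<forall>b\<in>lie_alg S. \<forall>t\<in>{t0..t1}.
       (HL S L (Xt t) - dual_deriv {t0..t1} (\<lambda>s. FL S L (Xt s) - lam s) t) b
       + (FL S L (Xt t) - lam t) (B_map S (q t) (proj_vec S (Xt t)) b) = 0)"
proof -
  interpret chaplygin_path S L q Xt lam t0 t1
    using assms by unfold_locales
  show ?thesis by (rule extremal_iff)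
qed

end
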